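(* The Verdier condition is a $\mathcal{WL}$ condition of class $C^q$, for $q\ge 2$.
   Context: Fix $q\in\{2,3,\dots\}\cup\{\infty,\omega\}$ and an o-minimal structure $\mathcal{D}$ on the ordered field $\mathbb{R}$ admitting definable $C^q$ cell decompositions; "definable" means definable in $\mathcal{D}$. **The function $d$.** For a unit vector $v\in\mathbb{R}^n$ and a nonzero linear subspace $W\subset\mathbb{R}^n$, $d(v,W)=\inf\{\sin(v,w):w\in W,\ |w|=1\}$, where $\sin(v,w)$ is the sine of the angle between $v$ and $w$; $d(v,\{0\})=1$. For linear subspaces $P,Q\subset\mathbb{R}^n$, $d(P,Q)=\sup\{d(v,Q):v\in P,\ |v|=1\}$ if $P\ne\{0\}$, and $d(\{0\},Q)=0$. **Verdier condition.** Let $\Lambda,\Gamma$ be $C^2$ submanifolds of $\mathbb{R}^n$ with $\Gamma\subset\overline\Lambda\setminus\Lambda$. The pair $(\Lambda,\Gamma)$ satisfies the Verdier condition at $x_0\in\Gamma$ if there exist an open neighbourhood $U$ of $x_0$ in $\mathbb{R}^n$ and $C>0$ such that $d(T_x\Gamma,T_y\Lambda)\le C|x-y|$ for all $x\in\Gamma\cap U$ and $y\in\Lambda\cap U$. **Stratifications.** A $C^q$ stratification of $A\subset\mathbb{R}^n$ is a finite family $\mathfrak{X}_A$ of connected $C^q$ submanifolds of $\mathbb{R}^n$ (strata), pairwise disjoint, with union $A$, such that for each $\Gamma\in\mathfrak{X}_A$ the set $(\overline\Gamma\setminus\Gamma)\cap A$ is a union of strata of dimension $<\dim\Gamma$. **Weakly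 Lipschitz.** $f:A\to\mathbb{R}^m$ is weakly Lipschitz of class $C^q$ on $\mathfrak{X}_A$ if $f|_\Gamma$ is of class $C^q$ for each $\Gamma\in\mathfrak{X}_A$ and, whenever $\Lambda,\Gamma\in\mathfrak{X}_A$, $\Gamma\subset\overline\Lambda\setminus\Lambda$, $a\in\Gamma$, $a_\nu\in\Gamma$, $b_\nu\in\Lambda$, $a_\nu\to a$, $b_\nu\to a$, one has $\limsup_{\nu}\frac{|f(a_\nu)-f(b_\nu)|}{|a_\nu-b_\nu|}<+\infty$. The induced stratification of $\mathrm{graph} f$ is $\mathfrak{X}_{\mathrm{graph} f}(\mathfrak{X}_A)=\{\mathrm{graph} f|_\Gamma:\Gamma\in\mathfrak{X}_A\}$. A map is locally Lipschitz if each point of its domain has a neighbourhood in the domain on which it is Lipschitz. **Regularity conditions.** A (regularity) condition $\mathcal{Q}$ is a condition on pairs $(\Lambda,\Gamma)$ of $C^q$ submanifolds of a Euclidean space (any dimension) with $\Gamma\subset\overline\Lambda\setminus\Lambda$, at points $x\in\Gamma$. $\mathcal{W}^{\mathcal Q}(\Lambda,\Gamma,x)$ means that $\mathcal Q$ is satisfied for $(\Lambda,\Gamma)$ at $x$; $\mathcal{W}^{\mathcal Q}(\Lambda,\Gamma)$ means $\mathcal{W}^{\mathcal Q}(\Lambda,\Gamma,x)$ for all $x\in\Gamma$. Conditions considered are local: for every open neighbourhood $U$ of $x$, $\mathcal{W}^{\mathcal Q}(\Lambda,\Gamma,x)\iff\mathcal{W}^{\mathcal Q}(\Lambda\cap U,\Gamma\cap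 U,x)$. A stratification $\mathfrak{X}$ is a $\mathcal Q$-stratification if $\mathcal{W}^{\mathcal Q}(\Lambda,\Gamma)$ for all $\Lambda,\Gamma\in\mathfrak{X}$ with $\Gamma\subset\overline\Lambda\setminus\Lambda$. $\mathcal Q$ is a $\mathcal{WL}$ condition of class $C^q$ if: 1. (definable) for all definable $C^q$ submanifolds $\Lambda,\Gamma\subset\mathbb{R}^n$ with $\Gamma\subset\overline\Lambda\setminus\Lambda$, the set $\{x\in\Gamma:\mathcal{W}^{\mathcal Q}(\Lambda,\Gamma,x)\}$ is definable; 2. (generic) for such $\Lambda,\Gamma$, the set of $x\in\Gamma$ at which $\mathcal{W}^{\mathcal Q}(\Lambda,\Gamma,x)$ fails is nowhere dense in $\Gamma$; 3. (invariant under definable $C^q$ diffeomorphisms) for any definable $C^q$ diffeomorphism $\phi:U\to W$ of open subsets of $\mathbb{R}^n$, any $C^q$ submanifolds $\Lambda,\Gamma\subset U$ with $\Gamma\subset\overline\Lambda\setminus\Lambda$ and any $x\in\Gamma$: $\mathcal{W}^{\mathcal Q}(\Lambda,\Gamma,x)\iff\mathcal{W}^{\mathcal Q}(\phi(\Lambda),\phi(\Gamma),\phi(x))$; 4. (projection property) for any $f:A\to\mathbb{R}^m$ weakly Lipschitz of class $C^q$ on a $C^q$ stratification $\mathfrak{X}_A$ of a set $A\subset\mathbb{R}^n$: if $\mathfrak{X}_{\mathrm{graph} f}(\mathfrak{X}_A)$ is a $\mathcal Q$-stratification, then $\mathfrak{X}_A$ is a $\mathcal Q$-stratification; 5. (lifting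 property) for any $C^q$ submanifolds $\Lambda,\Gamma\subset\mathbb{R}^n$ with $\Gamma\subset\overline\Lambda\setminus\Lambda$, any locally Lipschitz $f:\Lambda\cup\Gamma\to\mathbb{R}^m$ with $f|_\Lambda,f|_\Gamma$ of class $C^q$, and any $C^q$ submanifolds $M,N\subset\mathbb{R}^n$ with $N\subset\overline M\setminus M$ and each of $M,N$ contained in $\Lambda$ or in $\Gamma$: $\mathcal{W}^{\mathcal Q}(M,N)$ and $\mathcal{W}^{\mathcal Q}(\mathrm{graph} f|_\Lambda,\mathrm{graph} f|_\Gamma)$ imply $\mathcal{W}^{\mathcal Q}(\mathrm{graph} f|_M,\mathrm{graph} f|_N)$. *)

theory Defs
  imports "HOL-Analysis.Analysis" "HOL-Library.Disjoint_Sets"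
begin

section \<open>Euclidean spaces of all dimensions inside one inner product space\<close>

text \<open>
  Structures, regularity conditions and cells relate \<open>R^n\<close> for all \<open>n\<close> at once, so the dimension
  has to be a number and not a type. We use the inner product space of finitely supported real
  sequences with the \<open>l2\<close> inner product; \<open>R^n\<close> is the subspace \<open>Rn n\<close> of the sequences supported
  in \<open>{0, ..., n - 1}\<close>, with the usual Euclidean norm and topology. It is closed, so closures
  taken in the whole space agree with closures in \<open>R^n\<close>; open subsets of \<open>R^n\<close> are the sets open
  in the subspace topology \<open>top_of_set (Rn n)\<close>.
\<close>

typedef rvec = "{x :: nat \<Rightarrow> real. finite {i. x i \<noteq> 0}}"
  morphisms coord Abs_rvec
  by (rule exI[of _ "\<lambda>_. 0"]) simp

setup_lifting type_definition_rvec

lemma rvec_eqI: "(\<And>i. coord x i = coord y i) \<Longrightarrow> x = y"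
  by (simp add: coord_inject[symmetric] fun_eq_iff)

lemma finite_coord [simp]: "finite {i. coord x i \<noteq> 0}"
  using coord[of x] by simp

instantiation rvec :: real_vector
begin

lift_definition zero_rvec :: rvec is "\<lambda>_. 0" by simp

lift_definition plus_rvec :: "rvec \<Rightarrow> rvec \<Rightarrow> rvec" is "\<lambda>x y i. x i + y i"
proof -
  fix f g :: "nat \<Rightarrow> real"
  assume "finite {i. f i \<noteq> 0}" "finite {i. g i \<noteq> 0}"
  then have "finite ({i. f i \<noteq> 0} \<union> {i. g i \<noteq> 0})" by simp
  then show "finite {i. f i + g i \<noteq> 0}" by (rule rev_finite_subset) auto
qed

lift_definition uminus_rvec :: "rvec \<Rightarrow> rvec" is "\<lambda>x i. - x i" by simp

lift_definition minus_rvec :: "rvec \<Rightarrow> rvec \<Rightarrow> rvec" is "\<lambda>x y i. x i - y i"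
proof -
  fix f g :: "nat \<Rightarrow> real"
  assume "finite {i. f i \<noteq> 0}" "finite {i. g i \<noteq> 0}"
  then have "finite ({i. f i \<noteq> 0} \<union> {i. g i \<noteq> 0})" by simp
  then show "finite {i. f i - g i \<noteq> 0}" by (rule rev_finite_subset) auto
qed

lift_definition scaleR_rvec :: "real \<Rightarrow> rvec \<Rightarrow> rvec" is "\<lambda>r x i. r * x i"
  by (erule rev_finite_subset) auto

instance
  by (standard; transfer; simp add: fun_eq_iff algebra_simps)

end

lemma coord_zero [simp]: "coord 0 i = 0"
  by transfer simp

lemma coord_add [simp]: "coord (x + y) i = coord x i + coord y i"
  by transfer simp

lemma coord_minus [simp]: "coord (- x) i = - coord x i"
  by transfer simp

lemma coord_diff [simp]: "coord (x - y) i = coord x i - coord y i"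
  by transfer simp

lemma coord_scaleR [simp]: "coord (r *\<^sub>R x) i = r * coord x i"
  by transfer simp

definition Rn :: "nat \<Rightarrow> rvec set" where
  "Rn n = {x. \<forall>i\<ge>n. coord x i = 0}"

instantiation rvec :: real_inner
begin

definition inner_rvec :: "rvec \<Rightarrow> rvec \<Rightarrow> real" where
  "inner x y = (\<Sum>i | coord x i \<noteq> 0. coord x i * coord y i)"

definition norm_rvec :: "rvec \<Rightarrow> real" where
  "norm_rvec x = sqrt (inner x x)"

definition sgn_rvec :: "rvec \<Rightarrow> rvec" where
  "sgn_rvec x = x /\<^sub>R norm x"

definition dist_rvec :: "rvec \<Rightarrow> rvec \<Rightarrow> real" where
  "dist_rvec x y = norm (x - y)"

definition uniformity_rvec :: "(rvec \<times> rvec) filter" where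
  "uniformity_rvec = (INF e\<in>{0<..}. principal {(x, y). dist x y < e})"

definition open_rvec :: "rvec set \<Rightarrow> bool" where
  "open_rvec U = (\<forall>x\<in>U. \<forall>\<^sub>F (x', y) in uniformity. x' = x \<longrightarrow> y \<in> U)"

lemma inner_rvec_superset:
  assumes "finite I" "{i. coord x i \<noteq> 0} \<subseteq> I"
  shows "inner x y = (\<Sum>i\<in>I. coord x i * coord y i)"
  unfolding inner_rvec_def using assms by (intro sum.mono_neutral_left) auto

instance
proof
  fix x y z :: rvec and r :: real
  let ?I = "{i. coord x i \<noteq> 0} \<union> {i. coord y i \<noteq> 0}"
  have fin: "finite ?I" by simp
  show "inner x y = inner y x"
    by (subst (1 2) inner_rvec_superset[OF fin]) (auto simp: mult.commute)
  have "{i. coord (x + y) i \<noteq> 0} \<subseteq> ?I" by auto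
  then show "inner (x + y) z = inner x z + inner y z"
    by (subst (1 2 3) inner_rvec_superset[OF fin]) (auto simp: distrib_right sum.distrib)
  have "{i. coord (r *\<^sub>R x) i \<noteq> 0} \<subseteq> ?I" by auto
  then show "inner (r *\<^sub>R x) y = r * inner x y"
    by (subst (1 2) inner_rvec_superset[OF fin]) (auto simp: sum_distrib_left mult.assoc)
  show "0 \<le> inner x x"
    unfolding inner_rvec_def by (intro sum_nonneg) simp
  have "inner x x = 0 \<longleftrightarrow> (\<forall>i\<in>{i. coord x i \<noteq> 0}. coord x i * coord x i = 0)"
    unfolding inner_rvec_def by (intro sum_nonneg_eq_0_iff) auto
  then show "inner x x = 0 \<longleftrightarrow> x = 0"
    by (auto intro: rvec_eqI)
qed (simp_all only: norm_rvec_def sgn_rvec_def dist_rvec_def uniformity_rvec_def open_rvec_def)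

end

lemma inner_Rn: "x \<in> Rn n \<Longrightarrow> inner x y = (\<Sum>i<n. coord x i * coord y i)"
  by (rule inner_rvec_superset) (auto simp: Rn_def not_le[symmetric])

lift_definition ax :: "nat \<Rightarrow> rvec" is "\<lambda>k i. if i = k then 1 else 0"
  by (rule finite_subset[of _ "{k}" for k]) auto

lift_definition proj :: "nat \<Rightarrow> rvec \<Rightarrow> rvec" is "\<lambda>n x i. if i < n then x i else 0"
  by (erule rev_finite_subset) auto

text \<open>The identification of \<open>R^n \<times> R^m\<close> with \<open>R^(n + m)\<close>, to be used for \<open>x \<in> Rn n\<close>.\<close>

lift_definition pair :: "nat \<Rightarrow> rvec \<Rightarrow> rvec \<Rightarrow> rvec"
  is "\<lambda>n x y i. if i < n then x i else y (i - n)"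
proof -
  fix n and f g :: "nat \<Rightarrow> real"
  assume "finite {i. f i \<noteq> 0}" "finite {i. g i \<noteq> 0}"
  then have "finite ({..<n} \<union> (\<lambda>i. i + n) ` {i. g i \<noteq> 0})" by simp
  moreover have "i \<in> {..<n} \<union> (\<lambda>i. i + n) ` {i. g i \<noteq> 0}"
    if "(if i < n then f i else g (i - n)) \<noteq> 0" for i
  proof (cases "i < n")
    case False
    then have "i = (i - n) + n" "g (i - n) \<noteq> 0" using that by auto
    then show ?thesis by blast
  qed simp
  ultimately show "finite {i. (if i < n then f i else g (i - n)) \<noteq> 0}"
    by (elim finite_subset[rotated]) blast
qed

definition set_prod :: "nat \<Rightarrow> rvec set \<Rightarrow> rvec set \<Rightarrow> rvec set" where
  "set_prod n A B = {pair n x y | x y. x \<in> A \<and> y \<in> B}"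

definition graph_on :: "nat \<Rightarrow> rvec set \<Rightarrow> (rvec \<Rightarrow> rvec) \<Rightarrow> rvec set" where
  "graph_on n A f = {pair n x (f x) | x. x \<in> A}"

definition open_in_Rn :: "nat \<Rightarrow> rvec set \<Rightarrow> bool" where
  "open_in_Rn n U \<longleftrightarrow> openin (top_of_set (Rn n)) U"


section \<open>Maps and submanifolds of class \<open>C^q\<close>\<close>

datatype smoothness = C_fin nat | C_infinity | C_omega

definition at_least_C2 :: "smoothness \<Rightarrow> bool" where
  "at_least_C2 q \<longleftrightarrow> (case q of C_fin k \<Rightarrow> 2 \<le> k | C_infinity \<Rightarrow> True | C_omega \<Rightarrow> True)"

text \<open>Continuous partial derivatives up to order \<open>k\<close>, on a set \<open>U\<close> open in \<open>R^n\<close>.\<close>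

primrec Ck_on :: "nat \<Rightarrow> nat \<Rightarrow> rvec set \<Rightarrow> (rvec \<Rightarrow> 'b::real_normed_vector) \<Rightarrow> bool" where
  "Ck_on 0 n U f \<longleftrightarrow> continuous_on U f"
| "Ck_on (Suc k) n U f \<longleftrightarrow> continuous_on U f \<and>
     (\<exists>g. \<forall>i<n. (\<forall>x\<in>U. ((\<lambda>t. f (x + t *\<^sub>R ax i)) has_vector_derivative g i x) (at 0)) \<and>
                 Ck_on k n U (g i))"

text \<open>
  Local expansions \<open>f x = \<Sum>\<alpha>. (x - a)^\<alpha> c\<^sub>\<alpha>\<close> over the multi-indices \<open>\<alpha> \<in> N^n\<close>, the latter
  being sequences vanishing from \<open>n\<close> on; \<open>has_sum\<close> is unconditional summation.
\<close>

definition analytic_map_on :: "nat \<Rightarrow> rvec set \<Rightarrow> (rvec \<Rightarrow> 'b::real_normed_vector) \<Rightarrow> bool" where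
  "analytic_map_on n U f \<longleftrightarrow>
     (\<forall>a\<in>U. \<exists>r>0. \<exists>c. \<forall>x\<in>U. dist x a < r \<longrightarrow>
        ((\<lambda>\<alpha>. (\<Prod>i<n. (coord x i - coord a i) ^ \<alpha> i) *\<^sub>R c \<alpha>) has_sum f x)
          {\<alpha> :: nat \<Rightarrow> nat. \<forall>i\<ge>n. \<alpha> i = 0})"

definition Cq_on_open ::
  "smoothness \<Rightarrow> nat \<Rightarrow> rvec set \<Rightarrow> (rvec \<Rightarrow> 'b::real_normed_vector) \<Rightarrow> bool" where
  "Cq_on_open q n U f \<longleftrightarrow> open_in_Rn n U \<and>
     (case q of C_fin k \<Rightarrow> Ck_on k n U f
      | C_infinity \<Rightarrow> (\<forall>k. Ck_on k n U f)
      | C_omega \<Rightarrow> analytic_map_on n U f)"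

definition Cq_diffeo :: "smoothness \<Rightarrow> nat \<Rightarrow> rvec set \<Rightarrow> rvec set \<Rightarrow> (rvec \<Rightarrow> rvec) \<Rightarrow> bool" where
  "Cq_diffeo q n U W \<phi> \<longleftrightarrow> Cq_on_open q n U \<phi> \<and> \<phi> ` U = W \<and>
     (\<exists>\<psi>. Cq_on_open q n W \<psi> \<and> (\<forall>x\<in>U. \<psi> (\<phi> x) = x))"

text \<open>
  Embedded submanifolds of \<open>R^n\<close> of (pure) dimension \<open>k\<close>: locally flattened onto
  \<open>Rn k\<close>, which is \<open>R^k \<times> {0}\<close> in \<open>R^n\<close>.
\<close>

definition submanifold_dim :: "smoothness \<Rightarrow> nat \<Rightarrow> nat \<Rightarrow> rvec set \<Rightarrow> bool" where
  "submanifold_dim q n k M \<longleftrightarrow> k \<le> n \<and> M \<subseteq> Rn n \<and>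
     (\<forall>x\<in>M. \<exists>U V \<phi>. x \<in> U \<and> Cq_diffeo q n U V \<phi> \<and> \<phi> ` (M \<inter> U) = V \<inter> Rn k)"

definition submanifold :: "smoothness \<Rightarrow> nat \<Rightarrow> rvec set \<Rightarrow> bool" where
  "submanifold q n M \<longleftrightarrow> (\<exists>k. submanifold_dim q n k M)"

definition mdim :: "smoothness \<Rightarrow> nat \<Rightarrow> rvec set \<Rightarrow> nat" where
  "mdim q n M = (THE k. submanifold_dim q n k M)"

text \<open>Maps of class \<open>C^q\<close> on a submanifold: local restrictions of \<open>C^q\<close> maps on open sets.\<close>

definition Cq_on :: "smoothness \<Rightarrow> nat \<Rightarrow> rvec set \<Rightarrow> (rvec \<Rightarrow> 'b::real_normed_vector) \<Rightarrow> bool" where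
  "Cq_on q n M f \<longleftrightarrow>
     (\<forall>x\<in>M. \<exists>U F. x \<in> U \<and> Cq_on_open q n U F \<and> (\<forall>y\<in>M \<inter> U. F y = f y))"

definition tangent_space :: "rvec set \<Rightarrow> rvec \<Rightarrow> rvec set" where
  "tangent_space M x = {v. \<exists>\<gamma> \<epsilon>. 0 < \<epsilon> \<and> \<gamma> 0 = x \<and> \<gamma> C1_differentiable_on {-\<epsilon><..<\<epsilon>} \<and>
     \<gamma> ` {-\<epsilon><..<\<epsilon>} \<subseteq> M \<and> (\<gamma> has_vector_derivative v) (at 0)}"


section \<open>O-minimal structures and \<open>C^q\<close> cell decompositions\<close>

text \<open>\<open>D n\<close> is the collection of definable subsets of \<open>R^n\<close>; constants are definable.\<close>

locale o_minimal_structure =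
  fixes D :: "nat \<Rightarrow> rvec set set"
  assumes subset_Rn: "A \<in> D n \<Longrightarrow> A \<subseteq> Rn n"
    and empty: "{} \<in> D n"
    and Un: "A \<in> D n \<Longrightarrow> B \<in> D n \<Longrightarrow> A \<union> B \<in> D n"
    and compl: "A \<in> D n \<Longrightarrow> Rn n - A \<in> D n"
    and prod_right: "A \<in> D n \<Longrightarrow> set_prod n A (Rn 1) \<in> D (n + 1)"
    and prod_left: "A \<in> D n \<Longrightarrow> set_prod 1 (Rn 1) A \<in> D (1 + n)"
    and diagonal: "i < j \<Longrightarrow> j < n \<Longrightarrow> {x \<in> Rn n. coord x i = coord x j} \<in> D n"
    and projection: "A \<in> D (n + 1) \<Longrightarrow> proj n ` A \<in> D n"
    and less: "{x \<in> Rn 2. coord x 0 < coord x 1} \<in> D 2"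
    and add: "{x \<in> Rn 3. coord x 0 + coord x 1 = coord x 2} \<in> D 3"
    and mult: "{x \<in> Rn 3. coord x 0 * coord x 1 = coord x 2} \<in> D 3"
    and o_minimal: "A \<subseteq> Rn 1 \<Longrightarrow> A \<in> D 1 \<longleftrightarrow>
      (\<exists>F. finite F \<and> (\<forall>I\<in>F. is_interval I) \<and> (\<lambda>x. coord x 0) ` A = \<Union>F)"

definition definable_map ::
  "(nat \<Rightarrow> rvec set set) \<Rightarrow> nat \<Rightarrow> nat \<Rightarrow> rvec set \<Rightarrow> (rvec \<Rightarrow> rvec) \<Rightarrow> bool" where
  "definable_map D n m A f \<longleftrightarrow> A \<subseteq> Rn n \<and> f ` A \<subseteq> Rn m \<and> graph_on n A f \<in> D (n + m)"

text \<open>Definable \<open>C^q\<close> functions \<open>C \<rightarrow> R\<close>; \<open>x + t *\<^sub>R ax n\<close> is the point \<open>(x, t)\<close> of \<open>R^n \<times> R\<close>.\<close>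

definition cell_function ::
  "(nat \<Rightarrow> rvec set set) \<Rightarrow> smoothness \<Rightarrow> nat \<Rightarrow> rvec set \<Rightarrow> (rvec \<Rightarrow> real) \<Rightarrow> bool" where
  "cell_function D q n C f \<longleftrightarrow> {x + f x *\<^sub>R ax n | x. x \<in> C} \<in> D (n + 1) \<and> Cq_on q n C f"

definition cell_bound ::
  "(nat \<Rightarrow> rvec set set) \<Rightarrow> smoothness \<Rightarrow> nat \<Rightarrow> rvec set \<Rightarrow> ereal \<Rightarrow> (rvec \<Rightarrow> ereal) \<Rightarrow> bool" where
  "cell_bound D q n C e F \<longleftrightarrow> (\<forall>x\<in>C. F x = e) \<or>
     (\<exists>f. cell_function D q n C f \<and> (\<forall>x\<in>C. F x = ereal (f x)))"

inductive cell :: "(nat \<Rightarrow> rvec set set) \<Rightarrow> smoothness \<Rightarrow> nat \<Rightarrow> rvec set \<Rightarrow> bool"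
  for D q where
  point: "cell D q 0 (Rn 0)"
| graph: "cell D q n C \<Longrightarrow> cell_function D q n C f \<Longrightarrow>
    cell D q (Suc n) {x + f x *\<^sub>R ax n | x. x \<in> C}"
| band: "cell D q n C \<Longrightarrow> cell_bound D q n C (-\<infinity>) F \<Longrightarrow> cell_bound D q n C \<infinity> G \<Longrightarrow>
    (\<forall>x\<in>C. F x < G x) \<Longrightarrow>
    cell D q (Suc n) {x + t *\<^sub>R ax n | x t. x \<in> C \<and> F x < ereal t \<and> ereal t < G x}"

primrec cell_decomposition ::
  "(nat \<Rightarrow> rvec set set) \<Rightarrow> smoothness \<Rightarrow> nat \<Rightarrow> rvec set set \<Rightarrow> bool" where
  "cell_decomposition D q 0 X \<longleftrightarrow> X = {Rn 0}"
| "cell_decomposition D q (Suc n) X \<longleftrightarrow> finite X \<and> partition_on (Rn (Suc n)) X \<and>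
     (\<forall>C\<in>X. cell D q (Suc n) C) \<and> cell_decomposition D q n ((\<lambda>C. proj n ` C) ` X)"

definition admits_cell_decompositions :: "(nat \<Rightarrow> rvec set set) \<Rightarrow> smoothness \<Rightarrow> bool" where
  "admits_cell_decompositions D q \<longleftrightarrow>
     (\<forall>n \<A>. finite \<A> \<and> \<A> \<subseteq> D n \<longrightarrow>
        (\<exists>X. cell_decomposition D q n X \<and> (\<forall>A\<in>\<A>. \<forall>C\<in>X. C \<subseteq> A \<or> C \<inter> A = {})))"


section \<open>Stratifications and weakly Lipschitz maps\<close>

abbreviation in_frontier :: "rvec set \<Rightarrow> rvec set \<Rightarrow> bool" where
  "in_frontier \<Gamma> \<Lambda> \<equiv> \<Gamma> \<subseteq> closure \<Lambda> - \<Lambda>"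

definition stratification :: "smoothness \<Rightarrow> nat \<Rightarrow> rvec set \<Rightarrow> rvec set set \<Rightarrow> bool" where
  "stratification q n A X \<longleftrightarrow> finite X \<and> partition_on A X \<and>
     (\<forall>\<Gamma>\<in>X. connected \<Gamma> \<and> submanifold q n \<Gamma>) \<and>
     (\<forall>\<Gamma>\<in>X. \<exists>Y\<subseteq>X. (closure \<Gamma> - \<Gamma>) \<inter> A = \<Union>Y \<and> (\<forall>\<Delta>\<in>Y. mdim q n \<Delta> < mdim q n \<Gamma>))"

definition weakly_lipschitz ::
  "smoothness \<Rightarrow> nat \<Rightarrow> nat \<Rightarrow> rvec set \<Rightarrow> rvec set set \<Rightarrow> (rvec \<Rightarrow> rvec) \<Rightarrow> bool" where
  "weakly_lipschitz q n m A X f \<longleftrightarrow> f ` A \<subseteq> Rn m \<and> (\<forall>\<Gamma>\<in>X. Cq_on q n \<Gamma> f) \<and>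
     (\<forall>\<Lambda>\<in>X. \<forall>\<Gamma>\<in>X. in_frontier \<Gamma> \<Lambda> \<longrightarrow>
        (\<forall>a\<in>\<Gamma>. \<forall>u w. (\<forall>\<nu>. u \<nu> \<in> \<Gamma>) \<and> (\<forall>\<nu>. w \<nu> \<in> \<Lambda>) \<and> u \<longlonglongrightarrow> a \<and> w \<longlonglongrightarrow> a \<longrightarrow>
           limsup (\<lambda>\<nu>. ereal (norm (f (u \<nu>) - f (w \<nu>)) / norm (u \<nu> - w \<nu>))) < \<infinity>))"

definition graph_stratification :: "nat \<Rightarrow> rvec set set \<Rightarrow> (rvec \<Rightarrow> rvec) \<Rightarrow> rvec set set" where
  "graph_stratification n X f = (\<lambda>\<Gamma>. graph_on n \<Gamma> f) ` X"

definition locally_lipschitz :: "rvec set \<Rightarrow> (rvec \<Rightarrow> rvec) \<Rightarrow> bool" where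
  "locally_lipschitz A f \<longleftrightarrow>
     (\<forall>x\<in>A. \<exists>U L. openin (top_of_set A) U \<and> x \<in> U \<and> L-lipschitz_on U f)"


section \<open>Regularity conditions\<close>

text \<open>
  \<open>Q n \<Lambda> \<Gamma> x\<close> means that the condition holds at \<open>x\<close> for the pair \<open>(\<Lambda>, \<Gamma>)\<close> of
  submanifolds of \<open>R^n\<close>. Its value is relevant only for \<open>C^q\<close> submanifolds with
  \<open>\<Gamma> \<subseteq> closure \<Lambda> - \<Lambda>\<close> and \<open>x \<in> \<Gamma>\<close>: it is used for no other arguments.
\<close>

type_synonym reg_condition = "nat \<Rightarrow> rvec set \<Rightarrow> rvec set \<Rightarrow> rvec \<Rightarrow> bool"

definition incident_pair :: "smoothness \<Rightarrow> nat \<Rightarrow> rvec set \<Rightarrow> rvec set \<Rightarrow> bool" where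
  "incident_pair q n \<Lambda> \<Gamma> \<longleftrightarrow> submanifold q n \<Lambda> \<and> submanifold q n \<Gamma> \<and> in_frontier \<Gamma> \<Lambda>"

definition regular_pair :: "reg_condition \<Rightarrow> nat \<Rightarrow> rvec set \<Rightarrow> rvec set \<Rightarrow> bool" where
  "regular_pair Q n \<Lambda> \<Gamma> \<longleftrightarrow> (\<forall>x\<in>\<Gamma>. Q n \<Lambda> \<Gamma> x)"

definition Q_stratification ::
  "reg_condition \<Rightarrow> smoothness \<Rightarrow> nat \<Rightarrow> rvec set \<Rightarrow> rvec set set \<Rightarrow> bool" where
  "Q_stratification Q q n A X \<longleftrightarrow> stratification q n A X \<and>
     (\<forall>\<Lambda>\<in>X. \<forall>\<Gamma>\<in>X. in_frontier \<Gamma> \<Lambda> \<longrightarrow> regular_pair Q n \<Lambda> \<Gamma>)"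

definition local_condition :: "smoothness \<Rightarrow> reg_condition \<Rightarrow> bool" where
  "local_condition q Q \<longleftrightarrow>
     (\<forall>n \<Lambda> \<Gamma> x U. incident_pair q n \<Lambda> \<Gamma> \<and> x \<in> \<Gamma> \<and> open_in_Rn n U \<and> x \<in> U \<longrightarrow>
        (Q n \<Lambda> \<Gamma> x \<longleftrightarrow> Q n (\<Lambda> \<inter> U) (\<Gamma> \<inter> U) x))"

definition definable_condition ::
  "(nat \<Rightarrow> rvec set set) \<Rightarrow> smoothness \<Rightarrow> reg_condition \<Rightarrow> bool" where
  "definable_condition D q Q \<longleftrightarrow>
     (\<forall>n \<Lambda> \<Gamma>. incident_pair q n \<Lambda> \<Gamma> \<and> \<Lambda> \<in> D n \<and> \<Gamma> \<in> D n \<longrightarrow> {x \<in> \<Gamma>. Q n \<Lambda> \<Gamma> x} \<in> D n)"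

definition generic_condition ::
  "(nat \<Rightarrow> rvec set set) \<Rightarrow> smoothness \<Rightarrow> reg_condition \<Rightarrow> bool" where
  "generic_condition D q Q \<longleftrightarrow>
     (\<forall>n \<Lambda> \<Gamma>. incident_pair q n \<Lambda> \<Gamma> \<and> \<Lambda> \<in> D n \<and> \<Gamma> \<in> D n \<longrightarrow>
        top_of_set \<Gamma> interior_of (top_of_set \<Gamma> closure_of {x \<in> \<Gamma>. \<not> Q n \<Lambda> \<Gamma> x}) = {})"

definition invariant_condition ::
  "(nat \<Rightarrow> rvec set set) \<Rightarrow> smoothness \<Rightarrow> reg_condition \<Rightarrow> bool" where
  "invariant_condition D q Q \<longleftrightarrow>
     (\<forall>n U W \<phi> \<Lambda> \<Gamma> x. Cq_diffeo q n U W \<phi> \<and> definable_map D n n U \<phi> \<and>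
        incident_pair q n \<Lambda> \<Gamma> \<and> \<Lambda> \<subseteq> U \<and> \<Gamma> \<subseteq> U \<and> x \<in> \<Gamma> \<longrightarrow>
        (Q n \<Lambda> \<Gamma> x \<longleftrightarrow> Q n (\<phi> ` \<Lambda>) (\<phi> ` \<Gamma>) (\<phi> x)))"

definition projection_property :: "smoothness \<Rightarrow> reg_condition \<Rightarrow> bool" where
  "projection_property q Q \<longleftrightarrow>
     (\<forall>n m A X f. stratification q n A X \<and> weakly_lipschitz q n m A X f \<and>
        Q_stratification Q q (n + m) (graph_on n A f) (graph_stratification n X f) \<longrightarrow>
        Q_stratification Q q n A X)"

definition lifting_property :: "smoothness \<Rightarrow> reg_condition \<Rightarrow> bool" where
  "lifting_property q Q \<longleftrightarrow>
     (\<forall>n m \<Lambda> \<Gamma> f M N. incident_pair q n \<Lambda> \<Gamma> \<and>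
        f ` (\<Lambda> \<union> \<Gamma>) \<subseteq> Rn m \<and> locally_lipschitz (\<Lambda> \<union> \<Gamma>) f \<and> Cq_on q n \<Lambda> f \<and> Cq_on q n \<Gamma> f \<and>
        incident_pair q n M N \<and> (M \<subseteq> \<Lambda> \<or> M \<subseteq> \<Gamma>) \<and> (N \<subseteq> \<Lambda> \<or> N \<subseteq> \<Gamma>) \<and>
        regular_pair Q n M N \<and> regular_pair Q (n + m) (graph_on n \<Lambda> f) (graph_on n \<Gamma> f) \<longrightarrow>
        regular_pair Q (n + m) (graph_on n M f) (graph_on n N f))"

definition WL_condition :: "(nat \<Rightarrow> rvec set set) \<Rightarrow> smoothness \<Rightarrow> reg_condition \<Rightarrow> bool" where
  "WL_condition D q Q \<longleftrightarrow> local_condition q Q \<and>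
     definable_condition D q Q \<and> generic_condition D q Q \<and> invariant_condition D q Q \<and>
     projection_property q Q \<and> lifting_property q Q"


section \<open>The Verdier condition\<close>

definition angle :: "rvec \<Rightarrow> rvec \<Rightarrow> real" where
  "angle v w = arccos (inner v w / (norm v * norm w))"

definition d_vec :: "rvec \<Rightarrow> rvec set \<Rightarrow> real" where
  "d_vec v W = (if W = {0} then 1 else Inf {sin (angle v w) | w. w \<in> W \<and> norm w = 1})"

definition d_space :: "rvec set \<Rightarrow> rvec set \<Rightarrow> real" where
  "d_space P Q = (if P = {0} then 0 else Sup {d_vec v Q | v. v \<in> P \<and> norm v = 1})"

definition verdier :: reg_condition where
  "verdier n \<Lambda> \<Gamma> x\<^sub>0 \<longleftrightarrow>
     (\<exists>U C. open_in_Rn n U \<and> x\<^sub>0 \<in> U \<and> 0 < C \<and>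
        (\<forall>x\<in>\<Gamma> \<inter> U. \<forall>y\<in>\<Lambda> \<inter> U.
           d_space (tangent_space \<Gamma> x) (tangent_space \<Lambda> y) \<le> C * norm (x - y)))"

end

theory Submission
  imports Defs
begin

text \<open>
  \<^bold>\<open>Reduction.\<close> Angles, infima and suprema are eliminated first: up to a factor that disappears in the
  constant of the Verdier condition, \<open>d_space P Q \<le> c\<close> means that every \<open>v \<in> P\<close> has a \<open>w \<in> Q\<close> with
  \<open>norm (v - w) \<le> c * norm v\<close> (\<open>vbound\<close>, \<open>verdier_iff_vb\<close>). What is used of a map of class \<open>C^q\<close> is that,
  locally, its derivative is bounded and Lipschitz (\<open>C11\<close>); for \<open>q = \<omega>\<close> this comes from termwise
  differentiation of power series. In a flattening chart the tangent space at \<open>x\<close> is the image of a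
  fixed subspace under a linear map that depends on \<open>x\<close> in a Lipschitz way, so tangent spaces of one
  manifold vary in a Lipschitz way.

  \<^bold>\<open>Locality, invariance, projection, lifting.\<close> Tangent spaces are local. A diffeomorphism, or the
  map from the domain to the graph of a map, carries tangent vectors forward by its derivative; as
  the derivative is Lipschitz, the estimate \<open>norm (v - w) \<le> C * norm (x - y) * norm v\<close> is preserved
  with another constant. For the projection property, the weak Lipschitz condition compares
  \<open>norm (x - y)\<close> with the distance of the points of the graph. For the lifting property the only case
  with an idea is \<open>M \<subseteq> \<Lambda>\<close>, \<open>N \<subseteq> \<Gamma>\<close>: the vertical part of a tangent vector of the graph over
  \<open>\<Lambda>\<close> is controlled by the horizontal part, because \<open>f\<close> is Lipschitz (\<open>verdier_vb_lift_mixed\<close>).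

  \<^bold>\<open>Definability.\<close> A vector \<open>v\<close> is tangent to \<open>M\<close> at \<open>x\<close> iff \<open>M\<close> has points within \<open>e * t\<close> of \<open>x + t *\<^sub>R v\<close>
  for all small \<open>t > 0\<close>, for every \<open>e > 0\<close> (\<open>tangent_space_iff_cone\<close>). This is a first-order formula,
  and so is the Verdier condition.

  \<^bold>\<open>Genericity.\<close> Near any of its points, \<open>\<Gamma>\<close> is the graph of a map \<open>g\<close> after a permutation of
  coordinates (\<open>local_graph\<close>). For \<open>x\<close> in the domain of \<open>g\<close> and small \<open>t > 0\<close> consider the points of \<open>\<Lambda>\<close>
  over \<open>x\<close> at distance \<open>t\<close> from \<open>g x\<close>. Definable choice and cell decomposition give, over a slab
  \<open>ball a \<rho> \<times> (0, \<eta>)\<close>, either no such points or a \<open>C11\<close> map \<open>Y (x, t)\<close> that selects one at which the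
  distance from the tangent space of \<open>\<Gamma>\<close> is, up to a factor \<open>2\<close>, the worst one over \<open>(x, t)\<close>
  (\<open>near_maximal_exists\<close>, \<open>definable_choice\<close>). As
  \<open>norm (Y (x, t) - g x) = t\<close>, the crucial estimate \<open>derivative_bound\<close> shows that the
  derivative of \<open>Y (x, t) - g x\<close> in \<open>x\<close> is at most \<open>C * t\<close> on a smaller slab. The tangent spaces contain the
  graphs of the derivatives of \<open>Y\<close> and \<open>g\<close> in \<open>x\<close>, which gives the estimate for base points with the
  same \<open>x\<close> (\<open>fibre_estimate\<close>); as \<open>g\<close> and the tangent spaces of \<open>\<Gamma>\<close> are Lipschitz, the Verdier condition holds at
  a point of \<open>\<Gamma>\<close> near the given one (\<open>verdier_vb_from_fibres\<close>, \<open>verdier_vb_near\<close>). Since it is an open condition, it holds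
  outside a nowhere dense set.
\<close>

section \<open>Linear algebra and calculus in the spaces \<open>Rn n\<close>\<close>

lemma coord_sum [simp]: "coord (sum f A) i = (\<Sum>a\<in>A. coord (f a) i)"
  by (induction A rule: infinite_finite_induct) auto

lemma coord_ax [simp]: "coord (ax k) i = (if i = k then 1 else 0)"
  by transfer simp

lemma coord_proj [simp]: "coord (proj n x) i = (if i < n then coord x i else 0)"
  by transfer simp

lemma coord_pair [simp]: "coord (pair n x y) i = (if i < n then coord x i else coord y (i - n))"
  by transfer simp

lemma ax_in_Rn [simp]: "ax i \<in> Rn n \<longleftrightarrow> i < n"
  by (auto simp: Rn_def)

lemma subspace_Rn [simp]: "subspace (Rn n)"
  by (auto simp: subspace_def Rn_def)

lemmas Rn_add [intro] = subspace_add[OF subspace_Rn]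
  and Rn_diff [intro] = subspace_diff[OF subspace_Rn]
  and Rn_scale [intro] = subspace_scale[OF subspace_Rn]
  and Rn_0 [simp] = subspace_0[OF subspace_Rn]
  and Rn_sum [intro] = subspace_sum[OF subspace_Rn]

lemma Rn_mono: "n \<le> m \<Longrightarrow> Rn n \<subseteq> Rn m"
  by (auto simp: Rn_def)

lemma convex_Rn [simp]: "convex (Rn n)"
  by (simp add: subspace_imp_convex)

lemma Rn_zero: "Rn 0 = {0}"
  by (auto simp: Rn_def intro: rvec_eqI)

lemma Rn_expand: "x \<in> Rn n \<Longrightarrow> x = (\<Sum>i<n. coord x i *\<^sub>R ax i)"
  by (rule rvec_eqI) (auto simp: Rn_def if_distrib cong: if_cong)

lemma Rn_eqI: "x \<in> Rn n \<Longrightarrow> y \<in> Rn n \<Longrightarrow> (\<And>i. i < n \<Longrightarrow> coord x i = coord y i) \<Longrightarrow> x = y"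
  by (rule rvec_eqI) (metis (mono_tags) Rn_def mem_Collect_eq not_le)

lemma proj_in_Rn [simp]: "proj n x \<in> Rn n"
  by (auto simp: Rn_def)

lemma proj_Rn: "x \<in> Rn n \<Longrightarrow> proj n x = x"
  by (rule rvec_eqI) (auto simp: Rn_def)

lemma proj_proj [simp]: "proj n (proj m x) = proj (min n m) x"
  by (rule rvec_eqI) auto

lemma linear_proj: "linear (proj n)"
  by (rule linearI) (auto intro!: rvec_eqI)

lemma inner_ax: "inner x (ax i) = coord x i"
proof -
  have "inner x (ax i) = inner (ax i) x" by (rule inner_commute)
  also have "\<dots> = (\<Sum>j\<in>{i}. coord (ax i) j * coord x j)"
    by (rule inner_rvec_superset) auto
  finally show ?thesis by simp
qed

lemma norm_ax [simp]: "norm (ax i) = 1"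
  by (simp add: norm_eq_sqrt_inner inner_ax)

lemma abs_coord_le_norm: "\<bar>coord x i\<bar> \<le> norm x"
  using Cauchy_Schwarz_ineq2[of x "ax i"] by (simp add: inner_ax)

lemma norm_le_sum_coord: "x \<in> Rn n \<Longrightarrow> norm x \<le> (\<Sum>i<n. \<bar>coord x i\<bar>)"
  by (subst Rn_expand, assumption, rule order_trans[OF norm_sum]) simp

lemma norm_power2_Rn: "x \<in> Rn n \<Longrightarrow> (norm x)\<^sup>2 = (\<Sum>i<n. (coord x i)\<^sup>2)"
  by (simp only: power2_norm_eq_inner inner_Rn) (simp only: power2_eq_square)

lemma norm_proj_le: "norm (proj n x) \<le> norm x"
proof -
  have "(norm (proj n x))\<^sup>2 = inner (proj n x) x"
    by (subst norm_power2_Rn[of _ n]) (auto simp: inner_Rn[of _ n] power2_eq_square)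
  also have "\<dots> \<le> norm (proj n x) * norm x"
    by (rule norm_cauchy_schwarz)
  finally show ?thesis
    by (cases "norm (proj n x) = 0") (auto simp: power2_eq_square)
qed

lemma bounded_linear_coord: "bounded_linear (\<lambda>x. coord x i)"
  by (rule bounded_linear_intro[where K = 1]) (auto simp: abs_coord_le_norm)

lemma bounded_linear_proj: "bounded_linear (proj n)"
  by (rule bounded_linear_intro[where K = 1]) (auto simp: norm_proj_le linear_proj linear_add linear_scale)

lemmas continuous_on_coord [continuous_intros] =
  bounded_linear.continuous_on[OF bounded_linear_coord]
lemmas continuous_on_proj [continuous_intros] =
  bounded_linear.continuous_on[OF bounded_linear_proj]
lemma closed_Rn: "closed (Rn n)"
proof -
  have "Rn n = (\<Inter>i\<in>{n..}. {x. coord x i = 0})"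
    by (auto simp: Rn_def)
  moreover have "closed {x. coord x i = 0}" for i
    by (intro closed_Collect_eq continuous_intros)
  ultimately show ?thesis by auto
qed

lemma complete_Rn: "complete (Rn n)"
proof (rule completeI)
  fix f :: "nat \<Rightarrow> rvec"
  assume f: "\<forall>k. f k \<in> Rn n" "Cauchy f"
  have "Cauchy (\<lambda>k. coord (f k) i)" for i
    by (rule bounded_linear.Cauchy[OF bounded_linear_coord f(2)])
  then have "\<forall>i. \<exists>l. (\<lambda>k. coord (f k) i) \<longlonglongrightarrow> l"
    by (simp add: convergent_def[symmetric] Cauchy_convergent)
  then obtain l where l: "\<And>i. (\<lambda>k. coord (f k) i) \<longlonglongrightarrow> l i" by metis
  have "(\<lambda>k. \<Sum>i<n. coord (f k) i *\<^sub>R ax i) \<longlonglongrightarrow> (\<Sum>i<n. l i *\<^sub>R ax i)"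
    by (intro tendsto_intros l)
  moreover have "f = (\<lambda>k. \<Sum>i<n. coord (f k) i *\<^sub>R ax i)"
    using f(1) Rn_expand by blast
  ultimately have "f \<longlonglongrightarrow> (\<Sum>i<n. l i *\<^sub>R ax i)" by simp
  moreover have "(\<Sum>i<n. l i *\<^sub>R ax i) \<in> Rn n"
    by (intro Rn_sum Rn_scale) auto
  ultimately show "\<exists>l\<in>Rn n. f \<longlonglongrightarrow> l" by blast
qed

lemma open_in_Rn_ball:
  assumes "open_in_Rn n U" "x \<in> U"
  obtains r where "r > 0" "ball x r \<inter> Rn n \<subseteq> U" "x \<in> Rn n"
  using assms unfolding open_in_Rn_def openin_contains_ball by blast

lemma open_in_Rn_subset: "open_in_Rn n U \<Longrightarrow> U \<subseteq> Rn n"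
  unfolding open_in_Rn_def by (auto dest: openin_imp_subset)

lemma open_in_Rn_Int_open: "open T \<Longrightarrow> open_in_Rn n (T \<inter> Rn n)"
  unfolding open_in_Rn_def by (auto simp: openin_open)

text \<open>
  Moving from \<open>x\<close> to \<open>y\<close> along one axis after the other, the ordinary mean value theorem applies
  on each of the \<open>n\<close> segments, all of which stay within distance \<open>norm (y - x)\<close> of \<open>x\<close>.
\<close>

lemma mean_value_partials:
  fixes f :: "rvec \<Rightarrow> real"
  assumes S: "\<And>z. z \<in> Rn n \<Longrightarrow> norm (z - x) \<le> norm (y - x) \<Longrightarrow> z \<in> S"
    and d: "\<And>z i. z \<in> S \<Longrightarrow> i < n \<Longrightarrow> ((\<lambda>t. f (z + t *\<^sub>R ax i)) has_vector_derivative g i z) (at 0)"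
    and x: "x \<in> Rn n" and y: "y \<in> Rn n"
  shows "\<exists>\<xi>. (\<forall>i<n. \<xi> i \<in> Rn n \<and> norm (\<xi> i - x) \<le> norm (y - x)) \<and>
     f y - f x = (\<Sum>i<n. coord (y - x) i * g i (\<xi> i))"
proof -
  define v where "v = y - x"
  have v: "v \<in> Rn n" unfolding v_def using x y by blast
  define p where "p j = x + proj j v" for j
  have step: "\<exists>\<xi>. \<xi> \<in> Rn n \<and> norm (\<xi> - x) \<le> norm v \<and> f (p (Suc j)) - f (p j) = coord v j * g j \<xi>"
    if j: "j < n" for j
  proof -
    define c where "c = coord v j"
    define q where "q s = p j + (s * c) *\<^sub>R ax j" for s
    have q_Rn: "q s \<in> Rn n" for s
      unfolding q_def p_def using x j Rn_mono[of j n] proj_in_Rn[of j v]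
      by (intro Rn_add Rn_scale) auto
    have q_norm: "norm (q s - x) \<le> norm v" if "0 \<le> s" "s \<le> 1" for s
    proof -
      have "(norm (q s - x))\<^sup>2 = (\<Sum>i<n. (coord (q s - x) i)\<^sup>2)"
        using q_Rn x by (intro norm_power2_Rn) blast
      also have "\<dots> \<le> (\<Sum>i<n. (coord v i)\<^sup>2)"
      proof (intro sum_mono)
        fix i
        have "\<bar>coord (q s - x) i\<bar> \<le> \<bar>coord v i\<bar>"
          using that by (auto simp: q_def p_def c_def abs_mult mult_left_le_one_le)
        then show "(coord (q s - x) i)\<^sup>2 \<le> (coord v i)\<^sup>2" by (simp add: abs_le_square_iff)
      qed
      also have "\<dots> = (norm v)\<^sup>2" using v by (simp add: norm_power2_Rn)
      finally show ?thesis by (simp add: power2_le_iff_abs_le)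
    qed
    have der: "((\<lambda>s. f (q s)) has_real_derivative c * g j (q s)) (at s)" if "0 \<le> s" "s \<le> 1" for s
    proof -
      have "q s \<in> S" using S q_Rn q_norm that unfolding v_def by blast
      then have "((\<lambda>t. f (q s + t *\<^sub>R ax j)) has_real_derivative g j (q s)) (at ((s - s) * c))"
        using d[OF _ j] by (simp add: has_real_derivative_iff_has_vector_derivative)
      moreover have "((\<lambda>s'. (s' - s) * c) has_real_derivative c) (at s)"
        by (auto intro!: derivative_eq_intros)
      ultimately have "((\<lambda>s'. f (q s + ((s' - s) * c) *\<^sub>R ax j)) has_real_derivative g j (q s) * c) (at s)"
        by (rule DERIV_chain2)
      moreover have "q s + ((s' - s) * c) *\<^sub>R ax j = q s'" for s'
        by (simp add: q_def algebra_simps)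
      ultimately show ?thesis by (simp add: mult.commute)
    qed
    obtain s where s: "0 < s" "s < 1" "f (q 1) - f (q 0) = (1 - 0) * (c * g j (q s))"
      using MVT2[of 0 1 "\<lambda>s. f (q s)" "\<lambda>s. c * g j (q s)"] der by auto
    have "q 1 = p (Suc j)" "q 0 = p j"
      by (auto simp: q_def p_def c_def less_Suc_eq intro!: rvec_eqI)
    then show ?thesis using s q_Rn q_norm[of s] by (intro exI[of _ "q s"]) (auto simp: c_def)
  qed
  then obtain \<xi> where \<xi>: "\<And>j. j < n \<Longrightarrow> \<xi> j \<in> Rn n \<and> norm (\<xi> j - x) \<le> norm v \<and>
      f (p (Suc j)) - f (p j) = coord v j * g j (\<xi> j)" by metis
  have "p n = y" "p 0 = x" using v by (auto simp: p_def proj_Rn v_def intro!: rvec_eqI)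
  then have "f y - f x = (\<Sum>j<n. f (p (Suc j)) - f (p j))"
    using sum_lessThan_telescope[of "\<lambda>j. f (p j)" n] by simp
  also have "\<dots> = (\<Sum>j<n. coord v j * g j (\<xi> j))" using \<xi> by (intro sum.cong) auto
  finally show ?thesis using \<xi> unfolding v_def by blast
qed

definition partials_map :: "nat \<Rightarrow> (nat \<Rightarrow> 'b::real_normed_vector) \<Rightarrow> rvec \<Rightarrow> 'b" where
  "partials_map n c v = (\<Sum>i<n. coord v i *\<^sub>R c i)"

lemma norm_partials_map_le: "(\<And>i. i < n \<Longrightarrow> norm (c i) \<le> K) \<Longrightarrow> norm (partials_map n c v) \<le> real n * K * norm v"
proof -
  assume K: "\<And>i. i < n \<Longrightarrow> norm (c i) \<le> K"
  have "norm (partials_map n c v) \<le> (\<Sum>i<n. norm v * K)"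
    unfolding partials_map_def
    by (rule sum_norm_le) (auto intro!: mult_mono K abs_coord_le_norm)
  then show ?thesis by (simp add: mult.commute mult.left_commute)
qed

lemma bounded_linear_partials_map: "bounded_linear (partials_map n c)"
  unfolding partials_map_def
  by (intro bounded_linear_sum bounded_linear_compose[OF bounded_linear_scaleR_left bounded_linear_coord])

lemma partials_map_diff: "partials_map n c v - partials_map n c' v = partials_map n (\<lambda>i. c i - c' i) v"
  by (simp add: partials_map_def sum_subtractf scaleR_diff_right)

text \<open>
  Linearize by \<open>mean_value_partials\<close>: the error is at most \<open>n * norm (y - x)\<close> times the oscillation of the partial
  derivatives between \<open>x\<close> and \<open>y\<close>, which tends to \<open>0\<close>.
\<close>

lemma has_derivative_partials:
  fixes f :: "rvec \<Rightarrow> real"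
  assumes U: "open_in_Rn n U" and x: "x \<in> U"
    and d: "\<And>z i. z \<in> U \<Longrightarrow> i < n \<Longrightarrow> ((\<lambda>t. f (z + t *\<^sub>R ax i)) has_vector_derivative g i z) (at 0)"
    and c: "\<And>i. i < n \<Longrightarrow> continuous_on U (g i)"
  shows "(f has_derivative partials_map n (\<lambda>i. g i x)) (at x within Rn n)"
  unfolding has_derivative_within_alt
proof (intro conjI allI impI bounded_linear_partials_map)
  fix e :: real assume e: "e > 0"
  obtain r where r: "r > 0" "ball x r \<inter> Rn n \<subseteq> U" and xR: "x \<in> Rn n" using open_in_Rn_ball[OF U x] by blast
  define e' where "e' = e / (real n + 1)"
  have e': "e' > 0" using e by (simp add: e'_def)
  have "\<forall>i<n. \<exists>d>0. \<forall>z\<in>U. dist z x < d \<longrightarrow> dist (g i z) (g i x) < e'"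
    using c x e' unfolding continuous_on_iff by blast
  then obtain D where D: "\<And>i. i < n \<Longrightarrow> D i > 0"
     "\<And>i z. i < n \<Longrightarrow> z \<in> U \<Longrightarrow> dist z x < D i \<Longrightarrow> dist (g i z) (g i x) < e'" by metis
  define d where "d = Min (insert r (D ` {..<n}))"
  have d0: "d > 0" unfolding d_def using D r by (subst Min_gr_iff) auto
  have dr: "d \<le> r" and dD: "\<And>i. i < n \<Longrightarrow> d \<le> D i" by (auto simp: d_def)
  show "\<exists>d>0. \<forall>y\<in>Rn n. norm (y - x) < d \<longrightarrow>
      norm (f y - f x - partials_map n (\<lambda>i. g i x) (y - x)) \<le> e * norm (y - x)"
  proof (intro exI[of _ d] conjI d0 ballI impI)
    fix y assume y: "y \<in> Rn n" "norm (y - x) < d"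
    have near: "z \<in> U" if "z \<in> Rn n" "norm (z - x) \<le> norm (y - x)" for z
      using that y dr r by (auto simp: dist_norm norm_minus_commute)
    obtain \<xi> where \<xi>: "\<And>i. i < n \<Longrightarrow> \<xi> i \<in> Rn n \<and> norm (\<xi> i - x) \<le> norm (y - x)"
      and eq: "f y - f x = (\<Sum>i<n. coord (y - x) i * g i (\<xi> i))"
      using mean_value_partials[where S = U and f = f and g = g and x = x and y = y and n = n]
        near assms(3) xR y by blast
    have "f y - f x - partials_map n (\<lambda>i. g i x) (y - x) = partials_map n (\<lambda>i. g i (\<xi> i) - g i x) (y - x)"
      by (simp add: eq partials_map_def sum_subtractf[symmetric] right_diff_distrib)
    moreover have "norm (g i (\<xi> i) - g i x) \<le> e'" if "i < n" for i
      using D(2)[OF that, of "\<xi> i"] near \<xi>[OF that] y dD[OF that]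
      by (simp add: dist_norm)
    ultimately have "norm (f y - f x - partials_map n (\<lambda>i. g i x) (y - x)) \<le> real n * e' * norm (y - x)"
      using norm_partials_map_le[of n "\<lambda>i. g i (\<xi> i) - g i x" e' "y - x"] by presburger
    also have "\<dots> \<le> e * norm (y - x)"
      using e by (intro mult_right_mono) (auto simp: e'_def field_simps)
    finally show "norm (f y - f x - partials_map n (\<lambda>i. g i x) (y - x)) \<le> e * norm (y - x)" .
  qed
qed

section \<open>Convergent power series are smooth\<close>

definition monomial :: "nat \<Rightarrow> (nat \<Rightarrow> nat) \<Rightarrow> (nat \<Rightarrow> real) \<Rightarrow> real" where
  "monomial n \<alpha> y = (\<Prod>i<n. y i ^ \<alpha> i)"

definition multi_indices :: "nat \<Rightarrow> (nat \<Rightarrow> nat) set" where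
  "multi_indices n = {\<alpha>. \<forall>i\<ge>n. \<alpha> i = 0}"

text \<open>
  Absolute convergence at the corner \<open>(\<rho>, ..., \<rho>)\<close> dominates the series on the whole polydisc of radius \<open>\<rho>\<close>.
\<close>

definition abs_conv :: "nat \<Rightarrow> real \<Rightarrow> ((nat \<Rightarrow> nat) \<Rightarrow> real) \<Rightarrow> bool" where
  "abs_conv n \<rho> c \<longleftrightarrow> (\<lambda>\<alpha>. \<bar>c \<alpha>\<bar> * monomial n \<alpha> (\<lambda>_. \<rho>)) summable_on multi_indices n"

definition series_value :: "nat \<Rightarrow> ((nat \<Rightarrow> nat) \<Rightarrow> real) \<Rightarrow> (nat \<Rightarrow> real) \<Rightarrow> real" where
  "series_value n c y = (\<Sum>\<^sub>\<infinity>\<alpha>\<in>multi_indices n. c \<alpha> * monomial n \<alpha> y)"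

text \<open>
  The coefficients of the partial derivative in the \<open>j\<close>-th variable.
\<close>

definition series_deriv :: "nat \<Rightarrow> ((nat \<Rightarrow> nat) \<Rightarrow> real) \<Rightarrow> (nat \<Rightarrow> nat) \<Rightarrow> real" where
  "series_deriv j c \<beta> = real (Suc (\<beta> j)) * c (\<beta>(j := Suc (\<beta> j)))"

lemma summable_on_dominated:
  fixes f g :: "'a \<Rightarrow> real"
  assumes g: "g summable_on A" and f: "\<And>x. x \<in> A \<Longrightarrow> 0 \<le> f x" "\<And>x. x \<in> A \<Longrightarrow> f x \<le> g x"
  shows "f summable_on A"
proof (rule nonneg_bdd_above_summable_on)
  show "bdd_above (sum f ` {F. F \<subseteq> A \<and> finite F})"
  proof (rule bdd_aboveI2)
    fix F assume F: "F \<in> {F. F \<subseteq> A \<and> finite F}"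
    then have "sum f F \<le> sum g F" using f by (intro sum_mono) auto
    also have "\<dots> \<le> infsum g A"
      using F f order_trans[OF f(1) f(2)] by (intro finite_sum_le_infsum g) auto
    finally show "sum f F \<le> infsum g A" .
  qed
qed (use f in auto)

lemma has_sum_diff_real:
  fixes f g :: "'a \<Rightarrow> real"
  assumes "(f has_sum a) A" "(g has_sum b) A"
  shows "((\<lambda>x. f x - g x) has_sum (a - b)) A"
  using has_sum_add[OF assms(1) has_sum_cmult_right[OF assms(2), of "-1"]] by simp

lemma abs_has_sum_le:
  fixes f g :: "'a \<Rightarrow> real"
  assumes "(f has_sum a) A" "(g has_sum b) A" "\<And>x. x \<in> A \<Longrightarrow> \<bar>f x\<bar> \<le> g x"
  shows "\<bar>a\<bar> \<le> b"
proof -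
  have "a \<le> b" by (rule has_sum_mono[OF assms(1,2)]) (use assms(3) in force)
  moreover have "- 1 * a \<le> b"
    by (rule has_sum_mono[OF has_sum_cmult_right[OF assms(1)] assms(2)]) (use assms(3) in force)
  ultimately show ?thesis by simp
qed

lemma abs_monomial_le: "(\<And>i. i < n \<Longrightarrow> \<bar>y i\<bar> \<le> z i) \<Longrightarrow> \<bar>monomial n \<alpha> y\<bar> \<le> monomial n \<alpha> z"
  unfolding monomial_def abs_prod by (intro prod_mono) (auto simp: power_abs intro!: power_mono)

lemma monomial_nonneg: "(\<And>i. i < n \<Longrightarrow> 0 \<le> z i) \<Longrightarrow> 0 \<le> monomial n \<alpha> z"
  unfolding monomial_def by (intro prod_nonneg) auto

lemma monomial_split: "j < n \<Longrightarrow> monomial n \<alpha> y = y j ^ \<alpha> j * (\<Prod>i\<in>{..<n} - {j}. y i ^ \<alpha> i)"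
  unfolding monomial_def by (subst prod.remove[of _ j]) auto

lemma abs_conv_has_sum:
  assumes "abs_conv n \<rho> c" "\<And>i. i < n \<Longrightarrow> \<bar>y i\<bar> \<le> \<rho>"
  shows "((\<lambda>\<alpha>. c \<alpha> * monomial n \<alpha> y) has_sum series_value n c y) (multi_indices n)"
proof -
  have "(\<lambda>\<alpha>. norm (c \<alpha> * monomial n \<alpha> y)) summable_on multi_indices n"
    by (rule summable_on_dominated[OF assms(1)[unfolded abs_conv_def]])
       (use assms(2) in \<open>auto simp: abs_mult intro!: mult_left_mono abs_monomial_le\<close>)
  then show ?thesis
    unfolding series_value_def by (intro has_sum_infsum) (rule abs_summable_summable)
qed

lemma continuous_on_series_value:
  assumes "abs_conv n \<rho> c"
  shows "continuous_on {x. \<forall>i<n. \<bar>coord x i - coord a i\<bar> \<le> \<rho>} (\<lambda>x. series_value n c (\<lambda>i. coord x i - coord a i))"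
    (is "continuous_on ?Q _")
proof (rule uniform_limit_theorem)
  show "uniform_limit ?Q (\<lambda>X x. \<Sum>\<alpha>\<in>X. c \<alpha> * monomial n \<alpha> (\<lambda>i. coord x i - coord a i))
     (\<lambda>x. series_value n c (\<lambda>i. coord x i - coord a i)) (finite_subsets_at_top (multi_indices n))"
    unfolding series_value_def
    by (rule Weierstrass_m_test_general[OF _ assms[unfolded abs_conv_def]])
       (auto simp: abs_mult intro!: mult_left_mono abs_monomial_le)
  show "\<forall>\<^sub>F X in finite_subsets_at_top (multi_indices n).
      continuous_on ?Q (\<lambda>x. \<Sum>\<alpha>\<in>X. c \<alpha> * monomial n \<alpha> (\<lambda>i. coord x i - coord a i))"
    unfolding monomial_def by (intro always_eventually allI continuous_intros)
qed auto

text \<open>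
  The second-order Taylor remainder of a power. The factor \<open>\<sigma>\<^sup>2\<close> stands on the left because
  dividing by it would need a separate treatment of \<open>\<sigma> = 0\<close> and of exponents below \<open>2\<close>.
\<close>

lemma power_linearization_bound:
  fixes s t \<sigma> :: real
  assumes "\<bar>s\<bar> \<le> \<sigma>" "\<bar>t\<bar> \<le> \<sigma>"
  shows "\<bar>s ^ m - t ^ m - real m * t ^ (m - 1) * (s - t)\<bar> * \<sigma>\<^sup>2 \<le> (real m)\<^sup>2 * \<sigma> ^ m * (s - t)\<^sup>2"
proof (induction m)
  case (Suc m)
  let ?E = "\<lambda>m. s ^ m - t ^ m - real m * t ^ (m - 1) * (s - t)"
  have \<sigma>: "0 \<le> \<sigma>" using assms by linarith
  have "?E (Suc m) = s * ?E m + real m * t ^ (m - 1) * (s - t)\<^sup>2"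
    by (cases m) (simp_all add: algebra_simps power2_eq_square)
  then have "\<bar>?E (Suc m)\<bar> \<le> \<bar>s * ?E m\<bar> + \<bar>real m * t ^ (m - 1) * (s - t)\<^sup>2\<bar>"
    by (simp only: abs_triangle_ineq)
  also have "\<dots> = \<bar>s\<bar> * \<bar>?E m\<bar> + real m * \<bar>t\<bar> ^ (m - 1) * (s - t)\<^sup>2"
    by (simp add: abs_mult power_abs)
  also have "\<dots> \<le> \<sigma> * \<bar>?E m\<bar> + real m * \<sigma> ^ (m - 1) * (s - t)\<^sup>2"
    using assms \<sigma> by (intro add_mono mult_right_mono mult_left_mono power_mono) auto
  finally have "\<bar>?E (Suc m)\<bar> * \<sigma>\<^sup>2 \<le> (\<sigma> * \<bar>?E m\<bar> + real m * \<sigma> ^ (m - 1) * (s - t)\<^sup>2) * \<sigma>\<^sup>2"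
    by (intro mult_right_mono) auto
  also have "\<dots> = \<sigma> * (\<bar>?E m\<bar> * \<sigma>\<^sup>2) + real m * \<sigma> ^ Suc m * (s - t)\<^sup>2"
    by (cases m) (simp_all add: algebra_simps power2_eq_square)
  also have "\<dots> \<le> \<sigma> * ((real m)\<^sup>2 * \<sigma> ^ m * (s - t)\<^sup>2) + real m * \<sigma> ^ Suc m * (s - t)\<^sup>2"
    using Suc \<sigma> by (intro add_mono mult_left_mono) auto
  also have "\<dots> = ((real m)\<^sup>2 + real m) * (\<sigma> ^ Suc m * (s - t)\<^sup>2)"
    by (simp add: algebra_simps)
  also have "\<dots> \<le> (real (Suc m))\<^sup>2 * (\<sigma> ^ Suc m * (s - t)\<^sup>2)"
    using \<sigma> by (intro mult_right_mono) (auto simp: power2_eq_square distrib_left distrib_right)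
  finally show ?case by (simp only: mult.assoc)
qed simp

text \<open>
  With \<open>monomial_half\<close>, this absorbs the factors \<open>m\<^sup>2\<close> of the Taylor remainders at half the radius.
\<close>

lemma square_le_4_power2: "(real m)\<^sup>2 \<le> 4 * 2 ^ m"
proof (induction m rule: less_induct)
  case (less m)
  show ?case
  proof (cases "m \<le> 3")
    case True
    then have "m = 0 \<or> m = 1 \<or> m = 2 \<or> m = 3" by auto
    then show ?thesis by auto
  next
    case False
    then obtain k where k: "m = Suc k" "3 \<le> k" by (cases m) auto
    have "(real m)\<^sup>2 = (real k)\<^sup>2 + (2 * real k + 1)" using k by (simp add: power2_eq_square algebra_simps)
    also have "2 * real k + 1 \<le> 3 * real k" using k by simp
    also have "3 * real k \<le> real k * real k" using k by (intro mult_right_mono) auto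
    also have "(real k)\<^sup>2 + real k * real k \<le> 4 * 2 ^ m"
      using less[of k] k by (simp add: power2_eq_square)
    finally show ?thesis by simp
  qed
qed

lemma inj_on_shift_index: "inj_on (\<lambda>\<beta>. \<beta>(j := Suc (\<beta> j))) A" for j :: nat
proof (rule inj_onI)
  fix \<alpha> \<beta> :: "nat \<Rightarrow> nat" assume eq: "\<alpha>(j := Suc (\<alpha> j)) = \<beta>(j := Suc (\<beta> j))"
  show "\<alpha> = \<beta>"
  proof
    fix i show "\<alpha> i = \<beta> i" using fun_cong[OF eq, of i] by (cases "i = j") auto
  qed
qed

lemma shift_index_image:
  assumes "j < n"
  shows "(\<lambda>\<beta>. \<beta>(j := Suc (\<beta> j))) ` multi_indices n = {\<alpha>\<in>multi_indices n. \<alpha> j \<noteq> 0}"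
proof (intro equalityI subsetI)
  fix \<alpha> assume \<alpha>: "\<alpha> \<in> {\<alpha>\<in>multi_indices n. \<alpha> j \<noteq> 0}"
  then have "\<alpha> = (\<alpha>(j := \<alpha> j - 1))(j := Suc ((\<alpha>(j := \<alpha> j - 1)) j))" by auto
  moreover have "\<alpha>(j := \<alpha> j - 1) \<in> multi_indices n" using \<alpha> by (auto simp: multi_indices_def)
  ultimately show "\<alpha> \<in> (\<lambda>\<beta>. \<beta>(j := Suc (\<beta> j))) ` multi_indices n" by blast
qed (use assms in \<open>auto simp: multi_indices_def\<close>)

lemma monomial_half: "monomial n \<alpha> (\<lambda>_. \<rho> / 2) \<le> monomial n \<alpha> (\<lambda>_. \<rho>) / 2 ^ \<alpha> j"
  if "j < n" "0 \<le> \<rho>"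
proof -
  have "(\<rho> / 2) ^ \<alpha> j * (\<Prod>i\<in>{..<n} - {j}. (\<rho> / 2) ^ \<alpha> i) \<le> (\<rho> / 2) ^ \<alpha> j * (\<Prod>i\<in>{..<n} - {j}. \<rho> ^ \<alpha> i)"
    using that by (intro mult_left_mono prod_mono conjI power_mono) auto
  then show ?thesis using that by (simp add: monomial_split[of j n] power_divide)
qed

text \<open>Halving the radius absorbs the factor that differentiation brings in.\<close>

lemma abs_conv_series_deriv:
  assumes c: "abs_conv n \<rho> c" and j: "j < n" and \<rho>: "0 < \<rho>"
  shows "abs_conv n (\<rho> / 2) (series_deriv j c)"
proof -
  let ?sh = "\<lambda>\<beta>::nat\<Rightarrow>nat. \<beta>(j := Suc (\<beta> j))"
  have "(\<lambda>\<alpha>. \<bar>c \<alpha>\<bar> * monomial n \<alpha> (\<lambda>_. \<rho>)) summable_on (?sh ` multi_indices n)"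
    by (rule summable_on_subset_banach[OF c[unfolded abs_conv_def]]) (auto simp: shift_index_image[OF j])
  then have "(\<lambda>\<beta>. \<bar>c (?sh \<beta>)\<bar> * monomial n (?sh \<beta>) (\<lambda>_. \<rho>)) summable_on multi_indices n"
    by (subst (asm) summable_on_reindex[OF inj_on_shift_index]) (simp add: o_def)
  then have "(\<lambda>\<beta>. (8 / \<rho>) * (\<bar>c (?sh \<beta>)\<bar> * monomial n (?sh \<beta>) (\<lambda>_. \<rho>))) summable_on multi_indices n"
    by (rule summable_on_cmult_right)
  then show ?thesis unfolding abs_conv_def
  proof (rule summable_on_dominated)
    fix \<beta>
    have m: "monomial n (?sh \<beta>) (\<lambda>_. \<rho>) = \<rho> * monomial n \<beta> (\<lambda>_. \<rho>)"
      using j by (simp add: monomial_split[of j n])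
    have "real (Suc (\<beta> j)) \<le> (real (Suc (\<beta> j)))\<^sup>2" by (simp add: power2_eq_square)
    also have "\<dots> \<le> 8 * 2 ^ \<beta> j" using square_le_4_power2[of "Suc (\<beta> j)"] by simp
    finally have b: "real (Suc (\<beta> j)) / 2 ^ \<beta> j \<le> 8" by (simp add: field_simps)
    have "\<bar>series_deriv j c \<beta>\<bar> * monomial n \<beta> (\<lambda>_. \<rho> / 2) \<le>
        \<bar>series_deriv j c \<beta>\<bar> * (monomial n \<beta> (\<lambda>_. \<rho>) / 2 ^ \<beta> j)"
      using j \<rho> by (intro mult_left_mono monomial_half) auto
    also have "\<dots> = (real (Suc (\<beta> j)) / 2 ^ \<beta> j) * (\<bar>c (?sh \<beta>)\<bar> * monomial n \<beta> (\<lambda>_. \<rho>))"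
      by (simp add: series_deriv_def abs_mult)
    also have "\<dots> \<le> 8 * (\<bar>c (?sh \<beta>)\<bar> * monomial n \<beta> (\<lambda>_. \<rho>))"
      using b \<rho> by (intro mult_right_mono) (auto intro!: mult_nonneg_nonneg monomial_nonneg)
    also have "\<dots> = (8 / \<rho>) * (\<bar>c (?sh \<beta>)\<bar> * monomial n (?sh \<beta>) (\<lambda>_. \<rho>))"
      using \<rho> by (simp add: m)
    finally show "\<bar>series_deriv j c \<beta>\<bar> * monomial n \<beta> (\<lambda>_. \<rho> / 2) \<le> \<dots>" .
    show "0 \<le> \<bar>series_deriv j c \<beta>\<bar> * monomial n \<beta> (\<lambda>_. \<rho> / 2)"
      using \<rho> by (intro mult_nonneg_nonneg monomial_nonneg) auto
  qed
qed

text \<open>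
  The error of the linearization of each term is at most \<open>h\<^sup>2\<close> times a summable coefficient, so
  the differentiated series gives the partial derivative.
\<close>

lemma series_value_has_derivative:
  assumes c: "abs_conv n \<rho> c" and j: "j < n" and \<rho>: "0 < \<rho>"
    and y: "\<And>i. i < n \<Longrightarrow> \<bar>y i\<bar> < \<rho> / 2"
  shows "((\<lambda>h. series_value n c (y(j := y j + h))) has_real_derivative series_value n (series_deriv j c) y) (at 0)"
proof -
  let ?I = "multi_indices n" and ?sh = "\<lambda>\<beta>::nat\<Rightarrow>nat. \<beta>(j := Suc (\<beta> j))"
  let ?R = "\<lambda>\<alpha>. \<Prod>i\<in>{..<n} - {j}. y i ^ \<alpha> i"
  define M where "M = (\<Sum>\<^sub>\<infinity>\<alpha>\<in>?I. (16 / \<rho>\<^sup>2) * (\<bar>c \<alpha>\<bar> * monomial n \<alpha> (\<lambda>_. \<rho>)))"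
  have sM: "((\<lambda>\<alpha>. (16 / \<rho>\<^sup>2) * (\<bar>c \<alpha>\<bar> * monomial n \<alpha> (\<lambda>_. \<rho>))) has_sum M) ?I"
    unfolding M_def by (intro has_sum_infsum summable_on_cmult_right c[unfolded abs_conv_def])
  have "((\<lambda>\<beta>. series_deriv j c \<beta> * monomial n \<beta> y) has_sum series_value n (series_deriv j c) y) ?I"
    using y by (intro abs_conv_has_sum[OF abs_conv_series_deriv[OF c j \<rho>]]) (auto intro: less_imp_le)
  moreover have "series_deriv j c \<beta> * monomial n \<beta> y =
      ((\<lambda>\<alpha>. c \<alpha> * (real (\<alpha> j) * y j ^ (\<alpha> j - 1) * ?R \<alpha>)) \<circ> ?sh) \<beta>" for \<beta>
    using j by (simp add: series_deriv_def monomial_split[of j n])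
  ultimately have "((\<lambda>\<alpha>. c \<alpha> * (real (\<alpha> j) * y j ^ (\<alpha> j - 1) * ?R \<alpha>)) has_sum
      series_value n (series_deriv j c) y) (?sh ` ?I)"
    by (subst has_sum_reindex[OF inj_on_shift_index]) (simp add: o_def)
  then have sD: "((\<lambda>\<alpha>. c \<alpha> * (real (\<alpha> j) * y j ^ (\<alpha> j - 1) * ?R \<alpha>)) has_sum
      series_value n (series_deriv j c) y) ?I"
    by (rule has_sum_cong_neutral[THEN iffD1, rotated -1]) (auto simp: shift_index_image[OF j])
  have bound: "\<bar>series_value n c (y(j := y j + h)) - series_value n c y - h * series_value n (series_deriv j c) y\<bar>
      \<le> M * h\<^sup>2" if h: "\<bar>y j + h\<bar> \<le> \<rho> / 2" for h
  proof -
    let ?z = "y(j := y j + h)"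
    have "\<bar>?z i\<bar> \<le> \<rho>" "\<bar>y i\<bar> \<le> \<rho>" if "i < n" for i using that y[of i] h \<rho> by auto
    then have "((\<lambda>\<alpha>. c \<alpha> * monomial n \<alpha> ?z - c \<alpha> * monomial n \<alpha> y - h * (c \<alpha> * (real (\<alpha> j) * y j ^ (\<alpha> j - 1) * ?R \<alpha>)))
       has_sum (series_value n c ?z - series_value n c y - h * series_value n (series_deriv j c) y)) ?I"
      by (intro has_sum_diff_real has_sum_cmult_right sD abs_conv_has_sum[OF c]) auto
    moreover have "((\<lambda>\<alpha>. (16 / \<rho>\<^sup>2) * (\<bar>c \<alpha>\<bar> * monomial n \<alpha> (\<lambda>_. \<rho>)) * h\<^sup>2) has_sum (M * h\<^sup>2)) ?I"
      by (rule has_sum_cmult_left[OF sM])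
    moreover have "norm (c \<alpha> * monomial n \<alpha> ?z - c \<alpha> * monomial n \<alpha> y - h * (c \<alpha> * (real (\<alpha> j) * y j ^ (\<alpha> j - 1) * ?R \<alpha>)))
        \<le> (16 / \<rho>\<^sup>2) * (\<bar>c \<alpha>\<bar> * monomial n \<alpha> (\<lambda>_. \<rho>)) * h\<^sup>2" for \<alpha>
    proof -
      define m where "m = \<alpha> j"
      define E where "E = \<bar>(y j + h) ^ m - y j ^ m - real m * y j ^ (m - 1) * h\<bar>"
      have Rz: "(\<Prod>i\<in>{..<n} - {j}. ?z i ^ \<alpha> i) = ?R \<alpha>" by (intro prod.cong) auto
      have "c \<alpha> * monomial n \<alpha> ?z - c \<alpha> * monomial n \<alpha> y - h * (c \<alpha> * (real (\<alpha> j) * y j ^ (\<alpha> j - 1) * ?R \<alpha>))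
        = c \<alpha> * ?R \<alpha> * ((y j + h) ^ m - y j ^ m - real m * y j ^ (m - 1) * h)"
        unfolding monomial_split[OF j] Rz m_def by (simp add: algebra_simps)
      then have "norm (c \<alpha> * monomial n \<alpha> ?z - c \<alpha> * monomial n \<alpha> y - h * (c \<alpha> * (real (\<alpha> j) * y j ^ (\<alpha> j - 1) * ?R \<alpha>)))
        = \<bar>c \<alpha>\<bar> * \<bar>?R \<alpha>\<bar> * E" by (simp add: abs_mult E_def)
      also have "\<dots> \<le> \<bar>c \<alpha>\<bar> * (\<Prod>i\<in>{..<n} - {j}. \<rho> ^ \<alpha> i) * (16 / \<rho>\<^sup>2 * \<rho> ^ m * h\<^sup>2)"
      proof (intro mult_mono mult_nonneg_nonneg prod_nonneg)
        have "\<bar>y i\<bar> \<le> \<rho>" if "i < n" for i using y[OF that] \<rho> by linarith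
        then show "\<bar>?R \<alpha>\<bar> \<le> (\<Prod>i\<in>{..<n} - {j}. \<rho> ^ \<alpha> i)"
          unfolding abs_prod by (intro prod_mono) (auto simp: power_abs intro!: power_mono)
        have "E * (\<rho> / 2)\<^sup>2 \<le> (real m)\<^sup>2 * (\<rho> / 2) ^ m * h\<^sup>2"
          unfolding E_def using power_linearization_bound[of "y j + h" "\<rho> / 2" "y j" m] h y[OF j] by simp
        also have "\<dots> \<le> (4 * 2 ^ m) * (\<rho> / 2) ^ m * h\<^sup>2"
          using \<rho> by (intro mult_right_mono square_le_4_power2) auto
        also have "\<dots> = 4 * \<rho> ^ m * h\<^sup>2" by (simp add: power_divide)
        finally have "E * (\<rho> / 2)\<^sup>2 * (4 / \<rho>\<^sup>2) \<le> 4 * \<rho> ^ m * h\<^sup>2 * (4 / \<rho>\<^sup>2)"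
          by (rule mult_right_mono) simp
        moreover have "E * (\<rho> / 2)\<^sup>2 * (4 / \<rho>\<^sup>2) = E" using \<rho> by (simp add: power_divide)
        ultimately show "E \<le> 16 / \<rho>\<^sup>2 * \<rho> ^ m * h\<^sup>2" by simp
      qed (use \<rho> in \<open>auto simp: E_def\<close>)
      also have "\<dots> = (16 / \<rho>\<^sup>2) * (\<bar>c \<alpha>\<bar> * monomial n \<alpha> (\<lambda>_. \<rho>)) * h\<^sup>2"
        by (simp add: monomial_split[OF j] m_def)
      finally show ?thesis .
    qed
    ultimately show ?thesis
      unfolding real_norm_def by (rule abs_has_sum_le)
  qed
  define d where "d = \<rho> / 2 - \<bar>y j\<bar>"
  have d: "d > 0" using y[OF j] by (simp add: d_def)
  have "((\<lambda>h. (series_value n c (y(j := y j + h)) - series_value n c y) / h - series_value n (series_deriv j c) y) \<longlongrightarrow> 0) (at 0)"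
  proof (rule Lim_null_comparison)
    show "((\<lambda>h. M * \<bar>h\<bar>) \<longlongrightarrow> 0) (at 0)" by (auto intro!: tendsto_eq_intros)
    show "\<forall>\<^sub>F h in at 0. norm ((series_value n c (y(j := y j + h)) - series_value n c y) / h - series_value n (series_deriv j c) y) \<le> M * \<bar>h\<bar>"
      unfolding eventually_at
    proof (intro exI[of _ d] conjI d ballI impI)
      fix h :: real assume h: "h \<noteq> 0 \<and> dist h 0 < d"
      then have "\<bar>y j + h\<bar> \<le> \<rho> / 2" using abs_triangle_ineq[of "y j" h] by (simp add: d_def)
      note b = bound[OF this]
      let ?A = "series_value n c (y(j := y j + h)) - series_value n c y" and ?D = "series_value n (series_deriv j c) y"
      have "norm (?A / h - ?D) = \<bar>?A - h * ?D\<bar> / \<bar>h\<bar>"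
        using h by (simp add: abs_divide[symmetric] diff_divide_distrib del: abs_divide)
      also have "\<dots> \<le> M * h\<^sup>2 / \<bar>h\<bar>" by (rule divide_right_mono[OF b]) simp
      also have "\<dots> = M * \<bar>h\<bar>"
        using h by (simp add: power2_eq_square field_simps)
      finally show "norm (?A / h - ?D) \<le> M * \<bar>h\<bar>" .
    qed
  qed
  then have "((\<lambda>h. (series_value n c (y(j := y j + h)) - series_value n c y) / h) \<longlongrightarrow> series_value n (series_deriv j c) y) (at 0)"
    by (simp add: LIM_zero_iff)
  then show ?thesis by (simp add: DERIV_def)
qed

text \<open>
  The given expansion converges unconditionally at the corner \<open>p = a + (\<rho>, ..., \<rho>)\<close>, for \<open>\<rho>\<close> so small
  that the whole cube lies in the ball of convergence. Real unconditional sums converge absolutely.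
\<close>

lemma analytic_local_series:
  fixes f :: "rvec \<Rightarrow> real"
  assumes U: "open_in_Rn n U" and f: "analytic_map_on n U f" and a: "a \<in> U"
  obtains \<rho> c where "\<rho> > 0" "abs_conv n \<rho> c"
    "\<And>x. x \<in> Rn n \<Longrightarrow> (\<And>i. i < n \<Longrightarrow> \<bar>coord x i - coord a i\<bar> \<le> \<rho>) \<Longrightarrow>
       x \<in> U \<and> f x = series_value n c (\<lambda>i. coord x i - coord a i)"
proof -
  obtain r c where r: "r > 0" and c: "\<And>x. x \<in> U \<Longrightarrow> dist x a < r \<Longrightarrow>
     ((\<lambda>\<alpha>. c \<alpha> * monomial n \<alpha> (\<lambda>i. coord x i - coord a i)) has_sum f x) (multi_indices n)"
    using f a unfolding analytic_map_on_def monomial_def multi_indices_def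
    by (simp add: mult.commute) blast
  obtain s where s: "s > 0" "ball a s \<inter> Rn n \<subseteq> U" and aR: "a \<in> Rn n" using open_in_Rn_ball[OF U a] by blast
  define \<rho> where "\<rho> = min r s / (real n + 1)"
  have n1: "real n + 1 \<noteq> 0" by linarith
  have \<rho>: "\<rho> > 0" using r s by (simp add: \<rho>_def)
  have near: "x \<in> U \<and> dist x a < r" if "x \<in> Rn n" "\<And>i. i < n \<Longrightarrow> \<bar>coord x i - coord a i\<bar> \<le> \<rho>" for x
  proof -
    have "norm (x - a) \<le> (\<Sum>i<n. \<bar>coord (x - a) i\<bar>)" using that aR by (intro norm_le_sum_coord) blast
    also have "\<dots> \<le> (\<Sum>i<n. \<rho>)" by (intro sum_mono) (use that in auto)
    also have "\<dots> = real n * \<rho>" by simp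
    also have "\<dots> < (real n + 1) * \<rho>"
      by (rule mult_strict_right_mono[OF _ \<rho>]) simp
    also have "\<dots> = min r s" unfolding \<rho>_def
      using n1 by (rule nonzero_mult_div_cancel_left[of "real n + 1" "min r s", folded times_divide_eq_right])
    finally have d: "dist x a < r" "dist a x < s" by (simp_all add: dist_norm norm_minus_commute)
    then show ?thesis using s(2) that(1) by (simp add: subset_iff)
  qed
  define p where "p = a + (\<Sum>i<n. \<rho> *\<^sub>R ax i)"
  have pi: "coord p i - coord a i = \<rho>" if "i < n" for i
    using that by (simp add: p_def if_distrib cong: if_cong)
  have "p \<in> Rn n" unfolding p_def using aR by (intro Rn_add Rn_sum Rn_scale) auto
  then have "p \<in> U \<and> dist p a < r" using pi \<rho> by (intro near) auto
  then have "((\<lambda>\<alpha>. c \<alpha> * monomial n \<alpha> (\<lambda>i. coord p i - coord a i)) has_sum f p) (multi_indices n)" by (intro c) auto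
  moreover have "monomial n \<alpha> (\<lambda>i. coord p i - coord a i) = monomial n \<alpha> (\<lambda>_. \<rho>)" for \<alpha>
    unfolding monomial_def using pi by (intro prod.cong) auto
  ultimately have "(\<lambda>\<alpha>. c \<alpha> * monomial n \<alpha> (\<lambda>_. \<rho>)) summable_on multi_indices n"
    by (auto simp: summable_on_def)
  then have "(\<lambda>\<alpha>. norm (c \<alpha> * monomial n \<alpha> (\<lambda>_. \<rho>))) summable_on multi_indices n"
    by (rule summable_on_iff_abs_summable_on_real[THEN iffD1])
  moreover have "\<bar>monomial n \<alpha> (\<lambda>_. \<rho>)\<bar> = monomial n \<alpha> (\<lambda>_. \<rho>)" for \<alpha>
    using \<rho> by (intro abs_of_nonneg monomial_nonneg) auto
  ultimately have ac: "abs_conv n \<rho> c" unfolding abs_conv_def by (simp add: abs_mult)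
  show ?thesis
  proof (rule that[OF \<rho> ac], intro conjI)
    fix x assume x: "x \<in> Rn n" "\<And>i. i < n \<Longrightarrow> \<bar>coord x i - coord a i\<bar> \<le> \<rho>"
    show "x \<in> U" using near x by blast
    then show "f x = series_value n c (\<lambda>i. coord x i - coord a i)"
      using near[OF x] infsumI[OF c[of x]] by (simp add: series_value_def)
  qed
qed

lemma analytic_continuous_on:
  fixes f :: "rvec \<Rightarrow> real"
  assumes U: "open_in_Rn n U" and f: "analytic_map_on n U f"
  shows "continuous_on U f"
  unfolding continuous_on_eq_continuous_within
proof
  fix a assume a: "a \<in> U"
  obtain \<rho> c where \<rho>: "\<rho> > 0" "abs_conv n \<rho> c" and v: "\<And>x. x \<in> Rn n \<Longrightarrow> (\<And>i. i < n \<Longrightarrow> \<bar>coord x i - coord a i\<bar> \<le> \<rho>) \<Longrightarrow>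
       x \<in> U \<and> f x = series_value n c (\<lambda>i. coord x i - coord a i)"
    using analytic_local_series[OF U f a] by metis
  let ?Q = "{x. \<forall>i<n. \<bar>coord x i - coord a i\<bar> \<le> \<rho>}"
  have "continuous_on (?Q \<inter> U) f"
    using continuous_on_subset[OF continuous_on_series_value[OF \<rho>(2), of a]]
    by (rule continuous_on_eq) (use v open_in_Rn_subset[OF U] in auto)
  moreover have "ball a \<rho> \<inter> U \<subseteq> ?Q \<inter> U"
  proof
    fix x assume "x \<in> ball a \<rho> \<inter> U"
    moreover have "\<bar>coord x i - coord a i\<bar> \<le> norm (x - a)" for i using abs_coord_le_norm[of "x - a" i] by simp
    ultimately show "x \<in> ?Q \<inter> U" by (auto simp: dist_norm norm_minus_commute intro: order_trans less_imp_le)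
  qed
  ultimately have "continuous_on (ball a \<rho> \<inter> U) f" by (rule continuous_on_subset)
  then have "continuous (at a within ball a \<rho> \<inter> U) f"
    using a \<rho> by (simp add: continuous_on_eq_continuous_within)
  moreover have "at a within ball a \<rho> \<inter> U = at a within U"
    by (rule at_within_nhd[of a "ball a \<rho>"]) (use \<rho> in auto)
  ultimately show "continuous (at a within U) f" by simp
qed

lemma analytic_partial:
  fixes f :: "rvec \<Rightarrow> real"
  assumes U: "open_in_Rn n U" and f: "analytic_map_on n U f" and j: "j < n"
  obtains g where "analytic_map_on n U g"
    "\<And>x. x \<in> U \<Longrightarrow> ((\<lambda>t. f (x + t *\<^sub>R ax j)) has_vector_derivative g x) (at 0)"
proof -
  define g where "g x = deriv (\<lambda>t. f (x + t *\<^sub>R ax j)) 0" for x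
  have local: "\<exists>\<rho> c. \<rho> > 0 \<and> abs_conv n (\<rho> / 2) (series_deriv j c) \<and>
     (\<forall>x\<in>Rn n. (\<forall>i<n. \<bar>coord x i - coord a i\<bar> < \<rho> / 2) \<longrightarrow>
       ((\<lambda>t. f (x + t *\<^sub>R ax j)) has_real_derivative series_value n (series_deriv j c) (\<lambda>i. coord x i - coord a i)) (at 0))"
    if a: "a \<in> U" for a
  proof -
    obtain \<rho> c where \<rho>: "\<rho> > 0" "abs_conv n \<rho> c" and v: "\<And>x. x \<in> Rn n \<Longrightarrow> (\<And>i. i < n \<Longrightarrow> \<bar>coord x i - coord a i\<bar> \<le> \<rho>) \<Longrightarrow>
         x \<in> U \<and> f x = series_value n c (\<lambda>i. coord x i - coord a i)"
      using analytic_local_series[OF U f a] by metis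
    have "((\<lambda>t. f (x + t *\<^sub>R ax j)) has_real_derivative series_value n (series_deriv j c) (\<lambda>i. coord x i - coord a i)) (at 0)"
      if x: "x \<in> Rn n" "\<forall>i<n. \<bar>coord x i - coord a i\<bar> < \<rho> / 2" for x
    proof (rule has_field_derivative_transform_within)
      let ?y = "\<lambda>i. coord x i - coord a i"
      show "((\<lambda>h. series_value n c (?y(j := ?y j + h))) has_real_derivative series_value n (series_deriv j c) ?y) (at 0)"
        by (rule series_value_has_derivative[OF \<rho>(2) j \<rho>(1)]) (use x in auto)
      fix t :: real assume t: "dist t 0 < \<rho> / 2"
      have "f (x + t *\<^sub>R ax j) = series_value n c (\<lambda>i. coord (x + t *\<^sub>R ax j) i - coord a i)"
      proof (rule v[THEN conjunct2])
        show "x + t *\<^sub>R ax j \<in> Rn n" using x j by (intro Rn_add Rn_scale) auto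
        fix i assume "i < n"
        then have "\<bar>coord x i - coord a i\<bar> < \<rho> / 2" using x by auto
        then show "\<bar>coord (x + t *\<^sub>R ax j) i - coord a i\<bar> \<le> \<rho>" using t \<rho>(1)
          by (cases "i = j") (simp_all add: abs_if split: if_splits)
      qed
      moreover have "(\<lambda>i. coord (x + t *\<^sub>R ax j) i - coord a i) = ?y(j := ?y j + t)" by auto
      ultimately show "series_value n c (?y(j := ?y j + t)) = f (x + t *\<^sub>R ax j)" by simp
    qed (use \<rho> in auto)
    then show ?thesis using \<rho> abs_conv_series_deriv[OF \<rho>(2) j \<rho>(1)] by blast
  qed
  show ?thesis
  proof (rule that)
    show "analytic_map_on n U g" unfolding analytic_map_on_def
    proof
      fix a assume a: "a \<in> U"
      obtain \<rho> c where \<rho>: "\<rho> > 0" "abs_conv n (\<rho> / 2) (series_deriv j c)"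
        and d: "\<And>x. x \<in> Rn n \<Longrightarrow> (\<forall>i<n. \<bar>coord x i - coord a i\<bar> < \<rho> / 2) \<Longrightarrow>
       ((\<lambda>t. f (x + t *\<^sub>R ax j)) has_real_derivative series_value n (series_deriv j c) (\<lambda>i. coord x i - coord a i)) (at 0)"
        using local[OF a] by blast
      have "((\<lambda>\<alpha>. (\<Prod>i<n. (coord x i - coord a i) ^ \<alpha> i) *\<^sub>R series_deriv j c \<alpha>) has_sum g x) {\<alpha>. \<forall>i\<ge>n. \<alpha> i = 0}"
        if x: "x \<in> U" "dist x a < \<rho> / 2" for x
      proof -
        have b: "\<bar>coord x i - coord a i\<bar> < \<rho> / 2" for i
          using abs_coord_le_norm[of "x - a" i] x by (simp add: dist_norm)
        have "g x = series_value n (series_deriv j c) (\<lambda>i. coord x i - coord a i)"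
          unfolding g_def using b x open_in_Rn_subset[OF U] by (intro DERIV_imp_deriv d) auto
        then show ?thesis
          using abs_conv_has_sum[OF \<rho>(2), of "\<lambda>i. coord x i - coord a i"] b
          by (simp add: monomial_def multi_indices_def less_imp_le mult.commute)
      qed
      then show "\<exists>r>0. \<exists>c. \<forall>x\<in>U. dist x a < r \<longrightarrow>
        ((\<lambda>\<alpha>. (\<Prod>i<n. (coord x i - coord a i) ^ \<alpha> i) *\<^sub>R c \<alpha>) has_sum g x) {\<alpha>. \<forall>i\<ge>n. \<alpha> i = 0}"
        using \<rho>(1) by (intro exI[of _ "\<rho> / 2"] conjI exI[of _ "series_deriv j c"]) auto
    qed
    fix x assume x: "x \<in> U"
    then obtain v where "((\<lambda>t. f (x + t *\<^sub>R ax j)) has_real_derivative v) (at 0)"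
      using local[OF x] open_in_Rn_subset[OF U] by fastforce
    then show "((\<lambda>t. f (x + t *\<^sub>R ax j)) has_vector_derivative g x) (at 0)"
      unfolding g_def using DERIV_imp_deriv by (fastforce simp: has_real_derivative_iff_has_vector_derivative)
  qed
qed

lemma Ck_on_SucE:
  assumes "Ck_on (Suc k) n U f"
  obtains g where "continuous_on U f"
    "\<And>i x. i < n \<Longrightarrow> x \<in> U \<Longrightarrow> ((\<lambda>t. f (x + t *\<^sub>R ax i)) has_vector_derivative g i x) (at 0)"
    "\<And>i. i < n \<Longrightarrow> Ck_on k n U (g i)"
  using assms by auto

lemma Ck_on_SucI:
  assumes "continuous_on U f"
    "\<And>i x. i < n \<Longrightarrow> x \<in> U \<Longrightarrow> ((\<lambda>t. f (x + t *\<^sub>R ax i)) has_vector_derivative g i x) (at 0)"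
    "\<And>i. i < n \<Longrightarrow> Ck_on k n U (g i)"
  shows "Ck_on (Suc k) n U f"
  using assms by auto

lemma analytic_Ck_on:
  fixes f :: "rvec \<Rightarrow> real"
  assumes "open_in_Rn n U" "analytic_map_on n U f"
  shows "Ck_on k n U f"
  using assms(2)
proof (induction k arbitrary: f)
  case 0
  then show ?case using analytic_continuous_on[OF assms(1)] by simp
next
  case (Suc k)
  have "\<forall>i. \<exists>g. i < n \<longrightarrow> analytic_map_on n U g \<and>
      (\<forall>x\<in>U. ((\<lambda>t. f (x + t *\<^sub>R ax i)) has_vector_derivative g x) (at 0))"
    using analytic_partial[OF assms(1) Suc.prems] by metis
  then obtain g where g: "\<And>i. i < n \<Longrightarrow> analytic_map_on n U (g i) \<and>
      (\<forall>x\<in>U. ((\<lambda>t. f (x + t *\<^sub>R ax i)) has_vector_derivative g i x) (at 0))" by metis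
  show ?case
    by (rule Ck_on_SucI[OF analytic_continuous_on[OF assms(1) Suc.prems]]) (use g Suc.IH in blast)+
qed

section \<open>Maps with locally Lipschitz derivative\<close>

lemma Ck_on_SucD: "Ck_on (Suc k) n U f \<Longrightarrow> Ck_on k n U f"
proof (induction k arbitrary: f)
  case (Suc k)
  obtain g where g: "continuous_on U f"
    "\<And>i x. i < n \<Longrightarrow> x \<in> U \<Longrightarrow> ((\<lambda>t. f (x + t *\<^sub>R ax i)) has_vector_derivative g i x) (at 0)"
    "\<And>i. i < n \<Longrightarrow> Ck_on (Suc k) n U (g i)"
    using Suc.prems by (elim Ck_on_SucE) (rule that)
  show ?case by (rule Ck_on_SucI[OF g(1,2) Suc.IH[OF g(3)]])
qed simp

lemma Ck_on_mono: "Ck_on k n U f \<Longrightarrow> l \<le> k \<Longrightarrow> Ck_on l n U f"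
proof (induction k)
  case (Suc k)
  then show ?case using Ck_on_SucD[of k n U f] by (cases "l = Suc k") (auto simp del: Ck_on.simps)
qed simp

lemma Ck_on_bounded_linear:
  assumes "bounded_linear b" "Ck_on k n U f"
  shows "Ck_on k n U (\<lambda>x. b (f x))"
  using assms(2)
proof (induction k arbitrary: f)
  case 0
  then show ?case using bounded_linear.continuous_on[OF assms(1)] by auto
next
  case (Suc k)
  obtain g where g: "continuous_on U f"
    "\<And>i x. i < n \<Longrightarrow> x \<in> U \<Longrightarrow> ((\<lambda>t. f (x + t *\<^sub>R ax i)) has_vector_derivative g i x) (at 0)"
    "\<And>i. i < n \<Longrightarrow> Ck_on k n U (g i)"
    using Suc.prems by (elim Ck_on_SucE) (rule that)
  show ?case
    by (rule Ck_on_SucI[OF bounded_linear.continuous_on[OF assms(1) g(1)]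
          bounded_linear.has_vector_derivative[OF assms(1) g(2)] Suc.IH[OF g(3)]])
qed

lemma analytic_map_on_bounded_linear:
  assumes b: "bounded_linear b" and f: "analytic_map_on n U f"
  shows "analytic_map_on n U (\<lambda>x. b (f x))"
  unfolding analytic_map_on_def
proof
  interpret bounded_linear b by fact
  fix a assume "a \<in> U"
  then have "\<exists>r>0. \<exists>c. \<forall>x\<in>U. dist x a < r \<longrightarrow>
        ((\<lambda>\<alpha>. (\<Prod>i<n. (coord x i - coord a i) ^ \<alpha> i) *\<^sub>R c \<alpha>) has_sum f x) {\<alpha>. \<forall>i\<ge>n. \<alpha> i = 0}"
    using f unfolding analytic_map_on_def by (rule bspec[rotated])
  then obtain r c where r: "r > 0" "\<And>x. x \<in> U \<Longrightarrow> dist x a < r \<Longrightarrow>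
     ((\<lambda>\<alpha>. (\<Prod>i<n. (coord x i - coord a i) ^ \<alpha> i) *\<^sub>R c \<alpha>) has_sum f x) {\<alpha>. \<forall>i\<ge>n. \<alpha> i = 0}"
    by auto
  have "((\<lambda>\<alpha>. (\<Prod>i<n. (coord x i - coord a i) ^ \<alpha> i) *\<^sub>R b (c \<alpha>)) has_sum b (f x)) {\<alpha>. \<forall>i\<ge>n. \<alpha> i = 0}"
    if "x \<in> U" "dist x a < r" for x
    using has_sum_bounded_linear[OF b r(2)[OF that]] by (simp only: scale)
  then show "\<exists>r>0. \<exists>c. \<forall>x\<in>U. dist x a < r \<longrightarrow>
        ((\<lambda>\<alpha>. (\<Prod>i<n. (coord x i - coord a i) ^ \<alpha> i) *\<^sub>R c \<alpha>) has_sum b (f x)) {\<alpha>. \<forall>i\<ge>n. \<alpha> i = 0}"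
    by (intro exI[of _ r] conjI r(1) exI[of _ "\<lambda>\<alpha>. b (c \<alpha>)"] ballI impI)
qed

text \<open>
  Composition with a linear functional reduces to real-valued maps, for which power series have
  been differentiated.
\<close>

lemma Cq_on_open_imp_C2:
  fixes b :: "'b::real_normed_vector \<Rightarrow> real"
  assumes q: "at_least_C2 q" and f: "Cq_on_open q n U f" and b: "bounded_linear b"
  shows "Ck_on 2 n U (\<lambda>x. b (f x))"
proof (cases "q = C_omega")
  case True
  then show ?thesis using f analytic_Ck_on[OF _ analytic_map_on_bounded_linear[OF b]]
    unfolding Cq_on_open_def by (simp del: Ck_on.simps)
next
  case False
  have "Ck_on 2 n U f"
  proof (cases q)
    case (C_fin k)
    then have "Ck_on k n U f" "2 \<le> k"
      using q f by (simp_all add: Cq_on_open_def at_least_C2_def del: Ck_on.simps)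
    then show ?thesis by (rule Ck_on_mono)
  next
    case C_infinity
    then show ?thesis using f by (simp add: Cq_on_open_def del: Ck_on.simps)
  qed (use False in simp)
  then show ?thesis by (rule Ck_on_bounded_linear[OF b])
qed

text \<open>
  All that the Verdier condition needs of a map of class \<open>C^q\<close>, \<open>q \<ge> 2\<close>: a derivative \<open>G\<close> that is
  bounded and Lipschitz on \<open>S\<close>, with one constant for both.
\<close>

definition C11 :: "rvec set \<Rightarrow> (rvec \<Rightarrow> 'b::real_normed_vector) \<Rightarrow> (rvec \<Rightarrow> rvec \<Rightarrow> 'b) \<Rightarrow> real \<Rightarrow> bool" where
  "C11 S F G K \<longleftrightarrow> 0 < K \<and> (\<forall>x\<in>S. (F has_derivative G x) (at x within S) \<and>
     (\<forall>v. norm (G x v) \<le> K * norm v) \<and>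
     (\<forall>y\<in>S. \<forall>v. norm (G x v - G y v) \<le> K * norm (x - y) * norm v))"

lemma C11_derivD:
  assumes "C11 S F G K" "x \<in> S"
  shows "(F has_derivative G x) (at x within S)" "bounded_linear (G x)"
    "norm (G x v) \<le> K * norm v" "y \<in> S \<Longrightarrow> norm (G x v - G y v) \<le> K * norm (x - y) * norm v" "0 < K"
  using assms unfolding C11_def by (auto dest: has_derivative_bounded_linear)

lemma C11_subset:
  assumes "C11 S F G K" "T \<subseteq> S" "K \<le> L"
  shows "C11 T F G L"
  unfolding C11_def
proof (intro conjI ballI allI)
  show "0 < L" using assms by (simp add: C11_def)
  fix x assume x: "x \<in> T"
  then show "(F has_derivative G x) (at x within T)"
    using assms by (auto simp: C11_def intro: has_derivative_subset)
  have "norm (G x v) \<le> K * norm v" for v using assms x by (auto simp: C11_def)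
  then show "norm (G x v) \<le> L * norm v" for v
    by (rule order_trans[OF _ mult_right_mono[OF assms(3)]]) auto
  fix y v assume y: "y \<in> T"
  have "norm (G x v - G y v) \<le> K * norm (x - y) * norm v"
    using assms(2) x y by (intro C11_derivD(4)[OF assms(1)]) auto
  also have "\<dots> \<le> L * norm (x - y) * norm v" by (intro mult_right_mono assms) auto
  finally show "norm (G x v - G y v) \<le> L * norm (x - y) * norm v" .
qed

lemma C11_lipschitz:
  assumes "C11 S F G K" "convex S" "x \<in> S" "y \<in> S"
  shows "norm (F x - F y) \<le> K * norm (x - y)"
proof (rule differentiable_bound[OF assms(2)])
  show "onorm (G z) \<le> K" if "z \<in> S" for z
    using C11_derivD[OF assms(1) that] by (intro onorm_bound) (auto simp: less_imp_le)
qed (use assms C11_derivD in auto)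

lemma C11_continuous_on: "C11 S F G K \<Longrightarrow> continuous_on S F"
  by (auto simp: continuous_on_eq_continuous_within dest!: C11_derivD(1) intro: has_derivative_continuous)

text \<open>
  The second partial derivatives are continuous, hence bounded near \<open>a\<close>, so that by the mean value
  inequality the first ones are Lipschitz there.
\<close>

lemma Ck2_imp_C11:
  fixes f :: "rvec \<Rightarrow> real"
  assumes U: "open_in_Rn n U" and f: "Ck_on 2 n U f" and a: "a \<in> U"
  shows "\<exists>r>0. \<exists>G K. ball a r \<inter> Rn n \<subseteq> U \<and> C11 (ball a r \<inter> Rn n) f G K"
proof -
  obtain g where g: "\<And>x i. x \<in> U \<Longrightarrow> i < n \<Longrightarrow> ((\<lambda>t. f (x + t *\<^sub>R ax i)) has_vector_derivative g i x) (at 0)"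
     "\<And>i. i < n \<Longrightarrow> Ck_on 1 n U (g i)"
    using f[folded Suc_1] by (elim Ck_on_SucE) (rule that)
  have cg: "continuous_on U (g i)" if "i < n" for i using g(2)[OF that] by auto
  have "\<forall>i. \<exists>h. i < n \<longrightarrow> (\<forall>j<n. (\<forall>x\<in>U. ((\<lambda>t. g i (x + t *\<^sub>R ax j)) has_vector_derivative h j x) (at 0)) \<and> continuous_on U (h j))"
    using g(2) by auto
  then obtain h where h: "\<And>i j x. i < n \<Longrightarrow> j < n \<Longrightarrow> x \<in> U \<Longrightarrow> ((\<lambda>t. g i (x + t *\<^sub>R ax j)) has_vector_derivative h i j x) (at 0)"
     "\<And>i j. i < n \<Longrightarrow> j < n \<Longrightarrow> continuous_on U (h i j)" by metis
  define F where "F = insert 0 ((\<lambda>i. \<bar>g i a\<bar>) ` {..<n} \<union> (\<lambda>(i,j). \<bar>h i j a\<bar>) ` ({..<n} \<times> {..<n}))"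
  define B where "B = Max F + 1"
  have F: "finite F" by (simp add: F_def)
  have B: "z < B" if "z \<in> F" for z
    using Max_ge[OF F that] by (simp add: B_def)
  have B0: "0 < B" by (rule B) (simp add: F_def)
  have ev: "\<forall>\<^sub>F z in at a within U. \<bar>p z\<bar> < B" if "continuous_on U p" "\<bar>p a\<bar> < B" for p :: "rvec \<Rightarrow> real"
  proof -
    have "((\<lambda>z. \<bar>p z\<bar>) \<longlongrightarrow> \<bar>p a\<bar>) (at a within U)"
      using that(1) a by (intro tendsto_intros) (auto simp: continuous_on_def)
    then show ?thesis using that(2) by (rule order_tendstoD)
  qed
  have "\<forall>\<^sub>F z in at a within U. (\<forall>i\<in>{..<n}. \<bar>g i z\<bar> < B) \<and> (\<forall>i\<in>{..<n}. \<forall>j\<in>{..<n}. \<bar>h i j z\<bar> < B)"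
    by (intro eventually_conj eventually_ball_finite ballI ev cg h(2) B finite_lessThan)
       (auto simp: F_def)
  then obtain d where d: "d > 0" "\<And>z. z \<in> U \<Longrightarrow> z \<noteq> a \<Longrightarrow> dist z a < d \<Longrightarrow>
      (\<forall>i<n. \<bar>g i z\<bar> < B) \<and> (\<forall>i<n. \<forall>j<n. \<bar>h i j z\<bar> < B)"
    unfolding eventually_at by (auto simp: lessThan_def)
  obtain s where s: "s > 0" "ball a s \<inter> Rn n \<subseteq> U" and aR: "a \<in> Rn n" using open_in_Rn_ball[OF U a] by blast
  define R where "R = min d s"
  have R: "R > 0" "ball a R \<inter> Rn n \<subseteq> U" using d s by (auto simp: R_def)
  have gB: "\<bar>g i z\<bar> \<le> B" if "z \<in> ball a R \<inter> Rn n" "i < n" for i z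
    using d(2)[of z] B[of "\<bar>g i a\<bar>"] that R by (cases "z = a") (auto simp: F_def R_def dist_commute less_imp_le)
  have hB: "\<bar>h i j z\<bar> \<le> B" if "z \<in> ball a R \<inter> Rn n" "i < n" "j < n" for i j z
    using d(2)[of z] B[of "\<bar>h i j a\<bar>"] that R by (cases "z = a") (force simp: F_def R_def dist_commute less_imp_le)+
  let ?S = "ball a (R / 3) \<inter> Rn n"
  define G where "G x = partials_map n (\<lambda>i. g i x)" for x
  define K where "K = real n * B + real n * (real n * B) + 1"
  have Lip: "\<bar>g i x - g i y\<bar> \<le> real n * B * norm (x - y)" if i: "i < n" and xy: "x \<in> ?S" "y \<in> ?S" for i x y
  proof -
    have "dist x y < R / 3 + R / 3" using xy dist_triangle2[of x y a] by (simp add: dist_commute) 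
    then have n: "norm (y - x) < 2 * R / 3" by (simp add: dist_norm norm_minus_commute)
    have near: "z \<in> ball a R \<inter> Rn n" if "z \<in> Rn n" "norm (z - x) \<le> norm (y - x)" for z
      using that n xy dist_triangle[of a z x] by (auto simp: dist_norm norm_minus_commute)
    have der: "((\<lambda>t. g i (z + t *\<^sub>R ax j)) has_vector_derivative h i j z) (at 0)"
      if "z \<in> ball a R \<inter> Rn n" "j < n" for z j using h(1) i that R by blast
    obtain \<xi> where \<xi>: "\<And>j. j < n \<Longrightarrow> \<xi> j \<in> Rn n \<and> norm (\<xi> j - x) \<le> norm (y - x)"
      and eq: "g i y - g i x = (\<Sum>j<n. coord (y - x) j * h i j (\<xi> j))"
      using mean_value_partials[where S = "ball a R \<inter> Rn n" and f = "g i" and g = "h i" and x = x and y = y and n = n]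
        near der xy by blast
    have "\<bar>g i y - g i x\<bar> = norm (partials_map n (\<lambda>j. h i j (\<xi> j)) (y - x))"
      by (simp add: eq partials_map_def)
    also have "\<dots> \<le> real n * B * norm (y - x)"
      by (rule norm_partials_map_le) (use hB near \<xi> i in auto)
    finally show ?thesis by (simp add: abs_minus_commute norm_minus_commute)
  qed
  have "C11 ?S f G K" unfolding C11_def
  proof (intro conjI ballI allI)
    show "0 < K" using B0 by (simp add: K_def add_nonneg_pos)
    have Kge: "real n * B \<le> K" "real n * (real n * B) \<le> K" using B0 by (auto simp: K_def)
    fix x assume x: "x \<in> ?S"
    have xR: "x \<in> ball a R \<inter> Rn n" using x subset_ball[of "R / 3" R a] R(1) by auto
    then have xU: "x \<in> U" using R by auto
    show "(f has_derivative G x) (at x within ?S)" unfolding G_def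
      by (rule has_derivative_subset[OF has_derivative_partials[OF U xU g(1) cg]]) auto
    show "norm (G x v) \<le> K * norm v" for v
      unfolding G_def by (rule order_trans[OF norm_partials_map_le mult_right_mono[OF Kge(1)]])
        (use gB xR in auto)
    fix y v assume y: "y \<in> ?S"
    have "norm (G x v - G y v) \<le> real n * (real n * B * norm (x - y)) * norm v"
      unfolding G_def partials_map_diff by (rule norm_partials_map_le) (use Lip x y in auto)
    also have "\<dots> = real n * (real n * B) * (norm (x - y) * norm v)" by simp
    also have "\<dots> \<le> K * (norm (x - y) * norm v)" using Kge(2) by (rule mult_right_mono) simp
    finally show "norm (G x v - G y v) \<le> K * norm (x - y) * norm v" by (simp add: mult.assoc)
  qed
  moreover have "ball a (R / 3) \<subseteq> ball a R" using R by (intro subset_ball) auto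
  ultimately show ?thesis using R by (intro exI[of _ "R / 3"] conjI exI[of _ G] exI[of _ K]) auto
qed

lemma C11_add:
  assumes "C11 S F G K" "C11 S F' G' K'"
  shows "C11 S (\<lambda>x. F x + F' x) (\<lambda>x v. G x v + G' x v) (K + K')"
  unfolding C11_def
proof (intro conjI ballI allI)
  show "0 < K + K'" using assms by (simp add: C11_def)
  fix x assume x: "x \<in> S"
  show "((\<lambda>x. F x + F' x) has_derivative (\<lambda>v. G x v + G' x v)) (at x within S)"
    by (intro has_derivative_add C11_derivD(1)[OF assms(1) x] C11_derivD(1)[OF assms(2) x])
  show "norm (G x v + G' x v) \<le> (K + K') * norm v" for v
    using C11_derivD(3)[OF assms(1) x, of v] C11_derivD(3)[OF assms(2) x, of v]
    by (simp add: distrib_right norm_triangle_le add_mono)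
  fix y v assume y: "y \<in> S"
  have "norm (G x v + G' x v - (G y v + G' y v)) \<le> norm (G x v - G y v) + norm (G' x v - G' y v)"
    by (rule norm_diff_triangle_ineq)
  also have "\<dots> \<le> K * norm (x - y) * norm v + K' * norm (x - y) * norm v"
    by (intro add_mono C11_derivD(4)[OF assms(1) x y] C11_derivD(4)[OF assms(2) x y])
  finally show "norm (G x v + G' x v - (G y v + G' y v)) \<le> (K + K') * norm (x - y) * norm v"
    by (simp add: distrib_right)
qed

lemma C11_const: "C11 S (\<lambda>x. c) (\<lambda>x v. 0) 1"
  by (auto simp: C11_def)

lemma C11_ident: "C11 S (\<lambda>x. x) (\<lambda>x v. v) 1"
  by (auto simp: C11_def)

lemma C11_bounded_linear:
  assumes "bounded_linear b" "C11 S F G K"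
  shows "\<exists>L. C11 S (\<lambda>x. b (F x)) (\<lambda>x v. b (G x v)) L"
proof -
  interpret bounded_linear b by fact
  obtain B where B: "B > 0" "\<And>x. norm (b x) \<le> norm x * B" using pos_bounded by blast
  have "C11 S (\<lambda>x. b (F x)) (\<lambda>x v. b (G x v)) (K * B)"
    unfolding C11_def
  proof (intro conjI ballI allI)
    show "0 < K * B" using assms B by (simp add: C11_def)
    fix x assume x: "x \<in> S"
    show "((\<lambda>x. b (F x)) has_derivative (\<lambda>v. b (G x v))) (at x within S)"
      by (intro has_derivative C11_derivD(1)[OF assms(2) x])
    have "norm (b (G x v)) \<le> (K * norm v) * B" for v
      using B by (intro order_trans[OF B(2) mult_right_mono] C11_derivD(3)[OF assms(2) x]) auto
    then show "norm (b (G x v)) \<le> K * B * norm v" for v by (simp add: algebra_simps)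
    fix y v assume y: "y \<in> S"
    have "norm (b (G x v - G y v)) \<le> (K * norm (x - y) * norm v) * B"
      using B by (intro order_trans[OF B(2) mult_right_mono] C11_derivD(4)[OF assms(2) x y]) auto
    then show "norm (b (G x v) - b (G y v)) \<le> K * B * norm (x - y) * norm v"
      by (simp add: diff algebra_simps)
  qed
  then show ?thesis by blast
qed

lemma C11_compose:
  assumes F: "C11 S F G K" and s: "C11 T s H L" and T: "convex T" and sT: "s ` T \<subseteq> S"
  shows "C11 T (\<lambda>x. F (s x)) (\<lambda>x v. G (s x) (H x v)) (K * L * (L + 1))"
  unfolding C11_def
proof (intro conjI ballI allI)
  have K: "0 < K" and L: "0 < L" using F s by (auto simp: C11_def)
  show "0 < K * L * (L + 1)" using K L by simp
  fix x assume x: "x \<in> T"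
  then have sx: "s x \<in> S" using sT by blast
  show "((\<lambda>x. F (s x)) has_derivative (\<lambda>v. G (s x) (H x v))) (at x within T)"
    using has_derivative_subset[OF C11_derivD(1)[OF F sx] sT]
    by (rule has_derivative_in_compose[OF C11_derivD(1)[OF s x]])
  have b: "norm (G z (H x v)) \<le> K * L * norm v" if "z \<in> S" for z v
  proof -
    have "norm (G z (H x v)) \<le> K * norm (H x v)" by (rule C11_derivD(3)[OF F that])
    also have "\<dots> \<le> K * (L * norm v)" using K by (intro mult_left_mono C11_derivD(3)[OF s x]) auto
    finally show ?thesis by (simp add: mult.assoc)
  qed
  have KL: "K * L \<le> K * L * (L + 1)" using K L by simp
  show "norm (G (s x) (H x v)) \<le> K * L * (L + 1) * norm v" for v
    by (rule order_trans[OF b[OF sx] mult_right_mono[OF KL]]) simp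
  fix y v assume y: "y \<in> T"
  then have sy: "s y \<in> S" using sT by blast
  have "norm (G (s x) (H x v) - G (s y) (H y v)) \<le>
      norm (G (s x) (H x v) - G (s y) (H x v)) + norm (G (s y) (H x v) - G (s y) (H y v))"
    using norm_triangle_ineq[of "G (s x) (H x v) - G (s y) (H x v)" "G (s y) (H x v) - G (s y) (H y v)"] by simp
  also have "G (s y) (H x v) - G (s y) (H y v) = G (s y) (H x v - H y v)"
    using C11_derivD(2)[OF F sy] by (simp add: linear_diff bounded_linear.linear)
  also have "norm (G (s x) (H x v) - G (s y) (H x v)) \<le> K * norm (s x - s y) * norm (H x v)"
    by (rule C11_derivD(4)[OF F sx sy])
  also have "\<dots> \<le> K * (L * norm (x - y)) * (L * norm v)"
    using K L by (intro mult_mono C11_lipschitz[OF s T x y] C11_derivD(3)[OF s x]) auto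
  also have "norm (G (s y) (H x v - H y v)) \<le> K * norm (H x v - H y v)"
    by (rule C11_derivD(3)[OF F sy])
  also have "\<dots> \<le> K * (L * norm (x - y) * norm v)"
    using K by (intro mult_left_mono C11_derivD(4)[OF s x y]) auto
  finally show "norm (G (s x) (H x v) - G (s y) (H y v)) \<le> K * L * (L + 1) * norm (x - y) * norm v"
    by (simp add: algebra_simps)
qed

lemma C11_coordinates:
  assumes c: "\<And>j. j < m \<Longrightarrow> C11 S (\<lambda>x. coord (F x) j) (G j) (K j)" and F: "F ` S \<subseteq> Rn m"
  shows "C11 S F (\<lambda>x v. \<Sum>j<m. G j x v *\<^sub>R ax j) ((\<Sum>j<m. K j) + 1)"
  unfolding C11_def
proof (intro conjI ballI allI)
  have K: "j < m \<Longrightarrow> 0 < K j" for j using c by (auto simp: C11_def)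
  have K0: "0 \<le> (\<Sum>j<m. K j)" using K by (intro sum_nonneg) (auto simp: less_imp_le)
  then show "0 < (\<Sum>j<m. K j) + 1" by simp
  have sum_bound: "norm (\<Sum>j<m. a j *\<^sub>R ax j) \<le> (\<Sum>j<m. K j) * t"
    if "\<And>j. j < m \<Longrightarrow> \<bar>a j\<bar> \<le> K j * t" for a t
    unfolding sum_distrib_right by (rule sum_norm_le) (use that in auto)
  fix x assume x: "x \<in> S"
  have "((\<lambda>x. \<Sum>j<m. coord (F x) j *\<^sub>R ax j) has_derivative (\<lambda>v. \<Sum>j<m. G j x v *\<^sub>R ax j)) (at x within S)"
    by (intro has_derivative_sum has_derivative_scaleR_left C11_derivD(1)[OF c x]) auto
  then show "(F has_derivative (\<lambda>v. \<Sum>j<m. G j x v *\<^sub>R ax j)) (at x within S)"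
    by (rule has_derivative_transform[OF x, rotated]) (use F Rn_expand in blast)
  show "norm (\<Sum>j<m. G j x v *\<^sub>R ax j) \<le> ((\<Sum>j<m. K j) + 1) * norm v" for v
  proof -
    have "norm (\<Sum>j<m. G j x v *\<^sub>R ax j) \<le> (\<Sum>j<m. K j) * norm v"
      by (rule sum_bound) (use C11_derivD(3)[OF c x] in auto)
    also have "\<dots> \<le> ((\<Sum>j<m. K j) + 1) * norm v" by (intro mult_right_mono) auto
    finally show ?thesis .
  qed
  fix y v assume y: "y \<in> S"
  have "norm (\<Sum>j<m. (G j x v - G j y v) *\<^sub>R ax j) \<le> (\<Sum>j<m. K j) * (norm (x - y) * norm v)"
    by (rule sum_bound) (use C11_derivD(4)[OF c x y] in \<open>auto simp: mult.assoc\<close>)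
  also have "\<dots> \<le> ((\<Sum>j<m. K j) + 1) * (norm (x - y) * norm v)" by (intro mult_right_mono) auto
  finally show "norm ((\<Sum>j<m. G j x v *\<^sub>R ax j) - (\<Sum>j<m. G j y v *\<^sub>R ax j)) \<le> ((\<Sum>j<m. K j) + 1) * norm (x - y) * norm v"
    by (simp add: sum_subtractf[symmetric] scaleR_diff_left mult.assoc)
qed

lemma finite_common_radius:
  fixes m :: nat
  assumes "\<And>j. j < m \<Longrightarrow> \<exists>r>0::real. P j r" "\<And>j r s. P j r \<Longrightarrow> 0 < s \<Longrightarrow> s \<le> r \<Longrightarrow> P j s"
  shows "\<exists>r>0. \<forall>j<m. P j r"
  using assms(1)
proof (induction m)
  case 0
  show ?case by (intro exI[of _ 1]) auto
next
  case (Suc m)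
  obtain r where r: "r > 0" "\<forall>j<m. P j r" using Suc by auto
  obtain r' where r': "r' > 0" "P m r'" using Suc.prems by auto
  show ?case using r r' by (intro exI[of _ "min r r'"]) (auto simp: less_Suc_eq intro: assms(2))
qed

lemma Cq_on_open_C11_real:
  fixes F :: "rvec \<Rightarrow> real"
  assumes "at_least_C2 q" "Cq_on_open q n U F" "a \<in> U"
  shows "\<exists>r>0. \<exists>G K. ball a r \<inter> Rn n \<subseteq> U \<and> C11 (ball a r \<inter> Rn n) F G K"
  using assms(2,3) Cq_on_open_imp_C2[OF assms(1,2) bounded_linear_ident]
  by (intro Ck2_imp_C11) (auto simp: Cq_on_open_def)

lemma Cq_on_open_C11:
  fixes F :: "rvec \<Rightarrow> rvec"
  assumes q: "at_least_C2 q" and F: "Cq_on_open q n U F" and m: "F ` U \<subseteq> Rn m" and a: "a \<in> U"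
  obtains r G K where "r > 0" "ball a r \<inter> Rn n \<subseteq> U" "C11 (ball a r \<inter> Rn n) F G K" "\<And>x v. G x v \<in> Rn m"
proof -
  have U: "open_in_Rn n U" using F by (simp add: Cq_on_open_def)
  have "\<exists>r>0. ball a r \<inter> Rn n \<subseteq> U \<and> (\<forall>j<m. \<exists>G K. C11 (ball a r \<inter> Rn n) (\<lambda>x. coord (F x) j) G K)"
  proof -
    have "\<exists>r>0. \<forall>j<m. \<exists>G K. C11 (ball a r \<inter> Rn n) (\<lambda>x. coord (F x) j) G K"
    proof (rule finite_common_radius)
      show "\<exists>r>0. \<exists>G K. C11 (ball a r \<inter> Rn n) (\<lambda>x. coord (F x) j) G K" for j
        using Ck2_imp_C11[OF U Cq_on_open_imp_C2[OF q F bounded_linear_coord] a] by blast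
      show "\<exists>G K. C11 (ball a s \<inter> Rn n) (\<lambda>x. coord (F x) j) G K"
        if "\<exists>G K. C11 (ball a r \<inter> Rn n) (\<lambda>x. coord (F x) j) G K" "0 < s" "s \<le> r" for j r s
        using that by (meson C11_subset Int_mono order_refl subset_ball)
    qed
    then obtain r where r: "r > 0" "\<forall>j<m. \<exists>G K. C11 (ball a r \<inter> Rn n) (\<lambda>x. coord (F x) j) G K" by blast
    obtain s where s: "s > 0" "ball a s \<inter> Rn n \<subseteq> U" using open_in_Rn_ball[OF U a] by blast
    show ?thesis
    proof (intro exI[of _ "min r s"] conjI allI impI)
      fix j assume "j < m"
      then obtain G K where "C11 (ball a r \<inter> Rn n) (\<lambda>x. coord (F x) j) G K" using r by blast
      then have "C11 (ball a (min r s) \<inter> Rn n) (\<lambda>x. coord (F x) j) G K"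
        by (rule C11_subset) auto
      then show "\<exists>G K. C11 (ball a (min r s) \<inter> Rn n) (\<lambda>x. coord (F x) j) G K" by blast
    qed (use r s in auto)
  qed
  then obtain r where r: "r > 0" "ball a r \<inter> Rn n \<subseteq> U"
    "\<forall>j<m. \<exists>G K. C11 (ball a r \<inter> Rn n) (\<lambda>x. coord (F x) j) G K" by blast
  from r(3) obtain G K where "\<And>j. j < m \<Longrightarrow> C11 (ball a r \<inter> Rn n) (\<lambda>x. coord (F x) j) (G j) (K j)" by metis
  then have "C11 (ball a r \<inter> Rn n) F (\<lambda>x v. \<Sum>j<m. G j x v *\<^sub>R ax j) ((\<Sum>j<m. K j) + 1)"
    by (rule C11_coordinates) (use m r in auto)
  then show ?thesis using r(1,2) by (intro that) (auto intro!: Rn_sum Rn_scale)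
qed

section \<open>Tangent spaces\<close>

lemma C11_curve:
  assumes F: "C11 S F G K" and I: "open I" and D: "\<And>t. t \<in> I \<Longrightarrow> (\<gamma> has_vector_derivative D t) (at t)"
    and c: "continuous_on I D" and S: "\<gamma> ` I \<subseteq> S"
  shows "\<And>t. t \<in> I \<Longrightarrow> ((\<lambda>t. F (\<gamma> t)) has_vector_derivative G (\<gamma> t) (D t)) (at t)"
    and "continuous_on I (\<lambda>t. G (\<gamma> t) (D t))"
proof -
  show "((\<lambda>t. F (\<gamma> t)) has_vector_derivative G (\<gamma> t) (D t)) (at t)" if t: "t \<in> I" for t
  proof -
    have g: "\<gamma> t \<in> S" using S t by blast
    have "(\<gamma> has_derivative (\<lambda>x. x *\<^sub>R D t)) (at t within I)"
      using D[OF t] by (auto simp: has_vector_derivative_def intro: has_derivative_at_withinI)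
    moreover have "(F has_derivative G (\<gamma> t)) (at (\<gamma> t) within \<gamma> ` I)"
      by (rule has_derivative_subset[OF C11_derivD(1)[OF F g] S])
    ultimately have "((\<lambda>t. F (\<gamma> t)) has_derivative (\<lambda>x. G (\<gamma> t) (x *\<^sub>R D t))) (at t within I)"
      by (rule has_derivative_in_compose)
    then show ?thesis
      using C11_derivD(2)[OF F g] at_within_open[OF t I]
      by (simp add: has_vector_derivative_def linear_scale bounded_linear.linear)
  qed
  have cg: "continuous_on I \<gamma>"
    by (intro continuous_at_imp_continuous_on ballI has_vector_derivative_continuous[OF D])
  show "continuous_on I (\<lambda>t. G (\<gamma> t) (D t))"
    unfolding continuous_on_def
  proof
    fix t assume t: "t \<in> I"
    have g: "\<gamma> s \<in> S" if "s \<in> I" for s using S that by blast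
    have lim: "(\<gamma> \<longlongrightarrow> \<gamma> t) (at t within I)" "(D \<longlongrightarrow> D t) (at t within I)"
      using cg c t by (auto simp: continuous_on_def)
    have "((\<lambda>s. K * norm (\<gamma> s - \<gamma> t) * norm (D s) + K * norm (D s - D t)) \<longlongrightarrow>
        K * norm (\<gamma> t - \<gamma> t) * norm (D t) + K * norm (D t - D t)) (at t within I)"
      by (intro tendsto_intros lim)
    then have l0: "((\<lambda>s. K * norm (\<gamma> s - \<gamma> t) * norm (D s) + K * norm (D s - D t)) \<longlongrightarrow> 0) (at t within I)"
      by simp
    have "((\<lambda>s. G (\<gamma> s) (D s) - G (\<gamma> t) (D t)) \<longlongrightarrow> 0) (at t within I)"
    proof (rule Lim_null_comparison[OF _ l0])
      have "norm (G (\<gamma> s) (D s) - G (\<gamma> t) (D t)) \<le> K * norm (\<gamma> s - \<gamma> t) * norm (D s) + K * norm (D s - D t)"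
        if s: "s \<in> I" for s
      proof -
        have "G (\<gamma> s) (D s) - G (\<gamma> t) (D t) = (G (\<gamma> s) (D s) - G (\<gamma> t) (D s)) + G (\<gamma> t) (D s - D t)"
          using C11_derivD(2)[OF F g[OF t]] by (simp add: linear_diff bounded_linear.linear)
        then show ?thesis
          using C11_derivD(4)[OF F g[OF s] g[OF t], of "D s"] C11_derivD(3)[OF F g[OF t], of "D s - D t"]
          by (metis add_mono norm_triangle_le)
      qed
      then show "\<forall>\<^sub>F s in at t within I. norm (G (\<gamma> s) (D s) - G (\<gamma> t) (D t)) \<le>
          K * norm (\<gamma> s - \<gamma> t) * norm (D s) + K * norm (D s - D t)"
        by (auto simp: eventually_at_filter)
    qed
    then show "((\<lambda>s. G (\<gamma> s) (D s)) \<longlongrightarrow> G (\<gamma> t) (D t)) (at t within I)"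
      by (simp add: LIM_zero_iff)
  qed
qed

lemma tangent_spaceI:
  assumes "0 < \<epsilon>" "\<gamma> 0 = x" "\<And>t. t \<in> {-\<epsilon><..<\<epsilon>} \<Longrightarrow> (\<gamma> has_vector_derivative D t) (at t)"
    "continuous_on {-\<epsilon><..<\<epsilon>} D" "\<gamma> ` {-\<epsilon><..<\<epsilon>} \<subseteq> M"
  shows "D 0 \<in> tangent_space M x"
  unfolding tangent_space_def C1_differentiable_on_def
  by (intro CollectI exI[of _ \<gamma>] exI[of _ \<epsilon>] exI[of _ D] conjI ballI assms) (use assms(1) in auto)

lemma tangent_spaceE:
  assumes "v \<in> tangent_space M x" "open T" "x \<in> T"
  obtains \<gamma> D \<epsilon> where "0 < \<epsilon>" "\<gamma> 0 = x" "\<And>t. t \<in> {-\<epsilon><..<\<epsilon>} \<Longrightarrow> (\<gamma> has_vector_derivative D t) (at t)"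
    "continuous_on {-\<epsilon><..<\<epsilon>} D" "\<gamma> ` {-\<epsilon><..<\<epsilon>} \<subseteq> M \<inter> T" "D 0 = v"
proof -
  obtain \<gamma> \<epsilon> where g: "0 < \<epsilon>" "\<gamma> 0 = x" "\<gamma> C1_differentiable_on {-\<epsilon><..<\<epsilon>}"
     "\<gamma> ` {-\<epsilon><..<\<epsilon>} \<subseteq> M" "(\<gamma> has_vector_derivative v) (at 0)"
    using assms(1) unfolding tangent_space_def by blast
  then obtain D where D: "\<And>t. t \<in> {-\<epsilon><..<\<epsilon>} \<Longrightarrow> (\<gamma> has_vector_derivative D t) (at t)"
    "continuous_on {-\<epsilon><..<\<epsilon>} D" unfolding C1_differentiable_on_def by blast
  have "(\<gamma> has_vector_derivative D 0) (at 0)" using D(1)[of 0] g(1) by simp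
  then have Dv: "D 0 = v" using g(5) by (rule vector_derivative_unique_at)
  have "continuous (at 0) \<gamma>" using g(5) by (rule has_vector_derivative_continuous)
  then have "(\<gamma> \<longlongrightarrow> x) (at 0)" using g(2) by (simp add: continuous_at)
  then have "\<forall>\<^sub>F t in at 0. \<gamma> t \<in> T" using assms(2,3) by (rule topological_tendstoD)
  then obtain d where d: "d > 0" "\<And>t. t \<noteq> 0 \<Longrightarrow> \<bar>t\<bar> < d \<Longrightarrow> \<gamma> t \<in> T"
    unfolding eventually_at by auto
  show ?thesis
  proof (rule that[of "min d \<epsilon>" \<gamma> D])
    show "\<gamma> ` {- min d \<epsilon><..<min d \<epsilon>} \<subseteq> M \<inter> T"
    proof (rule image_subsetI)
      fix t assume t: "t \<in> {- min d \<epsilon><..<min d \<epsilon>}"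
      then have "\<gamma> t \<in> M" using g(4) by auto
      moreover have "\<gamma> t \<in> T" using d(2)[of t] t g(2) assms(3) by (cases "t = 0") auto
      ultimately show "\<gamma> t \<in> M \<inter> T" by blast
    qed
    show "continuous_on {- min d \<epsilon><..<min d \<epsilon>} D" by (rule continuous_on_subset[OF D(2)]) auto
  qed (use d g D Dv in auto)
qed

text \<open>
  The chain rule along a curve that realizes \<open>v\<close>, shortened so that it stays in \<open>T\<close>; in particular
  tangent spaces are local.
\<close>

lemma tangent_space_map:
  assumes v: "v \<in> tangent_space M x" and T: "open T" "x \<in> T" and F: "C11 S F G K"
    and S: "M \<inter> T \<subseteq> S" and M': "F ` (M \<inter> T) \<subseteq> M'"
  shows "G x v \<in> tangent_space M' (F x)"
proof -
  obtain \<gamma> D \<epsilon> where g: "0 < \<epsilon>" "\<gamma> 0 = x" "\<And>t. t \<in> {-\<epsilon><..<\<epsilon>} \<Longrightarrow> (\<gamma> has_vector_derivative D t) (at t)"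
    "continuous_on {-\<epsilon><..<\<epsilon>} D" "\<gamma> ` {-\<epsilon><..<\<epsilon>} \<subseteq> M \<inter> T" "D 0 = v"
    by (rule tangent_spaceE[OF v T]) (rule that)
  have S': "\<gamma> ` {-\<epsilon><..<\<epsilon>} \<subseteq> S" using g(5) S by blast
  have "G (\<gamma> 0) (D 0) \<in> tangent_space M' (F x)"
  proof (rule tangent_spaceI[where \<gamma> = "\<lambda>t. F (\<gamma> t)" and D = "\<lambda>t. G (\<gamma> t) (D t)" and \<epsilon> = \<epsilon>])
    show "(\<lambda>t. F (\<gamma> t)) ` {-\<epsilon><..<\<epsilon>} \<subseteq> M'" using g(5) M' by blast
  qed (use g C11_curve[OF F _ g(3,4) S'] in auto)
  then show ?thesis using g by simp
qed

lemma tangent_space_Int_open: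
  assumes "open T" "x \<in> T"
  shows "tangent_space (M \<inter> T) x = tangent_space M x"
proof
  show "tangent_space (M \<inter> T) x \<subseteq> tangent_space M x"
    using tangent_space_map[of _ "M \<inter> T" x UNIV UNIV "\<lambda>x. x" "\<lambda>x v. v" 1 M] C11_ident by auto
  show "tangent_space M x \<subseteq> tangent_space (M \<inter> T) x"
    using tangent_space_map[of _ M x T UNIV "\<lambda>x. x" "\<lambda>x v. v" 1 "M \<inter> T"] C11_ident assms by auto
qed

lemma tangent_space_mono: "M \<subseteq> N \<Longrightarrow> tangent_space M x \<subseteq> tangent_space N x"
  using tangent_space_map[of _ M x UNIV UNIV "\<lambda>x. x" "\<lambda>x v. v" 1 N] C11_ident by auto

lemma tangent_space_Rn: "x \<in> Rn k \<Longrightarrow> tangent_space (Rn k) x = Rn k"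
proof
  assume x: "x \<in> Rn k"
  show "Rn k \<subseteq> tangent_space (Rn k) x"
  proof
    fix v assume v: "v \<in> Rn k"
    show "v \<in> tangent_space (Rn k) x"
      by (rule tangent_spaceI[where \<gamma> = "\<lambda>t. x + t *\<^sub>R v" and D = "\<lambda>_. v" and \<epsilon> = 1])
         (use x v in \<open>auto intro!: derivative_eq_intros Rn_add Rn_scale\<close>)
  qed
  show "tangent_space (Rn k) x \<subseteq> Rn k"
  proof
    fix v assume "v \<in> tangent_space (Rn k) x"
    then obtain \<gamma> D \<epsilon> where g: "0 < \<epsilon>" "\<And>t. t \<in> {-\<epsilon><..<\<epsilon>} \<Longrightarrow> (\<gamma> has_vector_derivative D t) (at t)"
       "\<gamma> ` {-\<epsilon><..<\<epsilon>} \<subseteq> Rn k" "D (0::real) = v"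
      using tangent_spaceE[of v "Rn k" x UNIV] by (metis Int_UNIV_right UNIV_I open_UNIV)
    have "coord v i = 0" if i: "k \<le> i" for i
    proof -
      have "((\<lambda>t. coord (\<gamma> t) i) has_vector_derivative coord v i) (at 0)"
        using bounded_linear.has_vector_derivative[OF bounded_linear_coord g(2)[of 0]] g(1,4) by simp
      moreover have "((\<lambda>t. coord (\<gamma> t) i) has_vector_derivative 0) (at 0)"
      proof (rule has_vector_derivative_transform_within_open)
        show "((\<lambda>t. 0::real) has_vector_derivative 0) (at 0)" by simp
        show "open {-\<epsilon><..<\<epsilon>}" by simp
        show "0 = coord (\<gamma> t) i" if t: "t \<in> {-\<epsilon><..<\<epsilon>}" for t
        proof -
          have "\<gamma> t \<in> Rn k" using g(3) t by blast
          then show ?thesis using i by (simp add: Rn_def)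
        qed
      qed (use g in auto)
      ultimately show ?thesis by (rule vector_derivative_unique_at)
    qed
    then show "v \<in> Rn k" by (auto simp: Rn_def)
  qed
qed

lemma tangent_space_subset_Rn:
  assumes "M \<subseteq> Rn n" "x \<in> M"
  shows "tangent_space M x \<subseteq> Rn n"
  using tangent_space_mono[OF assms(1), of x] tangent_space_Rn[of x n] assms by auto

lemma zero_in_tangent_space: "x \<in> M \<Longrightarrow> 0 \<in> tangent_space M x"
  by (rule tangent_spaceI[where \<gamma> = "\<lambda>_. x" and D = "\<lambda>_. 0" and \<epsilon> = 1]) auto

lemma C11_taylor:
  assumes F: "C11 S F G K" and S: "convex S" and x: "x \<in> S" and y: "y \<in> S"
  shows "norm (F y - F x - G x (y - x)) \<le> K * (norm (y - x))\<^sup>2"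
proof -
  let ?T = "S \<inter> cball x (norm (y - x))"
  have bl: "bounded_linear (G x)" by (rule C11_derivD(2)[OF F x])
  have "norm ((F y - G x y) - (F x - G x x)) \<le> (K * norm (y - x)) * norm (y - x)"
  proof (rule differentiable_bound[where S = ?T and f = "\<lambda>z. F z - G x z" and f' = "\<lambda>z v. G z v - G x v"])
    show "convex ?T" using S by (intro convex_Int) auto
    fix z assume z: "z \<in> ?T"
    then have zS: "z \<in> S" by blast
    have "(F has_derivative G z) (at z within ?T)"
      by (rule has_derivative_subset[OF C11_derivD(1)[OF F zS]]) auto
    then show "((\<lambda>z. F z - G x z) has_derivative (\<lambda>v. G z v - G x v)) (at z within ?T)"
      by (intro has_derivative_diff bounded_linear_imp_has_derivative bl)
    show "onorm (\<lambda>v. G z v - G x v) \<le> K * norm (y - x)"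
    proof (rule onorm_bound)
      show "0 \<le> K * norm (y - x)" using C11_derivD(5)[OF F x] by simp
      fix v
      have "norm (G z v - G x v) \<le> K * norm (z - x) * norm v" by (rule C11_derivD(4)[OF F zS x])
      also have "\<dots> \<le> K * norm (y - x) * norm v"
        using z C11_derivD(5)[OF F x]
        by (intro mult_right_mono mult_left_mono) (auto simp: dist_norm norm_minus_commute)
      finally show "norm (G z v - G x v) \<le> K * norm (y - x) * norm v" .
    qed
  qed (use x y in \<open>auto simp: dist_norm norm_minus_commute\<close>)
  moreover have "(F y - G x y) - (F x - G x x) = F y - F x - G x (y - x)"
    using bl by (simp add: linear_diff bounded_linear.linear)
  ultimately show ?thesis by (simp add: power2_eq_square mult.assoc)
qed

lemma convex_ball_Rn: "convex (ball x r \<inter> Rn n)"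
  by (intro convex_Int) auto

lemma C11_direction:
  assumes F: "C11 (ball a r \<inter> Rn n) F G K" and x: "x \<in> ball a r \<inter> Rn n" and v: "v \<in> Rn n"
  shows "((\<lambda>t. F (x + t *\<^sub>R v)) has_vector_derivative G x v) (at 0)"
proof -
  let ?I = "(\<lambda>t. x + t *\<^sub>R v) -` ball a r"
  have I: "open ?I" by (intro open_vimage) (auto intro!: continuous_intros)
  have "0 \<in> ?I" using x by auto
  then have "((\<lambda>t. F (x + t *\<^sub>R v)) has_vector_derivative G (x + 0 *\<^sub>R v) v) (at 0)"
    by (rule C11_curve(1)[OF F I, where \<gamma> = "\<lambda>t. x + t *\<^sub>R v" and D = "\<lambda>_. v", rotated -1])
       (use x v in \<open>auto intro!: derivative_eq_intros Rn_add Rn_scale\<close>)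
  then show ?thesis by simp
qed

lemma C11_left_inverse_deriv:
  assumes F: "C11 (ball a r \<inter> Rn n) F G K" and F': "C11 S F' G' K'" and S: "F ` (ball a r \<inter> Rn n) \<subseteq> S"
    and inv: "\<And>z. z \<in> ball a r \<inter> Rn n \<Longrightarrow> F' (F z) = z"
    and x: "x \<in> ball a r \<inter> Rn n" and v: "v \<in> Rn n"
  shows "G' (F x) (G x v) = v"
proof -
  have "((\<lambda>t. F' (F (x + t *\<^sub>R v))) has_vector_derivative G' (F x) (G x v)) (at 0)"
    using C11_direction[OF C11_compose[OF F' F convex_ball_Rn S] x v] .
  moreover have "((\<lambda>t. F' (F (x + t *\<^sub>R v))) has_vector_derivative v) (at 0)"
  proof (rule has_vector_derivative_transform_within_open)
    show "((\<lambda>t. x + t *\<^sub>R v) has_vector_derivative v) (at 0)" by (auto intro!: derivative_eq_intros)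
    show "open ((\<lambda>t. x + t *\<^sub>R v) -` ball a r)" by (intro open_vimage) (auto intro!: continuous_intros)
    show "0 \<in> (\<lambda>t. x + t *\<^sub>R v) -` ball a r" using x by auto
    fix t assume "t \<in> (\<lambda>t. x + t *\<^sub>R v) -` ball a r"
    then have "x + t *\<^sub>R v \<in> ball a r \<inter> Rn n" using x v by (auto intro!: Rn_add Rn_scale)
    then show "x + t *\<^sub>R v = F' (F (x + t *\<^sub>R v))" using inv by simp
  qed
  ultimately show ?thesis by (rule vector_derivative_unique_at)
qed

section \<open>The Verdier condition without angles\<close>

text \<open>
  For subspaces, \<open>vbound P Q c\<close> implies \<open>d_space P Q \<le> c\<close>, which implies \<open>vbound P Q (2 * c)\<close> if
  \<open>c > 0\<close>. The factor disappears in the constant of the Verdier condition.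
\<close>

definition vbound :: "rvec set \<Rightarrow> rvec set \<Rightarrow> real \<Rightarrow> bool" where
  "vbound P Q c \<longleftrightarrow> (\<forall>v\<in>P. \<exists>w\<in>Q. norm (v - w) \<le> c * norm v)"

lemma vbound_mono: "vbound P Q c \<Longrightarrow> c \<le> d \<Longrightarrow> vbound P Q d"
  unfolding vbound_def by (meson mult_right_mono norm_ge_zero order_trans)

lemma vboundI: "(\<And>v. v \<in> P \<Longrightarrow> \<exists>w\<in>Q. norm (v - w) \<le> c * norm v) \<Longrightarrow> vbound P Q c"
  by (simp add: vbound_def)

lemma vboundE:
  assumes "vbound P Q c" "v \<in> P"
  obtains w where "w \<in> Q" "norm (v - w) \<le> c * norm v"
  using assms by (auto simp: vbound_def)

lemma vbound_1: "0 \<in> Q \<Longrightarrow> vbound P Q 1"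
  unfolding vbound_def by (intro ballI bexI[of _ 0]) auto

lemma vbound_trans:
  assumes 1: "vbound P Q c" and 2: "vbound Q R d" and "0 \<le> d"
  shows "vbound P R (c + d * (1 + c))"
proof (rule vboundI)
  fix v assume v: "v \<in> P"
  obtain w where w: "w \<in> Q" "norm (v - w) \<le> c * norm v" using vboundE[OF 1 v] .
  obtain u where u: "u \<in> R" "norm (w - u) \<le> d * norm w" using vboundE[OF 2 w(1)] .
  have "norm w \<le> norm v + norm (v - w)" using norm_triangle_ineq4[of v "v - w"] by simp
  then have "d * norm w \<le> d * (norm v + c * norm v)"
    using w(2) assms(3) by (intro mult_left_mono) auto
  moreover have "norm (v - u) \<le> norm (v - w) + norm (w - u)"
    using norm_triangle_ineq[of "v - w" "w - u"] by simp
  ultimately have "norm (v - u) \<le> c * norm v + d * (norm v + c * norm v)" using w(2) u(2) by linarith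
  then show "\<exists>u\<in>R. norm (v - u) \<le> (c + d * (1 + c)) * norm v"
    using u(1) by (intro bexI[of _ u]) (auto simp: algebra_simps)
qed

text \<open>
  The sine is the distance from \<open>v\<close> to the line through \<open>w\<close>.
\<close>

lemma sin_angle_unit:
  assumes "norm v = 1" "norm w = 1"
  shows "sin (angle v w) = norm (v - inner v w *\<^sub>R w)" "0 \<le> sin (angle v w)" "sin (angle v w) \<le> 1"
proof -
  have ip: "\<bar>inner v w\<bar> \<le> 1" using Cauchy_Schwarz_ineq2[of v w] assms by simp
  have "(norm (v - inner v w *\<^sub>R w))\<^sup>2 = inner v v - (inner v w)\<^sup>2 * (2 - inner w w)"
    unfolding power2_norm_eq_inner
    by (simp add: inner_diff_left inner_diff_right inner_commute power2_eq_square algebra_simps)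
  also have "\<dots> = 1 - (inner v w)\<^sup>2" using assms by (simp add: power2_norm_eq_inner[symmetric])
  finally have n: "norm (v - inner v w *\<^sub>R w) = sqrt (1 - (inner v w)\<^sup>2)"
    by (metis norm_ge_zero real_sqrt_abs abs_of_nonneg)
  have s: "sin (angle v w) = sqrt (1 - (inner v w)\<^sup>2)"
    unfolding angle_def using assms ip by (simp add: sin_arccos_abs)
  show "sin (angle v w) = norm (v - inner v w *\<^sub>R w)" using n s by simp
  then show "0 \<le> sin (angle v w)" by simp
  show "sin (angle v w) \<le> 1" by simp
qed

lemma d_vec_le:
  assumes Q: "subspace Q" and v: "norm v = 1" and w: "w \<in> Q" "norm (v - w) \<le> c"
  shows "d_vec v Q \<le> c"
proof (cases "Q = {0}")
  case True
  then show ?thesis using v w by (auto simp: d_vec_def)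
next
  case False
  have "\<exists>u\<in>Q. norm u = 1 \<and> sin (angle v u) \<le> c"
  proof (cases "w = 0")
    case True
    obtain z where z: "z \<in> Q" "z \<noteq> 0" using False subspace_0[OF Q] by blast
    have u: "z /\<^sub>R norm z \<in> Q" "norm (z /\<^sub>R norm z) = 1" using z Q by (auto simp: subspace_scale)
    have "sin (angle v (z /\<^sub>R norm z)) \<le> 1" by simp
    also have "1 \<le> c" using w v True by simp
    finally show ?thesis using u by blast
  next
    case w0: False
    define u where "u = w /\<^sub>R norm w"
    have u: "u \<in> Q" "norm u = 1" using w w0 Q by (auto simp: subspace_scale u_def)
    have "(norm (v - w))\<^sup>2 = (norm (v - inner v u *\<^sub>R u))\<^sup>2 + (norm w - inner v u)\<^sup>2"
    proof -
      have wu: "w = norm w *\<^sub>R u" using w0 by (simp add: u_def)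
      have "inner u u = 1" using u by (simp add: power2_norm_eq_inner[symmetric])
      then show ?thesis
        by (subst (1) wu, unfold power2_norm_eq_inner)
           (simp add: inner_diff_left inner_diff_right inner_commute power2_eq_square algebra_simps)
    qed
    then have "(norm (v - inner v u *\<^sub>R u))\<^sup>2 \<le> (norm (v - w))\<^sup>2" by simp
    then have "norm (v - inner v u *\<^sub>R u) \<le> norm (v - w)" by (rule power2_le_imp_le) simp
    then show ?thesis using w u sin_angle_unit(1)[OF v u(2)] by (intro bexI[of _ u]) auto
  qed
  then obtain u where u: "u \<in> Q" "norm u = 1" "sin (angle v u) \<le> c" by blast
  have "Inf {sin (angle v w) | w. w \<in> Q \<and> norm w = 1} \<le> sin (angle v u)"
    by (rule cInf_lower) (use u v sin_angle_unit(2) in \<open>auto intro!: bdd_belowI[of _ 0]\<close>)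
  then show ?thesis using False u by (simp add: d_vec_def)
qed

lemma d_vec_less:
  assumes Q: "subspace Q" and v: "norm v = 1" and d: "d_vec v Q < c"
  shows "\<exists>w\<in>Q. norm (v - w) \<le> c"
proof (cases "Q = {0}")
  case True
  then show ?thesis using v d by (auto simp: d_vec_def)
next
  case False
  obtain z where z: "z \<in> Q" "z \<noteq> 0" using False subspace_0[OF Q] by blast
  then have "z /\<^sub>R norm z \<in> Q" "norm (z /\<^sub>R norm z) = 1" using Q by (auto simp: subspace_scale)
  then have ne: "{sin (angle v w) | w. w \<in> Q \<and> norm w = 1} \<noteq> {}" by blast
  have "Inf {sin (angle v w) | w. w \<in> Q \<and> norm w = 1} < c" using d False by (simp add: d_vec_def)
  then obtain w where w: "w \<in> Q" "norm w = 1" "sin (angle v w) < c"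
    using cInf_lessD[OF ne] by blast
  then show ?thesis using sin_angle_unit(1)[OF v w(2)] subspace_scale[OF Q w(1), of "inner v w"]
    by (intro bexI[of _ "inner v w *\<^sub>R w"]) auto
qed

lemma d_space_le_if_vbound:
  assumes P: "subspace P" and Q: "subspace Q" and c: "0 \<le> c" and vb: "vbound P Q c"
  shows "d_space P Q \<le> c"
proof (cases "P = {0}")
  case True
  then show ?thesis using c by (simp add: d_space_def)
next
  case False
  obtain z where z: "z \<in> P" "z \<noteq> 0" using False subspace_0[OF P] by blast
  then have "z /\<^sub>R norm z \<in> P" "norm (z /\<^sub>R norm z) = 1" using P by (auto simp: subspace_scale)
  then have ne: "{d_vec v Q | v. v \<in> P \<and> norm v = 1} \<noteq> {}" by blast
  have "Sup {d_vec v Q | v. v \<in> P \<and> norm v = 1} \<le> c"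
  proof (rule cSup_least[OF ne])
    fix x assume "x \<in> {d_vec v Q | v. v \<in> P \<and> norm v = 1}"
    then obtain v where v: "x = d_vec v Q" "v \<in> P" "norm v = 1" by blast
    obtain w where "w \<in> Q" "norm (v - w) \<le> c * norm v" using vboundE[OF vb v(2)] .
    then show "x \<le> c" using d_vec_le[OF Q v(3)] v by simp
  qed
  then show ?thesis using False by (simp add: d_space_def)
qed

text \<open>
  The factor \<open>2\<close> makes room to replace the infimum over \<open>Q\<close> by a vector that nearly attains it; this
  is why \<open>c\<close> must be positive.
\<close>

lemma vbound_if_d_space_le:
  assumes P: "subspace P" and Q: "subspace Q" and c: "0 < c" and d: "d_space P Q \<le> c"
  shows "vbound P Q (2 * c)"
proof (rule vboundI)
  fix v assume v: "v \<in> P"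
  show "\<exists>w\<in>Q. norm (v - w) \<le> 2 * c * norm v"
  proof (cases "v = 0")
    case True
    then show ?thesis using subspace_0[OF Q] by (intro bexI[of _ 0]) auto
  next
    case v0: False
    define u where "u = v /\<^sub>R norm v"
    have u: "u \<in> P" "norm u = 1" using v v0 P by (auto simp: subspace_scale u_def)
    have "P \<noteq> {0}" using v v0 by blast
    have "d_vec u Q \<le> Sup {d_vec v Q | v. v \<in> P \<and> norm v = 1}"
    proof (rule cSup_upper)
      have "d_vec v Q \<le> 1" if "norm v = 1" for v
        by (rule d_vec_le[OF Q that subspace_0[OF Q]]) (use that in simp)
      then show "bdd_above {d_vec v Q | v. v \<in> P \<and> norm v = 1}" by (intro bdd_aboveI[of _ 1]) auto
    qed (use u in blast)
    also have "\<dots> \<le> c" using d \<open>P \<noteq> {0}\<close> by (simp add: d_space_def)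
    also have "\<dots> < 2 * c" using c by simp
    finally obtain w where w: "w \<in> Q" "norm (u - w) \<le> 2 * c" using d_vec_less[OF Q u(2)] by blast
    have "v - norm v *\<^sub>R w = norm v *\<^sub>R (u - w)" using v0 by (simp add: u_def algebra_simps)
    then have "norm (v - norm v *\<^sub>R w) = norm v * norm (u - w)" by simp
    also have "\<dots> \<le> norm v * (2 * c)" using w by (intro mult_left_mono) auto
    finally show ?thesis using subspace_scale[OF Q w(1), of "norm v"]
      by (intro bexI[of _ "norm v *\<^sub>R w"]) (auto simp: algebra_simps)
  qed
qed

definition verdier_vb :: "rvec set \<Rightarrow> rvec set \<Rightarrow> rvec \<Rightarrow> bool" where
  "verdier_vb \<Lambda> \<Gamma> x\<^sub>0 \<longleftrightarrow> (\<exists>\<delta>>0. \<exists>C>0. \<forall>x\<in>\<Gamma>. \<forall>y\<in>\<Lambda>. dist x x\<^sub>0 < \<delta> \<longrightarrow> dist y x\<^sub>0 < \<delta> \<longrightarrow>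
     vbound (tangent_space \<Gamma> x) (tangent_space \<Lambda> y) (C * norm (x - y)))"

text \<open>
  Disjointness makes \<open>norm (x - y)\<close> positive, as \<open>vbound_if_d_space_le\<close> requires.
\<close>

lemma verdier_iff_vb:
  assumes L: "\<Lambda> \<subseteq> Rn n" and G: "\<Gamma> \<subseteq> Rn n" and disj: "\<Gamma> \<inter> \<Lambda> = {}" and x0: "x\<^sub>0 \<in> \<Gamma>"
    and sL: "\<And>y. y \<in> \<Lambda> \<Longrightarrow> subspace (tangent_space \<Lambda> y)"
    and sG: "\<And>x. x \<in> \<Gamma> \<Longrightarrow> subspace (tangent_space \<Gamma> x)"
  shows "verdier n \<Lambda> \<Gamma> x\<^sub>0 \<longleftrightarrow> verdier_vb \<Lambda> \<Gamma> x\<^sub>0"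
proof
  assume "verdier n \<Lambda> \<Gamma> x\<^sub>0"
  then obtain U C where U: "open_in_Rn n U" "x\<^sub>0 \<in> U" and C: "0 < C"
    and d: "\<And>x y. x \<in> \<Gamma> \<inter> U \<Longrightarrow> y \<in> \<Lambda> \<inter> U \<Longrightarrow> d_space (tangent_space \<Gamma> x) (tangent_space \<Lambda> y) \<le> C * norm (x - y)"
    unfolding verdier_def by blast
  obtain r where r: "r > 0" "ball x\<^sub>0 r \<inter> Rn n \<subseteq> U" using open_in_Rn_ball[OF U] by blast
  have "vbound (tangent_space \<Gamma> x) (tangent_space \<Lambda> y) ((2 * C) * norm (x - y))"
    if "x \<in> \<Gamma>" "y \<in> \<Lambda>" "dist x x\<^sub>0 < r" "dist y x\<^sub>0 < r" for x y
  proof -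
    have xy: "x \<in> \<Gamma> \<inter> U" "y \<in> \<Lambda> \<inter> U" using that r L G by (auto simp: dist_commute subset_iff)
    have "x \<noteq> y" using that disj by blast
    then show ?thesis
      using vbound_if_d_space_le[OF sG[OF that(1)] sL[OF that(2)] _ d[OF xy]] C by (simp add: mult.assoc)
  qed
  then show "verdier_vb \<Lambda> \<Gamma> x\<^sub>0" unfolding verdier_vb_def
    using r(1) C by (intro exI[of _ r] conjI exI[of _ "2 * C"]) auto
next
  assume "verdier_vb \<Lambda> \<Gamma> x\<^sub>0"
  then obtain \<delta> C where \<delta>: "\<delta> > 0" "C > 0" and vb: "\<And>x y. x \<in> \<Gamma> \<Longrightarrow> y \<in> \<Lambda> \<Longrightarrow> dist x x\<^sub>0 < \<delta> \<Longrightarrow> dist y x\<^sub>0 < \<delta> \<Longrightarrow>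
     vbound (tangent_space \<Gamma> x) (tangent_space \<Lambda> y) (C * norm (x - y))"
    unfolding verdier_vb_def by blast
  show "verdier n \<Lambda> \<Gamma> x\<^sub>0" unfolding verdier_def
  proof (intro exI[of _ "ball x\<^sub>0 \<delta> \<inter> Rn n"] exI[of _ C] conjI ballI)
    show "open_in_Rn n (ball x\<^sub>0 \<delta> \<inter> Rn n)" by (rule open_in_Rn_Int_open) simp
    fix x y assume "x \<in> \<Gamma> \<inter> (ball x\<^sub>0 \<delta> \<inter> Rn n)" "y \<in> \<Lambda> \<inter> (ball x\<^sub>0 \<delta> \<inter> Rn n)"
    then show "d_space (tangent_space \<Gamma> x) (tangent_space \<Lambda> y) \<le> C * norm (x - y)"
      using \<delta> by (intro d_space_le_if_vbound sG sL vb) (auto simp: dist_commute)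
  qed (use \<delta> x0 G in auto)
qed

section \<open>Submanifolds in charts\<close>

text \<open>
  A flattening diffeomorphism \<open>\<phi>\<close> near \<open>x\<^sub>0\<close> and its inverse \<open>\<psi>\<close>, reduced to what estimates need: the
  derivatives \<open>G\<close> and \<open>H\<close> and one constant \<open>K\<close> that bounds both of them and their variation.
\<close>

locale chart =
  fixes n k :: nat and M :: "rvec set" and x\<^sub>0 :: rvec and r s :: real
    and \<phi> \<psi> :: "rvec \<Rightarrow> rvec" and G H :: "rvec \<Rightarrow> rvec \<Rightarrow> rvec" and K :: real
  assumes k: "k \<le> n" and r: "0 < r" and s: "0 < s" and x0: "x\<^sub>0 \<in> M" and M: "M \<subseteq> Rn n"
    and \<phi>C: "C11 (ball x\<^sub>0 r \<inter> Rn n) \<phi> G K" and \<psi>C: "C11 (ball (\<phi> x\<^sub>0) s \<inter> Rn n) \<psi> H K"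
    and \<phi>_im: "\<phi> ` (ball x\<^sub>0 r \<inter> Rn n) \<subseteq> ball (\<phi> x\<^sub>0) s \<inter> Rn n"
    and \<psi>\<phi>: "\<And>x. x \<in> ball x\<^sub>0 r \<inter> Rn n \<Longrightarrow> \<psi> (\<phi> x) = x"
    and \<phi>M: "\<And>x. x \<in> ball x\<^sub>0 r \<inter> Rn n \<Longrightarrow> x \<in> M \<longleftrightarrow> \<phi> x \<in> Rn k"
    and \<psi>_Rn: "\<And>u. u \<in> ball (\<phi> x\<^sub>0) s \<inter> Rn n \<Longrightarrow> \<psi> u \<in> Rn n"
    and \<phi>\<psi>: "\<And>u. u \<in> ball (\<phi> x\<^sub>0) s \<inter> Rn n \<Longrightarrow> \<phi> (\<psi> u) = u"
    and \<psi>M: "\<And>u. u \<in> ball (\<phi> x\<^sub>0) s \<inter> Rn k \<Longrightarrow> \<psi> u \<in> M"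
    and G_Rn: "\<And>x v. G x v \<in> Rn n" and H_Rn: "\<And>u v. H u v \<in> Rn n"
begin

lemma K: "0 < K" using \<phi>C by (simp add: C11_def)

lemma x0_dom: "x\<^sub>0 \<in> ball x\<^sub>0 r \<inter> Rn n" using r x0 M by auto

lemma \<phi>_dom: "x \<in> ball x\<^sub>0 r \<inter> Rn n \<Longrightarrow> \<phi> x \<in> ball (\<phi> x\<^sub>0) s \<inter> Rn n"
  using \<phi>_im by blast

lemma HG: "x \<in> ball x\<^sub>0 r \<inter> Rn n \<Longrightarrow> v \<in> Rn n \<Longrightarrow> H (\<phi> x) (G x v) = v"
  by (rule C11_left_inverse_deriv[OF \<phi>C \<psi>C \<phi>_im \<psi>\<phi>])

lemma GH:
  assumes x: "x \<in> ball x\<^sub>0 r \<inter> Rn n" and v: "v \<in> Rn n"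
  shows "G x (H (\<phi> x) v) = v"
proof -
  have u: "\<phi> x \<in> ball (\<phi> x\<^sub>0) s \<inter> Rn n" using \<phi>_im x by blast
  define \<rho> where "\<rho> = min (s - dist (\<phi> x\<^sub>0) (\<phi> x)) ((r - dist x\<^sub>0 x) / K)"
  have \<rho>: "\<rho> > 0" using u x K by (simp add: \<rho>_def)
  have sub: "ball (\<phi> x) \<rho> \<inter> Rn n \<subseteq> ball (\<phi> x\<^sub>0) s \<inter> Rn n"
  proof
    fix w assume w: "w \<in> ball (\<phi> x) \<rho> \<inter> Rn n"
    have "dist (\<phi> x\<^sub>0) w \<le> dist (\<phi> x\<^sub>0) (\<phi> x) + dist (\<phi> x) w" by (rule dist_triangle)
    then show "w \<in> ball (\<phi> x\<^sub>0) s \<inter> Rn n" using w by (auto simp: \<rho>_def)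
  qed
  have C: "C11 (ball (\<phi> x) \<rho> \<inter> Rn n) \<psi> H K" by (rule C11_subset[OF \<psi>C sub order_refl])
  have "\<psi> ` (ball (\<phi> x) \<rho> \<inter> Rn n) \<subseteq> ball x\<^sub>0 r \<inter> Rn n"
  proof (rule image_subsetI)
    fix w assume w: "w \<in> ball (\<phi> x) \<rho> \<inter> Rn n"
    have "norm (\<psi> (\<phi> x) - \<psi> w) \<le> K * norm (\<phi> x - w)"
      using w u sub by (intro C11_lipschitz[OF \<psi>C convex_ball_Rn]) auto
    also have "\<dots> < K * \<rho>" using w K by (intro mult_strict_left_mono) (auto simp: dist_norm)
    also have "\<dots> \<le> K * ((r - dist x\<^sub>0 x) / K)" using K by (intro mult_left_mono) (auto simp: \<rho>_def)
    also have "\<dots> = r - dist x\<^sub>0 x" using K by simp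
    finally have "dist x (\<psi> w) < r - dist x\<^sub>0 x" using \<psi>\<phi>[OF x] by (simp add: dist_norm)
    moreover have "dist x\<^sub>0 (\<psi> w) \<le> dist x\<^sub>0 x + dist x (\<psi> w)" by (rule dist_triangle)
    ultimately show "\<psi> w \<in> ball x\<^sub>0 r \<inter> Rn n" using \<psi>_Rn w sub by auto
  qed
  then have "G (\<psi> (\<phi> x)) (H (\<phi> x) v) = v"
    by (rule C11_left_inverse_deriv[OF C \<phi>C]) (use \<phi>\<psi> sub u \<rho> v in auto)
  then show ?thesis using \<psi>\<phi>[OF x] by simp
qed

lemma G_tangent:
  assumes x: "x \<in> M \<inter> ball x\<^sub>0 r" and v: "v \<in> tangent_space M x"
  shows "G x v \<in> Rn k"
proof -
  have xR: "x \<in> ball x\<^sub>0 r \<inter> Rn n" using x M by auto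
  have "G x v \<in> tangent_space (Rn k) (\<phi> x)"
    by (rule tangent_space_map[OF v _ _ \<phi>C, of "ball x\<^sub>0 r"]) (use x M \<phi>M in auto)
  then show ?thesis using tangent_space_Rn[of "\<phi> x" k] \<phi>M[OF xR] x by auto
qed

text \<open>
  Both inclusions transport tangent vectors by \<open>tangent_space_map\<close>, along \<open>\<phi>\<close> and along \<open>\<psi>\<close>.
\<close>

lemma tangent_eq:
  assumes x: "x \<in> M \<inter> ball x\<^sub>0 r"
  shows "tangent_space M x = H (\<phi> x) ` Rn k"
proof
  have xR: "x \<in> ball x\<^sub>0 r \<inter> Rn n" using x M by auto
  then have u: "\<phi> x \<in> ball (\<phi> x\<^sub>0) s \<inter> Rn k" using \<phi>_im \<phi>M x by blast
  show "tangent_space M x \<subseteq> H (\<phi> x) ` Rn k"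
  proof
    fix v assume v: "v \<in> tangent_space M x"
    then have "v \<in> Rn n" using tangent_space_subset_Rn[OF M] x by blast
    then have "v = H (\<phi> x) (G x v)" using HG[OF xR] by simp
    then show "v \<in> H (\<phi> x) ` Rn k" using G_tangent[OF x v] by blast
  qed
  show "H (\<phi> x) ` Rn k \<subseteq> tangent_space M x"
  proof (rule image_subsetI)
    fix a assume "a \<in> Rn k"
    then have "a \<in> tangent_space (Rn k) (\<phi> x)" using tangent_space_Rn u by blast
    then have "H (\<phi> x) a \<in> tangent_space M (\<psi> (\<phi> x))"
      by (rule tangent_space_map[OF _ _ _ \<psi>C, of _ _ _ "ball (\<phi> x\<^sub>0) s"]) (use u Rn_mono[OF k] \<psi>M in auto)
    then show "H (\<phi> x) a \<in> tangent_space M x" using \<psi>\<phi>[OF xR] by simp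
  qed
qed

lemma linear_H: "u \<in> ball (\<phi> x\<^sub>0) s \<inter> Rn n \<Longrightarrow> linear (H u)"
  using C11_derivD(2)[OF \<psi>C] by (auto intro: bounded_linear.linear)

lemma linear_G: "u \<in> ball x\<^sub>0 r \<inter> Rn n \<Longrightarrow> linear (G u)"
  using C11_derivD(2)[OF \<phi>C] by (auto intro: bounded_linear.linear)

lemma subspace_tangent:
  assumes x: "x \<in> M \<inter> ball x\<^sub>0 r"
  shows "subspace (tangent_space M x)"
  unfolding tangent_eq[OF x]
  by (rule linear_subspace_image[OF linear_H[OF \<phi>_dom]]) (use x M in auto)

text \<open>
  Send \<open>v = H (\<phi> x) a\<close> to \<open>H (\<phi> y) a\<close>: the vector \<open>a\<close> lies in the fixed subspace \<open>Rn k\<close> and \<open>H\<close> is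
  Lipschitz in its base point.
\<close>

lemma tangent_lipschitz:
  assumes x: "x \<in> M \<inter> ball x\<^sub>0 r" and y: "y \<in> M \<inter> ball x\<^sub>0 r"
  shows "vbound (tangent_space M x) (tangent_space M y) (K * K * K * norm (x - y))"
proof (rule vboundI)
  fix v assume v: "v \<in> tangent_space M x"
  have xy: "x \<in> ball x\<^sub>0 r \<inter> Rn n" "y \<in> ball x\<^sub>0 r \<inter> Rn n" using x y M by auto
  then have u: "\<phi> x \<in> ball (\<phi> x\<^sub>0) s \<inter> Rn n" "\<phi> y \<in> ball (\<phi> x\<^sub>0) s \<inter> Rn n" using \<phi>_im by blast+
  define a where "a = G x v"
  have a: "a \<in> Rn k" unfolding a_def by (rule G_tangent[OF x v])
  have "v \<in> Rn n" using v tangent_space_subset_Rn[OF M] x by blast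
  then have v_eq: "v = H (\<phi> x) a" unfolding a_def using HG[OF xy(1)] by simp
  have "norm (H (\<phi> x) a - H (\<phi> y) a) \<le> K * norm (\<phi> x - \<phi> y) * norm a"
    by (rule C11_derivD(4)[OF \<psi>C u])
  also have "\<dots> \<le> K * (K * norm (x - y)) * (K * norm v)"
    using K C11_derivD(3)[OF \<phi>C xy(1), of v] C11_lipschitz[OF \<phi>C convex_ball_Rn xy]
    unfolding a_def by (intro mult_mono) auto
  finally have "norm (v - H (\<phi> y) a) \<le> K * K * K * norm (x - y) * norm v"
    using v_eq by (simp add: algebra_simps)
  moreover have "H (\<phi> y) a \<in> tangent_space M y" using tangent_eq[OF y] a by blast
  ultimately show "\<exists>w\<in>tangent_space M y. norm (v - w) \<le> K * K * K * norm (x - y) * norm v" by blast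
qed

lemma locally_closed:
  assumes y: "y \<in> closure M" "y \<in> ball x\<^sub>0 r"
  shows "y \<in> M"
proof -
  have yR: "y \<in> ball x\<^sub>0 r \<inter> Rn n" using y closure_minimal[OF M closed_Rn] by auto
  obtain z where z: "\<And>i. z i \<in> M" "z \<longlonglongrightarrow> y" using y(1) closure_sequential by metis
  have "\<forall>\<^sub>F i in sequentially. z i \<in> ball x\<^sub>0 r" using topological_tendstoD[OF z(2) open_ball y(2)] .
  then have ev: "\<forall>\<^sub>F i in sequentially. z i \<in> ball x\<^sub>0 r \<inter> Rn n"
    by (rule eventually_mono) (use z(1) M in blast)
  have "continuous_on (ball x\<^sub>0 r \<inter> Rn n) \<phi>" by (rule C11_continuous_on[OF \<phi>C])
  then have "(\<lambda>i. \<phi> (z i)) \<longlonglongrightarrow> \<phi> y"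
    by (rule continuous_on_tendsto_compose[OF _ z(2) yR ev])
  moreover have "\<forall>\<^sub>F i in sequentially. \<phi> (z i) \<in> Rn k"
    using ev by (rule eventually_mono) (use \<phi>M z(1) in blast)
  ultimately have "\<phi> y \<in> Rn k" by (intro Lim_in_closed_set[OF closed_Rn]) auto
  then show ?thesis using \<phi>M[OF yR] by blast
qed

text \<open>
  In the chart, the difference quotients between \<open>x\<close> and the approximating points of \<open>M\<close> lie in
  \<open>Rn k\<close> and converge to \<open>G x v\<close>; as \<open>Rn k\<close> is closed, it contains \<open>G x v\<close>.
\<close>

lemma tangent_if_cone:
  assumes x: "x \<in> M \<inter> ball x\<^sub>0 r" and v: "v \<in> Rn n"
    and cone: "\<And>e. e > 0 \<Longrightarrow> \<exists>d>0. \<forall>t. 0 < t \<and> t < d \<longrightarrow> (\<exists>y\<in>M. norm (y - (x + t *\<^sub>R v)) \<le> e * t)"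
  shows "v \<in> tangent_space M x"
proof -
  have xR: "x \<in> ball x\<^sub>0 r \<inter> Rn n" using x M by auto
  have "\<exists>p\<in>Rn k. dist p (G x v) < \<eta>" if \<eta>: "\<eta> > 0" for \<eta>
  proof -
    define e where "e = min 1 (\<eta> / (4 * K))"
    have e: "e > 0" "e \<le> 1" "K * e \<le> \<eta> / 4" using K \<eta> by (auto simp: e_def min_def field_simps)
    obtain d where d: "d > 0" "\<And>t. 0 < t \<Longrightarrow> t < d \<Longrightarrow> \<exists>y\<in>M. norm (y - (x + t *\<^sub>R v)) \<le> e * t"
      using cone[OF e(1)] by blast
    define B where "B = norm v + 1"
    have B: "B > 0" by (simp add: B_def add_nonneg_pos)
    define \<tau> where "\<tau> = min d (min ((r - dist x\<^sub>0 x) / B) (\<eta> / (4 * K * B\<^sup>2)))"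
    have \<tau>: "\<tau> > 0" using d xR B K \<eta> by (simp add: \<tau>_def)
    define t where "t = \<tau> / 2"
    have t: "0 < t" "t < d" "t < (r - dist x\<^sub>0 x) / B" "t < \<eta> / (4 * K * B\<^sup>2)"
    proof -
      have "t < \<tau>" "0 < t" using \<tau> by (auto simp: t_def)
      then show "0 < t" "t < d" "t < (r - dist x\<^sub>0 x) / B" "t < \<eta> / (4 * K * B\<^sup>2)"
        unfolding \<tau>_def by auto
    qed
    obtain y where y: "y \<in> M" "norm (y - (x + t *\<^sub>R v)) \<le> e * t" using d(2)[OF t(1,2)] by blast
    have "norm (y - x) \<le> norm (y - (x + t *\<^sub>R v)) + norm (t *\<^sub>R v)"
      using norm_triangle_ineq[of "y - (x + t *\<^sub>R v)" "t *\<^sub>R v"] by simp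
    also have "\<dots> \<le> t + t * norm v" 
    proof (rule add_mono)
      show "norm (y - (x + t *\<^sub>R v)) \<le> t" using y(2) mult_right_mono[OF e(2), of t] t(1) by linarith
    qed (use t(1) in simp)
    finally have yx: "norm (y - x) \<le> t * B" by (simp add: B_def algebra_simps)
    also have "t * B < r - dist x\<^sub>0 x" using t(3) B by (simp add: field_simps)
    finally have "dist x y < r - dist x\<^sub>0 x" by (simp add: dist_norm norm_minus_commute)
    then have "dist x\<^sub>0 y < r" using dist_triangle[of x\<^sub>0 y x] by simp
    then have yR: "y \<in> ball x\<^sub>0 r \<inter> Rn n" using y(1) M by auto
    have lin: "linear (G x)" by (rule linear_G[OF xR])
    have "norm ((\<phi> y - \<phi> x) - t *\<^sub>R G x v) = norm ((\<phi> y - \<phi> x - G x (y - x)) + G x (y - (x + t *\<^sub>R v)))"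
      using lin by (simp add: linear_diff linear_add linear_scale)
    also have "\<dots> \<le> K * (norm (y - x))\<^sup>2 + K * norm (y - (x + t *\<^sub>R v))"
      by (rule order_trans[OF norm_triangle_ineq add_mono[OF C11_taylor[OF \<phi>C convex_ball_Rn xR yR] C11_derivD(3)[OF \<phi>C xR]]])
    also have "\<dots> \<le> K * (t * B)\<^sup>2 + K * (e * t)"
      using K yx y(2) by (intro add_mono mult_left_mono power_mono) auto
    finally have est: "norm ((\<phi> y - \<phi> x) - t *\<^sub>R G x v) \<le> t * (K * B\<^sup>2 * t + K * e)"
      by (simp add: power2_eq_square algebra_simps)
    have "K * B\<^sup>2 * t < \<eta> / 4"
    proof -
      have "K * B\<^sup>2 * t < K * B\<^sup>2 * (\<eta> / (4 * K * B\<^sup>2))" using t(4) K B by (intro mult_strict_left_mono) auto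
      also have "\<dots> = \<eta> / 4" using K B by simp
      finally show ?thesis .
    qed
    then have "t * (K * B\<^sup>2 * t + K * e) \<le> t * (\<eta> / 2)" using t(1) e(3) by (intro mult_left_mono) auto
    with est have est': "norm ((\<phi> y - \<phi> x) - t *\<^sub>R G x v) \<le> t * (\<eta> / 2)" by linarith
    define p where "p = (\<phi> y - \<phi> x) /\<^sub>R t"
    have "p \<in> Rn k" unfolding p_def using \<phi>M xR yR x y(1) by (intro Rn_scale Rn_diff) auto
    moreover have "p - G x v = ((\<phi> y - \<phi> x) - t *\<^sub>R G x v) /\<^sub>R t" using t(1) by (simp add: p_def algebra_simps)
    then have "norm (p - G x v) = norm ((\<phi> y - \<phi> x) - t *\<^sub>R G x v) / t" using t(1) by (simp add: divide_inverse mult.commute)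
    then have "norm (p - G x v) \<le> \<eta> / 2" using est' t(1) by (simp add: pos_divide_le_eq mult.commute)
    then have "dist p (G x v) < \<eta>" using \<eta> by (simp add: dist_norm)
    ultimately show ?thesis by blast
  qed
  then have "G x v \<in> Rn k" using closed_approachable[OF closed_Rn] by blast
  then have "H (\<phi> x) (G x v) \<in> tangent_space M x" using tangent_eq[OF x] by blast
  then show ?thesis using HG[OF xR v] by simp
qed

end

lemma chart_of_diffeo:
  assumes q: "at_least_C2 q" and k: "k \<le> n" "M \<subseteq> Rn n" and x0: "x\<^sub>0 \<in> M"
    and U: "x\<^sub>0 \<in> U" "Cq_diffeo q n U V \<phi>" "\<phi> ` (M \<inter> U) = V \<inter> Rn k"
  obtains r s \<psi> G H K where "chart n k M x\<^sub>0 r s \<phi> \<psi> G H K" "ball x\<^sub>0 r \<inter> Rn n \<subseteq> U"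
proof -
  obtain \<psi> where \<phi>: "Cq_on_open q n U \<phi>" "\<phi> ` U = V" and \<psi>: "Cq_on_open q n V \<psi>" "\<And>x. x \<in> U \<Longrightarrow> \<psi> (\<phi> x) = x"
    using U(2) unfolding Cq_diffeo_def by blast
  have sub: "U \<subseteq> Rn n" "V \<subseteq> Rn n" using \<phi>(1) \<psi>(1) by (auto simp: Cq_on_open_def dest: open_in_Rn_subset)
  have \<psi>V: "\<psi> ` V \<subseteq> U" using \<phi>(2) \<psi>(2) by force
  have im: "\<phi> ` U \<subseteq> Rn n" "\<psi> ` V \<subseteq> Rn n" using \<phi>(2) \<psi>V sub by auto
  have V0: "\<phi> x\<^sub>0 \<in> V" using \<phi>(2) U(1) by blast
  obtain s H K1 where s: "s > 0" "ball (\<phi> x\<^sub>0) s \<inter> Rn n \<subseteq> V" "C11 (ball (\<phi> x\<^sub>0) s \<inter> Rn n) \<psi> H K1" "\<And>x v. H x v \<in> Rn n"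
    using Cq_on_open_C11[OF q \<psi>(1) im(2) V0] by metis
  obtain r1 G K2 where r1: "r1 > 0" "ball x\<^sub>0 r1 \<inter> Rn n \<subseteq> U" "C11 (ball x\<^sub>0 r1 \<inter> Rn n) \<phi> G K2" "\<And>x v. G x v \<in> Rn n"
    using Cq_on_open_C11[OF q \<phi>(1) im(1) U(1)] by metis
  have K2: "K2 > 0" using r1(3) by (simp add: C11_def)
  define r where "r = min r1 (s / K2)"
  have r: "r > 0" using r1 s K2 by (simp add: r_def)
  have bsub: "ball x\<^sub>0 r \<inter> Rn n \<subseteq> ball x\<^sub>0 r1 \<inter> Rn n" by (auto simp: r_def)
  have rU: "ball x\<^sub>0 r \<inter> Rn n \<subseteq> U" using bsub r1(2) by blast
  have inj: "x = x'" if "x \<in> U" "x' \<in> U" "\<phi> x = \<phi> x'" for x x' using \<psi>(2) that by metis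
  have "chart n k M x\<^sub>0 r s \<phi> \<psi> G H (max K1 K2)"
  proof
    show "C11 (ball x\<^sub>0 r \<inter> Rn n) \<phi> G (max K1 K2)" by (rule C11_subset[OF r1(3) bsub]) simp
    show "C11 (ball (\<phi> x\<^sub>0) s \<inter> Rn n) \<psi> H (max K1 K2)" by (rule C11_subset[OF s(3)]) auto
    show "\<phi> ` (ball x\<^sub>0 r \<inter> Rn n) \<subseteq> ball (\<phi> x\<^sub>0) s \<inter> Rn n"
    proof (rule image_subsetI)
      fix x assume x: "x \<in> ball x\<^sub>0 r \<inter> Rn n"
      have "norm (\<phi> x\<^sub>0 - \<phi> x) \<le> K2 * norm (x\<^sub>0 - x)"
        using x bsub r1(1) U(1) sub by (intro C11_lipschitz[OF r1(3) convex_ball_Rn]) auto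
      also have "\<dots> < K2 * r" using x K2 by (intro mult_strict_left_mono) (auto simp: dist_norm)
      also have "\<dots> \<le> K2 * (s / K2)" using K2 by (intro mult_left_mono) (auto simp: r_def)
      also have "\<dots> = s" using K2 by simp
      finally show "\<phi> x \<in> ball (\<phi> x\<^sub>0) s \<inter> Rn n" using x rU im(1) by (simp add: dist_norm image_subset_iff subset_iff)
    qed
    fix x assume x: "x \<in> ball x\<^sub>0 r \<inter> Rn n"
    show "x \<in> M \<longleftrightarrow> \<phi> x \<in> Rn k"
    proof
      assume "x \<in> M"
      then have "\<phi> x \<in> \<phi> ` (M \<inter> U)" using x rU by blast
      then show "\<phi> x \<in> Rn k" using U(3) by blast
    next
      assume "\<phi> x \<in> Rn k"
      then have "\<phi> x \<in> \<phi> ` (M \<inter> U)" using x rU U(3) \<phi>(2) by blast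
      then show "x \<in> M" using inj x rU by blast
    qed
  next
    fix u assume "u \<in> ball (\<phi> x\<^sub>0) s \<inter> Rn k"
    then have "u \<in> \<phi> ` (M \<inter> U)" using s(2) U(3) Rn_mono[OF k(1)] by blast
    then show "\<psi> u \<in> M" using \<psi>(2) by force
  next
    fix u assume "u \<in> ball (\<phi> x\<^sub>0) s \<inter> Rn n"
    then have "u \<in> \<phi> ` U" using s(2) \<phi>(2) by blast
    then show "\<psi> u \<in> Rn n" "\<phi> (\<psi> u) = u" using \<psi>(2) sub by auto
  qed (use k r s r1 x0 rU \<psi>(2) in \<open>auto\<close>)
  then show ?thesis using rU by (rule that)
qed

lemma submanifold_chart:
  assumes q: "at_least_C2 q" and M: "submanifold q n M" and x0: "x\<^sub>0 \<in> M"
  obtains k r s \<phi> \<psi> G H K where "chart n k M x\<^sub>0 r s \<phi> \<psi> G H K"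
proof -
  obtain k U V \<phi> where "k \<le> n" "M \<subseteq> Rn n" "x\<^sub>0 \<in> U" "Cq_diffeo q n U V \<phi>" "\<phi> ` (M \<inter> U) = V \<inter> Rn k"
    using M x0 unfolding submanifold_def submanifold_dim_def by blast
  then show ?thesis using chart_of_diffeo[OF q _ _ x0] that by metis
qed

lemma subspace_tangent_space:
  assumes "at_least_C2 q" "submanifold q n M" "x \<in> M"
  shows "subspace (tangent_space M x)"
proof -
  obtain k r s \<phi> \<psi> G H K where "chart n k M x r s \<phi> \<psi> G H K"
    using submanifold_chart[OF assms] .
  then interpret chart n k M x r s \<phi> \<psi> G H K .
  show ?thesis by (rule subspace_tangent) (use assms r in auto)
qed

section \<open>Locality and invariance under diffeomorphisms\<close>

lemma incident_pairD:
  assumes "incident_pair q n \<Lambda> \<Gamma>"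
  shows "submanifold q n \<Lambda>" "submanifold q n \<Gamma>" "\<Lambda> \<subseteq> Rn n" "\<Gamma> \<subseteq> Rn n" "\<Gamma> \<inter> \<Lambda> = {}" "\<Gamma> \<subseteq> closure \<Lambda>"
  using assms by (auto simp: incident_pair_def submanifold_def submanifold_dim_def)

lemma incident_verdier_iff:
  assumes q: "at_least_C2 q" and i: "incident_pair q n \<Lambda> \<Gamma>" and x: "x \<in> \<Gamma>"
  shows "verdier n \<Lambda> \<Gamma> x \<longleftrightarrow> verdier_vb \<Lambda> \<Gamma> x"
  using incident_pairD[OF i] x by (intro verdier_iff_vb subspace_tangent_space[OF q]) auto

text \<open>
  A tangent space at a point of \<open>U\<close> does not change when the manifold is intersected with \<open>U\<close>.
\<close>

lemma verdier_local: "local_condition q verdier"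
  unfolding local_condition_def
proof (intro allI impI, elim conjE)
  fix n \<Lambda> \<Gamma> x U
  assume i: "incident_pair q n \<Lambda> \<Gamma>" and x: "x \<in> \<Gamma>" "x \<in> U" and U: "open_in_Rn n U"
  obtain T where T: "open T" "U = Rn n \<inter> T" using U by (auto simp: open_in_Rn_def openin_open)
  have t: "tangent_space (M \<inter> U) y = tangent_space M y" if "y \<in> U" "M \<subseteq> Rn n" for M y
  proof -
    have "M \<inter> U = M \<inter> T" using that T by blast
    then show ?thesis using tangent_space_Int_open[OF T(1)] that T by auto
  qed
  note d = incident_pairD[OF i]
  show "verdier n \<Lambda> \<Gamma> x \<longleftrightarrow> verdier n (\<Lambda> \<inter> U) (\<Gamma> \<inter> U) x"
  proof
    assume "verdier n \<Lambda> \<Gamma> x"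
    then obtain V C where V: "open_in_Rn n V" "x \<in> V" "0 < C"
      "\<And>x y. x \<in> \<Gamma> \<inter> V \<Longrightarrow> y \<in> \<Lambda> \<inter> V \<Longrightarrow> d_space (tangent_space \<Gamma> x) (tangent_space \<Lambda> y) \<le> C * norm (x - y)"
      unfolding verdier_def by blast
    show "verdier n (\<Lambda> \<inter> U) (\<Gamma> \<inter> U) x" unfolding verdier_def
      by (intro exI[of _ V] exI[of _ C] conjI V ballI) (use V(4) t d in auto)
  next
    assume "verdier n (\<Lambda> \<inter> U) (\<Gamma> \<inter> U) x"
    then obtain V C where V: "open_in_Rn n V" "x \<in> V" "0 < C"
      "\<And>x y. x \<in> \<Gamma> \<inter> U \<inter> V \<Longrightarrow> y \<in> \<Lambda> \<inter> U \<inter> V \<Longrightarrow> d_space (tangent_space (\<Gamma> \<inter> U) x) (tangent_space (\<Lambda> \<inter> U) y) \<le> C * norm (x - y)"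
      unfolding verdier_def by blast
    show "verdier n \<Lambda> \<Gamma> x" unfolding verdier_def
    proof (intro exI[of _ "U \<inter> V"] exI[of _ C] conjI ballI)
      show "open_in_Rn n (U \<inter> V)" using U V(1) unfolding open_in_Rn_def by (rule openin_Int)
      fix a b assume "a \<in> \<Gamma> \<inter> (U \<inter> V)" "b \<in> \<Lambda> \<inter> (U \<inter> V)"
      then show "d_space (tangent_space \<Gamma> a) (tangent_space \<Lambda> b) \<le> C * norm (a - b)"
        using V(4)[of a b] t d by auto
    qed (use x V in auto)
  qed
qed

lemma Cq_diffeoE:
  assumes "Cq_diffeo q n U V \<phi>"
  obtains \<psi> where "U \<subseteq> Rn n" "V \<subseteq> Rn n" "\<phi> ` U = V" "\<And>x. x \<in> U \<Longrightarrow> \<psi> (\<phi> x) = x" "Cq_diffeo q n V U \<psi>"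
proof -
  obtain \<psi> where \<phi>: "Cq_on_open q n U \<phi>" "\<phi> ` U = V" and \<psi>: "Cq_on_open q n V \<psi>" "\<And>x. x \<in> U \<Longrightarrow> \<psi> (\<phi> x) = x"
    using assms unfolding Cq_diffeo_def by blast
  have "Cq_diffeo q n V U \<psi>" unfolding Cq_diffeo_def
  proof (intro conjI exI[of _ \<phi>] ballI \<psi>(1) \<phi>(1))
    show "\<psi> ` V = U" using \<phi>(2) \<psi>(2) by force
    show "\<phi> (\<psi> v) = v" if "v \<in> V" for v using that \<phi>(2) \<psi>(2) by auto
  qed
  moreover have "U \<subseteq> Rn n" "V \<subseteq> Rn n" using \<phi>(1) \<psi>(1) by (auto simp: Cq_on_open_def dest: open_in_Rn_subset)
  ultimately show ?thesis using that \<phi>(2) \<psi>(2) by blast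
qed

lemma diffeo_chart:
  assumes q: "at_least_C2 q" and \<phi>: "Cq_diffeo q n U V \<phi>" and x0: "x\<^sub>0 \<in> U"
  obtains r s \<psi> G H K where "chart n n U x\<^sub>0 r s \<phi> \<psi> G H K" "ball x\<^sub>0 r \<inter> Rn n \<subseteq> U"
proof -
  obtain \<psi> where "U \<subseteq> Rn n" "V \<subseteq> Rn n" "\<phi> ` U = V" using Cq_diffeoE[OF \<phi>] by metis
  then have "\<phi> ` (U \<inter> U) = V \<inter> Rn n" by auto
  then show ?thesis using chart_of_diffeo[OF q order_refl \<open>U \<subseteq> Rn n\<close> x0 x0 \<phi>] that by metis
qed

text \<open>
  The inverse chart maps \<open>\<phi> ` M\<close> near \<open>\<phi> x\<close> back into \<open>M\<close>, because \<open>\<phi>\<close> is injective on all of \<open>U\<close>; so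
  tangent vectors are transported in both directions.
\<close>

lemma diffeo_tangent:
  assumes c: "chart n n U x\<^sub>0 r s \<phi> \<psi> G H K" and inj: "inj_on \<phi> U" and im: "\<phi> ` U \<subseteq> Rn n" and MU: "M \<subseteq> U"
    and x: "x \<in> M" "x \<in> ball x\<^sub>0 r"
  shows "tangent_space (\<phi> ` M) (\<phi> x) = G x ` tangent_space M x"
    and "v' \<in> tangent_space (\<phi> ` M) (\<phi> x) \<Longrightarrow> H (\<phi> x) v' \<in> tangent_space M x \<and> G x (H (\<phi> x) v') = v'"
proof -
  have U: "U \<subseteq> Rn n" using c by (rule chart.M)
  interpret chart n n U x\<^sub>0 r s \<phi> \<psi> G H K by fact
  have MR: "M \<subseteq> Rn n" using MU U by blast
  then have xR: "x \<in> ball x\<^sub>0 r \<inter> Rn n" using x by blast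
  have fwd: "G x v \<in> tangent_space (\<phi> ` M) (\<phi> x)" if "v \<in> tangent_space M x" for v
    by (rule tangent_space_map[OF that open_ball x(2) \<phi>C]) (use MR in blast)+
  have bwd: "H (\<phi> x) v' \<in> tangent_space M x \<and> G x (H (\<phi> x) v') = v'" if v': "v' \<in> tangent_space (\<phi> ` M) (\<phi> x)" for v'
  proof
    have sub: "\<phi> ` M \<subseteq> Rn n" using MU im by blast
    have "\<psi> ` (\<phi> ` M \<inter> ball (\<phi> x\<^sub>0) s) \<subseteq> M"
    proof (rule image_subsetI)
      fix u assume u: "u \<in> \<phi> ` M \<inter> ball (\<phi> x\<^sub>0) s"
      then obtain z where z: "z \<in> M" "u = \<phi> z" by blast
      have uR: "u \<in> ball (\<phi> x\<^sub>0) s \<inter> Rn n" using u sub by blast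
      then have "\<psi> u \<in> U" "\<phi> (\<psi> u) = \<phi> z" using \<psi>M \<phi>\<psi> z by auto
      then have "\<psi> u = z" using inj z MU by (meson inj_onD subsetD)
      then show "\<psi> u \<in> M" using z by simp
    qed
    then have "H (\<phi> x) v' \<in> tangent_space M (\<psi> (\<phi> x))"
      by (intro tangent_space_map[OF v' _ _ \<psi>C, of "ball (\<phi> x\<^sub>0) s"]) (use sub \<phi>_dom[OF xR] in auto)
    then show "H (\<phi> x) v' \<in> tangent_space M x" using \<psi>\<phi>[OF xR] by simp
    have "v' \<in> Rn n" using v' tangent_space_subset_Rn[OF sub] x by blast
    then show "G x (H (\<phi> x) v') = v'" by (rule GH[OF xR])
  qed
  show "v' \<in> tangent_space (\<phi> ` M) (\<phi> x) \<Longrightarrow> H (\<phi> x) v' \<in> tangent_space M x \<and> G x (H (\<phi> x) v') = v'"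
    by (rule bwd)
  show "tangent_space (\<phi> ` M) (\<phi> x) = G x ` tangent_space M x"
    using fwd bwd by (metis (no_types, lifting) image_eqI image_subsetI subsetI subset_antisym)
qed

text \<open>
  Pull a tangent vector back from \<open>\<phi> x\<close> to \<open>x\<close>, approximate it at \<open>y\<close>, and push the result forward by the derivative
  \<open>G y\<close>. Replacing \<open>G x\<close> by \<open>G y\<close> costs a multiple of \<open>norm (x - y)\<close>, which the condition allows.
\<close>

lemma verdier_vb_diffeo:
  assumes q: "at_least_C2 q" and \<phi>: "Cq_diffeo q n U V \<phi>" and L: "\<Lambda> \<subseteq> U" and Gm: "\<Gamma> \<subseteq> U" and x0: "x\<^sub>0 \<in> \<Gamma>"
    and vb: "verdier_vb \<Lambda> \<Gamma> x\<^sub>0"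
  shows "verdier_vb (\<phi> ` \<Lambda>) (\<phi> ` \<Gamma>) (\<phi> x\<^sub>0)"
proof -
  obtain r s \<psi> G H K where c: "chart n n U x\<^sub>0 r s \<phi> \<psi> G H K"
    using diffeo_chart[OF q \<phi>, of x\<^sub>0] x0 Gm by (meson subsetD)
  interpret chart n n U x\<^sub>0 r s \<phi> \<psi> G H K by fact
  obtain \<psi>' where U: "U \<subseteq> Rn n" "V \<subseteq> Rn n" "\<phi> ` U = V" "\<And>x. x \<in> U \<Longrightarrow> \<psi>' (\<phi> x) = x"
    using Cq_diffeoE[OF \<phi>] by metis
  have inj: "inj_on \<phi> U" using U(4) by (metis inj_onI)
  have im: "\<phi> ` U \<subseteq> Rn n" using U by simp
  obtain \<delta> C where \<delta>: "\<delta> > 0" and C: "C > 0" and vb: "\<And>x y. x \<in> \<Gamma> \<Longrightarrow> y \<in> \<Lambda> \<Longrightarrow> dist x x\<^sub>0 < \<delta> \<Longrightarrow> dist y x\<^sub>0 < \<delta> \<Longrightarrow>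
     vbound (tangent_space \<Gamma> x) (tangent_space \<Lambda> y) (C * norm (x - y))"
    using vb unfolding verdier_vb_def by blast
  define \<rho> where "\<rho> = min r \<delta>"
  define \<epsilon> where "\<epsilon> = min s (\<rho> / K)"
  have \<epsilon>: "\<epsilon> > 0" using s r \<delta> K by (simp add: \<epsilon>_def \<rho>_def)
  have near: "dist z x\<^sub>0 < \<rho> \<and> z \<in> ball x\<^sub>0 r \<inter> Rn n \<and> \<phi> z \<in> ball (\<phi> x\<^sub>0) s \<inter> Rn n \<and> \<psi> (\<phi> z) = z" if z: "z \<in> U" "dist (\<phi> z) (\<phi> x\<^sub>0) < \<epsilon>" for z
  proof -
    have u: "\<phi> z \<in> ball (\<phi> x\<^sub>0) s \<inter> Rn n" using z im by (auto simp: \<epsilon>_def dist_commute)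
    then have "\<psi> (\<phi> z) \<in> U" "\<phi> (\<psi> (\<phi> z)) = \<phi> z" using \<psi>M \<phi>\<psi> by auto
    then have \<psi>z: "\<psi> (\<phi> z) = z" using inj z by (meson inj_onD)
    have "norm (\<psi> (\<phi> z) - \<psi> (\<phi> x\<^sub>0)) \<le> K * norm (\<phi> z - \<phi> x\<^sub>0)"
      using u \<phi>_dom[OF x0_dom] by (intro C11_lipschitz[OF \<psi>C convex_ball_Rn]) auto
    also have "\<dots> < K * \<epsilon>" using z K by (intro mult_strict_left_mono) (auto simp: dist_norm)
    also have "\<dots> \<le> K * (\<rho> / K)" using K by (intro mult_left_mono) (auto simp: \<epsilon>_def)
    also have "\<dots> = \<rho>" using K by simp
    finally have "dist z x\<^sub>0 < \<rho>" using \<psi>z \<psi>\<phi>[OF x0_dom] by (simp add: dist_norm)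
    then show ?thesis using u \<psi>z z U(1) by (auto simp: \<rho>_def dist_commute)
  qed
  define D where "D = K * (1 + C) * K * K"
  have "vbound (tangent_space (\<phi> ` \<Gamma>) (\<phi> x)) (tangent_space (\<phi> ` \<Lambda>) (\<phi> y)) (D * norm (\<phi> x - \<phi> y))"
    if xy: "x \<in> \<Gamma>" "y \<in> \<Lambda>" "dist (\<phi> x) (\<phi> x\<^sub>0) < \<epsilon>" "dist (\<phi> y) (\<phi> x\<^sub>0) < \<epsilon>" for x y
  proof (rule vboundI)
    fix v' assume v': "v' \<in> tangent_space (\<phi> ` \<Gamma>) (\<phi> x)"
    note nx = near[of x] and ny = near[of y]
    have xU: "x \<in> U" "y \<in> U" using xy L Gm by auto
    have xr: "x \<in> ball x\<^sub>0 r" "y \<in> ball x\<^sub>0 r" and xR: "x \<in> ball x\<^sub>0 r \<inter> Rn n" "y \<in> ball x\<^sub>0 r \<inter> Rn n"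
      using nx ny xU xy by auto
    define v where "v = H (\<phi> x) v'"
    have v: "v \<in> tangent_space \<Gamma> x" "G x v = v'"
      using diffeo_tangent(2)[OF c inj im Gm xy(1) xr(1) v'] by (auto simp: v_def)
    have "vbound (tangent_space \<Gamma> x) (tangent_space \<Lambda> y) (C * norm (x - y))"
      using nx ny xU xy by (intro vb) (auto simp: \<rho>_def)
    then obtain w where w: "w \<in> tangent_space \<Lambda> y" "norm (v - w) \<le> C * norm (x - y) * norm v"
      using v(1) by (rule vboundE)
    have nv: "norm v \<le> K * norm v'" unfolding v_def
      using nx xU xy by (intro C11_derivD(3)[OF \<psi>C]) auto
    have nxy: "norm (x - y) \<le> K * norm (\<phi> x - \<phi> y)"
      using C11_lipschitz[OF \<psi>C convex_ball_Rn, of "\<phi> x" "\<phi> y"] nx ny xU xy by auto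
    have "v' - G y w = (G x v - G y v) + G y (v - w)"
      using v(2) linear_diff[OF linear_G[OF xR(2)], of v w] by simp
    then have "norm (v' - G y w) \<le> norm (G x v - G y v) + norm (G y (v - w))"
      by (simp add: norm_triangle_ineq)
    also have "\<dots> \<le> K * norm (x - y) * norm v + K * (C * norm (x - y) * norm v)"
      using K w(2) by (intro add_mono C11_derivD(4)[OF \<phi>C xR] order_trans[OF C11_derivD(3)[OF \<phi>C xR(2)]] mult_left_mono) auto
    also have "\<dots> = K * (1 + C) * (norm (x - y) * norm v)" by (simp add: algebra_simps)
    also have "\<dots> \<le> K * (1 + C) * ((K * norm (\<phi> x - \<phi> y)) * (K * norm v'))"
      using K C nv nxy by (intro mult_left_mono mult_mono) auto
    also have "\<dots> = D * norm (\<phi> x - \<phi> y) * norm v'" by (simp add: D_def algebra_simps)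
    finally show "\<exists>w'\<in>tangent_space (\<phi> ` \<Lambda>) (\<phi> y). norm (v' - w') \<le> D * norm (\<phi> x - \<phi> y) * norm v'"
      using w(1) diffeo_tangent(1)[OF c inj im L xy(2) xr(2)] by blast
  qed
  moreover have "D > 0" using K C by (simp add: D_def)
  ultimately show ?thesis unfolding verdier_vb_def using \<epsilon> by (intro exI[of _ \<epsilon>] conjI exI[of _ D]) auto
qed

lemma verdier_invariant:
  assumes q: "at_least_C2 q"
  shows "invariant_condition D q verdier"
  unfolding invariant_condition_def
proof (intro allI impI, elim conjE)
  fix n U W \<phi> \<Lambda> \<Gamma> x
  assume \<phi>: "Cq_diffeo q n U W \<phi>" and i: "incident_pair q n \<Lambda> \<Gamma>" and sub: "\<Lambda> \<subseteq> U" "\<Gamma> \<subseteq> U" and x: "x \<in> \<Gamma>"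
  note d = incident_pairD[OF i]
  obtain \<psi> where U: "U \<subseteq> Rn n" "W \<subseteq> Rn n" "\<phi> ` U = W" "\<And>x. x \<in> U \<Longrightarrow> \<psi> (\<phi> x) = x" and \<psi>: "Cq_diffeo q n W U \<psi>"
    by (rule Cq_diffeoE[OF \<phi>]) (rule that)
  have inj: "inj_on \<phi> U" using U(4) by (metis inj_onI)
  have im: "\<phi> ` U \<subseteq> Rn n" using U by simp
  have bk: "\<psi> ` \<phi> ` M = M" if "M \<subseteq> U" for M using U(4) that by force
  have sp: "subspace (tangent_space (\<phi> ` N) y)" if N: "N \<subseteq> U" "submanifold q n N" and y: "y \<in> \<phi> ` N" for N y
  proof -
    obtain z where z: "z \<in> N" "y = \<phi> z" using y by blast
    then obtain r s \<psi>' G H K where c: "chart n n U z r s \<phi> \<psi>' G H K"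
      using diffeo_chart[OF q \<phi>, of z] N by (meson subsetD)
    interpret chart n n U z r s \<phi> \<psi>' G H K by fact
    have "tangent_space (\<phi> ` N) y = G z ` tangent_space N z"
      unfolding z by (rule diffeo_tangent(1)[OF c inj im N(1)]) (use z r in auto)
    then show ?thesis
      using linear_subspace_image[OF linear_G[OF x0_dom] subspace_tangent_space[OF q N(2) z(1)]] by simp
  qed
  have disj: "\<phi> ` \<Gamma> \<inter> \<phi> ` \<Lambda> = {}" using inj sub d(5) by (metis image_empty inj_on_image_Int)
  have "verdier n (\<phi> ` \<Lambda>) (\<phi> ` \<Gamma>) (\<phi> x) \<longleftrightarrow> verdier_vb (\<phi> ` \<Lambda>) (\<phi> ` \<Gamma>) (\<phi> x)"
    by (rule verdier_iff_vb) (use sub im disj x sp d in \<open>auto\<close>)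
  moreover have "verdier_vb (\<phi> ` \<Lambda>) (\<phi> ` \<Gamma>) (\<phi> x) \<longleftrightarrow> verdier_vb \<Lambda> \<Gamma> x"
  proof
    assume "verdier_vb (\<phi> ` \<Lambda>) (\<phi> ` \<Gamma>) (\<phi> x)"
    then have "verdier_vb (\<psi> ` \<phi> ` \<Lambda>) (\<psi> ` \<phi> ` \<Gamma>) (\<psi> (\<phi> x))"
      by (rule verdier_vb_diffeo[OF q \<psi>, rotated -1]) (use sub U x in auto)
    then show "verdier_vb \<Lambda> \<Gamma> x" using bk[OF sub(1)] bk[OF sub(2)] U(4)[of x] x sub by auto
  qed (use verdier_vb_diffeo[OF q \<phi> sub x] in blast)
  ultimately show "verdier n \<Lambda> \<Gamma> x \<longleftrightarrow> verdier n (\<phi> ` \<Lambda>) (\<phi> ` \<Gamma>) (\<phi> x)"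
    using incident_verdier_iff[OF q i x] by simp
qed

section \<open>Graphs\<close>

lift_definition tail :: "nat \<Rightarrow> rvec \<Rightarrow> rvec" is "\<lambda>n x i. x (i + n)"
proof -
  fix n and f :: "nat \<Rightarrow> real" assume "finite {i. f i \<noteq> 0}"
  then have "finite ((\<lambda>i. i + n) -` {i. f i \<noteq> 0})" by (rule finite_vimageI) (auto simp: inj_def)
  then show "finite {i. f (i + n) \<noteq> 0}" by (simp add: vimage_def)
qed

lemma coord_tail [simp]: "coord (tail n x) i = coord x (i + n)"
  by transfer simp

lemma Rn_exhaust: "\<exists>m. x \<in> Rn m"
proof -
  obtain m where "\<forall>i\<in>{i. coord x i \<noteq> 0}. i < m" using finite_nat_set_iff_bounded[of "{i. coord x i \<noteq> 0}"] by auto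
  then have "x \<in> Rn m" by (auto simp: Rn_def not_less[symmetric])
  then show ?thesis by blast
qed

lemma proj_pair [simp]: "x \<in> Rn n \<Longrightarrow> proj n (pair n x y) = x"
  by (rule rvec_eqI) (auto simp: Rn_def)

lemma tail_pair [simp]: "tail n (pair n x y) = y"
  by (rule rvec_eqI) simp

lemma pair_proj_tail [simp]: "pair n (proj n z) (tail n z) = z"
  by (rule rvec_eqI) simp

lemma pair_in_Rn: "y \<in> Rn m \<Longrightarrow> pair n x y \<in> Rn (n + m)"
  by (auto simp: Rn_def)

lemma tail_in_Rn: "z \<in> Rn (n + m) \<Longrightarrow> tail n z \<in> Rn m"
  by (auto simp: Rn_def)

lemma pair_eq_iff: "x \<in> Rn n \<Longrightarrow> x' \<in> Rn n \<Longrightarrow> pair n x y = pair n x' y' \<longleftrightarrow> x = x' \<and> y = y'"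
  by (metis proj_pair tail_pair)

lemma pair_add: "pair n (x + x') (y + y') = pair n x y + pair n x' y'"
  by (rule rvec_eqI) simp

lemma pair_diff: "pair n (x - x') (y - y') = pair n x y - pair n x' y'"
  by (rule rvec_eqI) simp

lemma pair_scale: "pair n (c *\<^sub>R x) (c *\<^sub>R y) = c *\<^sub>R pair n x y"
  by (rule rvec_eqI) simp

lemma norm_pair_power2:
  assumes x: "x \<in> Rn n"
  shows "(norm (pair n x y))\<^sup>2 = (norm x)\<^sup>2 + (norm y)\<^sup>2"
proof -
  obtain m where y: "y \<in> Rn m" using Rn_exhaust by blast
  have split: "(\<Sum>i<n + m. f i) = (\<Sum>i<n. f i) + (\<Sum>i<m. f (n + i))" for f :: "nat \<Rightarrow> real"
    by (induction m) auto
  show ?thesis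
    by (simp add: norm_power2_Rn[OF pair_in_Rn[OF y]] norm_power2_Rn[OF x] norm_power2_Rn[OF y] split)
qed

lemma norm_pair_bounds:
  assumes x: "x \<in> Rn n"
  shows "norm x \<le> norm (pair n x y)" "norm y \<le> norm (pair n x y)" "norm (pair n x y) \<le> norm x + norm y"
proof -
  have e: "norm (pair n x y) = sqrt ((norm x)\<^sup>2 + (norm y)\<^sup>2)"
    using norm_pair_power2[OF x, of y] by (metis norm_ge_zero real_sqrt_unique)
  show "norm x \<le> norm (pair n x y)" "norm y \<le> norm (pair n x y)" "norm (pair n x y) \<le> norm x + norm y"
    unfolding e by (auto intro: sqrt_sum_squares_le_sum)
qed

lemma bounded_linear_pair_snd: "bounded_linear (pair n 0)"
proof (rule bounded_linear_intro[where K = 1])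
  show "norm (pair n 0 y) \<le> norm y * 1" for y using norm_pair_bounds(3)[of 0 n y] by simp
qed (auto intro!: rvec_eqI)

lemma bounded_linear_tail: "bounded_linear (tail n)"
proof (rule bounded_linear_intro[where K = 1])
  show "norm (tail n z) \<le> norm z * 1" for z
    using norm_pair_bounds(2)[of "proj n z" n "tail n z"] by simp
qed (auto intro!: rvec_eqI)

lemma pair_eq_sum: "x \<in> Rn n \<Longrightarrow> pair n x y = x + pair n 0 y"
  by (rule rvec_eqI) (auto simp: Rn_def)

lemma graph_onI: "x \<in> A \<Longrightarrow> pair n x (f x) \<in> graph_on n A f"
  by (auto simp: graph_on_def)

lemma graph_on_mono: "A \<subseteq> B \<Longrightarrow> graph_on n A f \<subseteq> graph_on n B f"
  by (auto simp: graph_on_def)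

lemma graph_on_subset_Rn: "f ` A \<subseteq> Rn m \<Longrightarrow> graph_on n A f \<subseteq> Rn (n + m)"
  by (auto simp: graph_on_def intro!: pair_in_Rn)

lemma graph_tangent_proj:
  assumes M: "M \<subseteq> Rn n" and u: "u \<in> tangent_space (graph_on n M f) (pair n x (f x))" and x: "x \<in> M"
  shows "proj n u \<in> tangent_space M x"
proof -
  obtain K where K: "C11 UNIV (proj n) (\<lambda>_. proj n) K"
    using C11_bounded_linear[OF bounded_linear_proj C11_ident] by blast
  have "proj n u \<in> tangent_space M (proj n (pair n x (f x)))"
    by (rule tangent_space_map[OF u _ _ K, of UNIV]) (use M in \<open>auto simp: graph_on_def\<close>)
  then show ?thesis using x M by auto
qed

text \<open>
  One inclusion is the chain rule for \<open>x \<mapsto> (x, F x)\<close>. For the other one, a curve in the graph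
  is \<open>(\<gamma>, F \<circ> \<gamma>)\<close> with \<open>\<gamma>\<close> in \<open>M\<close>, and derivatives are unique.
\<close>

lemma graph_tangent:
  assumes M: "M \<subseteq> Rn n" and F: "C11 (ball x\<^sub>0 r \<inter> Rn n) F G K" and Ff: "\<And>x. x \<in> M \<inter> ball x\<^sub>0 r \<Longrightarrow> F x = f x"
    and x: "x \<in> M \<inter> ball x\<^sub>0 r"
  shows "tangent_space (graph_on n M f) (pair n x (f x)) = (\<lambda>v. pair n v (G x v)) ` tangent_space M x"
proof
  let ?S = "ball x\<^sub>0 r \<inter> Rn n"
  show "(\<lambda>v. pair n v (G x v)) ` tangent_space M x \<subseteq> tangent_space (graph_on n M f) (pair n x (f x))"
  proof (rule image_subsetI)
    fix v assume v: "v \<in> tangent_space M x"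
    obtain L where L: "C11 ?S (\<lambda>x. pair n 0 (F x)) (\<lambda>x v. pair n 0 (G x v)) L"
      using C11_bounded_linear[OF bounded_linear_pair_snd F] by blast
    have "C11 ?S (\<lambda>x. x + pair n 0 (F x)) (\<lambda>x v. v + pair n 0 (G x v)) (1 + L)"
      by (rule C11_add[OF C11_ident L])
    then have "v + pair n 0 (G x v) \<in> tangent_space (graph_on n M f) (x + pair n 0 (F x))"
    proof (rule tangent_space_map[OF v open_ball[of x\<^sub>0 r], rotated])
      show "(\<lambda>x. x + pair n 0 (F x)) ` (M \<inter> ball x\<^sub>0 r) \<subseteq> graph_on n M f"
      proof (rule image_subsetI)
        fix y assume y: "y \<in> M \<inter> ball x\<^sub>0 r"
        then have "y \<in> Rn n" using M by blast
        from pair_eq_sum[OF this, of "F y", symmetric]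
        have "y + pair n 0 (F y) = pair n y (f y)" using Ff[OF y] by simp
        then show "y + pair n 0 (F y) \<in> graph_on n M f" using y graph_onI[of y M n f] by auto
      qed
    qed (use x M in auto)
    moreover have "v \<in> Rn n" "x \<in> Rn n" using tangent_space_subset_Rn[OF M] v x M by blast+
    ultimately show "pair n v (G x v) \<in> tangent_space (graph_on n M f) (pair n x (f x))"
      unfolding Ff[OF x] pair_eq_sum[OF \<open>v \<in> Rn n\<close>, of "G x v"] pair_eq_sum[OF \<open>x \<in> Rn n\<close>, of "f x"]
      by blast
  qed
  show "tangent_space (graph_on n M f) (pair n x (f x)) \<subseteq> (\<lambda>v. pair n v (G x v)) ` tangent_space M x"
  proof
    fix u assume u: "u \<in> tangent_space (graph_on n M f) (pair n x (f x))"
    have xM: "x \<in> M" and xRn: "x \<in> Rn n" using x M by auto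
    have op: "open (proj n -` ball x\<^sub>0 r)"
      by (intro open_vimage) (auto intro!: continuous_intros)
    have inT: "pair n x (f x) \<in> proj n -` ball x\<^sub>0 r" using x xRn by simp
    obtain \<gamma> D \<epsilon> where g: "0 < \<epsilon>" "\<gamma> 0 = pair n x (f x)"
      "\<And>t. t \<in> {-\<epsilon><..<\<epsilon>} \<Longrightarrow> (\<gamma> has_vector_derivative D t) (at t)"
      "continuous_on {-\<epsilon><..<\<epsilon>} D" "\<gamma> ` {-\<epsilon><..<\<epsilon>} \<subseteq> graph_on n M f \<inter> proj n -` ball x\<^sub>0 r" "D 0 = u"
      by (rule tangent_spaceE[OF u op inT]) (rule that)
    let ?I = "{-\<epsilon><..<\<epsilon>}"
    have on: "proj n (\<gamma> t) \<in> M \<inter> ball x\<^sub>0 r \<and> tail n (\<gamma> t) = F (proj n (\<gamma> t))" if "t \<in> ?I" for t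
    proof -
      have "\<gamma> t \<in> graph_on n M f \<inter> proj n -` ball x\<^sub>0 r" using g(5) that by blast
      then obtain z where z: "z \<in> M" "\<gamma> t = pair n z (f z)" "proj n (\<gamma> t) \<in> ball x\<^sub>0 r" by (auto simp: graph_on_def)
      then have "proj n (\<gamma> t) = z" using M by auto
      then show ?thesis using z Ff[of z] by simp
    qed
    have p: "((\<lambda>t. proj n (\<gamma> t)) has_vector_derivative proj n (D t)) (at t)" if "t \<in> ?I" for t
      by (rule bounded_linear.has_vector_derivative[OF bounded_linear_proj g(3)[OF that]])
    have "((\<lambda>t. F (proj n (\<gamma> t))) has_vector_derivative G (proj n (\<gamma> 0)) (proj n (D 0))) (at 0)"
      by (rule C11_curve(1)[OF F _ p]) (use g(1,4) on M in \<open>auto intro!: continuous_intros\<close>)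
    then have 1: "((\<lambda>t. F (proj n (\<gamma> t))) has_vector_derivative G x (proj n u)) (at 0)" using g xRn by simp
    have "((\<lambda>t. tail n (\<gamma> t)) has_vector_derivative tail n (D 0)) (at 0)"
      by (rule bounded_linear.has_vector_derivative[OF bounded_linear_tail g(3)]) (use g(1) in simp)
    then have "((\<lambda>t. F (proj n (\<gamma> t))) has_vector_derivative tail n u) (at 0)"
      unfolding g(6) by (rule has_vector_derivative_transform_within_open[of _ _ _ ?I]) (use on g(1) in auto)
    with 1 have "G x (proj n u) = tail n u" by (rule vector_derivative_unique_at)
    then have "u = pair n (proj n u) (G x (proj n u))" by simp
    then show "u \<in> (\<lambda>v. pair n v (G x v)) ` tangent_space M x"
      using graph_tangent_proj[OF M u xM] by blast
  qed
qed

lemma Cq_on_open_bounded_linear: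
  assumes "bounded_linear b" "Cq_on_open q n U F"
  shows "Cq_on_open q n U (\<lambda>x. b (F x))"
  using assms unfolding Cq_on_open_def
  by (auto split: smoothness.splits simp del: Ck_on.simps
      intro: Ck_on_bounded_linear analytic_map_on_bounded_linear)

lemma Cq_on_C11:
  assumes q: "at_least_C2 q" and f: "Cq_on q n M f" "f ` M \<subseteq> Rn m" and x: "x \<in> M"
  obtains r F G K where "r > 0" "C11 (ball x r \<inter> Rn n) F G K" "\<And>y. y \<in> M \<inter> (ball x r \<inter> Rn n) \<Longrightarrow> F y = f y"
proof -
  obtain U F where U: "x \<in> U" "Cq_on_open q n U F" "\<And>y. y \<in> M \<inter> U \<Longrightarrow> F y = f y"
  proof -
    have "\<exists>U F. x \<in> U \<and> Cq_on_open q n U F \<and> (\<forall>y\<in>M \<inter> U. F y = f y)"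
      using f(1) x unfolding Cq_on_def by (rule bspec)
    then show ?thesis using that by auto
  qed
  have C: "Cq_on_open q n U (\<lambda>x. proj m (F x))" by (rule Cq_on_open_bounded_linear[OF bounded_linear_proj U(2)])
  obtain r G K where r: "r > 0" "ball x r \<inter> Rn n \<subseteq> U" "C11 (ball x r \<inter> Rn n) (\<lambda>x. proj m (F x)) G K"
    using Cq_on_open_C11[OF q C, of m x] U(1) by (metis (no_types, lifting) image_subsetI proj_in_Rn)
  show ?thesis
  proof (rule that[OF r(1,3)])
    fix y assume y: "y \<in> M \<inter> (ball x r \<inter> Rn n)"
    then have "F y = f y" using r(2) U(3) by blast
    then show "proj m (F y) = f y" using y f(2) by (simp add: image_subset_iff proj_Rn)
  qed
qed

lemma Cq_on_subset: "Cq_on q n M f \<Longrightarrow> N \<subseteq> M \<Longrightarrow> Cq_on q n N f"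
  unfolding Cq_on_def by (meson Int_mono order_refl subsetD)

lemma linear_pair_graph: "linear L \<Longrightarrow> linear (\<lambda>v. pair n v (L v))"
  by (rule linearI) (simp_all add: linear_add linear_scale pair_add pair_scale)

lemma subspace_graph_tangent:
  assumes q: "at_least_C2 q" and M: "submanifold q n M" and f: "Cq_on q n M f" "f ` M \<subseteq> Rn m"
    and z: "z \<in> graph_on n M f"
  shows "subspace (tangent_space (graph_on n M f) z)"
proof -
  obtain x where x: "x \<in> M" "z = pair n x (f x)" using z by (auto simp: graph_on_def)
  have MR: "M \<subseteq> Rn n" using M by (auto simp: submanifold_def submanifold_dim_def)
  obtain r F G K where r: "r > 0" "C11 (ball x r \<inter> Rn n) F G K" "\<And>y. y \<in> M \<inter> (ball x r \<inter> Rn n) \<Longrightarrow> F y = f y"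
    using Cq_on_C11[OF q f x(1)] by metis
  have "tangent_space (graph_on n M f) z = (\<lambda>v. pair n v (G x v)) ` tangent_space M x"
    unfolding x(2) by (rule graph_tangent[OF MR r(2)]) (use r x MR in auto)
  moreover have "linear (G x)" using C11_derivD(2)[OF r(2), of x] r(1) x MR by (auto intro: bounded_linear.linear)
  ultimately show ?thesis
    using linear_subspace_image[OF linear_pair_graph subspace_tangent_space[OF q M x(1)]] by simp
qed

lemma graph_disjoint:
  assumes "A \<subseteq> Rn n" "B \<subseteq> Rn n" "A \<inter> B = {}"
  shows "graph_on n A f \<inter> graph_on n B f = {}"
  using assms by (auto simp: graph_on_def pair_eq_iff subset_iff)

lemma graph_verdier_iff:
  assumes q: "at_least_C2 q" and i: "incident_pair q n \<Lambda> \<Gamma>"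
    and f: "Cq_on q n \<Lambda> f" "Cq_on q n \<Gamma> f" "f ` (\<Lambda> \<union> \<Gamma>) \<subseteq> Rn m" and z: "z \<in> graph_on n \<Gamma> f"
  shows "verdier (n + m) (graph_on n \<Lambda> f) (graph_on n \<Gamma> f) z \<longleftrightarrow>
    verdier_vb (graph_on n \<Lambda> f) (graph_on n \<Gamma> f) z"
proof -
  note d = incident_pairD[OF i]
  have m: "f ` \<Lambda> \<subseteq> Rn m" "f ` \<Gamma> \<subseteq> Rn m" using f(3) by auto
  show ?thesis
    by (intro verdier_iff_vb graph_on_subset_Rn graph_disjoint z m d(3-5)
      subspace_graph_tangent[OF q d(1) f(1) m(1)] subspace_graph_tangent[OF q d(2) f(2) m(2)])
qed

section \<open>Projection and lifting\<close>

text \<open>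
  If no constant worked near \<open>a\<close>, choosing violations with constants \<open>1, 2, 3, ...\<close> would give
  sequences with an infinite upper limit of the quotients.
\<close>

lemma weakly_lipschitz_bound:
  assumes wl: "weakly_lipschitz q n m A X f" and X: "\<Lambda> \<in> X" "\<Gamma> \<in> X" "in_frontier \<Gamma> \<Lambda>" and a: "a \<in> \<Gamma>"
  obtains \<delta> L where "\<delta> > 0" "L > 0"
    "\<And>x y. x \<in> \<Gamma> \<Longrightarrow> y \<in> \<Lambda> \<Longrightarrow> dist x a < \<delta> \<Longrightarrow> dist y a < \<delta> \<Longrightarrow> norm (f x - f y) \<le> L * norm (x - y)"
proof -
  have "\<exists>\<delta>>0. \<exists>L>0. \<forall>x\<in>\<Gamma>. \<forall>y\<in>\<Lambda>. dist x a < \<delta> \<longrightarrow> dist y a < \<delta> \<longrightarrow> norm (f x - f y) \<le> L * norm (x - y)"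
  proof (rule ccontr)
  assume neg: "\<not> ?thesis"
  have no: "\<exists>x y. x \<in> \<Gamma> \<and> y \<in> \<Lambda> \<and> dist x a < \<delta> \<and> dist y a < \<delta> \<and> L * norm (x - y) < norm (f x - f y)"
    if "\<delta> > 0" "L > 0" for \<delta> L
  proof (rule ccontr)
    assume "\<not> ?thesis"
    then have "\<forall>x\<in>\<Gamma>. \<forall>y\<in>\<Lambda>. dist x a < \<delta> \<longrightarrow> dist y a < \<delta> \<longrightarrow> norm (f x - f y) \<le> L * norm (x - y)"
      by (meson not_le)
    with neg that show False by blast
  qed
  have "\<exists>x y. x \<in> \<Gamma> \<and> y \<in> \<Lambda> \<and> dist x a < 1 / real (Suc k) \<and> dist y a < 1 / real (Suc k) \<and>
      real (Suc k) * norm (x - y) < norm (f x - f y)" for k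
    by (rule no) auto
  then obtain u w where uw: "\<And>k. u k \<in> \<Gamma> \<and> w k \<in> \<Lambda> \<and> dist (u k) a < 1 / real (Suc k) \<and> dist (w k) a < 1 / real (Suc k) \<and>
      real (Suc k) * norm (u k - w k) < norm (f (u k) - f (w k))" by metis
  have lim: "z \<longlonglongrightarrow> a" if "\<And>k. dist (z k) a < 1 / real (Suc k)" for z
    by (rule metric_tendsto_imp_tendsto[OF LIMSEQ_inverse_real_of_nat])
       (use that in \<open>auto intro!: always_eventually simp: inverse_eq_divide less_imp_le\<close>)
  let ?q = "\<lambda>k. ereal (norm (f (u k) - f (w k)) / norm (u k - w k))"
  have "\<forall>\<Lambda>\<in>X. \<forall>\<Gamma>\<in>X. in_frontier \<Gamma> \<Lambda> \<longrightarrow>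
        (\<forall>a\<in>\<Gamma>. \<forall>u w. (\<forall>\<nu>. u \<nu> \<in> \<Gamma>) \<and> (\<forall>\<nu>. w \<nu> \<in> \<Lambda>) \<and> u \<longlonglongrightarrow> a \<and> w \<longlonglongrightarrow> a \<longrightarrow>
           limsup (\<lambda>\<nu>. ereal (norm (f (u \<nu>) - f (w \<nu>)) / norm (u \<nu> - w \<nu>))) < \<infinity>)"
    using wl unfolding weakly_lipschitz_def by (elim conjE)
  note this[rule_format, OF X a, of u w]
  then have "limsup ?q < \<infinity>" using uw lim[of u] lim[of w] by auto
  moreover have "?q \<longlonglongrightarrow> \<infinity>"
  proof (rule Lim_PInfty[THEN iffD2], intro allI)
    fix r :: real
    obtain N where N: "r < real N" using reals_Archimedean2 by blast
    show "\<exists>N. \<forall>k\<ge>N. ereal r \<le> ?q k"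
    proof (intro exI[of _ N] allI impI)
      fix k assume k: "N \<le> k"
      have "u k \<noteq> w k" using uw[of k] X(3) by auto
      then have "real (Suc k) < norm (f (u k) - f (w k)) / norm (u k - w k)"
        using uw[of k] by (simp add: pos_less_divide_eq)
      then show "ereal r \<le> ?q k" using N k by simp
    qed
  qed
  then have "limsup ?q = \<infinity>" by (intro lim_imp_Limsup) auto
  ultimately show False by simp
  qed
  then show ?thesis using that by blast
qed

lemma verdier_vbE:
  assumes "verdier_vb \<Lambda> \<Gamma> x\<^sub>0"
  obtains \<delta> C where "\<delta> > 0" "C > 0" "\<And>x y. x \<in> \<Gamma> \<Longrightarrow> y \<in> \<Lambda> \<Longrightarrow> dist x x\<^sub>0 < \<delta> \<Longrightarrow> dist y x\<^sub>0 < \<delta> \<Longrightarrow>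
     vbound (tangent_space \<Gamma> x) (tangent_space \<Lambda> y) (C * norm (x - y))"
  using assms unfolding verdier_vb_def by blast

lemma verdier_vbI:
  assumes "\<delta> > 0" "C > 0" "\<And>x y. x \<in> \<Gamma> \<Longrightarrow> y \<in> \<Lambda> \<Longrightarrow> dist x x\<^sub>0 < \<delta> \<Longrightarrow> dist y x\<^sub>0 < \<delta> \<Longrightarrow>
     vbound (tangent_space \<Gamma> x) (tangent_space \<Lambda> y) (C * norm (x - y))"
  shows "verdier_vb \<Lambda> \<Gamma> x\<^sub>0"
  using assms unfolding verdier_vb_def by blast

lemma norm_proj_diff: "norm (proj n a - proj n b) \<le> norm (a - b)"
  using norm_proj_le[of n "a - b"] linear_diff[OF linear_proj, of n a b] by simp

lemma norm_tail_le: "norm (tail n a) \<le> norm a"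
  using norm_pair_bounds(2)[of "proj n a" n "tail n a"] by simp

lemma tail_diff: "tail n (a - b) = tail n a - tail n b"
  by (rule rvec_eqI) simp

text \<open>
  Lift a tangent vector of \<open>\<Gamma>\<close> to the graph by the derivative of \<open>f\<close> on \<open>\<Gamma>\<close>, which is bounded near
  \<open>x\<^sub>0\<close>, approximate it in the graph over \<open>\<Lambda>\<close> and project. By \<open>lip\<close> the points of the graph
  are as close to each other as their projections, up to a constant.
\<close>

lemma verdier_vb_project:
  assumes \<Gamma>: "\<Gamma> \<subseteq> Rn n" and \<Lambda>: "\<Lambda> \<subseteq> Rn n" and x0: "x\<^sub>0 \<in> \<Gamma>"
    and r: "r > 0" and F: "C11 (ball x\<^sub>0 r \<inter> Rn n) F G K" and Ff: "\<And>y. y \<in> \<Gamma> \<inter> ball x\<^sub>0 r \<Longrightarrow> F y = f y"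
    and \<delta>1: "\<delta>1 > 0" and L: "L > 0" and lip: "\<And>x y. x \<in> \<Gamma> \<Longrightarrow> y \<in> \<Lambda> \<Longrightarrow> dist x x\<^sub>0 < \<delta>1 \<Longrightarrow> dist y x\<^sub>0 < \<delta>1 \<Longrightarrow> norm (f x - f y) \<le> L * norm (x - y)"
    and vb: "verdier_vb (graph_on n \<Lambda> f) (graph_on n \<Gamma> f) (pair n x\<^sub>0 (f x\<^sub>0))"
  shows "verdier_vb \<Lambda> \<Gamma> x\<^sub>0"
proof -
  obtain \<delta>2 C where \<delta>2: "\<delta>2 > 0" and C: "C > 0" and vb: "\<And>x y. x \<in> graph_on n \<Gamma> f \<Longrightarrow> y \<in> graph_on n \<Lambda> f \<Longrightarrow>
     dist x (pair n x\<^sub>0 (f x\<^sub>0)) < \<delta>2 \<Longrightarrow> dist y (pair n x\<^sub>0 (f x\<^sub>0)) < \<delta>2 \<Longrightarrow>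
     vbound (tangent_space (graph_on n \<Gamma> f) x) (tangent_space (graph_on n \<Lambda> f) y) (C * norm (x - y))"
    by (rule verdier_vbE[OF vb]) (rule that)
  have K: "K > 0" using F by (simp add: C11_def)
  have x0R: "x\<^sub>0 \<in> Rn n" using x0 \<Gamma> by blast
  define \<delta> where "\<delta> = min (min r \<delta>1) (\<delta>2 / (1 + L + K))"
  have \<delta>: "\<delta> > 0" using r \<delta>1 \<delta>2 L K by (simp add: \<delta>_def)
  have pd: "dist (pair n z (f z)) (pair n y (f y)) \<le> norm (z - y) + norm (f z - f y)" if "z \<in> Rn n" "y \<in> Rn n" for z y
    using norm_pair_bounds(3)[of "z - y" n "f z - f y"] that by (auto simp: dist_norm pair_diff intro: Rn_diff)
  have small: "dist (pair n z (f z)) (pair n x\<^sub>0 (f x\<^sub>0)) < \<delta>2"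
    if z: "z \<in> Rn n" "dist z x\<^sub>0 < \<delta>" "norm (f z - f x\<^sub>0) \<le> (L + K) * norm (z - x\<^sub>0)" for z
  proof -
    have ne: "1 + L + K \<noteq> 0" using L K by linarith
    have "dist (pair n z (f z)) (pair n x\<^sub>0 (f x\<^sub>0)) \<le> (1 + L + K) * norm (z - x\<^sub>0)"
      using pd[OF z(1) x0R] z(3) by (simp add: algebra_simps)
    also have "\<dots> < (1 + L + K) * \<delta>" using z(2) L K by (intro mult_strict_left_mono) (auto simp: dist_norm)
    also have "\<dots> \<le> (1 + L + K) * (\<delta>2 / (1 + L + K))" using L K by (intro mult_left_mono) (auto simp: \<delta>_def)
    also have "\<dots> = \<delta>2" using ne by simp
    finally show ?thesis .
  qed
  show ?thesis
  proof (rule verdier_vbI[OF \<delta>, of "C * (1 + L) * (1 + K)"])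
    show "C * (1 + L) * (1 + K) > 0" using C L K by simp
    fix x y assume x: "x \<in> \<Gamma>" "dist x x\<^sub>0 < \<delta>" and y: "y \<in> \<Lambda>" "dist y x\<^sub>0 < \<delta>"
    have xR: "x \<in> ball x\<^sub>0 r \<inter> Rn n" and yR: "y \<in> Rn n" using x y \<Gamma> \<Lambda> by (auto simp: \<delta>_def dist_commute)
    have fx: "norm (f x - f x\<^sub>0) \<le> K * norm (x - x\<^sub>0)"
      using C11_lipschitz[OF F convex_ball_Rn xR, of x\<^sub>0] Ff[of x] Ff[of x\<^sub>0] x x0 x0R r xR by auto
    have fy: "norm (f y - f x\<^sub>0) \<le> L * norm (y - x\<^sub>0)"
      using lip[of x\<^sub>0 y] x0 y \<delta>1 by (auto simp: \<delta>_def norm_minus_commute)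
    have d: "dist (pair n x (f x)) (pair n x\<^sub>0 (f x\<^sub>0)) < \<delta>2" "dist (pair n y (f y)) (pair n x\<^sub>0 (f x\<^sub>0)) < \<delta>2"
      using x y xR yR K L fx fy
      by (auto intro!: small elim!: order_trans simp: mult_right_mono)
    have vb': "vbound (tangent_space (graph_on n \<Gamma> f) (pair n x (f x))) (tangent_space (graph_on n \<Lambda> f) (pair n y (f y)))
        (C * norm (pair n x (f x) - pair n y (f y)))"
      by (intro vb graph_onI x y d)
    have nxy: "norm (pair n x (f x) - pair n y (f y)) \<le> (1 + L) * norm (x - y)"
      using pd[of x y] lip[of x y] x y xR yR by (auto simp: dist_norm \<delta>_def algebra_simps)
    show "vbound (tangent_space \<Gamma> x) (tangent_space \<Lambda> y) (C * (1 + L) * (1 + K) * norm (x - y))"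
    proof (rule vboundI)
      fix v assume v: "v \<in> tangent_space \<Gamma> x"
      then have vR: "v \<in> Rn n" using tangent_space_subset_Rn[OF \<Gamma> x(1)] by blast
      have "pair n v (G x v) \<in> tangent_space (graph_on n \<Gamma> f) (pair n x (f x))"
        using graph_tangent[OF \<Gamma> F Ff, of x] x xR v by auto
      with vb' obtain u where u: "u \<in> tangent_space (graph_on n \<Lambda> f) (pair n y (f y))"
        "norm (pair n v (G x v) - u) \<le> C * norm (pair n x (f x) - pair n y (f y)) * norm (pair n v (G x v))"
        by (rule vboundE)
      have "norm (v - proj n u) \<le> norm (pair n v (G x v) - u)"
        using norm_proj_diff[of n "pair n v (G x v)" u] vR by simp
      also have "\<dots> \<le> C * ((1 + L) * norm (x - y)) * ((1 + K) * norm v)"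
      proof (rule order_trans[OF u(2)], intro mult_mono nxy mult_left_mono)
        show "norm (pair n v (G x v)) \<le> (1 + K) * norm v"
          using norm_pair_bounds(3)[OF vR, of "G x v"] C11_derivD(3)[OF F xR, of v] by (simp add: algebra_simps)
      qed (use C L K in auto)
      finally show "\<exists>w\<in>tangent_space \<Lambda> y. norm (v - w) \<le> C * (1 + L) * (1 + K) * norm (x - y) * norm v"
        using graph_tangent_proj[OF \<Lambda> u(1) y(1)] by (intro bexI[of _ "proj n u"]) (auto simp: algebra_simps)
    qed
  qed
qed

text \<open>
  The weak Lipschitz condition is used twice: for \<open>verdier_vb_project\<close>, and to see that the graph over
  \<open>\<Gamma>\<close> lies in the frontier of the graph over \<open>\<Lambda>\<close>, so that the hypothesis applies to this pair.
\<close>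

lemma verdier_projection:
  assumes q: "at_least_C2 q"
  shows "projection_property q verdier"
  unfolding projection_property_def
proof (intro allI impI, elim conjE)
  fix n m A X f
  assume S: "stratification q n A X" and wl: "weakly_lipschitz q n m A X f"
    and QS: "Q_stratification verdier q (n + m) (graph_on n A f) (graph_stratification n X f)"
  show "Q_stratification verdier q n A X" unfolding Q_stratification_def regular_pair_def
  proof (intro conjI S ballI impI)
    fix \<Lambda> \<Gamma> x assume X: "\<Lambda> \<in> X" "\<Gamma> \<in> X" and fr: "in_frontier \<Gamma> \<Lambda>" and x: "x \<in> \<Gamma>"
    have i: "incident_pair q n \<Lambda> \<Gamma>" using S X fr by (auto simp: incident_pair_def stratification_def)
    note d = incident_pairD[OF i]
    have sub: "\<Lambda> \<subseteq> A" "\<Gamma> \<subseteq> A" using S X by (auto simp: stratification_def partition_on_def)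
    have fC: "Cq_on q n \<Lambda> f" "Cq_on q n \<Gamma> f" and fA: "f ` A \<subseteq> Rn m" using wl X by (auto simp: weakly_lipschitz_def)
    have fm: "f ` (\<Lambda> \<union> \<Gamma>) \<subseteq> Rn m" using fA sub by auto
    have Gfr: "in_frontier (graph_on n \<Gamma> f) (graph_on n \<Lambda> f)"
    proof
      fix z assume z: "z \<in> graph_on n \<Gamma> f"
      then obtain a where a: "a \<in> \<Gamma>" "z = pair n a (f a)" by (auto simp: graph_on_def)
      have aR: "a \<in> Rn n" using a d by blast
      obtain \<delta> L where \<delta>: "\<delta> > 0" "L > 0" and lip:
        "\<And>x y. x \<in> \<Gamma> \<Longrightarrow> y \<in> \<Lambda> \<Longrightarrow> dist x a < \<delta> \<Longrightarrow> dist y a < \<delta> \<Longrightarrow> norm (f x - f y) \<le> L * norm (x - y)"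
        by (rule weakly_lipschitz_bound[OF wl X fr a(1)]) (rule that)
      have "z \<in> closure (graph_on n \<Lambda> f)" unfolding closure_approachable
      proof (intro allI impI)
        fix e :: real assume e: "e > 0"
        have ne: "1 + L \<noteq> 0" using \<delta> by linarith
        define e' where "e' = min \<delta> (e / (1 + L))"
        have e': "e' > 0" using e \<delta> by (simp add: e'_def)
        have "a \<in> closure \<Lambda>" using a d by blast
        then obtain y where y: "y \<in> \<Lambda>" "dist y a < e'" using e' by (auto simp: closure_approachable)
        have yR: "y \<in> Rn n" using y d by blast
        have "norm (f a - f y) \<le> L * norm (a - y)" using y \<delta> a by (intro lip) (auto simp: e'_def)
        then have "dist (pair n y (f y)) z \<le> (1 + L) * norm (y - a)"
          using norm_pair_bounds(3)[of "y - a" n "f y - f a"] Rn_diff[OF yR aR]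
          by (simp add: a dist_norm pair_diff norm_minus_commute algebra_simps)
        also have "\<dots> < (1 + L) * e'" using y \<delta> by (intro mult_strict_left_mono) (auto simp: dist_norm)
        also have "\<dots> \<le> (1 + L) * (e / (1 + L))" using \<delta> by (intro mult_left_mono) (auto simp: e'_def)
        also have "\<dots> = e" using ne by simp
        finally show "\<exists>y\<in>graph_on n \<Lambda> f. dist y z < e" using graph_onI[OF y(1), of n f] by blast
      qed
      then show "z \<in> closure (graph_on n \<Lambda> f) - graph_on n \<Lambda> f"
        using graph_disjoint[OF d(4,3,5), of f] z by blast
    qed
    have zG: "pair n x (f x) \<in> graph_on n \<Gamma> f" by (rule graph_onI[OF x])
    have "verdier (n + m) (graph_on n \<Lambda> f) (graph_on n \<Gamma> f) (pair n x (f x))"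
      using QS X Gfr zG unfolding Q_stratification_def graph_stratification_def regular_pair_def by blast
    then have vb: "verdier_vb (graph_on n \<Lambda> f) (graph_on n \<Gamma> f) (pair n x (f x))"
      using graph_verdier_iff[OF q i fC fm zG] by blast
    obtain r F G K where r: "r > 0" "C11 (ball x r \<inter> Rn n) F G K" "\<And>y. y \<in> \<Gamma> \<inter> (ball x r \<inter> Rn n) \<Longrightarrow> F y = f y"
      using Cq_on_C11[OF q fC(2) _ x, of m] fm by (metis image_Un le_sup_iff)
    obtain \<delta> L where lip: "\<delta> > 0" "L > 0"
        "\<And>z y. z \<in> \<Gamma> \<Longrightarrow> y \<in> \<Lambda> \<Longrightarrow> dist z x < \<delta> \<Longrightarrow> dist y x < \<delta> \<Longrightarrow> norm (f z - f y) \<le> L * norm (z - y)"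
      by (rule weakly_lipschitz_bound[OF wl X fr x]) (rule that)
    have "verdier_vb \<Lambda> \<Gamma> x"
      by (rule verdier_vb_project[OF d(4,3) x r(1,2) _ lip vb]) (use r(3) d in auto)
    then show "verdier n \<Lambda> \<Gamma> x" using incident_verdier_iff[OF q i x] by blast
  qed
qed

text \<open>Along a Lipschitz function the vertical part of a tangent vector of the graph is bounded by the horizontal one.\<close>

lemma graph_tangent_tail_le:
  assumes A: "A \<subseteq> Rn n" and T: "open T" "x \<in> T" and L: "0 \<le> L"
    and lip: "\<And>a b. a \<in> A \<inter> T \<Longrightarrow> b \<in> A \<inter> T \<Longrightarrow> norm (f a - f b) \<le> L * norm (a - b)"
    and x: "x \<in> A" and u: "u \<in> tangent_space (graph_on n A f) (pair n x (f x))"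
  shows "norm (tail n u) \<le> L * norm (proj n u)"
proof -
  have op: "open (proj n -` T)" using T(1) by (intro open_vimage) (auto intro!: continuous_intros)
  have inT: "pair n x (f x) \<in> proj n -` T" using x A T by auto
  obtain \<gamma> D \<epsilon> where g: "0 < \<epsilon>" "\<gamma> 0 = pair n x (f x)"
      "\<And>t. t \<in> {-\<epsilon><..<\<epsilon>} \<Longrightarrow> (\<gamma> has_vector_derivative D t) (at t)"
      "continuous_on {-\<epsilon><..<\<epsilon>} D" "\<gamma> ` {-\<epsilon><..<\<epsilon>} \<subseteq> graph_on n A f \<inter> proj n -` T" "D 0 = u"
    by (rule tangent_spaceE[OF u op inT]) (rule that)
  have d: "((\<lambda>h. (\<gamma> h - \<gamma> 0) /\<^sub>R h) \<longlongrightarrow> u) (at 0)"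
  proof -
    have "(\<gamma> has_derivative (\<lambda>h. h *\<^sub>R u)) (at 0)"
      using g(3)[of 0] g(1,6) by (simp add: has_vector_derivative_def)
    then have "((\<lambda>h. norm (\<gamma> h - \<gamma> 0 - (h - 0) *\<^sub>R u) / norm (h - 0)) \<longlongrightarrow> 0) (at 0)"
      unfolding has_derivative_iff_norm by blast
    then have "((\<lambda>h. (\<gamma> h - \<gamma> 0) /\<^sub>R h - u) \<longlongrightarrow> 0) (at 0)"
    proof (rule Lim_null_comparison[rotated])
      have "norm ((\<gamma> h - \<gamma> 0) /\<^sub>R h - u) \<le> norm (\<gamma> h - \<gamma> 0 - (h - 0) *\<^sub>R u) / norm (h - 0)" if "h \<noteq> 0" for h
      proof -
        have "(\<gamma> h - \<gamma> 0) /\<^sub>R h - u = (\<gamma> h - \<gamma> 0 - (h - 0) *\<^sub>R u) /\<^sub>R h"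
          using that by (simp add: scaleR_diff_right)
        then show ?thesis by (simp add: divide_inverse mult.commute)
      qed
      then show "\<forall>\<^sub>F h in at 0. norm ((\<gamma> h - \<gamma> 0) /\<^sub>R h - u) \<le> norm (\<gamma> h - \<gamma> 0 - (h - 0) *\<^sub>R u) / norm (h - 0)"
        by (simp add: eventually_at_filter)
    qed
    then show ?thesis by (simp only: LIM_zero_iff)
  qed
  show ?thesis
  proof (rule tendsto_le[of "at (0::real)"])
    show "((\<lambda>h. norm (tail n ((\<gamma> h - \<gamma> 0) /\<^sub>R h))) \<longlongrightarrow> norm (tail n u)) (at 0)"
      by (intro tendsto_norm bounded_linear.tendsto[OF bounded_linear_tail] d)
    show "((\<lambda>h. L * norm (proj n ((\<gamma> h - \<gamma> 0) /\<^sub>R h))) \<longlongrightarrow> L * norm (proj n u)) (at 0)"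
      by (intro tendsto_mult tendsto_const tendsto_norm bounded_linear.tendsto[OF bounded_linear_proj] d)
    have on: "proj n (\<gamma> t) \<in> A \<inter> T \<and> tail n (\<gamma> t) = f (proj n (\<gamma> t))" if "t \<in> {-\<epsilon><..<\<epsilon>}" for t
    proof -
      have "\<gamma> t \<in> graph_on n A f \<inter> proj n -` T" using g(5) that by blast
      then obtain z where z: "z \<in> A" "\<gamma> t = pair n z (f z)" "proj n (\<gamma> t) \<in> T" by (auto simp: graph_on_def)
      then have "proj n (\<gamma> t) = z" using A by auto
      then show ?thesis using z by simp
    qed
    have "norm (tail n ((\<gamma> h - \<gamma> 0) /\<^sub>R h)) \<le> L * norm (proj n ((\<gamma> h - \<gamma> 0) /\<^sub>R h))" if h0: "\<bar>h\<bar> < \<epsilon>" for h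
    proof -
      have h: "h \<in> {-\<epsilon><..<\<epsilon>}" using h0 by auto
      have "norm (tail n (\<gamma> h - \<gamma> 0)) \<le> L * norm (proj n (\<gamma> h) - proj n (\<gamma> 0))"
        using on[OF h] on[of 0] g(1) lip[of "proj n (\<gamma> h)" "proj n (\<gamma> 0)"] by (simp add: tail_diff)
      then have "norm (tail n (\<gamma> h - \<gamma> 0)) / \<bar>h\<bar> \<le> L * norm (proj n (\<gamma> h - \<gamma> 0)) / \<bar>h\<bar>"
        by (intro divide_right_mono) (auto simp: linear_diff[OF linear_proj])
      then show ?thesis
        by (simp add: linear_scale[OF linear_proj] linear_scale[OF bounded_linear.linear[OF bounded_linear_tail]] divide_inverse mult_ac)
    qed
    then show "\<forall>\<^sub>F h in at 0. norm (tail n ((\<gamma> h - \<gamma> 0) /\<^sub>R h)) \<le> L * norm (proj n ((\<gamma> h - \<gamma> 0) /\<^sub>R h))"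
      using g(1) unfolding eventually_at by (intro exI[of _ \<epsilon>]) auto
  qed auto
qed

lemma dist_proj_graph: "x \<in> Rn n \<Longrightarrow> y \<in> Rn n \<Longrightarrow> norm (x - y) \<le> norm (pair n x a - pair n y b)"
  using norm_proj_diff[of n "pair n x a" "pair n y b"] by simp

text \<open>
  Near \<open>x\<^sub>0\<close> both graphs are images under the \<open>C11\<close> map \<open>x \<mapsto> (x, F x)\<close>.
\<close>

lemma verdier_vb_lift_same:
  assumes MR: "M \<subseteq> Rn n" and NR: "N \<subseteq> Rn n" and x0: "x\<^sub>0 \<in> N"
    and r: "r > 0" and F: "C11 (ball x\<^sub>0 r \<inter> Rn n) F G K" and Ff: "\<And>y. y \<in> (M \<union> N) \<inter> ball x\<^sub>0 r \<Longrightarrow> F y = f y"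
    and vb: "verdier_vb M N x\<^sub>0"
  shows "verdier_vb (graph_on n M f) (graph_on n N f) (pair n x\<^sub>0 (f x\<^sub>0))"
proof -
  obtain \<delta> C where \<delta>: "\<delta> > 0" and C: "C > 0" and vb: "\<And>x y. x \<in> N \<Longrightarrow> y \<in> M \<Longrightarrow> dist x x\<^sub>0 < \<delta> \<Longrightarrow> dist y x\<^sub>0 < \<delta> \<Longrightarrow>
     vbound (tangent_space N x) (tangent_space M y) (C * norm (x - y))"
    by (rule verdier_vbE[OF vb]) (rule that)
  have K: "K > 0" using F by (simp add: C11_def)
  have x0R: "x\<^sub>0 \<in> Rn n" using x0 NR by blast
  show ?thesis
  proof (rule verdier_vbI[of "min \<delta> r" "C + K + K * C"])
    show "min \<delta> r > 0" "C + K + K * C > 0" using \<delta> r C K by (auto intro: add_pos_pos)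
    fix X Y assume X: "X \<in> graph_on n N f" "dist X (pair n x\<^sub>0 (f x\<^sub>0)) < min \<delta> r"
      and Y: "Y \<in> graph_on n M f" "dist Y (pair n x\<^sub>0 (f x\<^sub>0)) < min \<delta> r"
    obtain x where x: "x \<in> N" "X = pair n x (f x)" using X by (auto simp: graph_on_def)
    obtain y where y: "y \<in> M" "Y = pair n y (f y)" using Y by (auto simp: graph_on_def)
    have xR: "x \<in> Rn n" and yR: "y \<in> Rn n" using x y MR NR by auto
    have dx: "dist x x\<^sub>0 < min \<delta> r" "dist y x\<^sub>0 < min \<delta> r"
      using dist_proj_graph[OF xR x0R, of "f x" "f x\<^sub>0"] dist_proj_graph[OF yR x0R, of "f y" "f x\<^sub>0"] X(2) Y(2)
      by (auto simp: dist_norm x y)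
    have xb: "x \<in> ball x\<^sub>0 r \<inter> Rn n" "y \<in> ball x\<^sub>0 r \<inter> Rn n" using dx xR yR by (auto simp: dist_commute)
    have vb': "vbound (tangent_space N x) (tangent_space M y) (C * norm (x - y))"
      using dx by (intro vb x(1) y(1)) auto
    have tN: "tangent_space (graph_on n N f) X = (\<lambda>v. pair n v (G x v)) ` tangent_space N x"
      unfolding x(2) by (rule graph_tangent[OF NR F]) (use Ff x xb in auto)
    have tM: "tangent_space (graph_on n M f) Y = (\<lambda>v. pair n v (G y v)) ` tangent_space M y"
      unfolding y(2) by (rule graph_tangent[OF MR F]) (use Ff y xb in auto)
    show "vbound (tangent_space (graph_on n N f) X) (tangent_space (graph_on n M f) Y) ((C + K + K * C) * norm (X - Y))"
    proof (rule vboundI)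
      fix u assume "u \<in> tangent_space (graph_on n N f) X"
      then obtain v where v: "v \<in> tangent_space N x" "u = pair n v (G x v)" using tN by auto
      obtain w where w: "w \<in> tangent_space M y" "norm (v - w) \<le> C * norm (x - y) * norm v" by (rule vboundE[OF vb' v(1)])
      have vR: "v \<in> Rn n" "w \<in> Rn n"
        using v w tangent_space_subset_Rn[OF NR x(1)] tangent_space_subset_Rn[OF MR y(1)] by auto
      have "u - pair n w (G y w) = pair n (v - w) (G x v - G y w)" by (simp add: v pair_diff)
      then have "norm (u - pair n w (G y w)) \<le> norm (v - w) + norm (G x v - G y w)"
        using norm_pair_bounds(3)[OF Rn_diff[OF vR]] by simp
      also have "G x v - G y w = (G x v - G y v) + G y (v - w)"
        using linear_diff[OF bounded_linear.linear[OF C11_derivD(2)[OF F xb(2)]]] by simp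
      also have "norm ((G x v - G y v) + G y (v - w)) \<le> K * norm (x - y) * norm v + K * norm (v - w)"
        by (intro norm_triangle_le add_mono C11_derivD(4)[OF F xb] C11_derivD(3)[OF F xb(2)])
      also have "norm (v - w) + (K * norm (x - y) * norm v + K * norm (v - w))
          \<le> C * norm (x - y) * norm v + (K * norm (x - y) * norm v + K * (C * norm (x - y) * norm v))"
        using w(2) K by (intro add_mono mult_left_mono order_refl) auto
      also have "\<dots> = (C + K + K * C) * (norm (x - y) * norm v)" by (simp add: algebra_simps)
      also have "\<dots> \<le> (C + K + K * C) * (norm (X - Y) * norm u)"
        using C K dist_proj_graph[OF xR yR, of "f x" "f y"] norm_pair_bounds(1)[OF vR(1), of "G x v"]
        by (intro mult_left_mono mult_mono) (auto simp: x y v)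
      finally have "norm (u - pair n w (G y w)) \<le> (C + K + K * C) * norm (X - Y) * norm u" by (simp add: mult.assoc)
      then show "\<exists>u'\<in>tangent_space (graph_on n M f) Y. norm (u - u') \<le> (C + K + K * C) * norm (X - Y) * norm u"
        using w(1) tM by blast
    qed
  qed
qed

text \<open>
  Let \<open>u\<close> be tangent to the graph over \<open>N\<close>. The condition for the big graphs gives a vector \<open>u'\<close>
  tangent to the graph over \<open>\<Lambda>\<close> and close to \<open>u\<close>, the condition for \<open>(M, N)\<close> a vector \<open>z\<close> tangent to the
  graph over \<open>M\<close> whose horizontal part is close to that of \<open>u\<close>. As \<open>z - u'\<close> is tangent to the graph
  over \<open>\<Lambda>\<close>, on which \<open>f\<close> is Lipschitz, its vertical part is controlled by its horizontal part.
\<close>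

lemma verdier_vb_lift_mixed:
  assumes LR: "\<Lambda> \<subseteq> Rn n" and GR: "\<Gamma> \<subseteq> Rn n" and M: "M \<subseteq> \<Lambda>" and N: "N \<subseteq> \<Gamma>" and x0: "x\<^sub>0 \<in> N"
    and r: "r > 0" and L: "L \<ge> 0" and lip: "\<And>a b. a \<in> \<Lambda> \<inter> ball x\<^sub>0 r \<Longrightarrow> b \<in> \<Lambda> \<inter> ball x\<^sub>0 r \<Longrightarrow> norm (f a - f b) \<le> L * norm (a - b)"
    and sub: "\<And>z. z \<in> graph_on n \<Lambda> f \<Longrightarrow> subspace (tangent_space (graph_on n \<Lambda> f) z)"
    and tM: "\<And>y w. y \<in> M \<Longrightarrow> w \<in> tangent_space M y \<Longrightarrow> \<exists>z\<in>tangent_space (graph_on n M f) (pair n y (f y)). proj n z = w"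
    and vb1: "verdier_vb M N x\<^sub>0"
    and vb2: "verdier_vb (graph_on n \<Lambda> f) (graph_on n \<Gamma> f) (pair n x\<^sub>0 (f x\<^sub>0))"
  shows "verdier_vb (graph_on n M f) (graph_on n N f) (pair n x\<^sub>0 (f x\<^sub>0))"
proof -
  let ?z = "pair n x\<^sub>0 (f x\<^sub>0)"
  have MR: "M \<subseteq> Rn n" and NR: "N \<subseteq> Rn n" using M N LR GR by auto
  obtain \<delta>1 C1 where \<delta>1: "\<delta>1 > 0" and C1: "C1 > 0" and vb1: "\<And>x y. x \<in> N \<Longrightarrow> y \<in> M \<Longrightarrow> dist x x\<^sub>0 < \<delta>1 \<Longrightarrow> dist y x\<^sub>0 < \<delta>1 \<Longrightarrow>
     vbound (tangent_space N x) (tangent_space M y) (C1 * norm (x - y))"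
    by (rule verdier_vbE[OF vb1]) (rule that)
  obtain \<delta>2 C2 where \<delta>2: "\<delta>2 > 0" and C2: "C2 > 0" and vb2: "\<And>x y. x \<in> graph_on n \<Gamma> f \<Longrightarrow> y \<in> graph_on n \<Lambda> f \<Longrightarrow> dist x ?z < \<delta>2 \<Longrightarrow> dist y ?z < \<delta>2 \<Longrightarrow>
     vbound (tangent_space (graph_on n \<Gamma> f) x) (tangent_space (graph_on n \<Lambda> f) y) (C2 * norm (x - y))"
    by (rule verdier_vbE[OF vb2]) (rule that)
  define \<delta> where "\<delta> = min r (min \<delta>1 \<delta>2)"
  have x0R: "x\<^sub>0 \<in> Rn n" using x0 NR by blast
  define D where "D = (1 + L) * (C1 + C2)"
  show ?thesis
  proof (rule verdier_vbI[of \<delta> D])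
    show "\<delta> > 0" "D > 0" using r \<delta>1 \<delta>2 L C1 C2 by (auto simp: \<delta>_def D_def)
    fix X Y assume X: "X \<in> graph_on n N f" "dist X ?z < \<delta>" and Y: "Y \<in> graph_on n M f" "dist Y ?z < \<delta>"
    obtain x where x: "x \<in> N" "X = pair n x (f x)" using X by (auto simp: graph_on_def)
    obtain y where y: "y \<in> M" "Y = pair n y (f y)" using Y by (auto simp: graph_on_def)
    have xR: "x \<in> Rn n" and yR: "y \<in> Rn n" using x y MR NR by auto
    have dx: "dist x x\<^sub>0 < \<delta>" "dist y x\<^sub>0 < \<delta>"
      using dist_proj_graph[OF xR x0R, of "f x" "f x\<^sub>0"] dist_proj_graph[OF yR x0R, of "f y" "f x\<^sub>0"] X(2) Y(2)
      by (auto simp: dist_norm x y)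
    have v1: "vbound (tangent_space N x) (tangent_space M y) (C1 * norm (x - y))"
      using dx by (intro vb1 x(1) y(1)) (auto simp: \<delta>_def)
    have XG: "X \<in> graph_on n \<Gamma> f" and YL: "Y \<in> graph_on n \<Lambda> f"
      using X(1) Y(1) graph_on_mono[OF N, of n f] graph_on_mono[OF M, of n f] by auto
    have v2: "vbound (tangent_space (graph_on n \<Gamma> f) X) (tangent_space (graph_on n \<Lambda> f) Y) (C2 * norm (X - Y))"
      using X(2) Y(2) by (intro vb2 XG YL) (auto simp: \<delta>_def)
    show "vbound (tangent_space (graph_on n N f) X) (tangent_space (graph_on n M f) Y) (D * norm (X - Y))"
    proof (rule vboundI)
      fix u assume u: "u \<in> tangent_space (graph_on n N f) X"
      define v where "v = proj n u"
      have v: "v \<in> tangent_space N x" unfolding v_def by (rule graph_tangent_proj[OF NR _ x(1)]) (use u x in simp)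
      obtain w where w: "w \<in> tangent_space M y" "norm (v - w) \<le> C1 * norm (x - y) * norm v" by (rule vboundE[OF v1 v])
      obtain z where z: "z \<in> tangent_space (graph_on n M f) Y" "proj n z = w" using tM[OF y(1) w(1)] y(2) by blast
      have "u \<in> tangent_space (graph_on n \<Gamma> f) X" using u tangent_space_mono[OF graph_on_mono[OF N]] by blast
      then obtain u' where u': "u' \<in> tangent_space (graph_on n \<Lambda> f) Y" "norm (u - u') \<le> C2 * norm (X - Y) * norm u"
        by (rule vboundE[OF v2])
      have zL: "z \<in> tangent_space (graph_on n \<Lambda> f) Y" using z(1) tangent_space_mono[OF graph_on_mono[OF M]] by blast
      have "u' - z \<in> tangent_space (graph_on n \<Lambda> f) (pair n y (f y))"
        using subspace_diff[OF sub[OF YL] u'(1) zL] y(2) by simp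
      then have t: "norm (tail n (u' - z)) \<le> L * norm (proj n (u' - z))"
        using graph_tangent_tail_le[OF LR open_ball[of x\<^sub>0 r] _ L lip _ , of y "u' - z"] y(1) M dx
        by (auto simp: \<delta>_def dist_commute)
      let ?a = "C1 * norm (X - Y) * norm u" and ?b = "C2 * norm (X - Y) * norm u"
      have vw: "norm (v - w) \<le> ?a"
      proof -
        have "norm (x - y) * norm v \<le> norm (X - Y) * norm u"
          using dist_proj_graph[OF xR yR, of "f x" "f y"] norm_proj_le[of n u]
          by (intro mult_mono) (auto simp: x y v_def)
        then have "C1 * (norm (x - y) * norm v) \<le> C1 * (norm (X - Y) * norm u)" using C1 by (intro mult_left_mono) auto
        then show ?thesis using w(2) by (simp add: mult.assoc)
      qed
      have "proj n (u' - z) = proj n (u' - u) + (v - w)"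
        by (simp add: linear_diff[OF linear_proj] v_def z(2))
      then have "norm (proj n (u' - z)) \<le> norm (u - u') + norm (v - w)"
        using norm_triangle_ineq[of "proj n (u' - u)" "v - w"] norm_proj_le[of n "u' - u"]
        by (simp add: norm_minus_commute)
      then have p: "norm (proj n (u' - z)) \<le> ?b + ?a" using u'(2) vw by linarith
      have "u - z = pair n (v - w) (tail n (u - u') + tail n (u' - z))"
        by (rule rvec_eqI) (auto simp: v_def z(2)[symmetric])
      moreover have "v - w \<in> Rn n" by (auto simp: v_def z(2)[symmetric] intro!: Rn_diff)
      ultimately have "norm (u - z) \<le> norm (v - w) + norm (tail n (u - u') + tail n (u' - z))"
        using norm_pair_bounds(3) by simp
      also have "norm (tail n (u - u') + tail n (u' - z)) \<le> norm (u - u') + L * norm (proj n (u' - z))"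
        by (rule norm_triangle_le[OF add_mono[OF norm_tail_le t]])
      also have "\<dots> \<le> ?b + L * (?b + ?a)" using u'(2) p L by (intro add_mono mult_left_mono) auto
      finally have "norm (u - z) \<le> ?a + (?b + L * (?b + ?a))" using vw by simp
      also have "\<dots> = D * norm (X - Y) * norm u" by (simp add: D_def algebra_simps)
      finally show "\<exists>z\<in>tangent_space (graph_on n M f) Y. norm (u - z) \<le> D * norm (X - Y) * norm u"
        using z(1) by blast
    qed
  qed
qed

text \<open>
  If \<open>M\<close> and \<open>N\<close> lie in the same manifold, \<open>f\<close> extends to a \<open>C11\<close> map near \<open>x\<close>. The combination \<open>M \<subseteq> \<Gamma>\<close>,
  \<open>N \<subseteq> \<Lambda>\<close> cannot occur: \<open>\<Lambda>\<close> is locally closed and \<open>\<Gamma>\<close> lies in its closure, so a neighbourhood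
  of a point of \<open>\<Lambda>\<close> contains no point of \<open>\<Gamma>\<close>, but \<open>N\<close> lies in the closure of \<open>M\<close>.
\<close>

lemma verdier_lifting:
  assumes q: "at_least_C2 q"
  shows "lifting_property q verdier"
  unfolding lifting_property_def regular_pair_def
proof (intro allI impI ballI, elim conjE)
  fix n m \<Lambda> \<Gamma> f M N z
  assume i: "incident_pair q n \<Lambda> \<Gamma>" and fm: "f ` (\<Lambda> \<union> \<Gamma>) \<subseteq> Rn m" and ll: "locally_lipschitz (\<Lambda> \<union> \<Gamma>) f"
    and fC: "Cq_on q n \<Lambda> f" "Cq_on q n \<Gamma> f" and iM: "incident_pair q n M N"
    and M: "M \<subseteq> \<Lambda> \<or> M \<subseteq> \<Gamma>" and N: "N \<subseteq> \<Lambda> \<or> N \<subseteq> \<Gamma>"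
    and w1: "\<forall>x\<in>N. verdier n M N x"
    and w2: "\<forall>x\<in>graph_on n \<Gamma> f. verdier (n + m) (graph_on n \<Lambda> f) (graph_on n \<Gamma> f) x"
    and z: "z \<in> graph_on n N f"
  obtain x where x: "x \<in> N" "z = pair n x (f x)" using z by (auto simp: graph_on_def)
  note d = incident_pairD[OF i] and dM = incident_pairD[OF iM]
  have fCM: "Cq_on q n M f" "Cq_on q n N f" using M N fC Cq_on_subset by blast+
  have fmM: "f ` (M \<union> N) \<subseteq> Rn m" using M N fm by blast
  have fm': "f ` \<Lambda> \<subseteq> Rn m" "f ` \<Gamma> \<subseteq> Rn m" "f ` M \<subseteq> Rn m" using fm fmM by auto
  have vb1: "verdier_vb M N x" using incident_verdier_iff[OF q iM x(1)] w1 x(1) by blast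
  have same: "verdier_vb (graph_on n M f) (graph_on n N f) z"
    if P: "M \<subseteq> P" "N \<subseteq> P" "Cq_on q n P f" "f ` P \<subseteq> Rn m" for P
  proof -
    have "x \<in> P" using x P by blast
    then obtain r F G K where r: "r > 0" "C11 (ball x r \<inter> Rn n) F G K" "\<And>y. y \<in> P \<inter> (ball x r \<inter> Rn n) \<Longrightarrow> F y = f y"
      using Cq_on_C11[OF q P(3,4)] by metis
    show ?thesis unfolding x(2)
      by (rule verdier_vb_lift_same[OF dM(3,4) x(1) r(1,2) _ vb1]) (use r(3) P dM in blast)
  qed
  have "verdier_vb (graph_on n M f) (graph_on n N f) z"
  proof (cases "N \<subseteq> \<Gamma>")
    case NG: True
    show ?thesis
    proof (cases "M \<subseteq> \<Gamma>")
      case True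
      then show ?thesis using same[of \<Gamma>] NG fC fm' by blast
    next
      case False
      then have hML: "M \<subseteq> \<Lambda>" using M by blast
      have "x \<in> \<Lambda> \<union> \<Gamma>" using x NG by blast
      then obtain U L where U: "openin (top_of_set (\<Lambda> \<union> \<Gamma>)) U" "x \<in> U" "L-lipschitz_on U f"
        using ll unfolding locally_lipschitz_def by blast
      then obtain r where r: "r > 0" "ball x r \<inter> (\<Lambda> \<union> \<Gamma>) \<subseteq> U" unfolding openin_contains_ball by blast
      have L: "L \<ge> 0" using U(3) by (rule lipschitz_on_nonneg)
      have lip: "norm (f a - f b) \<le> L * norm (a - b)" if "a \<in> \<Lambda> \<inter> ball x r" "b \<in> \<Lambda> \<inter> ball x r" for a b
      proof -
        have "a \<in> U" "b \<in> U" using that r(2) by auto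
        from lipschitz_onD[OF U(3) this] show ?thesis by (simp add: dist_norm)
      qed
      have tM: "\<exists>z\<in>tangent_space (graph_on n M f) (pair n y (f y)). proj n z = w"
        if y: "y \<in> M" and w: "w \<in> tangent_space M y" for y w
      proof -
        obtain r F G K where r: "r > 0" "C11 (ball y r \<inter> Rn n) F G K" "\<And>z. z \<in> M \<inter> (ball y r \<inter> Rn n) \<Longrightarrow> F z = f z"
          using Cq_on_C11[OF q fCM(1) fm'(3) y] by metis
        have "pair n w (G y w) \<in> tangent_space (graph_on n M f) (pair n y (f y))"
          using graph_tangent[OF dM(3) r(2), of f y] r(1,3) y dM(3) w by auto
        moreover have "w \<in> Rn n" using w tangent_space_subset_Rn[OF dM(3) y] by blast
        ultimately show ?thesis by (intro bexI[of _ "pair n w (G y w)"]) auto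
      qed
      have zG: "pair n x (f x) \<in> graph_on n \<Gamma> f" using x NG by (intro graph_onI) blast
      have vb2: "verdier_vb (graph_on n \<Lambda> f) (graph_on n \<Gamma> f) (pair n x (f x))"
        using graph_verdier_iff[OF q i fC fm zG] w2 zG by blast
      show ?thesis unfolding x(2)
        by (rule verdier_vb_lift_mixed[OF d(3,4) hML NG x(1) r(1) L lip _ tM vb1 vb2])
           (use subspace_graph_tangent[OF q d(1) fC(1) fm'(1)] in blast)+
    qed
  next
    case False
    then have NL: "N \<subseteq> \<Lambda>" using N by blast
    have "M \<subseteq> \<Lambda>"
    proof (rule ccontr)
      assume "\<not> M \<subseteq> \<Lambda>"
      then have MG: "M \<subseteq> \<Gamma>" using M by blast
      have xL: "x \<in> \<Lambda>" using x NL by blast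
      obtain k r s \<phi> \<psi> G H K where c: "chart n k \<Lambda> x r s \<phi> \<psi> G H K"
        by (rule submanifold_chart[OF q d(1) xL]) (rule that)
      have "x \<in> closure M" using x dM(6) by blast
      then obtain y where y: "y \<in> M" "dist y x < r"
        using chart.r[OF c] unfolding closure_approachable by blast
      then have "y \<in> \<Lambda>" using chart.locally_closed[OF c, of y] d(6) MG by (auto simp: dist_commute)
      then show False using y MG d(5) by blast
    qed
    then show ?thesis using same[of \<Lambda>] NL fC fm' by blast
  qed
  then show "verdier (n + m) (graph_on n M f) (graph_on n N f) z"
    using graph_verdier_iff[OF q iM fCM fmM z] by blast
qed

section \<open>First-order definability\<close>

definition vec :: "nat \<Rightarrow> (nat \<Rightarrow> real) \<Rightarrow> rvec" where
  "vec n g = (\<Sum>i<n. g i *\<^sub>R ax i)"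

lemma coord_vec [simp]: "coord (vec n g) i = (if i < n then g i else 0)"
  by (simp add: vec_def if_distrib[of "\<lambda>r. _ * r"] cong: if_cong)

lemma vec_in_Rn [simp]: "vec n g \<in> Rn n"
  by (auto simp: Rn_def)

lemma tail_tail: "tail a (tail b x) = tail (a + b) x"
  by (rule rvec_eqI) (simp add: add.assoc)

context o_minimal_structure
begin

text \<open>
  Definability of predicates, functions and maps in \<open>N\<close> real variables, arguments outside \<open>Rn N\<close> being
  ignored. The rules below read definability off a first-order formula.
\<close>

definition dfn :: "nat \<Rightarrow> (rvec \<Rightarrow> bool) \<Rightarrow> bool" where
  "dfn N P \<longleftrightarrow> {x \<in> Rn N. P x} \<in> D N"

definition dfun :: "nat \<Rightarrow> (rvec \<Rightarrow> real) \<Rightarrow> bool" where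
  "dfun N f \<longleftrightarrow> dfn (Suc N) (\<lambda>z. coord z N = f (proj N z))"

definition dvec :: "nat \<Rightarrow> nat \<Rightarrow> (rvec \<Rightarrow> rvec) \<Rightarrow> bool" where
  "dvec N n v \<longleftrightarrow> (\<forall>x\<in>Rn N. v x \<in> Rn n) \<and> (\<forall>i<n. dfun N (\<lambda>x. coord (v x) i))"

lemma dfn_cong: "(\<And>x. x \<in> Rn N \<Longrightarrow> P x \<longleftrightarrow> Q x) \<Longrightarrow> dfn N P \<longleftrightarrow> dfn N Q"
proof -
  assume "\<And>x. x \<in> Rn N \<Longrightarrow> P x \<longleftrightarrow> Q x"
  then have "{x \<in> Rn N. P x} = {x \<in> Rn N. Q x}" by blast
  then show ?thesis by (simp add: dfn_def)
qed

lemma dfun_cong: "(\<And>x. x \<in> Rn N \<Longrightarrow> f x = g x) \<Longrightarrow> dfun N f \<longleftrightarrow> dfun N g"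
  unfolding dfun_def by (rule dfn_cong) auto

lemma dfn_mem: "A \<in> D N \<Longrightarrow> dfn N (\<lambda>x. x \<in> A)"
  unfolding dfn_def using subset_Rn[of A N] by (simp add: Int_absorb1 Collect_conj_eq)

lemma dfn_set: "dfn N (\<lambda>x. x \<in> A) \<Longrightarrow> A \<subseteq> Rn N \<Longrightarrow> A \<in> D N"
  unfolding dfn_def by (simp add: Int_absorb1 Collect_conj_eq)

lemma dfn_not: "dfn N P \<Longrightarrow> dfn N (\<lambda>x. \<not> P x)"
proof -
  assume "dfn N P"
  then have "Rn N - {x \<in> Rn N. P x} \<in> D N" unfolding dfn_def by (rule compl)
  moreover have "Rn N - {x \<in> Rn N. P x} = {x \<in> Rn N. \<not> P x}" by blast
  ultimately show ?thesis by (simp add: dfn_def)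
qed

lemma dfn_disj: "dfn N P \<Longrightarrow> dfn N Q \<Longrightarrow> dfn N (\<lambda>x. P x \<or> Q x)"
proof -
  assume "dfn N P" "dfn N Q"
  then have "{x \<in> Rn N. P x} \<union> {x \<in> Rn N. Q x} \<in> D N" unfolding dfn_def by (rule Un)
  moreover have "{x \<in> Rn N. P x} \<union> {x \<in> Rn N. Q x} = {x \<in> Rn N. P x \<or> Q x}" by blast
  ultimately show ?thesis by (simp add: dfn_def)
qed

lemma dfn_conj: 
  assumes "dfn N P" "dfn N Q"
  shows "dfn N (\<lambda>x. P x \<and> Q x)"
proof -
  have "dfn N (\<lambda>x. \<not> (\<not> P x \<or> \<not> Q x))" by (intro dfn_not dfn_disj assms)
  then show ?thesis by simp
qed

lemma dfn_eqI: "dfn N P \<Longrightarrow> (\<And>x. x \<in> Rn N \<Longrightarrow> P x \<longleftrightarrow> Q x) \<Longrightarrow> dfn N Q"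
  using dfn_cong[of N P Q] by blast

lemma dfn_imp:
  assumes "dfn N P" "dfn N Q"
  shows "dfn N (\<lambda>x. P x \<longrightarrow> Q x)"
proof -
  have "dfn N (\<lambda>x. \<not> P x \<or> Q x)" by (intro dfn_not dfn_disj assms)
  then show ?thesis by (rule dfn_eqI) blast
qed

lemma dfn_const: "dfn N (\<lambda>x. c)"
proof -
  have F: "dfn N (\<lambda>x. False)" using empty by (simp add: dfn_def)
  show ?thesis using F dfn_not[OF F] by (cases c) auto
qed

lemma dfn_finite_all: "(\<And>i. i < (k::nat) \<Longrightarrow> dfn N (P i)) \<Longrightarrow> dfn N (\<lambda>x. \<forall>i<k. P i x)"
proof (induction k)
  case (Suc k)
  have "dfn N (\<lambda>x. P k x \<and> (\<forall>i<k. P i x))" by (rule dfn_conj) (use Suc in auto)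
  then show ?case by (rule dfn_cong[THEN iffD1, rotated]) (auto simp: less_Suc_eq)
qed (simp add: dfn_const)

lemma proj_iter: "A \<in> D (N + k) \<Longrightarrow> proj N ` A \<in> D N"
proof (induction k arbitrary: A)
  case 0
  then have "proj N ` A = A" using subset_Rn[of A N] proj_Rn by force
  then show ?case using 0 by simp
next
  case (Suc k)
  have "proj (N + k) ` A \<in> D (N + k)" using Suc.prems by (intro projection) simp
  from Suc.IH[OF this] show ?case by (simp add: image_image)
qed

lemma dfn_ex_vec:
  assumes "dfn (N + k) (\<lambda>z. Q (proj N z) (tail N z))"
  shows "dfn N (\<lambda>x. \<exists>y\<in>Rn k. Q x y)"
proof -
  have "proj N ` {z \<in> Rn (N + k). Q (proj N z) (tail N z)} \<in> D N"
    using assms unfolding dfn_def by (rule proj_iter)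
  moreover have "proj N ` {z \<in> Rn (N + k). Q (proj N z) (tail N z)} = {x \<in> Rn N. \<exists>y\<in>Rn k. Q x y}"
  proof (intro equalityI subsetI)
    fix x assume "x \<in> {x \<in> Rn N. \<exists>y\<in>Rn k. Q x y}"
    then obtain y where xy: "x \<in> Rn N" "y \<in> Rn k" "Q x y" by blast
    then show "x \<in> proj N ` {z \<in> Rn (N + k). Q (proj N z) (tail N z)}"
      by (intro image_eqI[of _ _ "pair N x y"]) (auto intro!: pair_in_Rn)
  qed (auto intro: tail_in_Rn)
  ultimately show ?thesis by (simp add: dfn_def)
qed

lemma dfn_all_vec:
  assumes "dfn (N + k) (\<lambda>z. Q (proj N z) (tail N z))"
  shows "dfn N (\<lambda>x. \<forall>y\<in>Rn k. Q x y)"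
  using dfn_not[OF dfn_ex_vec[of N k "\<lambda>x y. \<not> Q x y"]] dfn_not[OF assms] by simp

lemma dfn_ex:
  assumes "dfn (Suc N) (\<lambda>z. Q (proj N z) (coord z N))"
  shows "dfn N (\<lambda>x. \<exists>t. Q x t)"
proof -
  have "dfn N (\<lambda>x. \<exists>y\<in>Rn 1. Q x (coord y 0))"
    by (rule dfn_ex_vec) (use assms in simp)
  moreover have "(\<exists>y\<in>Rn 1. Q x (coord y 0)) \<longleftrightarrow> (\<exists>t. Q x t)" for x
  proof
    assume "\<exists>t. Q x t"
    then obtain t where "Q x t" ..
    then show "\<exists>y\<in>Rn 1. Q x (coord y 0)" by (intro bexI[of _ "vec 1 (\<lambda>_. t)"]) auto
  qed blast
  ultimately show ?thesis by simp
qed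

lemma dfn_all:
  assumes "dfn (Suc N) (\<lambda>z. Q (proj N z) (coord z N))"
  shows "dfn N (\<lambda>x. \<forall>t. Q x t)"
  using dfn_not[OF dfn_ex[of N "\<lambda>x t. \<not> Q x t"]] dfn_not[OF assms] by simp

lemma dfn_tail: "dfn k P \<Longrightarrow> dfn (N + k) (\<lambda>z. P (tail N z))"
proof (induction N)
  case 0
  have "tail 0 z = z" for z by (rule rvec_eqI) simp
  then show ?case using 0 by simp
next
  case (Suc N)
  let ?A = "{x \<in> Rn (N + k). P (tail N x)}"
  have "set_prod 1 (Rn 1) ?A \<in> D (1 + (N + k))" using Suc unfolding dfn_def by (intro prod_left) auto
  moreover have "set_prod 1 (Rn 1) ?A = {z \<in> Rn (Suc N + k). P (tail (Suc N) z)}"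
  proof (intro equalityI subsetI)
    fix z assume z: "z \<in> {z \<in> Rn (Suc N + k). P (tail (Suc N) z)}"
    then have "tail 1 z \<in> Rn (N + k)" by (intro tail_in_Rn) simp
    then show "z \<in> set_prod 1 (Rn 1) ?A" using z
      unfolding set_prod_def by (intro CollectI exI[of _ "proj 1 z"] exI[of _ "tail 1 z"]) (auto simp: tail_tail)
  next
    fix z assume "z \<in> set_prod 1 (Rn 1) ?A"
    then obtain x y where xy: "z = pair 1 x y" "x \<in> Rn 1" "y \<in> Rn (N + k)" "P (tail N y)" by (auto simp: set_prod_def)
    have "tail (Suc N) z = tail N (tail 1 z)" by (simp add: tail_tail)
    then have "tail (Suc N) z = tail N y" using xy by simp
    then show "z \<in> {z \<in> Rn (Suc N + k). P (tail (Suc N) z)}" using xy pair_in_Rn[OF xy(3), of 1 x] by simp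
  qed
  ultimately show ?case by (simp add: dfn_def)
qed

lemma dfn_coord_eq: "i < N \<Longrightarrow> j < N \<Longrightarrow> dfn N (\<lambda>z. coord z i = coord z j)"
  using diagonal[of i j N] diagonal[of j i N] dfn_const[of N True]
  by (cases i j rule: linorder_cases) (auto simp: dfn_def eq_commute)

lemma dfn_subst_var:
  assumes P: "dfn n P" and \<sigma>: "\<And>i. i < n \<Longrightarrow> \<sigma> i < N"
  shows "dfn N (\<lambda>x. P (vec n (\<lambda>i. coord x (\<sigma> i))))"
proof -
  have "dfn N (\<lambda>x. \<exists>y\<in>Rn n. P y \<and> (\<forall>i<n. coord y i = coord x (\<sigma> i)))"
  proof (rule dfn_ex_vec, rule dfn_conj[OF dfn_tail[OF P] dfn_finite_all])
    fix i assume i: "i < n"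
    have "dfn (N + n) (\<lambda>z. coord z (i + N) = coord z (\<sigma> i))"
      using \<sigma>[OF i] i by (intro dfn_coord_eq) auto
    then show "dfn (N + n) (\<lambda>z. coord (tail N z) i = coord (proj N z) (\<sigma> i))" using \<sigma>[OF i] by simp
  qed
  moreover have "(\<exists>y\<in>Rn n. P y \<and> (\<forall>i<n. coord y i = coord x (\<sigma> i))) \<longleftrightarrow> P (vec n (\<lambda>i. coord x (\<sigma> i)))" for x
  proof -
    have "y = vec n (\<lambda>i. coord x (\<sigma> i))" if "y \<in> Rn n" "\<forall>i<n. coord y i = coord x (\<sigma> i)" for y
      by (rule Rn_eqI[OF that(1)]) (use that in auto)
    moreover have "\<forall>i<n. coord (vec n (\<lambda>i. coord x (\<sigma> i))) i = coord x (\<sigma> i)" by simp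
    ultimately show ?thesis using vec_in_Rn by blast
  qed
  ultimately show ?thesis by (rule dfn_eqI)
qed

lemma dfun_lift: 
  assumes f: "dfun N f"
  shows "dfun (N + k) (\<lambda>z. f (proj N z))"
proof -
  have "dfn (Suc (N + k)) (\<lambda>z. coord (vec (Suc N) (\<lambda>i. coord z (if i < N then i else N + k))) N =
      f (proj N (vec (Suc N) (\<lambda>i. coord z (if i < N then i else N + k)))))"
    by (rule dfn_subst_var[OF f[unfolded dfun_def]]) auto
  moreover have "proj N (vec (Suc N) (\<lambda>i. coord z (if i < N then i else N + k))) = proj N (proj (N + k) z)" for z
    by (rule rvec_eqI) auto
  ultimately show ?thesis by (simp add: dfun_def)
qed

lemma dfun_lift1: "dfun N f \<Longrightarrow> dfun (Suc N) (\<lambda>z. f (proj N z))"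
  using dfun_lift[of N f 1] by simp

lemma dfn_fun_eq_coord:
  assumes f: "dfun N f" and i: "i < k"
  shows "dfn (N + k) (\<lambda>z. coord z (N + i) = f (proj N z))"
proof -
  have "dfn (N + k) (\<lambda>z. coord (vec (Suc N) (\<lambda>j. coord z (if j < N then j else N + i))) N =
      f (proj N (vec (Suc N) (\<lambda>j. coord z (if j < N then j else N + i)))))"
    by (rule dfn_subst_var[OF f[unfolded dfun_def]]) (use i in auto)
  moreover have "proj N (vec (Suc N) (\<lambda>j. coord z (if j < N then j else N + i))) = proj N z" for z
    by (rule rvec_eqI) auto
  ultimately show ?thesis by simp
qed

text \<open>
  \<open>P (v x)\<close> is \<open>\<exists>y. P y \<and> y = v x\<close>, so it suffices that projections of definable sets are definable.
\<close>

lemma dfn_subst: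
  assumes P: "dfn n P" and v: "dvec N n v"
  shows "dfn N (\<lambda>x. P (v x))"
proof -
  have "dfn N (\<lambda>x. \<exists>y\<in>Rn n. P y \<and> (\<forall>i<n. coord y i = coord (v x) i))"
  proof (rule dfn_ex_vec, rule dfn_conj[OF dfn_tail[OF P] dfn_finite_all])
    fix i assume i: "i < n"
    have "dfun N (\<lambda>x. coord (v x) i)" using v i by (simp add: dvec_def)
    from dfn_fun_eq_coord[OF this i]
    show "dfn (N + n) (\<lambda>z. coord (tail N z) i = coord (v (proj N z)) i)" by (simp add: add.commute)
  qed
  moreover have "(\<exists>y\<in>Rn n. P y \<and> (\<forall>i<n. coord y i = coord (v x) i)) \<longleftrightarrow> P (v x)" if "x \<in> Rn N" for x
  proof -
    have vx: "v x \<in> Rn n" using v that by (simp add: dvec_def)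
    then have "y = v x" if "y \<in> Rn n" "\<forall>i<n. coord y i = coord (v x) i" for y
      by (intro Rn_eqI[OF that(1)]) (use that in auto)
    then show ?thesis using vx by blast
  qed
  ultimately show ?thesis by (rule dfn_eqI)
qed

lemma dfun_coord: "i < N \<Longrightarrow> dfun N (\<lambda>x. coord x i)"
  using dfn_coord_eq[of N "Suc N" i] by (simp add: dfun_def)

lemma dvec_vec: "(\<And>i. i < n \<Longrightarrow> dfun N (f i)) \<Longrightarrow> dvec N n (\<lambda>x. vec n (\<lambda>i. f i x))"
  by (auto simp: dvec_def)

lemma dvec_lift1: "dvec N n v \<Longrightarrow> dvec (Suc N) n (\<lambda>z. v (proj N z))"
  unfolding dvec_def using dfun_lift1[of N "\<lambda>x. coord (v x) i" for i] by auto

lemma dvec_lift: "dvec N n v \<Longrightarrow> dvec (N + k) n (\<lambda>z. v (proj N z))"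
  unfolding dvec_def using dfun_lift[of N "\<lambda>x. coord (v x) i" k for i] by auto

lemma dvec_proj: "k \<le> N \<Longrightarrow> dvec N k (proj k)"
  unfolding dvec_def by (auto intro!: dfun_coord)

lemma dvec_tail: "dvec (N + k) k (tail N)"
  unfolding dvec_def by (auto intro!: dfun_coord tail_in_Rn)

lemma dvec_id: "dvec N N (\<lambda>x. x)"
  unfolding dvec_def by (auto intro!: dfun_coord)

lemma dvec_coord: "dvec N n v \<Longrightarrow> i < n \<Longrightarrow> dfun N (\<lambda>x. coord (v x) i)"
  by (simp add: dvec_def)

lemma dfn_less: "dfun N f \<Longrightarrow> dfun N g \<Longrightarrow> dfn N (\<lambda>x. f x < g x)"
proof -
  assume fg: "dfun N f" "dfun N g"
  have "dfn 2 (\<lambda>x. coord x 0 < coord x 1)" unfolding dfn_def by (rule less)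
  from dfn_subst[OF this dvec_vec[of 2 N "\<lambda>i. if i = 0 then f else g"]] fg
  show ?thesis by simp
qed

lemma dfn_le: "dfun N f \<Longrightarrow> dfun N g \<Longrightarrow> dfn N (\<lambda>x. f x \<le> g x)"
  using dfn_not[OF dfn_less[of N g f]] by (simp add: not_less)

lemma dfn_eq: "dfun N f \<Longrightarrow> dfun N g \<Longrightarrow> dfn N (\<lambda>x. f x = g x)"
  using dfn_conj[OF dfn_le[of N f g] dfn_le[of N g f]] by (simp add: order_eq_iff)

lemma dfun_ternary:
  assumes R: "dfn 3 (\<lambda>x. coord x 2 = op (coord x 0) (coord x 1))" and fg: "dfun N f" "dfun N g"
  shows "dfun N (\<lambda>x. op (f x) (g x))"
proof -
  have "dvec (Suc N) 3 (\<lambda>x. vec 3 (\<lambda>i. (if i = 0 then (\<lambda>z. f (proj N z)) else if i = 1 then (\<lambda>z. g (proj N z)) else (\<lambda>z. coord z N)) x))"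
    by (rule dvec_vec) (use dfun_lift1[OF fg(1)] dfun_lift1[OF fg(2)] dfun_coord[of N "Suc N"] in auto)
  from dfn_subst[OF R this] show ?thesis by (simp add: dfun_def)
qed

lemma dfun_add: "dfun N f \<Longrightarrow> dfun N g \<Longrightarrow> dfun N (\<lambda>x. f x + g x)"
  by (rule dfun_ternary[where op = "(+)"]) (use add in \<open>auto simp: dfn_def eq_commute\<close>)

lemma dfun_mult: "dfun N f \<Longrightarrow> dfun N g \<Longrightarrow> dfun N (\<lambda>x. f x * g x)"
  by (rule dfun_ternary[where op = "(*)"]) (use mult in \<open>auto simp: dfn_def eq_commute\<close>)

lemma dfun_const: "dfun N (\<lambda>x. c)"
proof -
  let ?A = "{x \<in> Rn 1. coord x 0 = c}"
  have "(\<lambda>x. coord x 0) ` ?A = {c}"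
    by (auto intro!: image_eqI[of _ _ "vec 1 (\<lambda>_. c)"])
  then have "?A \<in> D 1" by (subst o_minimal) (auto intro!: exI[of _ "{{c}}"] simp: is_interval_def)
  then have "dfn 1 (\<lambda>x. coord x 0 = c)" by (simp add: dfn_def)
  from dfn_tail[OF this, of N] show ?thesis by (simp add: dfun_def)
qed

lemma dfun_minus: "dfun N f \<Longrightarrow> dfun N (\<lambda>x. - f x)"
  using dfun_mult[OF dfun_const[of N "-1"]] by simp

lemma dfun_diff: "dfun N f \<Longrightarrow> dfun N g \<Longrightarrow> dfun N (\<lambda>x. f x - g x)"
  using dfun_add[OF _ dfun_minus] by simp

lemma dfun_sum: "(\<And>i. i < (k::nat) \<Longrightarrow> dfun N (f i)) \<Longrightarrow> dfun N (\<lambda>x. \<Sum>i<k. f i x)"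
  by (induction k) (auto intro: dfun_add dfun_const)

lemma dfun_norm:
  assumes v: "dvec N n v"
  shows "dfun N (\<lambda>x. norm (v x))"
proof -
  have "dfn (Suc N) (\<lambda>z. 0 \<le> coord z N \<and> coord z N * coord z N = (\<Sum>i<n. coord (v (proj N z)) i * coord (v (proj N z)) i))"
    by (intro dfn_conj dfn_le dfn_eq dfun_const dfun_mult dfun_sum dfun_coord dvec_coord[OF dvec_lift1[OF v]]) auto
  moreover have "(0 \<le> t \<and> t * t = (\<Sum>i<n. coord (v (proj N z)) i * coord (v (proj N z)) i)) \<longleftrightarrow> t = norm (v (proj N z))" for t z
  proof -
    have "v (proj N z) \<in> Rn n" using v by (simp add: dvec_def)
    then have "(\<Sum>i<n. coord (v (proj N z)) i * coord (v (proj N z)) i) = (norm (v (proj N z)))\<^sup>2"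
      by (simp only: norm_power2_Rn) (simp only: power2_eq_square)
    then show ?thesis by (simp add: power2_eq_square[symmetric]) (metis norm_ge_zero power2_eq_imp_eq)
  qed
  ultimately show ?thesis by (simp add: dfun_def)
qed

lemma dvec_add: "dvec N n v \<Longrightarrow> dvec N n w \<Longrightarrow> dvec N n (\<lambda>x. v x + w x)"
  unfolding dvec_def by (auto intro: dfun_add Rn_add)

lemma dvec_diff: "dvec N n v \<Longrightarrow> dvec N n w \<Longrightarrow> dvec N n (\<lambda>x. v x - w x)"
  unfolding dvec_def by (auto intro: dfun_diff Rn_diff)

lemma dvec_scale: "dfun N f \<Longrightarrow> dvec N n w \<Longrightarrow> dvec N n (\<lambda>x. f x *\<^sub>R w x)"
  unfolding dvec_def by (auto intro: dfun_mult Rn_scale)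

lemma dvec_const: "c \<in> Rn n \<Longrightarrow> dvec N n (\<lambda>x. c)"
  unfolding dvec_def by (auto intro: dfun_const)

lemma dvec_pair:
  assumes "dvec N n v" "dvec N m w"
  shows "dvec N (n + m) (\<lambda>x. pair n (v x) (w x))"
  unfolding dvec_def
proof (intro conjI ballI allI impI)
  fix i assume "i < n + m"
  then show "dfun N (\<lambda>x. coord (pair n (v x) (w x)) i)"
    using dvec_coord[OF assms(1), of i] dvec_coord[OF assms(2), of "i - n"] by (cases "i < n") auto
qed (use assms in \<open>auto simp: dvec_def intro: pair_in_Rn\<close>)

section \<open>The Verdier condition is definable\<close>

text \<open>
  The definition of the tangent space quantifies over curves; the approximation property on the
  right quantifies over points and numbers only. The derivative at \<open>0\<close> of a curve gives one direction and
  \<open>chart.tangent_if_cone\<close> the other.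
\<close>

lemma tangent_space_iff_cone:
  assumes q: "at_least_C2 q" and M: "submanifold q n M" and x: "x \<in> M" and v: "v \<in> Rn n"
  shows "v \<in> tangent_space M x \<longleftrightarrow>
    (\<forall>e. e > 0 \<longrightarrow> (\<exists>d. d > 0 \<and> (\<forall>t. 0 < t \<and> t < d \<longrightarrow> (\<exists>y\<in>Rn n. y \<in> M \<and> norm (y - (x + t *\<^sub>R v)) \<le> e * t))))"
proof
  assume "v \<in> tangent_space M x"
  then obtain \<gamma> \<epsilon> where g: "0 < \<epsilon>" "\<gamma> 0 = x" "\<gamma> ` {-\<epsilon><..<\<epsilon>} \<subseteq> M" "(\<gamma> has_vector_derivative v) (at 0)"
    unfolding tangent_space_def by blast
  have MR: "M \<subseteq> Rn n" using M by (auto simp: submanifold_def submanifold_dim_def)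
  show "\<forall>e. e > 0 \<longrightarrow> (\<exists>d. d > 0 \<and> (\<forall>t. 0 < t \<and> t < d \<longrightarrow> (\<exists>y\<in>Rn n. y \<in> M \<and> norm (y - (x + t *\<^sub>R v)) \<le> e * t)))"
  proof (intro allI impI)
    fix e :: real assume e: "e > 0"
    obtain d where d: "d > 0" "\<And>t. norm t < d \<Longrightarrow> norm (\<gamma> t - \<gamma> 0 - t *\<^sub>R v) \<le> e * norm t"
      using g(4) e unfolding has_vector_derivative_def has_derivative_at_alt by force
    show "\<exists>d. d > 0 \<and> (\<forall>t. 0 < t \<and> t < d \<longrightarrow> (\<exists>y\<in>Rn n. y \<in> M \<and> norm (y - (x + t *\<^sub>R v)) \<le> e * t))"
    proof (intro exI[of _ "min d \<epsilon>"] conjI allI impI)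
      fix t assume t: "0 < t \<and> t < min d \<epsilon>"
      then have "\<gamma> t \<in> M" using g(3) by auto
      moreover have "norm (\<gamma> t - (x + t *\<^sub>R v)) \<le> e * t" using d(2)[of t] t g(2) by (simp add: algebra_simps)
      ultimately show "\<exists>y\<in>Rn n. y \<in> M \<and> norm (y - (x + t *\<^sub>R v)) \<le> e * t" using MR by blast
    qed (use d g in auto)
  qed
next
  assume c: "\<forall>e. e > 0 \<longrightarrow> (\<exists>d. d > 0 \<and> (\<forall>t. 0 < t \<and> t < d \<longrightarrow> (\<exists>y\<in>Rn n. y \<in> M \<and> norm (y - (x + t *\<^sub>R v)) \<le> e * t)))"
  obtain k r s \<phi> \<psi> G H K where ch: "chart n k M x r s \<phi> \<psi> G H K"
    by (rule submanifold_chart[OF q M x]) (rule that)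
  show "v \<in> tangent_space M x"
  proof (rule chart.tangent_if_cone[OF ch _ v])
    show "x \<in> M \<inter> ball x r" using x chart.r[OF ch] by simp
    fix e :: real assume e: "e > 0"
    obtain d where d: "d > 0" "\<And>t. 0 < t \<and> t < d \<Longrightarrow> \<exists>y\<in>Rn n. y \<in> M \<and> norm (y - (x + t *\<^sub>R v)) \<le> e * t"
      using c[rule_format, OF e] by auto
    show "\<exists>d>0. \<forall>t. 0 < t \<and> t < d \<longrightarrow> (\<exists>y\<in>M. norm (y - (x + t *\<^sub>R v)) \<le> e * t)"
    proof (intro exI[of _ d] conjI allI impI d(1))
      fix t assume "0 < t \<and> t < d"
      from d(2)[OF this] show "\<exists>y\<in>M. norm (y - (x + t *\<^sub>R v)) \<le> e * t" by (elim bexE conjE) (rule bexI)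
    qed
  qed
qed

lemmas dfn_rules = dfn_conj dfn_disj dfn_imp dfn_not dfn_all dfn_ex dfn_all_vec dfn_ex_vec
  dfn_less dfn_le dfn_eq dfn_const
  dfun_const dfun_coord dfun_norm dfun_add dfun_mult dfun_diff dfun_minus
  dvec_proj dvec_tail dvec_id dvec_add dvec_diff dvec_scale dvec_pair
  dvec_lift1 dvec_lift dfun_lift1 dfun_lift

text \<open>
  Membership of the base point is part of the formula because the characterization of tangent vectors
  holds at points of \<open>M\<close> only.
\<close>

lemma dfn_tangent:
  assumes q: "at_least_C2 q" and M: "submanifold q n M" "M \<in> D n" and p: "dvec N n p" and v: "dvec N n v"
  shows "dfn N (\<lambda>z. p z \<in> M \<and> v z \<in> tangent_space M (p z))"
proof -
  have 1: "dfn (n + n) (\<lambda>z. proj n z \<in> M \<and>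
    (\<forall>e. e > 0 \<longrightarrow> (\<exists>d. d > 0 \<and> (\<forall>t. 0 < t \<and> t < d \<longrightarrow>
       (\<exists>y\<in>Rn n. y \<in> M \<and> norm (y - (proj n z + t *\<^sub>R tail n z)) \<le> e * t)))))"
    by (rule dfn_rules dfn_subst[OF dfn_mem[OF M(2)]] | (simp; fail))+
  have 2: "dfn (n + n) (\<lambda>z. proj n z \<in> M \<and> tail n z \<in> tangent_space M (proj n z))"
  proof (rule dfn_eqI[OF 1], rule conj_cong[OF refl])
    fix z assume z: "z \<in> Rn (n + n)" and pM: "proj n z \<in> M"
    show "(\<forall>e. e > 0 \<longrightarrow> (\<exists>d. d > 0 \<and> (\<forall>t. 0 < t \<and> t < d \<longrightarrow>
       (\<exists>y\<in>Rn n. y \<in> M \<and> norm (y - (proj n z + t *\<^sub>R tail n z)) \<le> e * t)))) \<longleftrightarrow> tail n z \<in> tangent_space M (proj n z)"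
      using tangent_space_iff_cone[OF q M(1) pM tail_in_Rn[OF z]] by (rule sym)
  qed
  show ?thesis
    by (rule dfn_eqI[OF dfn_subst[OF 2 dvec_pair[OF p v]]]) (use p in \<open>simp add: dvec_def\<close>)
qed

lemma verdier_definable:
  assumes q: "at_least_C2 q"
  shows "definable_condition D q verdier"
  unfolding definable_condition_def
proof (intro allI impI, elim conjE)
  fix n \<Lambda> \<Gamma> assume i: "incident_pair q n \<Lambda> \<Gamma>" and L: "\<Lambda> \<in> D n" and G: "\<Gamma> \<in> D n"
  note d = incident_pairD[OF i]
  have 1: "dfn n (\<lambda>p. p \<in> \<Gamma> \<and> (\<exists>e. 0 < e \<and> (\<exists>C. 0 < C \<and> (\<forall>x\<in>Rn n. \<forall>y\<in>Rn n. \<forall>v\<in>Rn n.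
      norm (x - p) < e \<and> norm (y - p) < e \<and> y \<in> \<Lambda> \<and> (x \<in> \<Gamma> \<and> v \<in> tangent_space \<Gamma> x) \<longrightarrow>
        (\<exists>w\<in>Rn n. (y \<in> \<Lambda> \<and> w \<in> tangent_space \<Lambda> y) \<and> norm (v - w) \<le> C * norm (x - y) * norm v)))))"
    by (rule dfn_tangent[OF q d(2) G] dfn_tangent[OF q d(1) L] dfn_rules
          dfn_subst[OF dfn_mem[OF G]] dfn_subst[OF dfn_mem[OF L]] | (simp; fail))+
  have "dfn n (\<lambda>p. p \<in> {x \<in> \<Gamma>. verdier n \<Lambda> \<Gamma> x})"
  proof (rule dfn_eqI[OF 1])
    fix p
    have TG: "v \<in> Rn n" if "v \<in> tangent_space \<Gamma> x" "x \<in> \<Gamma>" for v x using tangent_space_subset_Rn[OF d(4)] that by blast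
    have TL: "v \<in> Rn n" if "v \<in> tangent_space \<Lambda> x" "x \<in> \<Lambda>" for v x using tangent_space_subset_Rn[OF d(3)] that by blast
    have R: "x \<in> \<Gamma> \<Longrightarrow> x \<in> Rn n" "x \<in> \<Lambda> \<Longrightarrow> x \<in> Rn n" for x using d by auto
    have "(\<forall>x\<in>Rn n. \<forall>y\<in>Rn n. \<forall>v\<in>Rn n.
      norm (x - p) < e \<and> norm (y - p) < e \<and> y \<in> \<Lambda> \<and> (x \<in> \<Gamma> \<and> v \<in> tangent_space \<Gamma> x) \<longrightarrow>
        (\<exists>w\<in>Rn n. (y \<in> \<Lambda> \<and> w \<in> tangent_space \<Lambda> y) \<and> norm (v - w) \<le> C * norm (x - y) * norm v)) \<longleftrightarrow>
      (\<forall>x\<in>\<Gamma>. \<forall>y\<in>\<Lambda>. dist x p < e \<longrightarrow> dist y p < e \<longrightarrow>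
         vbound (tangent_space \<Gamma> x) (tangent_space \<Lambda> y) (C * norm (x - y)))" for e C
      unfolding vbound_def dist_norm using TG TL R by meson
    then have "(\<exists>e. 0 < e \<and> (\<exists>C. 0 < C \<and> (\<forall>x\<in>Rn n. \<forall>y\<in>Rn n. \<forall>v\<in>Rn n.
      norm (x - p) < e \<and> norm (y - p) < e \<and> y \<in> \<Lambda> \<and> (x \<in> \<Gamma> \<and> v \<in> tangent_space \<Gamma> x) \<longrightarrow>
        (\<exists>w\<in>Rn n. (y \<in> \<Lambda> \<and> w \<in> tangent_space \<Lambda> y) \<and> norm (v - w) \<le> C * norm (x - y) * norm v)))) \<longleftrightarrow> verdier_vb \<Lambda> \<Gamma> p"
      unfolding verdier_vb_def by (simp only:)
    then show "(p \<in> \<Gamma> \<and> (\<exists>e. 0 < e \<and> (\<exists>C. 0 < C \<and> (\<forall>x\<in>Rn n. \<forall>y\<in>Rn n. \<forall>v\<in>Rn n.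
      norm (x - p) < e \<and> norm (y - p) < e \<and> y \<in> \<Lambda> \<and> (x \<in> \<Gamma> \<and> v \<in> tangent_space \<Gamma> x) \<longrightarrow>
        (\<exists>w\<in>Rn n. (y \<in> \<Lambda> \<and> w \<in> tangent_space \<Lambda> y) \<and> norm (v - w) \<le> C * norm (x - y) * norm v))))) \<longleftrightarrow>
      p \<in> {x \<in> \<Gamma>. verdier n \<Lambda> \<Gamma> x}"
      using incident_verdier_iff[OF q i, of p] by blast
  qed
  then show "{x \<in> \<Gamma>. verdier n \<Lambda> \<Gamma> x} \<in> D n" by (rule dfn_set) (use d in auto)
qed

end

section \<open>Cells and definable choice\<close>

text \<open>
  The point \<open>(x, t)\<close> of \<open>R^n \<times> R\<close>, for \<open>x \<in> Rn n\<close>.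
\<close>

definition over :: "nat \<Rightarrow> rvec \<Rightarrow> real \<Rightarrow> rvec" where
  "over n x t = x + t *\<^sub>R ax n"

lemma coord_over: "x \<in> Rn n \<Longrightarrow> coord (over n x t) i = (if i = n then t else coord x i)"
  by (auto simp: over_def Rn_def)

lemma over_in_Rn: "x \<in> Rn n \<Longrightarrow> over n x t \<in> Rn (Suc n)"
  by (auto simp: Rn_def over_def)

lemma proj_over [simp]: "x \<in> Rn n \<Longrightarrow> proj n (over n x t) = x"
  by (rule rvec_eqI) (auto simp: coord_over Rn_def)

lemma coord_over_top [simp]: "x \<in> Rn n \<Longrightarrow> coord (over n x t) n = t"
  by (simp add: coord_over)

lemma over_proj: "z \<in> Rn (Suc n) \<Longrightarrow> over n (proj n z) (coord z n) = z"
  by (rule Rn_eqI[of _ "Suc n"]) (auto simp: coord_over over_in_Rn less_Suc_eq)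

lemma dist_over: "dist (over n x t) (over n y s) \<le> dist x y + \<bar>t - s\<bar>"
proof -
  have "over n x t - over n y s = (x - y) + (t - s) *\<^sub>R ax n" by (simp add: over_def algebra_simps)
  then show ?thesis using norm_triangle_ineq[of "x - y" "(t - s) *\<^sub>R ax n"] by (simp add: dist_norm)
qed

text \<open>
  What is needed of the \<open>C^q\<close> functions on cells; cells may be thin, so the \<open>C11\<close> map lives on a
  neighbourhood.
\<close>

definition C11_ext :: "nat \<Rightarrow> rvec set \<Rightarrow> (rvec \<Rightarrow> real) \<Rightarrow> bool" where
  "C11_ext n C f \<longleftrightarrow> (\<forall>x\<in>C. \<exists>r>0. \<exists>F G K. C11 (ball x r \<inter> Rn n) F G K \<and> (\<forall>y\<in>C \<inter> (ball x r \<inter> Rn n). F y = f y))"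

definition C11_loc :: "nat \<Rightarrow> rvec set \<Rightarrow> (rvec \<Rightarrow> rvec) \<Rightarrow> bool" where
  "C11_loc n W s \<longleftrightarrow> (\<forall>a\<in>W. \<exists>r>0. \<exists>G K. ball a r \<inter> Rn n \<subseteq> W \<and> C11 (ball a r \<inter> Rn n) s G K)"

lemma C11_cong:
  assumes "C11 S F G K" "\<And>x. x \<in> S \<Longrightarrow> F x = F' x"
  shows "C11 S F' G K"
  using assms(1) unfolding C11_def
  by (auto intro: has_derivative_transform[where f = F, rotated 2] simp: assms(2)[symmetric])

lemma Cq_on_C11_ext:
  assumes q: "at_least_C2 q" and f: "Cq_on q n C f"
  shows "C11_ext n C f"
  unfolding C11_ext_def
proof
  fix x assume "x \<in> C"
  then have "\<exists>U F. x \<in> U \<and> Cq_on_open q n U F \<and> (\<forall>y\<in>C \<inter> U. F y = f y)"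
    using f unfolding Cq_on_def by (rule bspec[rotated])
  then obtain U F where U: "x \<in> U" "Cq_on_open q n U F" "\<And>y. y \<in> C \<inter> U \<Longrightarrow> F y = f y" by auto
  obtain r G K where r: "r > 0" "ball x r \<inter> Rn n \<subseteq> U" "C11 (ball x r \<inter> Rn n) F G K"
    using Cq_on_open_C11_real[OF q U(2,1)] by auto
  have "\<forall>y\<in>C \<inter> (ball x r \<inter> Rn n). F y = f y" using r(2) U(3) by blast
  then show "\<exists>r>0. \<exists>F G K. C11 (ball x r \<inter> Rn n) F G K \<and> (\<forall>y\<in>C \<inter> (ball x r \<inter> Rn n). F y = f y)"
    using r(1,3) by auto
qed

lemma C11_ext_near:
  assumes f: "C11_ext n C f" and C: "C \<subseteq> Rn n" and x: "x \<in> C" and e: "e > 0"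
  obtains d where "d > 0" "\<And>y. y \<in> C \<Longrightarrow> dist y x < d \<Longrightarrow> \<bar>f y - f x\<bar> < e"
proof -
  obtain r F G K where r: "r > 0" "C11 (ball x r \<inter> Rn n) F G K" "\<forall>y\<in>C \<inter> (ball x r \<inter> Rn n). F y = f y"
    using f x unfolding C11_ext_def by auto
  have K: "K > 0" using r(2) by (simp add: C11_def)
  show ?thesis
  proof (rule that[of "min r (e / K)"])
    show "min r (e / K) > 0" using r e K by simp
    fix y assume y: "y \<in> C" "dist y x < min r (e / K)"
    have yx: "y \<in> ball x r \<inter> Rn n" "x \<in> ball x r \<inter> Rn n" using y x C r by (auto simp: dist_commute)
    have "norm (F y - F x) \<le> K * norm (y - x)" by (rule C11_lipschitz[OF r(2) convex_ball_Rn yx])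
    also have "\<dots> < K * (e / K)" using y K by (intro mult_strict_left_mono) (auto simp: dist_norm)
    also have "\<dots> = e" using K by simp
    finally show "\<bar>f y - f x\<bar> < e" using r(3) yx x y(1) by simp
  qed
qed

lemma C11_ext_const: "C11_ext n C (\<lambda>_. c)"
  unfolding C11_ext_def using C11_const zero_less_one by blast

lemma C11_ext_lincomb:
  assumes f: "C11_ext n C f" and g: "C11_ext n C g"
  shows "C11_ext n C (\<lambda>x. a * f x + b * g x)"
  unfolding C11_ext_def
proof
  fix x assume x: "x \<in> C"
  obtain r F G K where r: "r > 0" "C11 (ball x r \<inter> Rn n) F G K" "\<forall>y\<in>C \<inter> (ball x r \<inter> Rn n). F y = f y"
    using f x unfolding C11_ext_def by auto
  obtain r' F' G' K' where r': "r' > 0" "C11 (ball x r' \<inter> Rn n) F' G' K'" "\<forall>y\<in>C \<inter> (ball x r' \<inter> Rn n). F' y = g y"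
    using g x unfolding C11_ext_def by auto
  obtain L where L: "C11 (ball x r \<inter> Rn n) (\<lambda>x. a * F x) (\<lambda>x v. a * G x v) L"
    using C11_bounded_linear[OF bounded_linear_mult_right r(2)] by auto
  obtain L' where L': "C11 (ball x r' \<inter> Rn n) (\<lambda>x. b * F' x) (\<lambda>x v. b * G' x v) L'"
    using C11_bounded_linear[OF bounded_linear_mult_right r'(2)] by auto
  let ?S = "ball x (min r r') \<inter> Rn n"
  have "C11 ?S (\<lambda>x. a * F x + b * F' x) (\<lambda>x v. a * G x v + b * G' x v) (L + L')"
    by (intro C11_add C11_subset[OF L] C11_subset[OF L']) auto
  moreover have "\<forall>y\<in>C \<inter> ?S. a * F y + b * F' y = a * f y + b * g y" using r(3) r'(3) by auto
  ultimately show "\<exists>r>0. \<exists>F G K. C11 (ball x r \<inter> Rn n) F G K \<and> (\<forall>y\<in>C \<inter> (ball x r \<inter> Rn n). F y = a * f y + b * g y)"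
    using r(1) r'(1) by (intro exI[of _ "min r r'"]) auto
qed

text \<open>
  The two kinds of cells in terms of the base \<open>proj n ` C\<close> of a given cell \<open>C\<close>.
\<close>

definition graph_cell :: "(nat \<Rightarrow> rvec set set) \<Rightarrow> smoothness \<Rightarrow> nat \<Rightarrow> rvec set \<Rightarrow> (rvec \<Rightarrow> real) \<Rightarrow> bool" where
  "graph_cell D q n C f \<longleftrightarrow> cell_function D q n (proj n ` C) f \<and> C = {over n x (f x) | x. x \<in> proj n ` C}"

definition band_cell :: "(nat \<Rightarrow> rvec set set) \<Rightarrow> smoothness \<Rightarrow> nat \<Rightarrow> rvec set \<Rightarrow> (rvec \<Rightarrow> ereal) \<Rightarrow> (rvec \<Rightarrow> ereal) \<Rightarrow> bool" where
  "band_cell D q n C F G \<longleftrightarrow> cell_bound D q n (proj n ` C) (-\<infinity>) F \<and> cell_bound D q n (proj n ` C) \<infinity> G \<and>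
     (\<forall>x\<in>proj n ` C. F x < G x) \<and> C = {over n x t | x t. x \<in> proj n ` C \<and> F x < ereal t \<and> ereal t < G x}"

lemma cell_subset_Rn: "cell D q n C \<Longrightarrow> C \<subseteq> Rn n"
proof (induction rule: cell.induct)
  case (graph n C f)
  then show ?case using over_in_Rn[of _ n] by (auto simp: over_def)
next
  case (band n C F G)
  then show ?case using over_in_Rn[of _ n] by (auto simp: over_def)
qed simp

lemma cell_Suc:
  assumes "cell D q (Suc n) C"
  shows "cell D q n (proj n ` C)" and "(\<exists>f. graph_cell D q n C f) \<or> (\<exists>F G. band_cell D q n C F G)"
proof -
  have "cell D q n (proj n ` C) \<and> ((\<exists>f. graph_cell D q n C f) \<or> (\<exists>F G. band_cell D q n C F G))"
    using assms
  proof (cases rule: cell.cases)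
    case (graph B f)
    have B: "B \<subseteq> Rn n" by (rule cell_subset_Rn[OF graph(2)])
    have C: "C = {over n x (f x) | x. x \<in> B}" using graph(1) by (simp add: over_def)
    have "proj n ` C = B" unfolding C using B by (force simp: image_iff subset_iff)
    then show ?thesis using graph(2,3) C unfolding graph_cell_def by blast
  next
    case (band B F G)
    have B: "B \<subseteq> Rn n" by (rule cell_subset_Rn[OF band(2)])
    have C: "C = {over n x t | x t. x \<in> B \<and> F x < ereal t \<and> ereal t < G x}" using band(1) by (simp add: over_def)
    have "proj n ` C = B"
    proof
      show "proj n ` C \<subseteq> B" unfolding C using B by (auto simp: subset_iff)
      show "B \<subseteq> proj n ` C"
      proof
        fix x assume x: "x \<in> B"
        then obtain t where "F x < ereal t" "ereal t < G x" using band(5) ereal_dense2 by blast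
        then have "over n x t \<in> C" using x unfolding C by blast
        then show "x \<in> proj n ` C" using x B by (intro image_eqI[of _ _ "over n x t"]) auto
      qed
    qed
    then have "band_cell D q n C F G" using band(3-5) C unfolding band_cell_def by (simp only: simp_thms)
    then show ?thesis using \<open>proj n ` C = B\<close> band(2) by blast
  qed
  then show "cell D q n (proj n ` C)" "(\<exists>f. graph_cell D q n C f) \<or> (\<exists>F G. band_cell D q n C F G)" by auto
qed

lemma graph_cell_coord:
  assumes g: "graph_cell D q n C f" and C: "C \<subseteq> Rn (Suc n)" and z: "z \<in> C"
  shows "coord z n = f (proj n z)"
proof -
  have B: "proj n ` C \<subseteq> Rn n" by auto
  have "z \<in> {over n x (f x) | x. x \<in> proj n ` C}" using g z unfolding graph_cell_def by metis
  then obtain x where "z = over n x (f x)" "x \<in> proj n ` C" by blast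
  then show ?thesis using B by (simp add: subset_iff)
qed

lemma cell_bound_upper:
  assumes q: "at_least_C2 q" and b: "cell_bound D q n C \<infinity> G" and C: "C \<subseteq> Rn n" and x: "x \<in> C" "ereal t < G x"
  obtains d where "d > 0" "\<And>y s. y \<in> C \<Longrightarrow> dist y x < d \<Longrightarrow> \<bar>s - t\<bar> < d \<Longrightarrow> ereal s < G y"
proof (cases "\<forall>x\<in>C. G x = \<infinity>")
  case True
  then show ?thesis by (intro that[of 1]) auto
next
  case False
  then obtain g where g: "cell_function D q n C g" "\<forall>x\<in>C. G x = ereal (g x)"
    using b unfolding cell_bound_def by blast
  define e where "e = (g x - t) / 2"
  have e: "e > 0" using x g(2) by (simp add: e_def)
  have "C11_ext n C g" using g(1) q Cq_on_C11_ext unfolding cell_function_def by blast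
  then obtain d where d: "d > 0" "\<And>y. y \<in> C \<Longrightarrow> dist y x < d \<Longrightarrow> \<bar>g y - g x\<bar> < e"
    by (rule C11_ext_near[OF _ C x(1) e]) (rule that)
  show ?thesis
  proof (rule that[of "min d e"])
    fix y s assume y: "y \<in> C" "dist y x < min d e" "\<bar>s - t\<bar> < min d e"
    have "\<bar>g y - g x\<bar> < e" using d(2) y by auto
    moreover have "s < t + e" using y(3) by linarith
    moreover have "g x - e = t + e" by (simp add: e_def field_simps)
    ultimately have "s < g y" by linarith
    then show "ereal s < G y" using g(2) y(1) by simp
  qed (use d e in auto)
qed

lemma cell_bound_lower:
  assumes q: "at_least_C2 q" and b: "cell_bound D q n C (-\<infinity>) F" and C: "C \<subseteq> Rn n" and x: "x \<in> C" "F x < ereal t"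
  obtains d where "d > 0" "\<And>y s. y \<in> C \<Longrightarrow> dist y x < d \<Longrightarrow> \<bar>s - t\<bar> < d \<Longrightarrow> F y < ereal s"
proof (cases "\<forall>x\<in>C. F x = -\<infinity>")
  case True
  then show ?thesis by (intro that[of 1]) auto
next
  case False
  then obtain g where g: "cell_function D q n C g" "\<forall>x\<in>C. F x = ereal (g x)"
    using b unfolding cell_bound_def by blast
  define e where "e = (t - g x) / 2"
  have e: "e > 0" using x g(2) by (simp add: e_def)
  have "C11_ext n C g" using g(1) q Cq_on_C11_ext unfolding cell_function_def by blast
  then obtain d where d: "d > 0" "\<And>y. y \<in> C \<Longrightarrow> dist y x < d \<Longrightarrow> \<bar>g y - g x\<bar> < e"
    by (rule C11_ext_near[OF _ C x(1) e]) (rule that)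
  show ?thesis
  proof (rule that[of "min d e"])
    fix y s assume y: "y \<in> C" "dist y x < min d e" "\<bar>s - t\<bar> < min d e"
    have "\<bar>g y - g x\<bar> < e" using d(2) y by auto
    moreover have "s > t - e" using y(3) by linarith
    moreover have "g x + e = t - e" by (simp add: e_def field_simps)
    ultimately have "g y < s" by linarith
    then show "F y < ereal s" using g(2) y(1) by simp
  qed (use d e in auto)
qed

lemma open_in_Rn_iff: "open_in_Rn n U \<longleftrightarrow> U \<subseteq> Rn n \<and> (\<forall>x\<in>U. \<exists>e>0. \<forall>y\<in>Rn n. dist y x < e \<longrightarrow> y \<in> U)"
  unfolding open_in_Rn_def openin_euclidean_subtopology_iff by (simp add: Ball_def)

lemma band_cell_open:
  assumes q: "at_least_C2 q" and b: "band_cell D q n C F G" and o: "open_in_Rn n (proj n ` C)"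
  shows "open_in_Rn (Suc n) C"
proof -
  let ?B = "proj n ` C"
  have BR: "?B \<subseteq> Rn n" by auto
  have C: "C = {over n x t | x t. x \<in> ?B \<and> F x < ereal t \<and> ereal t < G x}"
    and bd: "cell_bound D q n ?B (-\<infinity>) F" "cell_bound D q n ?B \<infinity> G"
    using b unfolding band_cell_def by blast+
  show ?thesis unfolding open_in_Rn_iff
  proof (intro conjI ballI)
    show "C \<subseteq> Rn (Suc n)"
    proof
      fix z assume "z \<in> C"
      then have "z \<in> {over n x t | x t. x \<in> ?B \<and> F x < ereal t \<and> ereal t < G x}" using C by blast
      then show "z \<in> Rn (Suc n)" using BR over_in_Rn by blast
    qed
    fix z assume "z \<in> C"
    then have "z \<in> {over n x t | x t. x \<in> ?B \<and> F x < ereal t \<and> ereal t < G x}" using C by blast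
    then obtain x t where x: "x \<in> ?B" "F x < ereal t" "ereal t < G x" "z = over n x t" by blast
    have xR: "x \<in> Rn n" using x(1) BR by blast
    obtain d1 where d1: "d1 > 0" "\<And>y s. y \<in> ?B \<Longrightarrow> dist y x < d1 \<Longrightarrow> \<bar>s - t\<bar> < d1 \<Longrightarrow> F y < ereal s"
      by (rule cell_bound_lower[OF q bd(1) BR x(1,2)]) (rule that)
    obtain d2 where d2: "d2 > 0" "\<And>y s. y \<in> ?B \<Longrightarrow> dist y x < d2 \<Longrightarrow> \<bar>s - t\<bar> < d2 \<Longrightarrow> ereal s < G y"
      by (rule cell_bound_upper[OF q bd(2) BR x(1,3)]) (rule that)
    obtain d3 where d3: "d3 > 0" "\<And>y. y \<in> Rn n \<Longrightarrow> dist y x < d3 \<Longrightarrow> y \<in> ?B"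
      using o[unfolded open_in_Rn_iff, THEN conjunct2, rule_format, OF x(1)] by auto
    show "\<exists>e>0. \<forall>w\<in>Rn (Suc n). dist w z < e \<longrightarrow> w \<in> C"
    proof (intro exI[of _ "min d1 (min d2 d3)"] conjI ballI impI)
      fix w assume w: "w \<in> Rn (Suc n)" "dist w z < min d1 (min d2 d3)"
      have "dist (proj n w) x \<le> dist w z" using norm_proj_diff[of n w z] xR by (simp add: x(4) dist_norm)
      moreover have "\<bar>coord w n - t\<bar> \<le> dist w z"
        using abs_coord_le_norm[of "w - z" n] xR by (simp add: x(4) dist_norm)
      ultimately have "proj n w \<in> ?B" "F (proj n w) < ereal (coord w n)" "ereal (coord w n) < G (proj n w)"
        using w d1(2) d2(2) d3(2)[of "proj n w"] by auto
      moreover have "w = over n (proj n w) (coord w n)" using over_proj[OF w(1)] by simp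
      ultimately have "w \<in> {over n x t | x t. x \<in> ?B \<and> F x < ereal t \<and> ereal t < G x}" by blast
      then show "w \<in> C" using C by blast
    qed (use d1 d2 d3 in auto)
  qed
qed

lemma cell_decompositionD:
  assumes "cell_decomposition D q n X"
  shows "finite X" "partition_on (Rn n) X" "\<And>C. C \<in> X \<Longrightarrow> cell D q n C"
proof -
  have "finite X \<and> partition_on (Rn n) X \<and> (\<forall>C\<in>X. cell D q n C)"
  proof (cases n)
    case 0
    then have "X = {Rn 0}" using assms by simp
    then show ?thesis using 0 by (auto simp: partition_on_def disjoint_def Rn_zero intro: cell.point[unfolded Rn_zero])
  next
    case (Suc m)
    have "finite X \<and> partition_on (Rn (Suc m)) X \<and> (\<forall>C\<in>X. cell D q (Suc m) C)"
      using assms unfolding Suc cell_decomposition.simps by (elim conjE) (intro conjI)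
    then show ?thesis unfolding Suc .
  qed
  then show "finite X" "partition_on (Rn n) X" "\<And>C. C \<in> X \<Longrightarrow> cell D q n C" by auto
qed

lemma cell_decomposition_unique:
  assumes "cell_decomposition D q n X" "A \<in> X" "B \<in> X" "x \<in> A" "x \<in> B"
  shows "A = B"
  using cell_decompositionD(2)[OF assms(1)] assms(2-) by (auto simp: partition_on_def disjoint_def)

lemma cell_decomposition_cover:
  assumes "cell_decomposition D q n X" "x \<in> Rn n"
  obtains C where "C \<in> X" "x \<in> C"
  using cell_decompositionD(2)[OF assms(1)] assms(2) by (auto simp: partition_on_def)

lemma cell_decomposition_proj:
  "cell_decomposition D q (m + j) X \<Longrightarrow> cell_decomposition D q m ((\<lambda>C. proj m ` C) ` X)"
proof (induction j arbitrary: X)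
  case 0
  have "proj m ` C = C" if "C \<in> X" for C
    using cell_subset_Rn[OF cell_decompositionD(3)[OF 0 that]] proj_Rn by force
  then have "(\<lambda>C. proj m ` C) ` X = X" by auto
  then show ?case using 0 by simp
next
  case (Suc j)
  then have "cell_decomposition D q (m + j) ((\<lambda>C. proj (m + j) ` C) ` X)" by simp
  from Suc.IH[OF this] show ?case by (simp add: image_image)
qed

text \<open>
  Over an open cell there are finitely many graphs, and a vertical segment misses all of them
  at all but finitely many points; the remaining points lie in bands, which are open.
\<close>

lemma open_meets_open_cell:
  assumes q: "at_least_C2 q"
  shows "cell_decomposition D q n X \<Longrightarrow> open_in_Rn n U \<Longrightarrow> U \<noteq> {} \<Longrightarrow> \<exists>C\<in>X. open_in_Rn n C \<and> C \<inter> U \<noteq> {}"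
proof (induction n arbitrary: X U)
  case 0
  then have "U \<subseteq> Rn 0" by (simp add: open_in_Rn_subset)
  moreover have "X = {Rn 0}" using 0(1) by simp
  moreover have "open_in_Rn 0 (Rn 0)" by (simp add: open_in_Rn_def)
  ultimately show ?case using 0(3) by auto
next
  case (Suc n)
  obtain z where z: "z \<in> U" using Suc.prems by blast
  obtain r where r: "r > 0" "ball z r \<inter> Rn (Suc n) \<subseteq> U" and zR: "z \<in> Rn (Suc n)" using open_in_Rn_ball[OF Suc.prems(2) z] by blast
  let ?X = "(\<lambda>C. proj n ` C) ` X" and ?V = "ball (proj n z) (r / 2) \<inter> Rn n"
  have X: "cell_decomposition D q n ?X" using Suc.prems(1) by simp
  have "proj n z \<in> ?V" using r by simp
  then have "\<exists>B\<in>?X. open_in_Rn n B \<and> B \<inter> ?V \<noteq> {}"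
    by (intro Suc.IH[OF X] open_in_Rn_Int_open open_ball) blast
  then obtain B x where B: "B \<in> ?X" "open_in_Rn n B" and x: "x \<in> B" "x \<in> ?V" by blast
  have xR: "x \<in> Rn n" using x by blast
  define bad where "bad = (\<Union>C\<in>X. {t. \<exists>f. graph_cell D q n C f \<and> t = f x \<and> over n x t \<in> C})"
  have "finite {t. \<exists>f. graph_cell D q n C f \<and> t = f x \<and> over n x t \<in> C}" if C: "C \<in> X" for C
  proof (rule finite_subset)
    have uniq: "t = t'" if "graph_cell D q n C f" "t = f x" "over n x t \<in> C" "graph_cell D q n C f'" "t' = f' x" "over n x t' \<in> C" for t t' f f'
      using graph_cell_coord[OF that(1) cell_subset_Rn[OF cell_decompositionD(3)[OF Suc.prems(1) C]] that(6)] xR that by simp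
    show "{t. \<exists>f. graph_cell D q n C f \<and> t = f x \<and> over n x t \<in> C} \<subseteq>
        {SOME t. t \<in> {t. \<exists>f. graph_cell D q n C f \<and> t = f x \<and> over n x t \<in> C}}"
      (is "?T \<subseteq> _")
    proof (intro subsetI)
      fix t assume t: "t \<in> ?T"
      then have "(SOME t. t \<in> ?T) \<in> ?T" by (rule someI[where P = "\<lambda>t. t \<in> ?T"])
      then have "t = (SOME t. t \<in> ?T)" using t uniq by blast
      then show "t \<in> {SOME t. t \<in> ?T}" by blast
    qed
  qed simp
  then have fin: "finite bad" unfolding bad_def using cell_decompositionD(1)[OF Suc.prems(1)] by blast
  have "infinite {coord z n - r / 2<..<coord z n + r / 2}" using r by (intro infinite_Ioo) simp
  then obtain t where t: "t \<in> {coord z n - r / 2<..<coord z n + r / 2}" "t \<notin> bad"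
    using fin by (meson finite_subset subsetI)
  let ?w = "over n x t"
  have wR: "?w \<in> Rn (Suc n)" by (rule over_in_Rn[OF xR])
  have "dist ?w z < r"
  proof -
    have "dist ?w z \<le> dist x (proj n z) + \<bar>t - coord z n\<bar>"
      using dist_over[of n x t "proj n z" "coord z n"] over_proj[OF zR] by simp
    also have "\<dots> < r / 2 + r / 2" 
    proof (rule add_strict_mono)
      show "dist x (proj n z) < r / 2" using x(2) by (simp add: dist_commute)
      show "\<bar>t - coord z n\<bar> < r / 2" using t(1) by (auto simp: abs_if)
    qed
    finally show ?thesis by simp
  qed
  then have wU: "?w \<in> U" using r(2) wR by (auto simp: dist_commute)
  obtain C where C: "C \<in> X" "?w \<in> C" by (rule cell_decomposition_cover[OF Suc.prems(1) wR]) (rule that)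
  have "proj n ?w \<in> proj n ` C" using C(2) by blast
  then have "proj n ` C = B" using cell_decomposition_unique[OF X _ B(1) _ x(1)] C(1) xR by auto
  moreover have "\<not> graph_cell D q n C f" for f
  proof
    assume g: "graph_cell D q n C f"
    have "t = f x" using graph_cell_coord[OF g cell_subset_Rn[OF cell_decompositionD(3)[OF Suc.prems(1) C(1)]] C(2)] xR by simp
    then show False using t(2) g C unfolding bad_def by blast
  qed
  ultimately have "open_in_Rn (Suc n) C"
    using cell_Suc(2)[OF cell_decompositionD(3)[OF Suc.prems(1) C(1)]] band_cell_open[OF q] B(2) by blast
  then show ?case using C wU by blast
qed

text \<open>
  One function at a time: either it is nonpositive on the whole ball, or the ball is replaced by a
  smaller one around a point where it is positive.
\<close>

lemma finite_positive_gap: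
  assumes fin: "finite \<F>" and f: "\<And>f. f \<in> \<F> \<Longrightarrow> C11_ext k B f" and B: "open_in_Rn k B"
    and U: "open_in_Rn k U" "U \<noteq> {}" "U \<subseteq> B"
  shows "\<exists>a \<rho> \<eta>. 0 < \<rho> \<and> 0 < \<eta> \<and> a \<in> Rn k \<and> ball a \<rho> \<inter> Rn k \<subseteq> U \<and>
    (\<forall>f\<in>\<F>. \<forall>x\<in>ball a \<rho> \<inter> Rn k. f x \<le> 0 \<or> \<eta> \<le> f x)"
  using fin f
proof (induction \<F> rule: finite_induct)
  case empty
  obtain a where a: "a \<in> U" using U by blast
  obtain r where "r > 0" "ball a r \<inter> Rn k \<subseteq> U" "a \<in> Rn k" using open_in_Rn_ball[OF U(1) a] by blast
  then show ?case by (intro exI[of _ a] exI[of _ r] exI[of _ 1]) auto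
next
  case (insert f \<F>)
  obtain a \<rho> \<eta> where a: "0 < \<rho>" "0 < \<eta>" "a \<in> Rn k" "ball a \<rho> \<inter> Rn k \<subseteq> U"
    "\<And>g x. g \<in> \<F> \<Longrightarrow> x \<in> ball a \<rho> \<inter> Rn k \<Longrightarrow> g x \<le> 0 \<or> \<eta> \<le> g x"
    using insert by (metis insertCI)
  show ?case
  proof (cases "\<exists>x\<in>ball a \<rho> \<inter> Rn k. f x > 0")
    case False
    then have "\<forall>g\<in>insert f \<F>. \<forall>x\<in>ball a \<rho> \<inter> Rn k. g x \<le> 0 \<or> \<eta> \<le> g x" using a(5) by force
    then show ?thesis using a(1-4) by blast
  next
    case True
    then obtain b where b: "b \<in> ball a \<rho> \<inter> Rn k" "f b > 0" by blast
    have bB: "b \<in> B" using b(1) a(4) U(3) by blast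
    obtain d where d: "d > 0" "\<And>y. y \<in> B \<Longrightarrow> dist y b < d \<Longrightarrow> \<bar>f y - f b\<bar> < f b / 2"
      by (rule C11_ext_near[OF insert.prems[of f] open_in_Rn_subset[OF B] bB, of "f b / 2"]) (use b that in auto)
    define \<rho>' where "\<rho>' = min d (\<rho> - dist a b)"
    have \<rho>': "\<rho>' > 0" using d b by (simp add: \<rho>'_def)
    have sub: "ball b \<rho>' \<inter> Rn k \<subseteq> ball a \<rho> \<inter> Rn k"
    proof
      fix y assume y: "y \<in> ball b \<rho>' \<inter> Rn k"
      have "dist a y \<le> dist a b + dist b y" by (rule dist_triangle)
      then show "y \<in> ball a \<rho> \<inter> Rn k" using y by (auto simp: \<rho>'_def)
    qed
    show ?thesis
    proof (rule exI[of _ b], rule exI[of _ \<rho>'], rule exI[of _ "min \<eta> (f b / 2)"], intro conjI ballI)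
      fix g x assume g: "g \<in> insert f \<F>" and x: "x \<in> ball b \<rho>' \<inter> Rn k"
      show "g x \<le> 0 \<or> min \<eta> (f b / 2) \<le> g x"
      proof (cases "g = f")
        case True
        have "x \<in> B" using x sub a(4) U(3) by blast
        then have "\<bar>f x - f b\<bar> < f b / 2" using x by (intro d(2)) (auto simp: \<rho>'_def dist_commute)
        then have "f b / 2 \<le> f x" by linarith
        then show ?thesis using True by auto
      next
        case False
        then have "g \<in> \<F>" "x \<in> ball a \<rho> \<inter> Rn k" using g x sub by auto
        then show ?thesis using a(5)[of g x] by auto
      qed
    qed (use \<rho>' a b sub in auto)
  qed
qed

text \<open>
  A thin slab over a small ball lies in a single cell: once the ball is so small that each
  of the finitely many graphs is either nonpositive or bounded away from \<open>0\<close>, the slab is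
  a connected set covered by disjoint open bands.
\<close>

lemma slab_in_cell:
  assumes q: "at_least_C2 q" and X: "cell_decomposition D q (Suc k) X" and U: "open_in_Rn k U" "U \<noteq> {}"
  shows "\<exists>a \<rho> \<eta> C. 0 < \<rho> \<and> 0 < \<eta> \<and> a \<in> Rn k \<and> ball a \<rho> \<inter> Rn k \<subseteq> U \<and> C \<in> X \<and>
    (\<forall>x\<in>ball a \<rho> \<inter> Rn k. \<forall>t. 0 < t \<and> t < \<eta> \<longrightarrow> over k x t \<in> C)"
proof -
  let ?X = "(\<lambda>C. proj k ` C) ` X"
  have X': "cell_decomposition D q k ?X" using X by simp
  obtain B where B: "B \<in> ?X" "open_in_Rn k B" "B \<inter> U \<noteq> {}" using open_meets_open_cell[OF q X' U] by blast
  define gr where "gr C = (SOME f. graph_cell D q k C f)" for C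
  let ?G = "{C \<in> X. proj k ` C = B \<and> (\<exists>f. graph_cell D q k C f)}"
  have gr: "graph_cell D q k C (gr C)" if "C \<in> ?G" for C
    unfolding gr_def by (rule someI_ex[of "graph_cell D q k C"]) (use that in blast)
  have CR: "C \<subseteq> Rn (Suc k)" if "C \<in> X" for C using cell_subset_Rn[OF cell_decompositionD(3)[OF X that]] .
  have fin: "finite (gr ` ?G)" using cell_decompositionD(1)[OF X] by auto
  have ext: "C11_ext k B f" if "f \<in> gr ` ?G" for f
  proof -
    obtain C where C: "C \<in> ?G" "f = gr C" using \<open>f \<in> gr ` ?G\<close> by blast
    then show ?thesis using gr[OF C(1)] Cq_on_C11_ext[OF q] by (auto simp: graph_cell_def cell_function_def)
  qed
  have BU: "open_in_Rn k (B \<inter> U)" using B(2) U(1) unfolding open_in_Rn_def by (rule openin_Int)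
  have "\<exists>a \<rho> \<eta>. 0 < \<rho> \<and> 0 < \<eta> \<and> a \<in> Rn k \<and> ball a \<rho> \<inter> Rn k \<subseteq> B \<inter> U \<and>
    (\<forall>f\<in>gr ` ?G. \<forall>x\<in>ball a \<rho> \<inter> Rn k. f x \<le> 0 \<or> \<eta> \<le> f x)"
    by (rule finite_positive_gap[OF fin ext B(2) BU B(3)]) auto
  then obtain a \<rho> \<eta> where aa: "0 < \<rho> \<and> 0 < \<eta> \<and> a \<in> Rn k \<and> ball a \<rho> \<inter> Rn k \<subseteq> B \<inter> U \<and>
    (\<forall>f\<in>gr ` ?G. \<forall>x\<in>ball a \<rho> \<inter> Rn k. f x \<le> 0 \<or> \<eta> \<le> f x)" by (elim exE)
  then have a: "0 < \<rho>" "0 < \<eta>" "a \<in> Rn k" "ball a \<rho> \<inter> Rn k \<subseteq> B \<inter> U" by (simp_all only: simp_thms)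
  have a5: "gr C x \<le> 0 \<or> \<eta> \<le> gr C x" if "C \<in> ?G" "x \<in> ball a \<rho> \<inter> Rn k" for C x using aa that by blast
  define W where "W = {over k x t | x t. x \<in> ball a \<rho> \<inter> Rn k \<and> 0 < t \<and> t < \<eta>}"
  have conn: "connected W"
  proof -
    have "connected ((\<lambda>p. over k (fst p) (snd p)) ` ((ball a \<rho> \<inter> Rn k) \<times> {0<..<\<eta>}))"
    proof (rule connected_continuous_image)
      show "continuous_on ((ball a \<rho> \<inter> Rn k) \<times> {0<..<\<eta>}) (\<lambda>p. over k (fst p) (snd p))"
        unfolding over_def by (intro continuous_intros)
      show "connected ((ball a \<rho> \<inter> Rn k) \<times> {0<..<\<eta>})"
        by (intro connected_Times convex_connected convex_ball_Rn) auto
    qed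
    moreover have "(\<lambda>p. over k (fst p) (snd p)) ` ((ball a \<rho> \<inter> Rn k) \<times> {0<..<\<eta>}) = W"
      unfolding W_def by force
    ultimately show ?thesis by simp
  qed
  let ?O = "{C \<in> X. open_in_Rn (Suc k) C}"
  have cov: "\<exists>C\<in>?O. w \<in> C" if wW: "w \<in> W" for w
  proof -
    obtain x t where x: "x \<in> ball a \<rho> \<inter> Rn k" "0 < t" "t < \<eta>" "w = over k x t"
      using wW unfolding W_def by blast
    have xR: "x \<in> Rn k" using x by blast
    obtain C where C: "C \<in> X" "w \<in> C"
      by (rule cell_decomposition_cover[OF X, of w]) (use x(4) over_in_Rn[OF xR] in auto)
    have "proj k w \<in> proj k ` C" using C(2) by blast
    moreover have "x \<in> B" using x a(4) by blast
    ultimately have pB: "proj k ` C = B"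
      using cell_decomposition_unique[OF X' _ B(1), of "proj k ` C" x] C(1) xR x(4) by auto
    have "\<not> graph_cell D q k C f" for f
    proof
      assume "graph_cell D q k C f"
      then have CG: "C \<in> ?G" using C pB by blast
      have "t = gr C x" using graph_cell_coord[OF gr[OF CG] CR[OF C(1)] C(2)] xR x(4) by simp
      moreover have "gr C x \<le> 0 \<or> \<eta> \<le> gr C x" by (rule a5[OF CG x(1)])
      ultimately show False using x(2,3) by linarith
    qed
    then have "open_in_Rn (Suc k) C"
      using cell_Suc(2)[OF cell_decompositionD(3)[OF X C(1)]] band_cell_open[OF q] B(2) pB by blast
    then show ?thesis using C by blast
  qed
  have a0: "over k a (\<eta> / 2) \<in> W" unfolding W_def using a(1-3) by fastforce
  then obtain C where C: "C \<in> ?O" "over k a (\<eta> / 2) \<in> C" using cov by blast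
  have "W \<subseteq> C"
  proof (rule ccontr)
    assume nsub: "\<not> W \<subseteq> C"
    have WR: "W \<subseteq> Rn (Suc k)" unfolding W_def using over_in_Rn by blast
    have "openin (top_of_set (Rn (Suc k))) (\<Union>(?O - {C}))"
      by (rule openin_Union) (auto simp: open_in_Rn_def)
    then obtain T2 where T2: "open T2" "\<Union>(?O - {C}) = Rn (Suc k) \<inter> T2" by (auto simp: openin_open)
    obtain T1 where T1: "open T1" "C = Rn (Suc k) \<inter> T1" using C(1) by (auto simp: openin_open open_in_Rn_def)
    have "C' = C" if "C' \<in> X" "x \<in> C" "x \<in> C'" for C' x
      using C(1) cell_decomposition_unique[OF X that(1) _ that(3), of C] that(2) by simp
    then have disj: "C \<inter> \<Union>(?O - {C}) = {}" by blast
    have "W \<subseteq> T1 \<union> T2" using cov T1(2) T2(2) by blast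
    moreover have "T1 \<inter> T2 \<inter> W = {}" using disj T1(2) T2(2) WR by blast
    ultimately have "T1 \<inter> W = {} \<or> T2 \<inter> W = {}" using connectedD[OF conn T1(1) T2(1)] by blast
    moreover have "T1 \<inter> W \<noteq> {}" using C(2) a0 T1(2) by blast
    moreover have "T2 \<inter> W \<noteq> {}" using nsub cov T2(2) by blast
    ultimately show False by blast
  qed
  then have in_C: "over k x t \<in> C" if "x \<in> ball a \<rho> \<inter> Rn k" "0 < t" "t < \<eta>" for x t
    using that unfolding W_def by blast
  have CX: "C \<in> X" using C(1) by blast
  show ?thesis
    by (rule exI[of _ a], rule exI[of _ \<rho>], rule exI[of _ \<eta>], rule exI[of _ C])
       (use a CX in_C in blast)
qed

text \<open>
  A one-sided neighbourhood, in \<open>R^k \<times> R\<close>, of a ball in the boundary \<open>t = 0\<close>.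
\<close>

definition slab :: "nat \<Rightarrow> rvec \<Rightarrow> real \<Rightarrow> real \<Rightarrow> rvec set" where
  "slab k a \<rho> \<eta> = {w \<in> Rn (Suc k). norm (proj k w - a) < \<rho> \<and> 0 < coord w k \<and> coord w k < \<eta>}"

lemma over_in_slab: "x \<in> Rn k \<Longrightarrow> over k x t \<in> slab k a \<rho> \<eta> \<longleftrightarrow> norm (x - a) < \<rho> \<and> 0 < t \<and> t < \<eta>"
  by (simp add: slab_def over_in_Rn)

lemma slabE:
  assumes "w \<in> slab k a \<rho> \<eta>"
  obtains x t where "w = over k x t" "x \<in> Rn k" "norm (x - a) < \<rho>" "0 < t" "t < \<eta>"
  using assms over_proj[of w k] that[of "proj k w" "coord w k"] by (auto simp: slab_def)

lemma open_slab: "open_in_Rn (Suc k) (slab k a \<rho> \<eta>)"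
proof -
  let ?T = "{w. norm (proj k w - a) < \<rho>} \<inter> {w. 0 < coord w k} \<inter> {w. coord w k < \<eta>}"
  have "open ?T"
    by (intro open_Int open_Collect_less continuous_intros)
  moreover have "slab k a \<rho> \<eta> = ?T \<inter> Rn (Suc k)" by (auto simp: slab_def)
  ultimately show ?thesis by (simp add: open_in_Rn_Int_open)
qed

lemma C11_loc_ext_compose:
  assumes W: "W \<subseteq> Rn m" and s: "C11_loc m W s" and sC: "s ` W \<subseteq> C" and C: "C \<subseteq> Rn N" and h: "C11_ext N C h"
  shows "C11_loc m W (\<lambda>x. over N (s x) (h (s x)))"
  unfolding C11_loc_def
proof
  fix a assume a: "a \<in> W"
  obtain r G K where r: "r > 0" "ball a r \<inter> Rn m \<subseteq> W" "C11 (ball a r \<inter> Rn m) s G K"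
    using s a unfolding C11_loc_def by blast
  have K: "K > 0" using r(3) by (simp add: C11_def)
  have sa: "s a \<in> C" using a sC by blast
  obtain r' F G' K' where r': "r' > 0" "C11 (ball (s a) r' \<inter> Rn N) F G' K'" "\<forall>y\<in>C \<inter> (ball (s a) r' \<inter> Rn N). F y = h y"
    using h sa unfolding C11_ext_def by auto
  define \<rho> where "\<rho> = min r (r' / K)"
  have \<rho>: "\<rho> > 0" using r(1) r'(1) K by (simp add: \<rho>_def)
  let ?S = "ball a \<rho> \<inter> Rn m"
  have sub: "?S \<subseteq> ball a r \<inter> Rn m" by (auto simp: \<rho>_def)
  have c: "C11 ?S s G K" by (rule C11_subset[OF r(3) sub order_refl])
  have aS: "a \<in> ?S" using a W \<rho> by auto
  have im: "s x \<in> C \<and> s x \<in> ball (s a) r' \<inter> Rn N" if x: "x \<in> ?S" for x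
  proof -
    have "s x \<in> C" using x sub r(2) sC by blast
    have "norm (s a - s x) \<le> K * norm (a - x)" by (rule C11_lipschitz[OF c convex_ball_Rn aS x])
    also have "\<dots> < K * \<rho>" using x K by (intro mult_strict_left_mono) (auto simp: dist_norm)
    also have "\<dots> \<le> K * (r' / K)" using K by (intro mult_left_mono) (auto simp: \<rho>_def)
    also have "\<dots> = r'" using K by simp
    finally show ?thesis using \<open>s x \<in> C\<close> C by (auto simp: dist_norm)
  qed
  have comp: "C11 ?S (\<lambda>x. F (s x)) (\<lambda>x v. G' (s x) (G x v)) (K' * K * (K + 1))"
    by (rule C11_compose[OF r'(2) c convex_ball_Rn]) (use im in blast)
  obtain L where "C11 ?S (\<lambda>x. F (s x) *\<^sub>R ax N) (\<lambda>x v. G' (s x) (G x v) *\<^sub>R ax N) L"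
    using C11_bounded_linear[OF bounded_linear_scaleR_left comp] by blast
  from C11_add[OF c this]
  have "C11 ?S (\<lambda>x. over N (s x) (h (s x))) (\<lambda>x v. G x v + G' (s x) (G x v) *\<^sub>R ax N) (K + L)"
    by (rule C11_cong) (use im r'(3) in \<open>auto simp: over_def\<close>)
  then show "\<exists>r>0. \<exists>G K. ball a r \<inter> Rn m \<subseteq> W \<and> C11 (ball a r \<inter> Rn m) (\<lambda>x. over N (s x) (h (s x))) G K"
    using \<rho> sub r(2) by blast
qed

context o_minimal_structure
begin

lemma dvec_over:
  assumes p: "dvec M N p" and t: "dfun M t"
  shows "dvec M (Suc N) (\<lambda>z. over N (p z) (t z))"
  unfolding dvec_def
proof (intro conjI ballI allI impI)
  have pR: "p z \<in> Rn N" if "z \<in> Rn M" for z using p that by (simp add: dvec_def)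
  then show "over N (p z) (t z) \<in> Rn (Suc N)" if "z \<in> Rn M" for z using that over_in_Rn by blast
  fix i assume "i < Suc N"
  then show "dfun M (\<lambda>z. coord (over N (p z) (t z)) i)"
    using t dvec_coord[OF p, of i] dfun_cong[of M "\<lambda>z. coord (over N (p z) (t z)) i" "\<lambda>z. if i = N then t z else coord (p z) i"] pR
    by (cases "i = N") (auto simp: coord_over)
qed

lemma over_mem_graph_iff:
  assumes "B \<subseteq> Rn N" "x \<in> B"
  shows "over N x t \<in> {y + f y *\<^sub>R ax N | y. y \<in> B} \<longleftrightarrow> t = f x"
proof
  assume "over N x t \<in> {y + f y *\<^sub>R ax N | y. y \<in> B}"
  then obtain y where y: "over N x t = over N y (f y)" "y \<in> B" by (auto simp: over_def)
  have "proj N (over N x t) = proj N (over N y (f y))" "coord (over N x t) N = coord (over N y (f y)) N" using y(1) by simp_all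
  then show "t = f x" using assms y(2) by (auto simp: subset_iff)
qed (use assms in \<open>auto simp: over_def\<close>)

lemma definable_mean:
  assumes B: "B \<subseteq> Rn N" and f: "cell_function D q N B f" and g: "cell_function D q N B g"
  shows "\<exists>R. dfn (Suc N) R \<and> (\<forall>x\<in>B. \<forall>t. R (over N x t) \<longleftrightarrow> t = 1/2 * f x + 1/2 * g x + c)"
proof -
  let ?F = "{y + f y *\<^sub>R ax N | y. y \<in> B}" and ?G = "{y + g y *\<^sub>R ax N | y. y \<in> B}"
  have F: "?F \<in> D (Suc N)" and G: "?G \<in> D (Suc N)" using f g by (simp_all add: cell_function_def)
  have pr: "dvec (Suc N) N (proj N)" by (rule dvec_proj) simp
  have "dfn (Suc N) (\<lambda>z. \<exists>s. \<exists>u. over N (proj N z) s \<in> ?F \<and> over N (proj N z) u \<in> ?G \<and> coord z N = 1/2 * s + 1/2 * u + c)"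
    by (rule dfn_rules dvec_over dfn_subst[OF dfn_mem[OF F]] dfn_subst[OF dfn_mem[OF G]] | (simp; fail))+
  moreover have "(\<exists>s. \<exists>u. over N (proj N (over N x t)) s \<in> ?F \<and> over N (proj N (over N x t)) u \<in> ?G \<and>
      coord (over N x t) N = 1/2 * s + 1/2 * u + c) \<longleftrightarrow> t = 1/2 * f x + 1/2 * g x + c" if x: "x \<in> B" for x t
  proof -
    have xR: "x \<in> Rn N" using x B by blast
    show ?thesis unfolding proj_over[OF xR] coord_over_top[OF xR] over_mem_graph_iff[OF B x] by blast
  qed
  ultimately show ?thesis by blast
qed

text \<open>
  The fibre of a cell is a point or an open interval. The chosen point is the middle of the interval
  if it is bounded, a point at distance \<open>1\<close> from its end if it is a half-line, and \<open>0\<close> if it is the line.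
\<close>

lemma cell_choice:
  assumes q: "at_least_C2 q" and C: "(\<exists>f. graph_cell D q N C f) \<or> (\<exists>F G. band_cell D q N C F G)"
  shows "\<exists>h R. C11_ext N (proj N ` C) h \<and> (\<forall>x\<in>proj N ` C. over N x (h x) \<in> C) \<and>
    dfn (Suc N) R \<and> (\<forall>x\<in>proj N ` C. \<forall>t. R (over N x t) \<longleftrightarrow> t = h x)"
proof -
  let ?B = "proj N ` C"
  have B: "?B \<subseteq> Rn N" by auto
  have mean: ?thesis if f: "cell_function D q N ?B f" and g: "cell_function D q N ?B g"
    and h: "\<And>x. x \<in> ?B \<Longrightarrow> over N x (1/2 * f x + 1/2 * g x + c) \<in> C" for f g c
  proof -
    obtain R where R: "dfn (Suc N) R" "\<forall>x\<in>?B. \<forall>t. R (over N x t) \<longleftrightarrow> t = 1/2 * f x + 1/2 * g x + c"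
      using definable_mean[OF B f g, of c] by blast
    have "C11_ext N ?B (\<lambda>x. 1/2 * f x + 1/2 * g x)"
      using f g Cq_on_C11_ext[OF q] by (intro C11_ext_lincomb) (auto simp: cell_function_def)
    from C11_ext_lincomb[OF this C11_ext_const[of N ?B c], of 1 1]
    have "C11_ext N ?B (\<lambda>x. 1/2 * f x + 1/2 * g x + c)" by simp
    then show ?thesis using R h by blast
  qed
  show ?thesis
  proof (cases "\<exists>f. graph_cell D q N C f")
    case True
    then obtain f where f: "cell_function D q N ?B f" "C = {over N x (f x) | x. x \<in> ?B}" unfolding graph_cell_def by blast
    have "over N x (1/2 * f x + 1/2 * f x + 0) \<in> C" if "x \<in> ?B" for x
    proof -
      have "over N x (f x) \<in> {over N x (f x) | x. x \<in> ?B}" using that by blast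
      then show ?thesis using f(2) by simp
    qed
    then show ?thesis by (rule mean[OF f(1) f(1)])
  next
    case False
    then obtain F G where b: "cell_bound D q N ?B (-\<infinity>) F" "cell_bound D q N ?B \<infinity> G" "\<forall>x\<in>?B. F x < G x"
      "C = {over N x t | x t. x \<in> ?B \<and> F x < ereal t \<and> ereal t < G x}" using C unfolding band_cell_def by blast
    have mem: "over N x t \<in> C" if "x \<in> ?B" "F x < ereal t" "ereal t < G x" for x t
    proof -
      have "over N x t \<in> {over N x t | x t. x \<in> ?B \<and> F x < ereal t \<and> ereal t < G x}" using that by blast
      then show ?thesis using b(4) by simp
    qed
    consider "\<forall>x\<in>?B. F x = -\<infinity>" "\<forall>x\<in>?B. G x = \<infinity>"
      | f where "cell_function D q N ?B f" "\<forall>x\<in>?B. F x = ereal (f x)" "\<forall>x\<in>?B. G x = \<infinity>"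
      | g where "\<forall>x\<in>?B. F x = -\<infinity>" "cell_function D q N ?B g" "\<forall>x\<in>?B. G x = ereal (g x)"
      | f g where "cell_function D q N ?B f" "\<forall>x\<in>?B. F x = ereal (f x)" "cell_function D q N ?B g" "\<forall>x\<in>?B. G x = ereal (g x)"
      using b(1,2) unfolding cell_bound_def by blast
    then show ?thesis
    proof cases
      case 1
      have d: "dfn (Suc N) (\<lambda>z. coord z N = 0)" by (intro dfn_eq dfun_coord dfun_const) simp
      have "\<forall>x\<in>?B. over N x 0 \<in> C" using 1 mem by simp
      moreover have "\<forall>x\<in>?B. \<forall>t. coord (over N x t) N = 0 \<longleftrightarrow> t = 0" using B by (simp add: subset_iff)
      ultimately show ?thesis using d C11_ext_const[of N ?B 0]
        by (intro exI[of _ "\<lambda>_. 0"] exI[of _ "\<lambda>z. coord z N = 0"] conjI)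
    next
      case (2 f)
      show ?thesis
      proof (rule mean[OF 2(1) 2(1), of 1], rule mem)
        fix x assume x: "x \<in> ?B"
        show "F x < ereal (1/2 * f x + 1/2 * f x + 1)" "ereal (1/2 * f x + 1/2 * f x + 1) < G x"
          using bspec[OF 2(2) x] bspec[OF 2(3) x] by simp_all
      qed
    next
      case (3 g)
      show ?thesis
      proof (rule mean[OF 3(2) 3(2), of "-1"], rule mem)
        fix x assume x: "x \<in> ?B"
        show "F x < ereal (1/2 * g x + 1/2 * g x + - 1)" "ereal (1/2 * g x + 1/2 * g x + - 1) < G x"
          using bspec[OF 3(1) x] bspec[OF 3(3) x] by simp_all
      qed
    next
      case (4 f g)
      show ?thesis
      proof (rule mean[OF 4(1) 4(3), of 0], rule mem)
        fix x assume x: "x \<in> ?B"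
        show "F x < ereal (1/2 * f x + 1/2 * g x + 0)" "ereal (1/2 * f x + 1/2 * g x + 0) < G x"
          using bspec[OF 4(2) x] bspec[OF 4(4) x] bspec[OF b(3) x] by simp_all
      qed
    qed
  qed
qed

text \<open>
  Induction on the number \<open>j\<close> of coordinates to be chosen, each one by \<open>cell_choice\<close>.
\<close>

lemma cell_section:
  assumes q: "at_least_C2 q" and W: "open_in_Rn m W" "W \<in> D m"
  shows "cell D q (m + j) C \<Longrightarrow> W \<subseteq> proj m ` C \<Longrightarrow>
    \<exists>s. (\<forall>x\<in>W. s x \<in> C \<and> proj m (s x) = x) \<and> C11_loc m W s \<and> s ` W \<in> D (m + j)"
proof (induction j arbitrary: C)
  case 0
  have WR: "W \<subseteq> Rn m" by (rule open_in_Rn_subset[OF W(1)])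
  have "proj m ` C = C" using cell_subset_Rn[of D q m C] 0(1) proj_Rn by force
  moreover have "C11_loc m W (\<lambda>x. x)" unfolding C11_loc_def
    using open_in_Rn_ball[OF W(1)] C11_ident by metis
  ultimately show ?case using 0 W(2) WR by (intro exI[of _ "\<lambda>x. x"]) (auto simp: proj_Rn subset_iff)
next
  case (Suc j)
  let ?N = "m + j" and ?C = "proj (m + j) ` C"
  have WR: "W \<subseteq> Rn m" by (rule open_in_Rn_subset[OF W(1)])
  have cC: "cell D q (Suc ?N) C" using Suc.prems(1) by simp
  have CR: "?C \<subseteq> Rn ?N" by auto
  have "W \<subseteq> proj m ` ?C" using Suc.prems(2) by (simp add: image_image)
  then obtain s where s: "\<forall>x\<in>W. s x \<in> ?C \<and> proj m (s x) = x" "C11_loc m W s" "s ` W \<in> D ?N"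
    using Suc.IH[OF cell_Suc(1)[OF cC]] by blast
  obtain h R where h: "C11_ext ?N ?C h" "\<forall>x\<in>?C. over ?N x (h x) \<in> C" "dfn (Suc ?N) R"
    "\<forall>x\<in>?C. \<forall>t. R (over ?N x t) \<longleftrightarrow> t = h x" using cell_choice[OF q cell_Suc(2)[OF cC]] by blast
  let ?s = "\<lambda>x. over ?N (s x) (h (s x))"
  have sC: "s ` W \<subseteq> ?C" using s(1) by blast
  have sR: "s x \<in> Rn ?N" if "x \<in> W" for x using s(1) that CR by blast
  have 1: "?s x \<in> C \<and> proj m (?s x) = x" if x: "x \<in> W" for x
  proof -
    have "proj m (?s x) = proj m (proj ?N (?s x))" by simp
    also have "\<dots> = x" using s(1) x sR[OF x] by simp
    finally show ?thesis using s(1) h(2) x by blast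
  qed
  have 2: "C11_loc m W ?s" by (rule C11_loc_ext_compose[OF WR s(2) sC CR h(1)])
  have pr: "dvec (Suc ?N) ?N (proj ?N)" by (rule dvec_proj) simp
  have d: "dfn (Suc ?N) (\<lambda>z. proj ?N z \<in> s ` W \<and> R z)"
    by (rule dfn_conj[OF dfn_subst[OF dfn_mem[OF s(3)] pr] h(3)])
  have "dfn (Suc ?N) (\<lambda>z. z \<in> ?s ` W)"
  proof (rule dfn_eqI[OF d])
    fix z assume z: "z \<in> Rn (Suc ?N)"
    show "(proj ?N z \<in> s ` W \<and> R z) \<longleftrightarrow> z \<in> ?s ` W"
    proof
      assume a: "proj ?N z \<in> s ` W \<and> R z"
      then obtain x where x: "x \<in> W" "proj ?N z = s x" by blast
      have "R (over ?N (s x) (coord z ?N))" using a over_proj[OF z] x(2) by simp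
      then have "coord z ?N = h (s x)" using h(4) s(1) x(1) by blast
      then have "z = ?s x" using over_proj[OF z] x(2) by simp
      then show "z \<in> ?s ` W" using x(1) by blast
    next
      assume "z \<in> ?s ` W"
      then obtain x where x: "x \<in> W" "z = ?s x" by blast
      have "s x \<in> ?C" using s(1) x(1) by blast
      with h(4) have "R (over ?N (s x) (h (s x)))" by blast
      then show "proj ?N z \<in> s ` W \<and> R z" using x sR[OF x(1)] by simp
    qed
  qed
  then have "?s ` W \<in> D (Suc ?N)" by (rule dfn_set) (use sR over_in_Rn in blast)
  then show ?case using 1 2 by (intro exI[of _ ?s]) auto
qed

lemma slab_definable: "a \<in> Rn k \<Longrightarrow> slab k a \<rho> \<eta> \<in> D (Suc k)"
proof -
  assume a: "a \<in> Rn k"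
  have "dfn (Suc k) (\<lambda>w. norm (proj k w - a) < \<rho> \<and> 0 < coord w k \<and> coord w k < \<eta>)"
    by (rule dfn_rules dvec_const[OF a] | (simp; fail))+
  then show ?thesis by (simp add: dfn_def slab_def)
qed

text \<open>
  Definable choice with a \<open>C11\<close> choice function, over a slab that is small enough to lie in one cell \<open>B\<close>
  of the projection of a decomposition compatible with \<open>Y\<close>. Either a cell inside \<open>Y\<close> lies over \<open>B\<close> and
  \<open>cell_section\<close> applies, or no point of \<open>Y\<close> lies over \<open>B\<close>.
\<close>

lemma definable_choice:
  assumes q: "at_least_C2 q" and adm: "admits_cell_decompositions D q" and Y: "Y \<in> D (Suc k + j)"
    and U: "open_in_Rn k U" "U \<noteq> {}"
  obtains a \<rho> \<eta> where "0 < \<rho>" "0 < \<eta>" "a \<in> Rn k" "ball a \<rho> \<inter> Rn k \<subseteq> U"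
    "(\<forall>z\<in>Y. proj (Suc k) z \<notin> slab k a \<rho> \<eta>) \<or>
     (\<exists>s. (\<forall>w\<in>slab k a \<rho> \<eta>. s w \<in> Y \<and> proj (Suc k) (s w) = w) \<and>
       C11_loc (Suc k) (slab k a \<rho> \<eta>) s \<and> s ` slab k a \<rho> \<eta> \<in> D (Suc k + j))"
proof -
  have "finite {Y} \<and> {Y} \<subseteq> D (Suc k + j)" using Y by simp
  then obtain X where X: "cell_decomposition D q (Suc k + j) X" "\<forall>A\<in>{Y}. \<forall>C\<in>X. C \<subseteq> A \<or> C \<inter> A = {}"
    using adm[unfolded admits_cell_decompositions_def, rule_format, OF \<open>finite {Y} \<and> {Y} \<subseteq> D (Suc k + j)\<close>]
    by (elim exE conjE) (rule that)
  let ?X = "(\<lambda>C. proj (Suc k) ` C) ` X"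
  have X1: "cell_decomposition D q (Suc k) ?X" by (rule cell_decomposition_proj[OF X(1)])
  obtain a \<rho> \<eta> B where a: "0 < \<rho>" "0 < \<eta>" "a \<in> Rn k" "ball a \<rho> \<inter> Rn k \<subseteq> U" and B: "B \<in> ?X"
    "\<forall>x\<in>ball a \<rho> \<inter> Rn k. \<forall>t. 0 < t \<and> t < \<eta> \<longrightarrow> over k x t \<in> B"
  proof -
    have "\<exists>a \<rho> \<eta> B. 0 < \<rho> \<and> 0 < \<eta> \<and> a \<in> Rn k \<and> ball a \<rho> \<inter> Rn k \<subseteq> U \<and> B \<in> ?X \<and>
      (\<forall>x\<in>ball a \<rho> \<inter> Rn k. \<forall>t. 0 < t \<and> t < \<eta> \<longrightarrow> over k x t \<in> B)"
      by (rule slab_in_cell[OF q X1 U])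
    then show ?thesis by (elim exE conjE) (rule that)
  qed
  let ?S = "slab k a \<rho> \<eta>"
  have SB: "?S \<subseteq> B"
  proof
    fix w assume "w \<in> ?S"
    then obtain x t where "w = over k x t" "x \<in> Rn k" "norm (x - a) < \<rho>" "0 < t" "t < \<eta>" by (rule slabE)
    then show "w \<in> B" using B(2) by (auto simp: dist_norm norm_minus_commute)
  qed
  show ?thesis
  proof (rule that[OF a])
    show "(\<forall>z\<in>Y. proj (Suc k) z \<notin> ?S) \<or> (\<exists>s. (\<forall>w\<in>?S. s w \<in> Y \<and> proj (Suc k) (s w) = w) \<and>
       C11_loc (Suc k) ?S s \<and> s ` ?S \<in> D (Suc k + j))"
    proof (cases "\<exists>C\<in>X. proj (Suc k) ` C = B \<and> C \<inter> Y \<noteq> {}")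
      case True
      then obtain C where C: "C \<in> X" "proj (Suc k) ` C = B" "C \<subseteq> Y" using X(2) by blast
      have "\<exists>s. (\<forall>w\<in>?S. s w \<in> C \<and> proj (Suc k) (s w) = w) \<and> C11_loc (Suc k) ?S s \<and> s ` ?S \<in> D (Suc k + j)"
        by (rule cell_section[OF q open_slab slab_definable[OF a(3)] cell_decompositionD(3)[OF X(1) C(1)]])
           (use C(2) SB in simp)
      then show ?thesis using C(3) by blast
    next
      case False
      have "proj (Suc k) z \<notin> ?S" if z: "z \<in> Y" for z
      proof
        assume zS: "proj (Suc k) z \<in> ?S"
        have "z \<in> Rn (Suc k + j)" using z subset_Rn[OF Y] by blast
        then obtain C where C: "C \<in> X" "z \<in> C" using cell_decomposition_cover[OF X(1)] by metis
        have "proj (Suc k) z \<in> proj (Suc k) ` C" using C(2) by blast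
        moreover have "proj (Suc k) z \<in> B" using zS SB by blast
        ultimately have "proj (Suc k) ` C = B" using cell_decomposition_unique[OF X1 _ B(1)] C(1) by blast
        then show False using False C z by blast
      qed
      then show ?thesis by blast
    qed
  qed
qed

text \<open>
  O-minimality in \<open>t\<close>, uniformly in \<open>x\<close>: near \<open>t = 0\<close> and over some ball, a definable property of
  \<open>(x, t)\<close> holds always or never.
\<close>

lemma definable_germ:
  assumes q: "at_least_C2 q" and adm: "admits_cell_decompositions D q" and P: "dfn (Suc k) P"
    and U: "open_in_Rn k U" "U \<noteq> {}"
  obtains a \<rho> \<eta> where "0 < \<rho>" "0 < \<eta>" "a \<in> Rn k" "ball a \<rho> \<inter> Rn k \<subseteq> U"
    "(\<forall>w\<in>slab k a \<rho> \<eta>. \<not> P w) \<or> (\<forall>w\<in>slab k a \<rho> \<eta>. P w)"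
proof -
  let ?Y = "{w \<in> Rn (Suc k). P w}"
  have Y: "?Y \<in> D (Suc k + 0)" using P by (simp add: dfn_def)
  obtain a \<rho> \<eta> where a: "0 < \<rho>" "0 < \<eta>" "a \<in> Rn k" "ball a \<rho> \<inter> Rn k \<subseteq> U" and d:
    "(\<forall>z\<in>?Y. proj (Suc k) z \<notin> slab k a \<rho> \<eta>) \<or>
     (\<exists>s. (\<forall>w\<in>slab k a \<rho> \<eta>. s w \<in> ?Y \<and> proj (Suc k) (s w) = w) \<and>
       C11_loc (Suc k) (slab k a \<rho> \<eta>) s \<and> s ` slab k a \<rho> \<eta> \<in> D (Suc k + 0))"
    by (rule definable_choice[OF q adm Y U]) (rule that)
  have SR: "slab k a \<rho> \<eta> \<subseteq> Rn (Suc k)" by (auto simp: slab_def)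
  from d have "(\<forall>w\<in>slab k a \<rho> \<eta>. \<not> P w) \<or> (\<forall>w\<in>slab k a \<rho> \<eta>. P w)"
  proof
    assume e: "\<forall>z\<in>?Y. proj (Suc k) z \<notin> slab k a \<rho> \<eta>"
    have "\<not> P w" if w: "w \<in> slab k a \<rho> \<eta>" for w
    proof
      assume "P w"
      moreover have wR: "w \<in> Rn (Suc k)" using w SR by blast
      ultimately have "proj (Suc k) w \<notin> slab k a \<rho> \<eta>" using e by blast
      then show False using w proj_Rn[OF wR] by simp
    qed
    then show ?thesis by blast
  next
    assume "\<exists>s. (\<forall>w\<in>slab k a \<rho> \<eta>. s w \<in> ?Y \<and> proj (Suc k) (s w) = w) \<and>
       C11_loc (Suc k) (slab k a \<rho> \<eta>) s \<and> s ` slab k a \<rho> \<eta> \<in> D (Suc k + 0)"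
    then obtain s where s: "\<forall>w\<in>slab k a \<rho> \<eta>. s w \<in> ?Y \<and> proj (Suc k) (s w) = w" by blast
    have "P w" if w: "w \<in> slab k a \<rho> \<eta>" for w
    proof -
      have "s w \<in> ?Y" "proj (Suc k) (s w) = w" using s w by blast+
      then show "P w" using proj_Rn[of "s w" "Suc k"] by simp
    qed
    then show ?thesis by blast
  qed
  with a show ?thesis by (rule that)
qed

end

section \<open>A derivative estimate near the boundary\<close>

lemma C11_loc_continuous_on:
  assumes W: "W \<subseteq> Rn n" and s: "C11_loc n W s"
  shows "continuous_on W s"
  unfolding continuous_on_eq_continuous_within
proof
  fix a assume a: "a \<in> W"
  obtain r G K where r: "r > 0" "ball a r \<inter> Rn n \<subseteq> W" "C11 (ball a r \<inter> Rn n) s G K"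
    using s a unfolding C11_loc_def by blast
  have "a \<in> ball a r \<inter> Rn n" using a W r(1) by auto
  then have "continuous (at a within ball a r \<inter> Rn n) s"
    using C11_continuous_on[OF r(3)] by (simp add: continuous_on_eq_continuous_within)
  moreover have "at a within W = at a within (ball a r \<inter> Rn n)"
    by (rule at_within_nhd[of a "ball a r"]) (use r W in auto)
  ultimately show "continuous (at a within W) s" by simp
qed

lemma centre_in_ball_Rn: "b \<in> Rn k \<Longrightarrow> 0 < r \<Longrightarrow> b \<in> ball b r \<inter> Rn k"
  by simp

lemma over_shift: "over k (x + h *\<^sub>R v) t = over k x t + h *\<^sub>R v"
  by (simp add: over_def)

context o_minimal_structure
begin

text \<open>
  Let \<open>r (x, t)\<close> be definable with \<open>\<bar>r (x, t)\<bar> \<le> t\<close>. Then a partial derivative in a direction of \<open>x\<close>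
  is bounded by \<open>C * t\<close> over a suitable ball. Otherwise, by o-minimality, for \<open>x\<close> in some ball and every
  small \<open>s > 0\<close> its absolute value is at least \<open>t / s\<close> for all \<open>t < \<sigma> (x, s)\<close>, where \<open>\<sigma>\<close> can be chosen
  positive and continuous, the ball being independent of \<open>s\<close>. On a segment of length \<open>l\<close> in this ball \<open>\<sigma>\<close> has a
  positive minimum. For \<open>t\<close> below it, the mean value theorem gives \<open>l * t / s \<le> 2 * t\<close>, which is
  false for small \<open>s\<close>.
\<close>

lemma derivative_bound:
  assumes q: "at_least_C2 q" and adm: "admits_cell_decompositions D q" and i: "i < k"
    and a: "a \<in> Rn k" "0 < \<rho>" "0 < \<eta>"
    and R: "dfn (Suc (Suc k)) R" "\<And>w t. w \<in> slab k a \<rho> \<eta> \<Longrightarrow> R (over (Suc k) w t) \<longleftrightarrow> t = r w"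
    and bd: "\<And>w. w \<in> slab k a \<rho> \<eta> \<Longrightarrow> \<bar>r w\<bar> \<le> coord w k"
    and der: "\<And>w. w \<in> slab k a \<rho> \<eta> \<Longrightarrow> ((\<lambda>h. r (w + h *\<^sub>R ax i)) has_real_derivative r' w) (at 0)"
  obtains a' \<rho>' \<eta>' C where "0 < \<rho>'" "0 < \<eta>'" "\<eta>' \<le> \<eta>" "0 < C" "a' \<in> Rn k" "ball a' \<rho>' \<inter> Rn k \<subseteq> ball a \<rho> \<inter> Rn k"
    "\<And>w. w \<in> slab k a' \<rho>' \<eta>' \<Longrightarrow> \<bar>r' w\<bar> \<le> C * coord w k"
proof -
  \<comment> \<open>\<open>Th x t s\<close> is implied by \<open>\<bar>r' (x, t)\<bar> * s < t\<close> and implies \<open>\<bar>r' (x, t)\<bar> * s \<le> t\<close>; it is stated by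
    difference quotients because the derivative itself is not given by a formula\<close>
  define Th where "Th x t s \<longleftrightarrow> (\<exists>d. 0 < d \<and> (\<forall>h. 0 < h \<and> h < d \<longrightarrow> (\<exists>u. \<exists>v.
      R (over (Suc k) (over k (x + h *\<^sub>R ax i) t) u) \<and> R (over (Suc k) (over k x t) v) \<and>
      (u - v) * s \<le> t * h \<and> (v - u) * s \<le> t * h)))" for x t s
  have axi: "ax i \<in> Rn k" using i by simp
  have dTh: "dfn M (\<lambda>z. Th (p z) (t z) (s z))" if "dvec M k p" "dfun M t" "dfun M s" for M p t s
    unfolding Th_def
    by (rule that dfn_rules dvec_over dvec_const[OF axi] dfn_subst[OF R(1)] | (simp; fail))+
  have inB: "x \<in> ball a \<rho> \<inter> Rn k \<longleftrightarrow> norm (x - a) < \<rho> \<and> x \<in> Rn k" for x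
    by (auto simp: dist_norm norm_minus_commute)
  have near: "\<exists>d>0. \<forall>h. 0 < h \<and> h < d \<longrightarrow> over k (x + h *\<^sub>R ax i) t \<in> slab k a \<rho> \<eta>"
    if x: "x \<in> ball a \<rho> \<inter> Rn k" "0 < t" "t < \<eta>" for x t
  proof (intro exI[of _ "\<rho> - norm (x - a)"] conjI allI impI)
    show "0 < \<rho> - norm (x - a)" using x(1) inB by auto
    fix h assume h: "0 < h \<and> h < \<rho> - norm (x - a)"
    have "norm (x + h *\<^sub>R ax i - a) \<le> norm (x - a) + norm (h *\<^sub>R ax i)"
      using norm_triangle_ineq[of "x - a" "h *\<^sub>R ax i"] by (simp add: algebra_simps)
    then have "norm (x + h *\<^sub>R ax i - a) < \<rho>" using h by simp
    moreover have "x + h *\<^sub>R ax i \<in> Rn k" using x(1) axi by (intro Rn_add Rn_scale) auto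
    ultimately show "over k (x + h *\<^sub>R ax i) t \<in> slab k a \<rho> \<eta>" using x over_in_slab by blast
  qed
  have Th_le: "\<bar>r' (over k x t)\<bar> * s \<le> t" if x: "x \<in> ball a \<rho> \<inter> Rn k" "0 < t" "t < \<eta>" and s: "0 < s" and T: "Th x t s" for x t s
  proof -
    let ?w = "over k x t"
    have w: "?w \<in> slab k a \<rho> \<eta>" using x inB over_in_slab by blast
    obtain d where d: "0 < d" "\<And>h. 0 < h \<and> h < d \<Longrightarrow> \<exists>u. \<exists>v.
      R (over (Suc k) (over k (x + h *\<^sub>R ax i) t) u) \<and> R (over (Suc k) (over k x t) v) \<and>
      (u - v) * s \<le> t * h \<and> (v - u) * s \<le> t * h" using T unfolding Th_def by auto
    obtain d' where d': "0 < d'" "\<And>h. 0 < h \<and> h < d' \<Longrightarrow> over k (x + h *\<^sub>R ax i) t \<in> slab k a \<rho> \<eta>"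
      using near[OF x] by auto
    have lim: "((\<lambda>h. (r (?w + h *\<^sub>R ax i) - r ?w) / h) \<longlongrightarrow> r' ?w) (at_right 0)"
      using der[OF w] by (auto simp: DERIV_def intro: filterlim_mono[OF _ order_refl at_le])
    have "((\<lambda>h. \<bar>(r (?w + h *\<^sub>R ax i) - r ?w) / h\<bar> * s) \<longlongrightarrow> \<bar>r' ?w\<bar> * s) (at_right 0)"
      by (intro tendsto_intros lim)
    moreover have "\<forall>\<^sub>F h in at_right 0. \<bar>(r (?w + h *\<^sub>R ax i) - r ?w) / h\<bar> * s \<le> t"
      unfolding eventually_at_right_field
    proof (intro exI[of _ "min d d'"] conjI allI impI)
      fix h assume h: "0 < h" "h < min d d'"
      obtain u v where uv: "R (over (Suc k) (over k (x + h *\<^sub>R ax i) t) u)" "R (over (Suc k) (over k x t) v)"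
        "(u - v) * s \<le> t * h" "(v - u) * s \<le> t * h" using d(2)[of h] h by auto
      have "u = r (?w + h *\<^sub>R ax i)" "v = r ?w" using uv(1,2) R(2) w d'(2)[of h] h by (auto simp: over_shift[of k x h "ax i" t])
      then have "\<bar>r (?w + h *\<^sub>R ax i) - r ?w\<bar> * s \<le> t * h" using uv(3,4) by (auto simp: abs_if)
      then show "\<bar>(r (?w + h *\<^sub>R ax i) - r ?w) / h\<bar> * s \<le> t" using h by (simp add: abs_divide pos_divide_le_eq)
    qed (use d d' in auto)
    ultimately show ?thesis by (intro tendsto_upperbound[where F = "at_right (0::real)"]) auto
  qed
  have Th_if: "Th x t s" if x: "x \<in> ball a \<rho> \<inter> Rn k" "0 < t" "t < \<eta>" and s: "0 < s" and T: "\<bar>r' (over k x t)\<bar> * s < t" for x t s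
  proof -
    let ?w = "over k x t"
    have w: "?w \<in> slab k a \<rho> \<eta>" using x inB over_in_slab by blast
    obtain d' where d': "0 < d'" "\<And>h. 0 < h \<and> h < d' \<Longrightarrow> over k (x + h *\<^sub>R ax i) t \<in> slab k a \<rho> \<eta>"
      using near[OF x] by auto
    have lim: "((\<lambda>h. (r (?w + h *\<^sub>R ax i) - r ?w) / h) \<longlongrightarrow> r' ?w) (at_right 0)"
      using der[OF w] by (auto simp: DERIV_def intro: filterlim_mono[OF _ order_refl at_le])
    have "((\<lambda>h. \<bar>(r (?w + h *\<^sub>R ax i) - r ?w) / h\<bar> * s) \<longlongrightarrow> \<bar>r' ?w\<bar> * s) (at_right 0)"
      by (intro tendsto_intros lim)
    then have "\<forall>\<^sub>F h in at_right 0. \<bar>(r (?w + h *\<^sub>R ax i) - r ?w) / h\<bar> * s < t" using T by (rule order_tendstoD)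
    then obtain d where d: "0 < d" "\<And>h. 0 < h \<Longrightarrow> h < d \<Longrightarrow> \<bar>(r (?w + h *\<^sub>R ax i) - r ?w) / h\<bar> * s < t"
      unfolding eventually_at_right_field by auto
    show "Th x t s" unfolding Th_def
    proof (rule exI[of _ "min d d'"], intro conjI allI impI)
      fix h assume h: "0 < h \<and> h < min d d'"
      have "\<bar>r (?w + h *\<^sub>R ax i) - r ?w\<bar> * s \<le> t * h"
        using d(2)[of h] h by (simp add: abs_divide pos_divide_less_eq)
      moreover have "(r (?w + h *\<^sub>R ax i) - r ?w) * s \<le> \<bar>r (?w + h *\<^sub>R ax i) - r ?w\<bar> * s"
        "(r ?w - r (?w + h *\<^sub>R ax i)) * s \<le> \<bar>r (?w + h *\<^sub>R ax i) - r ?w\<bar> * s"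
        by (rule mult_right_mono; use s in simp)+
      ultimately have b: "(r (?w + h *\<^sub>R ax i) - r ?w) * s \<le> t * h" "(r ?w - r (?w + h *\<^sub>R ax i)) * s \<le> t * h" by linarith+
      have "R (over (Suc k) (over k (x + h *\<^sub>R ax i) t) (r (?w + h *\<^sub>R ax i)))" "R (over (Suc k) (over k x t) (r ?w))"
        using R(2) w d'(2)[of h] h by (auto simp: over_shift[of k x h "ax i" t])
      with b show "\<exists>u. \<exists>v. R (over (Suc k) (over k (x + h *\<^sub>R ax i) t) u) \<and> R (over (Suc k) (over k x t) v) \<and>
        (u - v) * s \<le> t * h \<and> (v - u) * s \<le> t * h" by blast
    qed (use d d' in auto)
  qed
  have U0: "open_in_Rn k (ball a \<rho> \<inter> Rn k)" "ball a \<rho> \<inter> Rn k \<noteq> {}"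
    using centre_in_ball_Rn[OF a(1,2)] by (blast intro: open_in_Rn_Int_open)+
  \<comment> \<open>\<open>P1 (x, s)\<close>: the bound \<open>1 / s\<close> works for all small \<open>t\<close>, how small depending on \<open>x\<close>\<close>
  define P1 where "P1 w \<longleftrightarrow> (\<exists>\<tau>. 0 < \<tau> \<and> (\<forall>t. 0 < t \<and> t < \<tau> \<longrightarrow> Th (proj k w) t (coord w k)))" for w
  have dP1: "dfn (Suc k) P1" unfolding P1_def
    by (rule dTh dfn_rules | (simp; fail))+
  obtain a1 \<rho>1 s0 where a1: "0 < \<rho>1" "0 < s0" "a1 \<in> Rn k" "ball a1 \<rho>1 \<inter> Rn k \<subseteq> ball a \<rho> \<inter> Rn k"
    and alt: "(\<forall>w\<in>slab k a1 \<rho>1 s0. \<not> P1 w) \<or> (\<forall>w\<in>slab k a1 \<rho>1 s0. P1 w)"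
    by (rule definable_germ[OF q adm dP1 U0]) (rule that)
  have U1: "open_in_Rn k (ball a1 \<rho>1 \<inter> Rn k)" "ball a1 \<rho>1 \<inter> Rn k \<noteq> {}"
    using centre_in_ball_Rn[OF a1(3,1)] by (blast intro: open_in_Rn_Int_open)+
  have in1: "x \<in> ball b \<rho>' \<inter> Rn k" if "x \<in> Rn k" "norm (x - b) < \<rho>'" for x b \<rho>'
    using that by (auto simp: dist_norm norm_minus_commute)
  from alt show ?thesis
  proof
    assume all: "\<forall>w\<in>slab k a1 \<rho>1 s0. P1 w"
    define s where "s = s0 / 2"
    have s: "0 < s" "s < s0" using a1 by (auto simp: s_def)
    \<comment> \<open>the bound \<open>1 / s\<close> for a fixed \<open>s\<close>; the range of \<open>t\<close> is now made independent of \<open>x\<close>\<close>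
    define P2 where "P2 w \<longleftrightarrow> (\<forall>t. 0 < t \<and> t \<le> coord w k \<longrightarrow> Th (proj k w) t s)" for w
    have dP2: "dfn (Suc k) P2" unfolding P2_def
      by (rule dTh dfn_rules | (simp; fail))+
    obtain a2 \<rho>2 \<eta>2 where a2: "0 < \<rho>2" "0 < \<eta>2" "a2 \<in> Rn k" "ball a2 \<rho>2 \<inter> Rn k \<subseteq> ball a1 \<rho>1 \<inter> Rn k"
      and alt2: "(\<forall>w\<in>slab k a2 \<rho>2 \<eta>2. \<not> P2 w) \<or> (\<forall>w\<in>slab k a2 \<rho>2 \<eta>2. P2 w)"
      by (rule definable_germ[OF q adm dP2 U1]) (rule that)
    have "\<exists>w\<in>slab k a2 \<rho>2 \<eta>2. P2 w"
    proof -
      have a2b: "a2 \<in> ball a1 \<rho>1 \<inter> Rn k" using centre_in_ball_Rn[OF a2(3,1)] a2(4) by blast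
      then have "over k a2 s \<in> slab k a1 \<rho>1 s0" using s by (auto simp: over_in_slab dist_norm norm_minus_commute)
      then have "P1 (over k a2 s)" using all by blast
      then obtain \<tau> where \<tau>: "0 < \<tau>" "\<And>t. 0 < t \<and> t < \<tau> \<Longrightarrow> Th a2 t s" unfolding P1_def using a2(3) by auto
      define \<tau>' where "\<tau>' = min \<tau> \<eta>2 / 2"
      have \<tau>': "0 < \<tau>'" "\<tau>' < \<tau>" "\<tau>' < \<eta>2" using \<tau>(1) a2(2) by (auto simp: \<tau>'_def)
      have "P2 (over k a2 \<tau>')" unfolding P2_def using \<tau>(2) \<tau>' a2(3) by auto
      moreover have "over k a2 \<tau>' \<in> slab k a2 \<rho>2 \<eta>2" using \<tau>' a2 by (simp add: over_in_slab)
      ultimately show ?thesis by blast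
    qed
    then have all2: "\<forall>w\<in>slab k a2 \<rho>2 \<eta>2. P2 w" using alt2 by blast
    show ?thesis
    proof (rule that[of \<rho>2 "min \<eta>2 \<eta>" "1 / s" a2])
      show "ball a2 \<rho>2 \<inter> Rn k \<subseteq> ball a \<rho> \<inter> Rn k" using a2(4) a1(4) by blast
      fix w assume "w \<in> slab k a2 \<rho>2 (min \<eta>2 \<eta>)"
      then obtain x t where w: "w = over k x t" "x \<in> Rn k" "norm (x - a2) < \<rho>2" "0 < t" "t < min \<eta>2 \<eta>" by (rule slabE)
      have "over k x t \<in> slab k a2 \<rho>2 \<eta>2" using w by (simp add: over_in_slab)
      then have "P2 (over k x t)" using all2 by blast
      then have T: "Th x t s" unfolding P2_def using w by simp
      have "x \<in> ball a \<rho> \<inter> Rn k" using in1[OF w(2,3)] a2(4) a1(4) by blast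
      then have "\<bar>r' (over k x t)\<bar> * s \<le> t" using w s by (intro Th_le[OF _ _ _ _ T]) auto
      then show "\<bar>r' w\<bar> \<le> 1 / s * coord w k" using w s by (simp add: pos_le_divide_eq)
    qed (use a2 a s in auto)
  next
    assume none: "\<forall>w\<in>slab k a1 \<rho>1 s0. \<not> P1 w"
    \<comment> \<open>\<open>((x, s), \<tau>) \<in> Y\<close>: the bound \<open>1 / s\<close> fails for all \<open>t < \<tau>\<close>\<close>
    define Y where "Y = {z \<in> Rn (Suc (Suc k)). 0 < coord z (Suc k) \<and> (\<forall>t. 0 < t \<and> t < coord z (Suc k) \<longrightarrow> \<not> Th (proj k z) t (coord z k))}"
    have "dfn (Suc (Suc k)) (\<lambda>z. 0 < coord z (Suc k) \<and> (\<forall>t. 0 < t \<and> t < coord z (Suc k) \<longrightarrow> \<not> Th (proj k z) t (coord z k)))"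
      by (rule dTh dfn_rules | (simp; fail))+
    then have Y: "Y \<in> D (Suc k + 1)" by (simp add: dfn_def Y_def)
    obtain a3 \<rho>3 \<eta>3 where a3: "0 < \<rho>3" "0 < \<eta>3" "a3 \<in> Rn k" "ball a3 \<rho>3 \<inter> Rn k \<subseteq> ball a1 \<rho>1 \<inter> Rn k"
      and alt3: "(\<forall>z\<in>Y. proj (Suc k) z \<notin> slab k a3 \<rho>3 \<eta>3) \<or>
     (\<exists>s. (\<forall>w\<in>slab k a3 \<rho>3 \<eta>3. s w \<in> Y \<and> proj (Suc k) (s w) = w) \<and>
       C11_loc (Suc k) (slab k a3 \<rho>3 \<eta>3) s \<and> s ` slab k a3 \<rho>3 \<eta>3 \<in> D (Suc k + 1))"
      by (rule definable_choice[OF q adm Y U1]) (rule that)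
    have "\<exists>z\<in>Y. proj (Suc k) z \<in> slab k a3 \<rho>3 \<eta>3"
    proof -
      define s where "s = min s0 \<eta>3 / 2"
      have s: "0 < s" "s < s0" "s < \<eta>3" using a1 a3 by (auto simp: s_def)
      have d: "dfn (Suc 0) (\<lambda>w. Th a3 (coord w 0) s)"
        by (rule dTh dfn_rules dvec_const[OF a3(3)] | (simp; fail))+
      \<comment> \<open>\<open>definable_germ\<close> over the point \<open>R^0\<close> is o-minimality in the single variable \<open>t\<close>\<close>
      have U: "open_in_Rn 0 (Rn 0)" "Rn 0 \<noteq> {}" by (auto simp: open_in_Rn_def Rn_zero)
      obtain b \<rho>4 \<eta>4 where b: "0 < \<rho>4" "0 < \<eta>4" "b \<in> Rn 0"
        and alt4: "(\<forall>w\<in>slab 0 b \<rho>4 \<eta>4. \<not> Th a3 (coord w 0) s) \<or> (\<forall>w\<in>slab 0 b \<rho>4 \<eta>4. Th a3 (coord w 0) s)"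
        by (rule definable_germ[OF q adm d U]) (rule that)
      have in0: "over 0 b t \<in> slab 0 b \<rho>4 \<eta>4" "coord (over 0 b t) 0 = t" if "0 < t" "t < \<eta>4" for t
        using that b by (auto simp: over_in_slab)
      have "over k a3 s \<in> slab k a1 \<rho>1 s0"
      proof -
        have "a3 \<in> ball a1 \<rho>1 \<inter> Rn k" using centre_in_ball_Rn[OF a3(3,1)] a3(4) by blast
        then show ?thesis using s by (auto simp: over_in_slab dist_norm norm_minus_commute)
      qed
      then have "\<not> P1 (over k a3 s)" using none by blast
      then have "\<not> (\<forall>t. 0 < t \<and> t < \<eta>4 \<longrightarrow> Th a3 t s)" unfolding P1_def using b(2) a3(3) by auto
      then have "\<not> (\<forall>w\<in>slab 0 b \<rho>4 \<eta>4. Th a3 (coord w 0) s)" using in0 by metis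
      then have no: "\<not> Th a3 t s" if "0 < t" "t < \<eta>4" for t using alt4 in0[OF that] by metis
      let ?z = "over (Suc k) (over k a3 s) \<eta>4"
      have oR: "over k a3 s \<in> Rn (Suc k)" by (rule over_in_Rn[OF a3(3)])
      have "proj k ?z = proj k (proj (Suc k) ?z)" by simp
      also have "\<dots> = a3" using oR a3(3) by simp
      finally have pz: "proj k ?z = a3" .
      have "coord ?z k = s" using oR a3(3) by (simp add: coord_over)
      then have "?z \<in> Y" unfolding Y_def using pz oR no b(2) over_in_Rn[OF oR] by auto
      moreover have "proj (Suc k) ?z \<in> slab k a3 \<rho>3 \<eta>3" using oR s a3 by (simp add: over_in_slab)
      ultimately show ?thesis by blast
    qed
    then obtain \<sigma> where \<sigma>: "\<And>w. w \<in> slab k a3 \<rho>3 \<eta>3 \<Longrightarrow> \<sigma> w \<in> Y \<and> proj (Suc k) (\<sigma> w) = w" "C11_loc (Suc k) (slab k a3 \<rho>3 \<eta>3) \<sigma>"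
      using alt3 by blast
    define l where "l = \<rho>3 / 2"
    define s where "s = min (min s0 \<eta>3) l / 4"
    have l: "0 < l" "l < \<rho>3" and s: "0 < s" "s < \<eta>3" "2 * s < l" using a1 a3 by (auto simp: l_def s_def)
    have xh: "a3 + h *\<^sub>R ax i \<in> Rn k" "norm (a3 + h *\<^sub>R ax i - a3) < \<rho>3" if "0 \<le> h" "h \<le> l" for h
      using that l a3(3) axi by (auto intro!: Rn_add Rn_scale)
    have wS: "over k (a3 + h *\<^sub>R ax i) s \<in> slab k a3 \<rho>3 \<eta>3" if "0 \<le> h" "h \<le> l" for h
      using xh[OF that] s by (simp add: over_in_slab)
    let ?\<tau> = "\<lambda>h. coord (\<sigma> (over k (a3 + h *\<^sub>R ax i) s)) (Suc k)"
    have "continuous_on {0..l} ?\<tau>"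
    proof (rule continuous_on_coord, rule continuous_on_compose2[of "slab k a3 \<rho>3 \<eta>3" \<sigma>])
      show "continuous_on (slab k a3 \<rho>3 \<eta>3) \<sigma>"
        by (rule C11_loc_continuous_on[OF _ \<sigma>(2)]) (auto simp: slab_def)
      show "continuous_on {0..l} (\<lambda>h. over k (a3 + h *\<^sub>R ax i) s)" unfolding over_def by (intro continuous_intros)
      show "(\<lambda>h. over k (a3 + h *\<^sub>R ax i) s) ` {0..l} \<subseteq> slab k a3 \<rho>3 \<eta>3" using wS by auto
    qed
    then obtain h0 where h0: "h0 \<in> {0..l}" "\<forall>h\<in>{0..l}. ?\<tau> h0 \<le> ?\<tau> h"
      using continuous_attains_inf[of "{0..l}" ?\<tau>] l by auto
    have \<tau>0: "0 < ?\<tau> h0" using \<sigma>(1)[OF wS, of h0] h0(1) unfolding Y_def by auto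
    define t where "t = min (?\<tau> h0) \<eta> / 2"
    have t: "0 < t" "t < ?\<tau> h0" "t < \<eta>" using \<tau>0 a(3) by (auto simp: t_def)
    have xB: "a3 + h *\<^sub>R ax i \<in> ball a \<rho> \<inter> Rn k" if "0 \<le> h" "h \<le> l" for h
      using in1[OF xh[OF that]] a3(4) a1(4) by blast
    have big: "t \<le> \<bar>r' (over k (a3 + h *\<^sub>R ax i) t)\<bar> * s" if h: "0 \<le> h" "h \<le> l" for h
    proof (rule ccontr)
      assume "\<not> ?thesis"
      then have T: "Th (a3 + h *\<^sub>R ax i) t s" using xB[OF h] t s by (intro Th_if) auto
      let ?z = "\<sigma> (over k (a3 + h *\<^sub>R ax i) s)"
      have z: "?z \<in> Y" "proj (Suc k) ?z = over k (a3 + h *\<^sub>R ax i) s" using \<sigma>(1)[OF wS[OF h]] by auto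
      have "proj k ?z = proj k (proj (Suc k) ?z)" by simp
      then have pz: "proj k ?z = a3 + h *\<^sub>R ax i" using z(2) xh[OF h] by simp
      have "coord ?z k = coord (proj (Suc k) ?z) k" by simp
      then have cz: "coord ?z k = s" using z(2) xh[OF h] by simp
      have "t < coord ?z (Suc k)" using t(2) bspec[OF h0(2), of h] h by simp
      then have "\<not> Th (proj k ?z) t (coord ?z k)" using z(1) t(1) unfolding Y_def by blast
      then show False using T pz cz by simp
    qed
    have "\<exists>\<xi>. \<xi> > 0 \<and> \<xi> < l \<and> r (over k (a3 + l *\<^sub>R ax i) t) - r (over k (a3 + 0 *\<^sub>R ax i) t) = (l - 0) * r' (over k (a3 + \<xi> *\<^sub>R ax i) t)"
    proof (rule MVT2[OF l(1)])
      fix h assume h: "0 \<le> h" "h \<le> l"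
      let ?w = "over k (a3 + h *\<^sub>R ax i) t"
      have w: "?w \<in> slab k a \<rho> \<eta>" using xB[OF h] t inB by (simp add: over_in_slab)
      have "((\<lambda>g. r (?w + g *\<^sub>R ax i)) has_real_derivative r' ?w) (at (h - h))" using der[OF w] by simp
      then have "((\<lambda>h'. r (?w + (h' - h) *\<^sub>R ax i)) has_real_derivative r' ?w * 1) (at h)"
        by (rule DERIV_chain2) (auto intro!: derivative_eq_intros)
      moreover have "?w + (h' - h) *\<^sub>R ax i = over k (a3 + h' *\<^sub>R ax i) t" for h'
        by (simp add: over_def algebra_simps)
      ultimately show "((\<lambda>h. r (over k (a3 + h *\<^sub>R ax i) t)) has_real_derivative r' (over k (a3 + h *\<^sub>R ax i) t)) (at h)" by simp
    qed
    then obtain \<xi> where \<xi>: "\<xi> > 0" "\<xi> < l"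
      "r (over k (a3 + l *\<^sub>R ax i) t) - r (over k (a3 + 0 *\<^sub>R ax i) t) = l * r' (over k (a3 + \<xi> *\<^sub>R ax i) t)" by auto
    have b: "\<bar>r (over k (a3 + h *\<^sub>R ax i) t)\<bar> \<le> t" if h: "0 \<le> h" "h \<le> l" for h
    proof -
      have "over k (a3 + h *\<^sub>R ax i) t \<in> slab k a \<rho> \<eta>" using xB[OF h] t inB by (simp add: over_in_slab)
      from bd[OF this] show ?thesis using xh[OF h] by simp
    qed
    have "l * \<bar>r' (over k (a3 + \<xi> *\<^sub>R ax i) t)\<bar> \<le> 2 * t"
    proof -
      have "l * \<bar>r' (over k (a3 + \<xi> *\<^sub>R ax i) t)\<bar> = \<bar>l * r' (over k (a3 + \<xi> *\<^sub>R ax i) t)\<bar>" using l by (simp add: abs_mult)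
      also have "\<dots> \<le> \<bar>r (over k (a3 + l *\<^sub>R ax i) t)\<bar> + \<bar>r (over k (a3 + 0 *\<^sub>R ax i) t)\<bar>"
        unfolding \<xi>(3)[symmetric] by (rule abs_triangle_ineq4)
      also have "\<dots> \<le> 2 * t" using b[of l] b[of 0] l by simp
      finally show ?thesis .
    qed
    then have "l * \<bar>r' (over k (a3 + \<xi> *\<^sub>R ax i) t)\<bar> * s \<le> 2 * t * s" using s by (intro mult_right_mono) auto
    moreover have "l * t \<le> l * (\<bar>r' (over k (a3 + \<xi> *\<^sub>R ax i) t)\<bar> * s)" using big[of \<xi>] \<xi> l by (intro mult_left_mono) auto
    ultimately have "l * t \<le> (2 * s) * t" by (simp add: algebra_simps)
    then have False using s(3) t(1) by simp
    then show ?thesis ..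
  qed
qed

end

section \<open>Submanifolds as graphs after a permutation of coordinates\<close>

definition permute :: "nat \<Rightarrow> (nat \<Rightarrow> nat) \<Rightarrow> rvec \<Rightarrow> rvec" where
  "permute n p x = vec n (\<lambda>i. coord x (p i))"

lemma coord_permute [simp]: "coord (permute n p x) i = (if i < n then coord x (p i) else 0)"
  by (simp add: permute_def)

lemma permute_in_Rn [simp]: "permute n p x \<in> Rn n"
  by (simp add: permute_def)

lemma linear_permute: "linear (permute n p)"
  by (rule linearI) (auto intro!: rvec_eqI)

lemma norm_permute:
  assumes p: "p permutes {..<n}" and x: "x \<in> Rn n"
  shows "norm (permute n p x) = norm x"
proof -
  have "(norm (permute n p x))\<^sup>2 = (\<Sum>i<n. (coord x (p i))\<^sup>2)"
    by (simp add: norm_power2_Rn[OF permute_in_Rn])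
  also have "\<dots> = (\<Sum>i<n. (coord x i)\<^sup>2)"
    using sum.permute[OF p, of "\<lambda>i. (coord x i)\<^sup>2"] by (simp add: o_def)
  also have "\<dots> = (norm x)\<^sup>2" by (simp add: norm_power2_Rn[OF x])
  finally show ?thesis by simp
qed

lemma norm_permute_diff:
  "p permutes {..<n} \<Longrightarrow> x \<in> Rn n \<Longrightarrow> y \<in> Rn n \<Longrightarrow> norm (permute n p x - permute n p y) = norm (x - y)"
  using norm_permute[of p n "x - y"] linear_diff[OF linear_permute, of n p x y] by (simp add: Rn_diff)

lemma permute_inverse:
  assumes p: "p permutes {..<n}" and x: "x \<in> Rn n"
  shows "permute n (inv p) (permute n p x) = x" "permute n p (permute n (inv p) x) = x"
proof -
  have q: "inv p permutes {..<n}" by (rule permutes_inv[OF p])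
  show "permute n (inv p) (permute n p x) = x"
    by (rule Rn_eqI[OF _ x]) (use permutes_inverses[OF p] permutes_in_image[OF q] in auto)
  show "permute n p (permute n (inv p) x) = x"
    by (rule Rn_eqI[OF _ x]) (use permutes_inverses[OF p] permutes_in_image[OF p] in auto)
qed

lemma bounded_linear_permute: "bounded_linear (permute n p)"
  unfolding permute_def vec_def
  by (intro bounded_linear_sum bounded_linear_compose[OF bounded_linear_scaleR_left bounded_linear_coord])

text \<open>
  A maximal set \<open>J\<close> of coordinates whose coordinate subspace meets \<open>T\<close> only in \<open>0\<close> has the
  property that \<open>T\<close> projects isomorphically onto the remaining coordinates.
\<close>

lemma subspace_graph_coordinates:
  assumes T: "subspace T" "T \<subseteq> Rn n"
  obtains p k where "p permutes {..<n}" "k \<le> n"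
    "\<forall>v\<in>T. (\<forall>i<k. coord v (p i) = 0) \<longrightarrow> v = 0"
    "\<forall>i<k. \<exists>v\<in>T. \<forall>j<k. coord v (p j) = (if j = i then 1 else 0)"
proof -
  define good where "good J \<longleftrightarrow> J \<subseteq> {..<n} \<and> (\<forall>v\<in>T. (\<forall>i. i \<notin> J \<longrightarrow> coord v i = 0) \<longrightarrow> v = 0)" for J
  have fin: "finite {J. good J}" by (rule finite_subset[of _ "Pow {..<n}"]) (auto simp: good_def)
  have "good {}" by (auto simp: good_def intro: rvec_eqI)
  then obtain J where J: "good J" "\<And>J'. good J' \<Longrightarrow> J \<subseteq> J' \<Longrightarrow> J' = J"
    using finite_has_maximal[OF fin] by blast
  have Jn: "J \<subseteq> {..<n}" using J(1) by (simp add: good_def)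
  define I where "I = {..<n} - J"
  define k where "k = card I"
  have fI: "finite I" "finite J" using Jn finite_subset by (auto simp: I_def)
  have card: "card J = n - k"
    using card_Diff_subset[OF fI(2) Jn] card_mono[OF _ Jn] by (simp add: k_def I_def)
  have kn: "k \<le> n" using card_mono[of "{..<n}" I] by (simp add: k_def I_def)
  obtain h1 where h1: "bij_betw h1 {0..<k} I" using ex_bij_betw_nat_finite[OF fI(1)] by (auto simp: k_def)
  obtain h2 where h2: "bij_betw h2 {0..<n - k} J" using ex_bij_betw_nat_finite[OF fI(2)] card by auto
  define p where "p i = (if i < k then h1 i else if i < n then h2 (i - k) else i)" for i
  have b1: "bij_betw p {..<k} I" using h1 by (subst bij_betw_cong[of _ p h1]) (auto simp: p_def lessThan_atLeast0)
  have "bij_betw (\<lambda>i. i - k) {k..<n} {0..<n - k}"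
    by (rule bij_betwI[of _ _ _ "\<lambda>i. i + k"]) auto
  then have "bij_betw (h2 \<circ> (\<lambda>i. i - k)) {k..<n} J" using h2 by (rule bij_betw_trans)
  then have b2: "bij_betw p {k..<n} J" by (subst bij_betw_cong[of _ p "h2 \<circ> (\<lambda>i. i - k)"]) (auto simp: p_def)
  have "bij_betw p ({..<k} \<union> {k..<n}) (I \<union> J)" by (rule bij_betw_combine[OF b1 b2]) (auto simp: I_def)
  moreover have "{..<k} \<union> {k..<n} = {..<n}" "I \<union> J = {..<n}" using kn Jn by (auto simp: I_def)
  ultimately have "bij_betw p {..<n} {..<n}" by simp
  then have perm: "p permutes {..<n}" by (rule bij_imp_permutes) (use kn in \<open>auto simp: p_def\<close>)
  have img: "p ` {..<k} = I" using b1 by (simp add: bij_betw_def)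
  have inj: "inj_on p {..<k}" using b1 by (simp add: bij_betw_def)
  show ?thesis
  proof (rule that[OF perm kn], intro ballI impI)
    fix v assume v: "v \<in> T" "\<forall>i<k. coord v (p i) = 0"
    have "coord v i = 0" if i: "i \<notin> J" for i
    proof (cases "i < n")
      case True
      then have "i \<in> p ` {..<k}" using i img by (simp add: I_def)
      then show ?thesis using v(2) by auto
    next
      case False
      then show ?thesis using v(1) T(2) by (auto simp: Rn_def subset_iff)
    qed
    then show "v = 0" using J(1) v(1) unfolding good_def by blast
  next
    show "\<forall>i<k. \<exists>v\<in>T. \<forall>j<k. coord v (p j) = (if j = i then 1 else 0)"
    proof (intro allI impI)
    fix i assume i: "i < k"
    then have pI: "p i \<in> I" using img by blast
    then have "\<not> good (insert (p i) J)" using J(2)[of "insert (p i) J"] by (auto simp: I_def)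
    then obtain v where v: "v \<in> T" "\<And>j. j \<notin> insert (p i) J \<Longrightarrow> coord v j = 0" "v \<noteq> 0"
      using pI Jn unfolding good_def I_def by auto
    have c: "coord v (p i) \<noteq> 0"
    proof
      assume "coord v (p i) = 0"
      then have "coord v j = 0" if "j \<notin> J" for j using v(2)[of j] that by (cases "j = p i") auto
      then show False using J(1) v(1,3) unfolding good_def by blast
    qed
    let ?w = "(1 / coord v (p i)) *\<^sub>R v"
    have "coord ?w (p j) = (if j = i then 1 else 0)" if j: "j < k" for j
    proof (cases "j = i")
      case False
      have "p j \<noteq> p i" using False inj i j by (auto dest: inj_onD)
      moreover have "p j \<in> I" using img j by blast
      ultimately have "coord v (p j) = 0" by (intro v(2)) (auto simp: I_def)
      then show ?thesis using False by simp
    qed (use c in simp)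
    then show "\<exists>v\<in>T. \<forall>j<k. coord v (p j) = (if j = i then 1 else 0)"
      using subspace_scale[OF T(1) v(1)] by blast
    qed
  qed
qed

lemma C11_linearization:
  assumes F: "C11 (ball a s \<inter> Rn n) F G K" and \<sigma>: "0 < \<sigma>" "\<sigma> \<le> s" and a: "a \<in> Rn n"
    and x: "x \<in> ball a \<sigma> \<inter> Rn n" and y: "y \<in> ball a \<sigma> \<inter> Rn n"
  shows "norm (F x - F y - G a (x - y)) \<le> K * \<sigma> * norm (x - y)"
proof -
  let ?S = "ball a \<sigma> \<inter> Rn n"
  have sub: "?S \<subseteq> ball a s \<inter> Rn n" using \<sigma> by auto
  have aS: "a \<in> ball a s \<inter> Rn n" using \<sigma> a by simp
  have bl: "bounded_linear (G a)" by (rule C11_derivD(2)[OF F aS])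
  have "norm ((F x - G a x) - (F y - G a y)) \<le> K * \<sigma> * norm (x - y)"
  proof (rule differentiable_bound[OF convex_ball_Rn, of a \<sigma> n _ "\<lambda>z v. G z v - G a v"])
    fix z assume z: "z \<in> ?S"
    then have zs: "z \<in> ball a s \<inter> Rn n" using sub by blast
    have "(F has_derivative G z) (at z within ?S)" by (rule has_derivative_subset[OF C11_derivD(1)[OF F zs] sub])
    then show "((\<lambda>z. F z - G a z) has_derivative (\<lambda>v. G z v - G a v)) (at z within ?S)"
      by (intro has_derivative_diff bounded_linear_imp_has_derivative bl)
    show "onorm (\<lambda>v. G z v - G a v) \<le> K * \<sigma>"
    proof (rule onorm_bound)
      show "0 \<le> K * \<sigma>" using C11_derivD(5)[OF F aS] \<sigma> by simp
      fix v
      have "norm (G z v - G a v) \<le> K * norm (z - a) * norm v" by (rule C11_derivD(4)[OF F zs aS])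
      also have "\<dots> \<le> K * \<sigma> * norm v" using z C11_derivD(5)[OF F aS]
        by (intro mult_right_mono mult_left_mono) (auto simp: dist_norm norm_minus_commute)
      finally show "norm (G z v - G a v) \<le> K * \<sigma> * norm v" .
    qed
  qed (use x y in auto)
  moreover have "(F x - G a x) - (F y - G a y) = F x - F y - G a (x - y)"
    using bl by (simp add: linear_diff bounded_linear.linear)
  ultimately show ?thesis by simp
qed

text \<open>
  The inverse function theorem for the projection of a parametrization to the chosen
  coordinates, by the contraction principle in \<open>Rn k\<close>.
\<close>

lemma (in chart) local_graph:
  assumes e: "0 < e"
  obtains p k' \<delta> \<epsilon> where "p permutes {..<n}" "k' \<le> n" "0 < \<delta>" "0 < \<epsilon>" "\<delta> + \<epsilon> \<le> e"
    "\<And>x. x \<in> Rn k' \<Longrightarrow> norm (x - proj k' (permute n p x\<^sub>0)) < \<delta> \<Longrightarrow>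
      \<exists>!y. y \<in> Rn (n - k') \<and> norm (y - tail k' (permute n p x\<^sub>0)) < \<epsilon> \<and> permute n (inv p) (pair k' x y) \<in> M"
proof -
  define u0 where "u0 = \<phi> x\<^sub>0"
  define L where "L = H u0"
  let ?T = "tangent_space M x\<^sub>0"
  have x0M: "x\<^sub>0 \<in> M \<inter> ball x\<^sub>0 r" using x0 r by simp
  have x0R: "x\<^sub>0 \<in> Rn n" using x0 M by blast
  have u0n: "u0 \<in> ball u0 s \<inter> Rn n" using \<phi>_dom[OF x0_dom] by (simp add: u0_def)
  have u0k: "u0 \<in> Rn k" using \<phi>M[OF x0_dom] x0 by (simp add: u0_def)
  have linL: "linear L" unfolding L_def using linear_H u0n by (simp add: u0_def)
  have TL: "?T = L ` Rn k" using tangent_eq[OF x0M] by (simp add: L_def u0_def)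
  have TR: "?T \<subseteq> Rn n" by (rule tangent_space_subset_Rn[OF M x0])
  obtain p k' where p: "p permutes {..<n}" and k': "k' \<le> n"
    and inj: "\<forall>v\<in>?T. (\<forall>i<k'. coord v (p i) = 0) \<longrightarrow> v = 0"
    and sur: "\<forall>i<k'. \<exists>v\<in>?T. \<forall>j<k'. coord v (p j) = (if j = i then 1 else 0)"
    by (rule subspace_graph_coordinates[OF subspace_tangent[OF x0M] TR]) (rule that)
  define P where "P = permute n p"
  define Q where "Q = permute n (inv p)"
  define pr where "pr z = proj k' (P z)" for z
  have P_Rn: "P z \<in> Rn n" for z by (simp add: P_def)
  have QP: "Q (P z) = z" "P (Q z) = z" if "z \<in> Rn n" for z
    using permute_inverse[OF p that] by (simp_all add: P_def Q_def)
  have nP: "norm (P z) = norm z" if "z \<in> Rn n" for z unfolding P_def by (rule norm_permute[OF p that])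
  have linpr: "linear pr" unfolding pr_def P_def using linear_compose[OF linear_permute linear_proj] by (simp add: o_def)
  have npr: "norm (pr z) \<le> norm z" if "z \<in> Rn n" for z
    unfolding pr_def using norm_proj_le[of k' "P z"] nP[OF that] by simp
  have cpr: "coord (pr z) i = coord z (p i)" if "i < k'" for z i using that k' by (simp add: pr_def P_def)
  have prR: "pr z \<in> Rn k'" for z by (simp add: pr_def)
  define A where "A u = pr (L u)" for u
  have linA: "linear A" unfolding A_def using linear_compose[OF linL linpr] by (simp add: o_def)
  have LR: "L u \<in> Rn n" for u by (simp add: L_def H_Rn)
  have A0: "u = 0" if u: "u \<in> Rn k" "A u = 0" for u
  proof -
    have "coord (L u) (p i) = 0" if "i < k'" for i using cpr[OF that, of "L u"] u(2) by (simp add: A_def)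
    then have "L u = 0" using inj TL u(1) by blast
    moreover have "u \<in> Rn n" using u(1) Rn_mono[OF k] by blast
    then have "G x\<^sub>0 (L u) = u" using GH[OF x0_dom] by (simp add: L_def u0_def)
    ultimately show "u = 0" using linear_0[OF linear_G[OF x0_dom]] by simp
  qed
  have "\<exists>b. b \<in> Rn k \<and> A b = ax i" if i: "i < k'" for i
  proof -
    obtain v where v: "v \<in> ?T" "\<And>j. j < k' \<Longrightarrow> coord v (p j) = (if j = i then 1 else 0)" using sur i by blast
    then obtain b where b: "b \<in> Rn k" "v = L b" using TL by blast
    have "A b = ax i"
      by (rule Rn_eqI[of _ k']) (use i b v(2) cpr prR in \<open>auto simp: A_def\<close>)
    then show ?thesis using b by blast
  qed
  then obtain b where b: "\<And>i. i < k' \<Longrightarrow> b i \<in> Rn k \<and> A (b i) = ax i" by metis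
  define B where "B w = (\<Sum>i<k'. coord w i *\<^sub>R b i)" for w
  have BR: "B w \<in> Rn k" for w unfolding B_def using b by (intro Rn_sum Rn_scale) auto
  have AB: "A (B w) = w" if "w \<in> Rn k'" for w
  proof -
    have "A (B w) = (\<Sum>i<k'. coord w i *\<^sub>R ax i)"
      unfolding B_def using b by (simp add: linear_sum[OF linA] linear_scale[OF linA])
    then show ?thesis using Rn_expand[OF that] by simp
  qed
  have linB: "linear B" unfolding B_def
    by (rule linearI) (simp_all add: sum.distrib scaleR_add_left scaleR_sum_right)
  have BA: "B (A u) = u" if u: "u \<in> Rn k" for u
  proof -
    have "A u \<in> Rn k'" by (simp add: A_def prR)
    then have "A (B (A u) - u) = 0" using AB[of "A u"] by (simp add: linear_diff[OF linA])
    then have "B (A u) - u = 0" by (rule A0[rotated]) (use BR u in blast)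
    then show ?thesis by simp
  qed
  define \<beta> where "\<beta> = (\<Sum>i<k'. norm (b i)) + 1"
  have \<beta>: "0 < \<beta>" by (simp add: \<beta>_def sum_nonneg add_nonneg_pos)
  have nB: "norm (B w) \<le> \<beta> * norm w" for w
  proof -
    have "norm (B w) \<le> (\<Sum>i<k'. norm w * norm (b i))"
      unfolding B_def by (rule sum_norm_le) (auto intro!: mult_right_mono abs_coord_le_norm)
    also have "\<dots> \<le> \<beta> * norm w" by (simp add: \<beta>_def sum_distrib_left[symmetric] algebra_simps)
    finally show ?thesis .
  qed
  define \<sigma> where "\<sigma> = min s (1 / (2 * \<beta> * K))"
  have \<sigma>: "0 < \<sigma>" "\<sigma> \<le> s" using s \<beta> K by (auto simp: \<sigma>_def)
  have \<sigma>K: "\<beta> * (K * \<sigma>) \<le> 1 / 2"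
  proof -
    have "\<beta> * (K * \<sigma>) \<le> \<beta> * (K * (1 / (2 * \<beta> * K)))" using \<beta> K by (intro mult_left_mono) (auto simp: \<sigma>_def)
    also have "\<dots> = 1 / 2" using \<beta> K by simp
    finally show ?thesis .
  qed
  define h where "h u = pr (\<psi> u)" for u
  have kn: "Rn k \<subseteq> Rn n" by (rule Rn_mono[OF k])
  have in_s: "u \<in> ball u0 s \<inter> Rn n" if "u \<in> ball u0 \<sigma> \<inter> Rn k" for u using that \<sigma> kn by auto
  have key: "norm (B (h u - h u' - A (u - u'))) \<le> 1 / 2 * norm (u - u')"
    if u: "u \<in> ball u0 \<sigma> \<inter> Rn k" "u' \<in> ball u0 \<sigma> \<inter> Rn k" for u u'
  proof -
    have un: "u \<in> ball u0 \<sigma> \<inter> Rn n" "u' \<in> ball u0 \<sigma> \<inter> Rn n" using u kn by auto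
    have psiR: "\<psi> u \<in> Rn n" "\<psi> u' \<in> Rn n" using in_s u \<psi>_Rn by (auto simp: u0_def)
    have "h u - h u' - A (u - u') = pr (\<psi> u - \<psi> u' - L (u - u'))"
      by (simp add: h_def A_def linear_diff[OF linpr])
    then have "norm (h u - h u' - A (u - u')) \<le> norm (\<psi> u - \<psi> u' - L (u - u'))"
      using npr[of "\<psi> u - \<psi> u' - L (u - u')"] psiR LR by (simp add: Rn_diff)
    also have "\<dots> \<le> K * \<sigma> * norm (u - u')"
      unfolding L_def by (rule C11_linearization[OF _ \<sigma> _ un]) (use \<psi>C u0n in \<open>auto simp: u0_def\<close>)
    finally have "\<beta> * norm (h u - h u' - A (u - u')) \<le> \<beta> * (K * \<sigma> * norm (u - u'))" using \<beta> by (intro mult_left_mono) auto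
    also have "\<dots> \<le> 1 / 2 * norm (u - u')" using mult_right_mono[OF \<sigma>K, of "norm (u - u')"] by (simp add: mult.assoc)
    finally show ?thesis using nB[of "h u - h u' - A (u - u')"] by linarith
  qed
  define \<epsilon> where "\<epsilon> = min (\<sigma> / (2 * K)) (min (r / 2) (e / 2))"
  have \<epsilon>: "0 < \<epsilon>" using \<sigma> K r e by (simp add: \<epsilon>_def)
  define \<sigma>1 where "\<sigma>1 = min (\<sigma> / 2) (\<epsilon> / (2 * K))"
  have \<sigma>1: "0 < \<sigma>1" "\<sigma>1 < \<sigma>" using \<sigma> \<epsilon> K by (auto simp: \<sigma>1_def)
  define \<delta> where "\<delta> = min \<epsilon> (\<sigma>1 / (2 * \<beta>))"
  have \<delta>: "0 < \<delta>" "\<delta> \<le> \<epsilon>" using \<epsilon> \<sigma>1 \<beta> by (auto simp: \<delta>_def)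
  have h0: "h u0 = proj k' (P x\<^sub>0)" using \<psi>\<phi>[OF x0_dom] by (simp add: h_def pr_def u0_def)
  show ?thesis
  proof (rule that[OF p k' \<delta>(1) \<epsilon>])
    show "\<delta> + \<epsilon> \<le> e" using \<delta>(2) by (auto simp: \<epsilon>_def min_def split: if_splits)
    fix x assume x: "x \<in> Rn k'" and "norm (x - proj k' (permute n p x\<^sub>0)) < \<delta>"
    then have xd: "norm (x - h u0) < \<delta>" using h0 by (simp add: P_def)
    let ?C = "cball u0 \<sigma>1 \<inter> Rn k"
    have Csub: "?C \<subseteq> ball u0 \<sigma> \<inter> Rn k" using \<sigma>1 by auto
    define f where "f u = u - B (h u - x)" for u
    have fdiff: "norm (f u - f u') \<le> 1 / 2 * norm (u - u')" if u: "u \<in> ?C" "u' \<in> ?C" for u u'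
    proof -
      have "B (A (u - u')) = u - u'" by (rule BA) (use u in blast)
      then have "f u - f u' = - B (h u - h u' - A (u - u'))"
        by (simp add: f_def linear_diff[OF linB])
      then show ?thesis using key[OF subsetD[OF Csub u(1)] subsetD[OF Csub u(2)]] by (simp only: norm_minus_cancel)
    qed
    have u0C: "u0 \<in> ?C" using \<sigma>1 u0k by simp
    have "\<exists>!u\<in>?C. f u = u"
    proof (rule Banach_fix[of _ "1/2"])
      show "complete ?C" by (rule complete_closed_subset[OF _ _ complete_Rn[of k]]) (auto intro: closed_Rn)
      show "f ` ?C \<subseteq> ?C"
      proof (rule image_subsetI)
        fix u assume u: "u \<in> ?C"
        have "norm (f u0 - u0) \<le> \<beta> * norm (h u0 - x)" using nB[of "h u0 - x"] by (simp add: f_def)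
        also have "\<dots> \<le> \<beta> * (\<sigma>1 / (2 * \<beta>))" using xd \<beta> by (intro mult_left_mono) (auto simp: \<delta>_def norm_minus_commute)
        also have "\<dots> = \<sigma>1 / 2" using \<beta> by simp
        finally have "norm (f u0 - u0) \<le> \<sigma>1 / 2" .
        moreover have "norm (f u - f u0) \<le> \<sigma>1 / 2"
          using fdiff[OF u u0C] u by (simp add: dist_norm norm_minus_commute)
        ultimately have "norm (f u - u0) \<le> \<sigma>1" using norm_triangle_ineq[of "f u - f u0" "f u0 - u0"] by simp
        moreover have "f u \<in> Rn k" unfolding f_def using u BR by blast
        ultimately show "f u \<in> ?C" by (simp add: dist_norm norm_minus_commute)
      qed
      show "dist (f u) (f u') \<le> 1 / 2 * dist u u'" if "u \<in> ?C" "u' \<in> ?C" for u u'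
        using fdiff[OF that] by (simp add: dist_norm)
      show "?C \<noteq> {}" using u0C by blast
    qed auto
    then obtain u where u: "u \<in> ?C" "f u = u" by blast
    have "B (h u - x) = 0" using u(2) by (simp add: f_def)
    then have "h u - x = 0" using AB[of "h u - x"] linear_0[OF linA] x prR by (auto simp: h_def)
    then have hu: "h u = x" by simp
    have us: "u \<in> ball u0 s \<inter> Rn n" by (rule in_s) (use u Csub in blast)
    have zM: "\<psi> u \<in> M" by (rule \<psi>M) (use us u in \<open>auto simp: u0_def\<close>)
    have zR: "\<psi> u \<in> Rn n" using zM M by blast
    define y where "y = tail k' (P (\<psi> u))"
    have Pz: "P (\<psi> u) = pair k' x y" using hu pair_proj_tail[of k' "P (\<psi> u)"]
      by (simp add: y_def h_def pr_def del: pair_proj_tail)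
    have yR: "y \<in> Rn (n - k')" unfolding y_def by (rule tail_in_Rn) (use k' P_Rn in simp)
    have yb: "norm (y - tail k' (P x\<^sub>0)) < \<epsilon>"
    proof -
      have "norm (y - tail k' (P x\<^sub>0)) \<le> norm (P (\<psi> u) - P x\<^sub>0)"
        using norm_tail_le[of k' "P (\<psi> u) - P x\<^sub>0"] by (simp add: tail_diff y_def)
      also have "\<dots> = norm (\<psi> u - \<psi> u0)"
        using norm_permute_diff[OF p zR x0R] \<psi>\<phi>[OF x0_dom] by (simp add: P_def u0_def)
      also have "\<dots> \<le> K * norm (u - u0)"
        using us u0n by (intro C11_lipschitz[OF \<psi>C convex_ball_Rn]) (auto simp: u0_def)
      also have "\<dots> \<le> K * (\<epsilon> / (2 * K))" using u K by (intro mult_left_mono) (auto simp: \<sigma>1_def dist_norm norm_minus_commute)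
      also have "\<dots> < \<epsilon>" using K \<epsilon> by simp
      finally show ?thesis .
    qed
    have Qy: "Q (pair k' x y) \<in> M" using zM QP(1)[OF zR] by (simp add: Pz[symmetric])
    have uniq: "y' = y" if y': "y' \<in> Rn (n - k')" "norm (y' - tail k' (P x\<^sub>0)) < \<epsilon>" "Q (pair k' x y') \<in> M" for y'
    proof -
      have param: "\<exists>u\<in>ball u0 \<sigma> \<inter> Rn k. \<psi> u = Q (pair k' x w)"
        if w: "w \<in> Rn (n - k')" "norm (w - tail k' (P x\<^sub>0)) < \<epsilon>" "Q (pair k' x w) \<in> M" for w
      proof -
        let ?z = "Q (pair k' x w)"
        have pR: "pair k' x w \<in> Rn n" using pair_in_Rn[OF w(1), of k' x] k' by simp
        have zR: "?z \<in> Rn n" using w(3) M by blast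
        have "norm (?z - x\<^sub>0) = norm (pair k' x w - P x\<^sub>0)"
          using norm_permute_diff[OF p zR x0R] QP(2)[OF pR] by (simp add: P_def)
        also have "pair k' x w - P x\<^sub>0 = pair k' (x - h u0) (w - tail k' (P x\<^sub>0))"
          unfolding h0 by (simp add: pair_diff)
        also have "norm \<dots> \<le> norm (x - h u0) + norm (w - tail k' (P x\<^sub>0))"
          by (rule norm_pair_bounds(3)) (use x in \<open>auto simp: h_def prR intro: Rn_diff\<close>)
        also have "\<dots> < \<epsilon> + \<epsilon>" using xd \<delta>(2) w(2) by linarith
        finally have zd: "norm (?z - x\<^sub>0) < 2 * \<epsilon>" by simp
        have "2 * \<epsilon> \<le> r" "2 * \<epsilon> \<le> \<sigma> / K" by (auto simp: \<epsilon>_def)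
        then have zb: "?z \<in> ball x\<^sub>0 r \<inter> Rn n" and zs: "norm (?z - x\<^sub>0) < \<sigma> / K"
          using zd zR by (auto simp: dist_norm norm_minus_commute)
        have "norm (\<phi> ?z - \<phi> x\<^sub>0) \<le> K * norm (?z - x\<^sub>0)"
          by (rule C11_lipschitz[OF \<phi>C convex_ball_Rn zb x0_dom])
        also have "\<dots> < K * (\<sigma> / K)" using zs K by (intro mult_strict_left_mono) auto
        also have "\<dots> = \<sigma>" using K by simp
        finally have "\<phi> ?z \<in> ball u0 \<sigma>" by (simp add: u0_def dist_norm norm_minus_commute)
        moreover have "\<phi> ?z \<in> Rn k" using \<phi>M[OF zb] w(3) by blast
        ultimately show ?thesis using \<psi>\<phi>[OF zb] by blast
      qed
      obtain u1 where u1: "u1 \<in> ball u0 \<sigma> \<inter> Rn k" "\<psi> u1 = Q (pair k' x y')" using param[OF y'] by blast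
      have uS: "u \<in> ball u0 \<sigma> \<inter> Rn k" using u Csub by blast
      have pR: "pair k' x y' \<in> Rn n" using pair_in_Rn[OF y'(1), of k' x] k' by simp
      have Pu1: "P (\<psi> u1) = pair k' x y'" using u1(2) QP(2)[OF pR] by simp
      then have "h u1 = x" using x by (simp add: h_def pr_def)
      then have "norm (B (A (u1 - u))) \<le> 1 / 2 * norm (u1 - u)"
        using key[OF u1(1) uS] hu linear_neg[OF linB, of "A (u1 - u)"] by simp
      moreover have "B (A (u1 - u)) = u1 - u" by (rule BA) (use u1 uS in blast)
      ultimately have "u1 = u" by simp
      then have "pair k' x y' = pair k' x y" using Pu1 Pz by simp
      then show ?thesis using pair_eq_iff[OF x x] by blast
    qed
    show "\<exists>!y. y \<in> Rn (n - k') \<and> norm (y - tail k' (permute n p x\<^sub>0)) < \<epsilon> \<and> permute n (inv p) (pair k' x y) \<in> M"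
      using yR yb Qy uniq unfolding P_def Q_def by blast
  qed
qed

section \<open>The Verdier condition is generic\<close>

text \<open>
  \<open>V y c\<close> says that \<open>c\<close> is a bound for \<open>y\<close>. The best bounds need not have a maximum over \<open>F\<close>, but some
  \<open>y\<close> has more than half of their supremum.
\<close>

lemma near_maximal_exists:
  fixes V :: "'a \<Rightarrow> real \<Rightarrow> bool"
  assumes ne: "F \<noteq> {}" and V1: "\<And>y. y \<in> F \<Longrightarrow> V y 1" and mono: "\<And>y c d. V y c \<Longrightarrow> c \<le> d \<Longrightarrow> V y d"
  shows "\<exists>y\<in>F. \<forall>z\<in>F. \<forall>c. 0 < c \<and> V y c \<longrightarrow> V z (2 * c)"
proof -
  define \<tau> where "\<tau> y = Inf {c. 0 < c \<and> V y c}" for y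
  have ne1: "{c. 0 < c \<and> V y c} \<noteq> {}" if "y \<in> F" for y using V1[OF that] by (auto intro: exI[of _ 1])
  have bb: "bdd_below {c. 0 < c \<and> V y c}" for y by (rule bdd_belowI[of _ 0]) auto
  have le: "\<tau> y \<le> c" if "0 < c" "V y c" for y c
    unfolding \<tau>_def by (rule cInf_lower[OF _ bb]) (use that in auto)
  have lt: "V y c" if yF: "y \<in> F" and yc: "\<tau> y < c" for y c
  proof -
    obtain d where "0 < d" "V y d" "d < c" using cInf_lessD[OF ne1[OF yF]] yc unfolding \<tau>_def by blast
    then show ?thesis using mono[of y d c] by simp
  qed
  have ub: "bdd_above (\<tau> ` F)" using V1 le by (intro bdd_aboveI[of _ 1]) auto
  define s where "s = Sup (\<tau> ` F)"
  have s: "\<tau> z \<le> s" if "z \<in> F" for z unfolding s_def using that ub by (intro cSup_upper) auto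
  have "\<exists>y\<in>F. s \<le> 0 \<or> s / 2 < \<tau> y"
  proof (cases "s \<le> 0")
    case False
    then have "s / 2 < Sup (\<tau> ` F)" by (simp add: s_def)
    then show ?thesis using less_cSupD[of "\<tau> ` F" "s / 2"] ne by auto
  qed (use ne in auto)
  then obtain y where y: "y \<in> F" "s \<le> 0 \<or> s / 2 < \<tau> y" by blast
  have "V z (2 * c)" if "z \<in> F" "0 < c" "V y c" for z c
  proof (rule lt[OF that(1)])
    have "\<tau> y \<le> c" by (rule le[OF that(2,3)])
    then show "\<tau> z < 2 * c" using s[OF that(1)] y(2) that(2) by auto
  qed
  then show ?thesis using y(1) by blast
qed

lemma tangent_space_open_Rn:
  assumes "x \<in> ball a r \<inter> Rn k"
  shows "tangent_space (ball a r \<inter> Rn k) x = Rn k"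
  using tangent_space_Int_open[of "ball a r" x "Rn k"] tangent_space_Rn[of x k] assms by (simp add: Int_commute)

lemma slice_C11:
  assumes Y: "C11_loc (Suc k) W Y" and x: "x \<in> Rn k" "over k x t \<in> W"
  shows "\<exists>r>0. \<exists>G K. C11 (ball x r \<inter> Rn k) (\<lambda>x. Y (over k x t)) G K"
proof -
  obtain r G K where r: "r > 0" "C11 (ball (over k x t) r \<inter> Rn (Suc k)) Y G K"
    using Y x(2) unfolding C11_loc_def by blast
  have "C11 (ball x r \<inter> Rn k) (\<lambda>x. over k x t) (\<lambda>x v. v + 0) (1 + 1)"
    unfolding over_def by (rule C11_add[OF C11_ident C11_const])
  moreover have "(\<lambda>x. over k x t) ` (ball x r \<inter> Rn k) \<subseteq> ball (over k x t) r \<inter> Rn (Suc k)"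
    using over_in_Rn by (auto simp: over_def dist_norm)
  ultimately have "C11 (ball x r \<inter> Rn k) (\<lambda>x. Y (over k x t)) (\<lambda>x v. G (over k x t) (v + 0)) (K * (1 + 1) * (1 + 1 + 1))"
    by (intro C11_compose[OF r(2) _ convex_ball_Rn])
  then show ?thesis using r(1) by blast
qed

lemma C11_loc_bounded_linear: "bounded_linear b \<Longrightarrow> C11_loc n W s \<Longrightarrow> C11_loc n W (\<lambda>w. b (s w))"
  unfolding C11_loc_def
proof
  fix a assume b: "bounded_linear b" and "\<forall>a\<in>W. \<exists>r>0. \<exists>G K. ball a r \<inter> Rn n \<subseteq> W \<and> C11 (ball a r \<inter> Rn n) s G K" and "a \<in> W"
  then obtain r G K where r: "r > 0" "ball a r \<inter> Rn n \<subseteq> W" "C11 (ball a r \<inter> Rn n) s G K" by blast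
  obtain L where "C11 (ball a r \<inter> Rn n) (\<lambda>w. b (s w)) (\<lambda>x v. b (G x v)) L"
    using C11_bounded_linear[OF b r(3)] by blast
  then show "\<exists>r>0. \<exists>G K. ball a r \<inter> Rn n \<subseteq> W \<and> C11 (ball a r \<inter> Rn n) (\<lambda>w. b (s w)) G K" using r by blast
qed

lemma C11_loc_partial:
  assumes W: "W \<subseteq> Rn n" and Y: "C11_loc n W Y" and w: "w \<in> W" and i: "i < n"
  shows "\<exists>d. ((\<lambda>h. Y (w + h *\<^sub>R ax i)) has_vector_derivative d) (at 0)"
proof -
  obtain r G K where r: "r > 0" "C11 (ball w r \<inter> Rn n) Y G K"
    using Y w unfolding C11_loc_def by blast
  have wr: "w \<in> ball w r \<inter> Rn n" and "ax i \<in> Rn n" using w W r(1) i by (auto simp: Rn_def)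
  then show ?thesis using C11_direction[OF r(2)] by blast
qed

lemma slab_mono:
  assumes "ball a' \<rho>' \<inter> Rn k \<subseteq> ball a \<rho> \<inter> Rn k" "\<eta>' \<le> \<eta>"
  shows "slab k a' \<rho>' \<eta>' \<subseteq> slab k a \<rho> \<eta>"
proof
  fix w assume "w \<in> slab k a' \<rho>' \<eta>'"
  then obtain x t where w: "w = over k x t" "x \<in> Rn k" "norm (x - a') < \<rho>'" "0 < t" "t < \<eta>'" by (rule slabE)
  then have "x \<in> ball a \<rho> \<inter> Rn k" using assms(1) by (auto simp: dist_norm norm_minus_commute)
  then show "w \<in> slab k a \<rho> \<eta>" using w assms(2) by (auto simp: over_in_slab dist_norm norm_minus_commute)
qed

context o_minimal_structure
begin

lemma dvec_permute: 
  assumes p: "p permutes {..<n}" and v: "dvec N n v"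
  shows "dvec N n (\<lambda>z. permute n p (v z))"
  unfolding dvec_def
proof (intro conjI ballI allI impI)
  fix i assume "i < n"
  then show "dfun N (\<lambda>z. coord (permute n p (v z)) i)"
    using dvec_coord[OF v, of "p i"] permutes_in_image[OF p, of i] by simp
qed simp

text \<open>All partial derivatives at once, by repeated shrinking of the slab.\<close>

lemma derivative_bounds:
  fixes k m :: nat
  assumes q: "at_least_C2 q" and adm: "admits_cell_decompositions D q"
    and a: "a \<in> Rn k" "0 < \<rho>" "0 < \<eta>"
    and R: "\<And>j. j < m \<Longrightarrow> dfn (Suc (Suc k)) (R j)"
      "\<And>j w t. j < m \<Longrightarrow> w \<in> slab k a \<rho> \<eta> \<Longrightarrow> R j (over (Suc k) w t) \<longleftrightarrow> t = r j w"
    and bd: "\<And>j w. j < m \<Longrightarrow> w \<in> slab k a \<rho> \<eta> \<Longrightarrow> \<bar>r j w\<bar> \<le> coord w k"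
    and der: "\<And>i j w. i < k \<Longrightarrow> j < m \<Longrightarrow> w \<in> slab k a \<rho> \<eta> \<Longrightarrow> ((\<lambda>h. r j (w + h *\<^sub>R ax i)) has_real_derivative r' i j w) (at 0)"
  obtains a' \<rho>' \<eta>' C where "0 < \<rho>'" "0 < \<eta>'" "\<eta>' \<le> \<eta>" "0 < C" "a' \<in> Rn k" "ball a' \<rho>' \<inter> Rn k \<subseteq> ball a \<rho> \<inter> Rn k"
    "\<And>i j w. i < k \<Longrightarrow> j < m \<Longrightarrow> w \<in> slab k a' \<rho>' \<eta>' \<Longrightarrow> \<bar>r' i j w\<bar> \<le> C * coord w k"
proof -
  have "finite I \<Longrightarrow> I \<subseteq> {..<k} \<times> {..<m} \<Longrightarrow> \<exists>a' \<rho>' \<eta>' C. 0 < \<rho>' \<and> 0 < \<eta>' \<and> \<eta>' \<le> \<eta> \<and> 0 < C \<and> a' \<in> Rn k \<and> ball a' \<rho>' \<inter> Rn k \<subseteq> ball a \<rho> \<inter> Rn k \<and>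
     (\<forall>(i,j)\<in>I. \<forall>w\<in>slab k a' \<rho>' \<eta>'. \<bar>r' i j w\<bar> \<le> C * coord w k)" for I
  proof (induction I rule: finite_induct)
    case empty
    show ?case by (rule exI[of _ a], rule exI[of _ \<rho>], rule exI[of _ \<eta>], rule exI[of _ 1]) (use a in auto)
  next
    case (insert ij I)
    obtain i j where ij: "ij = (i, j)" by fastforce
    have ijlt: "i < k" "j < m" using insert.prems ij by auto
    obtain a1 \<rho>1 \<eta>1 C1 where "0 < \<rho>1 \<and> 0 < \<eta>1 \<and> \<eta>1 \<le> \<eta> \<and> 0 < C1 \<and> a1 \<in> Rn k \<and> ball a1 \<rho>1 \<inter> Rn k \<subseteq> ball a \<rho> \<inter> Rn k \<and>
       (\<forall>(i,j)\<in>I. \<forall>w\<in>slab k a1 \<rho>1 \<eta>1. \<bar>r' i j w\<bar> \<le> C1 * coord w k)"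
      using insert by auto
    then have 1: "0 < \<rho>1" "0 < \<eta>1" "\<eta>1 \<le> \<eta>" "0 < C1" "a1 \<in> Rn k" "ball a1 \<rho>1 \<inter> Rn k \<subseteq> ball a \<rho> \<inter> Rn k"
      "\<And>i j w. (i,j) \<in> I \<Longrightarrow> w \<in> slab k a1 \<rho>1 \<eta>1 \<Longrightarrow> \<bar>r' i j w\<bar> \<le> C1 * coord w k" by auto
    have S1: "w \<in> slab k a \<rho> \<eta>" if "w \<in> slab k a1 \<rho>1 \<eta>1" for w using slab_mono[OF 1(6,3)] that by blast
    obtain a2 \<rho>2 \<eta>2 C2 where 2: "0 < \<rho>2" "0 < \<eta>2" "\<eta>2 \<le> \<eta>1" "0 < C2" "a2 \<in> Rn k" "ball a2 \<rho>2 \<inter> Rn k \<subseteq> ball a1 \<rho>1 \<inter> Rn k"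
      "\<And>w. w \<in> slab k a2 \<rho>2 \<eta>2 \<Longrightarrow> \<bar>r' i j w\<bar> \<le> C2 * coord w k"
    proof (rule derivative_bound[OF q adm ijlt(1) 1(5,1,2) R(1)[OF ijlt(2)], of "r j" "r' i j"])
      fix w assume w: "w \<in> slab k a1 \<rho>1 \<eta>1"
      show "R j (over (Suc k) w t) \<longleftrightarrow> t = r j w" for t by (rule R(2)[OF ijlt(2) S1[OF w]])
      show "\<bar>r j w\<bar> \<le> coord w k" by (rule bd[OF ijlt(2) S1[OF w]])
      show "((\<lambda>h. r j (w + h *\<^sub>R ax i)) has_real_derivative r' i j w) (at 0)" by (rule der[OF ijlt S1[OF w]])
    qed (rule that)
    have S2: "slab k a2 \<rho>2 \<eta>2 \<subseteq> slab k a1 \<rho>1 \<eta>1" by (rule slab_mono[OF 2(6,3)])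
    have all: "\<bar>r' i' j' w\<bar> \<le> max C1 C2 * coord w k" if "(i',j') \<in> insert ij I" "w \<in> slab k a2 \<rho>2 \<eta>2" for i' j' w
    proof -
      have w0: "0 \<le> coord w k" using that(2) by (simp add: slab_def)
      have "\<bar>r' i' j' w\<bar> \<le> C1 * coord w k \<or> \<bar>r' i' j' w\<bar> \<le> C2 * coord w k"
        using that 1(7) 2(7) S2 ij by blast
      then show ?thesis using mult_right_mono[OF max.cobounded1[of C1 C2] w0] mult_right_mono[OF max.cobounded2[of C2 C1] w0] by linarith
    qed
    show ?case
      by (rule exI[of _ a2], rule exI[of _ \<rho>2], rule exI[of _ \<eta>2], rule exI[of _ "max C1 C2"])
         (use 1(1-6) 2(1-6) all in \<open>auto simp: split_beta\<close>)
  qed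
  from this[OF finite_cartesian_product[OF finite_lessThan finite_lessThan] subset_refl] obtain a' \<rho>' \<eta>' C where
    "0 < \<rho>' \<and> 0 < \<eta>' \<and> \<eta>' \<le> \<eta> \<and> 0 < C \<and> a' \<in> Rn k \<and> ball a' \<rho>' \<inter> Rn k \<subseteq> ball a \<rho> \<inter> Rn k \<and>
     (\<forall>(i,j)\<in>{..<k} \<times> {..<m}. \<forall>w\<in>slab k a' \<rho>' \<eta>'. \<bar>r' i j w\<bar> \<le> C * coord w k)"
    by (elim exE) (rule that)
  then show ?thesis by (intro that[of \<rho>' \<eta>' C a']) auto
qed

end

text \<open>
  From the vertical estimate (base points of \<open>\<Gamma>\<close> and \<open>\<Lambda>\<close> over the same \<open>x\<close>) to the Verdier
  condition: move from \<open>z \<in> \<Gamma>\<close> to the point of \<open>\<Gamma>\<close> below \<open>z' \<in> \<Lambda>\<close>; tangent spaces of \<open>\<Gamma>\<close> vary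
  in a Lipschitz way.
\<close>

lemma verdier_vb_from_fibres:
  fixes n k m :: nat
  defines "n \<equiv> k + m"
  assumes p: "p permutes {..<n}" and L: "\<Lambda> \<subseteq> Rn n" and G: "\<Gamma> \<subseteq> Rn n" and disj: "\<Gamma> \<inter> \<Lambda> = {}"
    and a: "a \<in> Rn k" and pos: "0 < \<rho>" "0 < \<epsilon>" "0 < \<eta>" "0 < C" "0 \<le> A"
    and g: "\<And>x. x \<in> ball a \<rho> \<inter> Rn k \<Longrightarrow> g x \<in> Rn m \<and> norm (g x - b) < \<epsilon> \<and> permute n (inv p) (pair k x (g x)) \<in> \<Gamma>"
    and gu: "\<And>x y. x \<in> ball a \<rho> \<inter> Rn k \<Longrightarrow> y \<in> Rn m \<Longrightarrow> norm (y - b) < \<epsilon> \<Longrightarrow> permute n (inv p) (pair k x y) \<in> \<Gamma> \<Longrightarrow> y = g x"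
    and gl: "\<And>x x'. x \<in> ball a \<rho> \<inter> Rn k \<Longrightarrow> x' \<in> ball a \<rho> \<inter> Rn k \<Longrightarrow> norm (g x - g x') \<le> A * norm (x - x')"
    and \<Gamma>l: "0 < r" "0 < B" "\<And>z z'. z \<in> \<Gamma> \<Longrightarrow> z' \<in> \<Gamma> \<Longrightarrow> dist z x\<^sub>1 < r \<Longrightarrow> dist z' x\<^sub>1 < r \<Longrightarrow>
        vbound (tangent_space \<Gamma> z) (tangent_space \<Gamma> z') (B * norm (z - z'))"
    and x1: "x\<^sub>1 = permute n (inv p) (pair k a (g a))"
    and vert: "\<And>x y. x \<in> ball a \<rho> \<inter> Rn k \<Longrightarrow> y \<in> Rn m \<Longrightarrow> permute n (inv p) (pair k x y) \<in> \<Lambda> \<Longrightarrow> norm (y - g x) < \<eta> \<Longrightarrow>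
        vbound (tangent_space \<Gamma> (permute n (inv p) (pair k x (g x)))) (tangent_space \<Lambda> (permute n (inv p) (pair k x y))) (C * norm (y - g x))"
  shows "verdier_vb \<Lambda> \<Gamma> x\<^sub>1"
proof -
  let ?P = "permute n p" and ?Q = "permute n (inv p)"
  have q: "inv p permutes {..<n}" by (rule permutes_inv[OF p])
  have pairR: "pair k x y \<in> Rn n" if "y \<in> Rn m" for x y using pair_in_Rn[OF that] by (simp add: n_def)
  have PQ: "?P (?Q z) = z" "?Q (?P z) = z" if "z \<in> Rn n" for z using permute_inverse[OF p that] by auto
  have aB: "a \<in> ball a \<rho> \<inter> Rn k" using a pos by simp
  have gaR: "g a \<in> Rn m" using g[OF aB] by blast
  have x1R: "x\<^sub>1 \<in> Rn n" by (simp add: x1)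
  have Px1: "?P x\<^sub>1 = pair k a (g a)" unfolding x1 by (rule PQ(1)[OF pairR[OF gaR]])
  define \<delta> where "\<delta> = Min {\<rho>, \<epsilon> - norm (g a - b), \<eta> / (1 + A), r / (1 + A), 1 / (2 * B * (1 + A))}"
  have A1: "0 < 1 + A" using pos by simp
  have \<delta>: "0 < \<delta>" unfolding \<delta>_def using pos \<Gamma>l(1,2) g[OF aB] A1 by (subst Min_gr_iff) auto
  have d: "\<delta> \<le> \<rho>" "\<delta> \<le> \<epsilon> - norm (g a - b)" "\<delta> \<le> \<eta> / (1 + A)" "\<delta> \<le> r / (1 + A)" "\<delta> \<le> 1 / (2 * B * (1 + A))"
    unfolding \<delta>_def by (rule Min_le; simp)+
  have d': "(1 + A) * \<delta> \<le> \<eta>" "(1 + A) * \<delta> \<le> r" "B * (1 + A) * (2 * \<delta>) \<le> 1"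
  proof -
    show "(1 + A) * \<delta> \<le> \<eta>" "(1 + A) * \<delta> \<le> r" using d(3,4) A1 by (simp_all add: pos_le_divide_eq mult.commute)
    have "2 * B * (1 + A) > 0" using \<Gamma>l(2) A1 by simp
    then have "\<delta> * (2 * B * (1 + A)) \<le> 1" using d(5) by (simp only: pos_le_divide_eq)
    then show "B * (1 + A) * (2 * \<delta>) \<le> 1" by (simp add: mult_ac)
  qed
  define E where "E = B * (1 + A) + 2 * (C * (1 + A))"
  show ?thesis
  proof (rule verdier_vbI[OF \<delta>, of E])
    show "0 < E" unfolding E_def using \<Gamma>l(2) A1 pos by (auto intro!: add_pos_pos)
    fix z z' assume z: "z \<in> \<Gamma>" "dist z x\<^sub>1 < \<delta>" and z': "z' \<in> \<Lambda>" "dist z' x\<^sub>1 < \<delta>"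
    have zR: "z \<in> Rn n" "z' \<in> Rn n" using z z' L G by auto
    define x where "x = proj k (?P z)"
    define y where "y = tail k (?P z)"
    define u where "u = proj k (?P z')"
    define w where "w = tail k (?P z')"
    have Pz: "?P z = pair k x y" "?P z' = pair k u w" by (simp_all add: x_def y_def u_def w_def)
    have Rs: "x \<in> Rn k" "u \<in> Rn k" "y \<in> Rn m" "w \<in> Rn m"
      using tail_in_Rn[of "?P z" k m] tail_in_Rn[of "?P z'" k m] permute_in_Rn[of n p]
      by (auto simp: x_def u_def y_def w_def n_def)
    have zQ: "z = ?Q (pair k x y)" "z' = ?Q (pair k u w)" using PQ(2)[OF zR(1)] PQ(2)[OF zR(2)] Pz by auto
    have dz: "norm (?P z - ?P x\<^sub>1) < \<delta>" "norm (?P z' - ?P x\<^sub>1) < \<delta>" "norm (?P z - ?P z') = norm (z - z')"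
      using norm_permute_diff[OF p] zR x1R z(2) z'(2) by (simp_all add: dist_norm)
    have comp: "norm (x - a) < \<delta>" "norm (y - g a) < \<delta>" "norm (u - a) < \<delta>" "norm (w - g a) < \<delta>"
      using norm_pair_bounds(1,2)[OF Rn_diff[OF Rs(1) a], of "y - g a"] norm_pair_bounds(1,2)[OF Rn_diff[OF Rs(2) a], of "w - g a"]
        dz(1,2) Pz Px1 by (simp_all add: pair_diff)
    have cmp2: "norm (x - u) \<le> norm (z - z')" "norm (y - w) \<le> norm (z - z')"
      using norm_pair_bounds(1,2)[OF Rn_diff[OF Rs(1,2)], of "y - w"] dz(3) Pz by (simp_all add: pair_diff)
    have xB: "x \<in> ball a \<rho> \<inter> Rn k" and uB: "u \<in> ball a \<rho> \<inter> Rn k"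
      using comp d(1) Rs by (auto simp: dist_norm norm_minus_commute)
    have "norm (y - b) \<le> norm (y - g a) + norm (g a - b)" using norm_triangle_ineq[of "y - g a" "g a - b"] by simp
    then have "norm (y - b) < \<epsilon>" using comp(2) d(2) by linarith
    then have yg: "y = g x" using gu[OF xB Rs(3)] z(1) zQ(1) by blast
    let ?z = "?Q (pair k u (g u))"
    have zG: "?z \<in> \<Gamma>" and guR: "g u \<in> Rn m" using g[OF uB] by blast+
    have zzR: "?z \<in> Rn n" by simp
    have dQ: "norm (?Q (pair k s t) - ?Q (pair k s' t')) = norm (pair k (s - s') (t - t'))"
      if "t \<in> Rn m" "t' \<in> Rn m" for s s' t t'
      using norm_permute_diff[OF q pairR[OF that(1)] pairR[OF that(2)]] by (simp add: pair_diff)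
    have guw: "norm (w - g u) \<le> (1 + A) * norm (z - z')"
    proof -
      have "norm (w - g u) \<le> norm (w - y) + norm (g x - g u)" using norm_triangle_ineq[of "w - y" "g x - g u"] yg by simp
      also have "\<dots> \<le> norm (z - z') + A * norm (z - z')"
        using cmp2 gl[OF xB uB] mult_left_mono[OF cmp2(1) pos(5)] by (auto simp: norm_minus_commute)
      finally show ?thesis by (simp add: algebra_simps)
    qed
    have t: "norm (w - g u) < \<eta>"
    proof -
      have "norm (w - g u) \<le> norm (w - g a) + norm (g a - g u)" using norm_triangle_ineq[of "w - g a" "g a - g u"] by simp
      also have "\<dots> < \<delta> + A * \<delta>"
      proof (rule add_less_le_mono[OF comp(4)])
        have "norm (g a - g u) \<le> A * norm (a - u)" by (rule gl[OF aB uB])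
        also have "\<dots> \<le> A * \<delta>" using comp(3) pos by (intro mult_left_mono) (auto simp: norm_minus_commute)
        finally show "norm (g a - g u) \<le> A * \<delta>" .
      qed
      also have "\<dots> \<le> \<eta>" using d'(1) by (simp add: algebra_simps)
      finally show ?thesis .
    qed
    have zz: "norm (z - ?z) \<le> (1 + A) * norm (z - z')"
    proof -
      have "norm (z - ?z) = norm (pair k (x - u) (g x - g u))" using dQ[OF Rs(3) guR, of x u] zQ(1) yg by simp
      also have "\<dots> \<le> norm (x - u) + A * norm (x - u)"
        using norm_pair_bounds(3)[OF Rn_diff[OF Rs(1,2)], of "g x - g u"] gl[OF xB uB] by simp
      also have "\<dots> = (1 + A) * norm (x - u)" by (simp add: algebra_simps)
      also have "\<dots> \<le> (1 + A) * norm (z - z')" using cmp2(1) A1 by (intro mult_left_mono) auto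
      finally show ?thesis .
    qed
    have dzz: "dist ?z x\<^sub>1 < r"
    proof -
      have "norm (?z - x\<^sub>1) = norm (pair k (u - a) (g u - g a))" unfolding x1 by (rule dQ[OF guR gaR])
      also have "\<dots> \<le> norm (u - a) + A * norm (u - a)"
        using norm_pair_bounds(3)[OF Rn_diff[OF Rs(2) a], of "g u - g a"] gl[OF uB aB] by simp
      also have "\<dots> = (1 + A) * norm (u - a)" by (simp add: algebra_simps)
      also have "\<dots> < (1 + A) * \<delta>" using comp(3) A1 by (rule mult_strict_left_mono)
      also have "\<dots> \<le> r" by (rule d'(2))
      finally show ?thesis by (simp add: dist_norm)
    qed
    have dr: "dist z x\<^sub>1 < r"
    proof -
      have "\<delta> \<le> (1 + A) * \<delta>" using \<delta> pos(5) by (simp add: algebra_simps)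
      then show ?thesis using z(2) d'(2) by linarith
    qed
    have v1: "vbound (tangent_space \<Gamma> z) (tangent_space \<Gamma> ?z) (B * ((1 + A) * norm (z - z')))"
      by (rule vbound_mono[OF \<Gamma>l(3)[OF z(1) zG dr dzz]]) (use zz \<Gamma>l(2) in \<open>intro mult_left_mono; simp\<close>)
    have v2: "vbound (tangent_space \<Gamma> ?z) (tangent_space \<Lambda> z') (C * ((1 + A) * norm (z - z')))"
    proof (rule vbound_mono)
      show "vbound (tangent_space \<Gamma> ?z) (tangent_space \<Lambda> z') (C * norm (w - g u))"
        using vert[OF uB Rs(4) _ t] z'(1) zQ(2) by simp
      show "C * norm (w - g u) \<le> C * ((1 + A) * norm (z - z'))" using guw pos by (intro mult_left_mono) auto
    qed
    let ?c = "B * ((1 + A) * norm (z - z'))" and ?d = "C * ((1 + A) * norm (z - z'))"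
    have d0: "0 \<le> ?d" using pos A1 by simp
    have c1: "?c \<le> 1"
    proof -
      have "norm (z - z') \<le> 2 * \<delta>" using dist_triangle2[of z z' x\<^sub>1] z(2) z'(2) by (simp add: dist_norm)
      then have "B * (1 + A) * norm (z - z') \<le> B * (1 + A) * (2 * \<delta>)" using \<Gamma>l(2) A1 by (intro mult_left_mono) auto
      then show ?thesis using d'(3) by (simp add: mult.assoc)
    qed
    have "?c + ?d * (1 + ?c) \<le> ?c + ?d * 2" using d0 c1 by (intro add_left_mono mult_left_mono) auto
    also have "\<dots> = E * norm (z - z')" by (simp add: E_def algebra_simps)
    finally show "vbound (tangent_space \<Gamma> z) (tangent_space \<Lambda> z') (E * norm (z - z'))"
      by (rule vbound_mono[OF vbound_trans[OF v1 v2 d0]])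
  qed
qed

lemma tangent_point: "v \<in> tangent_space M x \<Longrightarrow> x \<in> M"
  unfolding tangent_space_def by force

lemma vector_derivative_in_Rn:
  assumes d: "(f has_vector_derivative d) (at t)" and f: "\<And>h. f h \<in> Rn m"
  shows "d \<in> Rn m"
  unfolding Rn_def
proof (intro CollectI allI impI)
  fix j assume j: "m \<le> j"
  have "((\<lambda>h. coord (f h) j) has_vector_derivative coord d j) (at t)"
    by (rule bounded_linear.has_vector_derivative[OF bounded_linear_coord d])
  moreover have "(\<lambda>h. coord (f h) j) = (\<lambda>h. 0)" using f j by (auto simp: Rn_def)
  ultimately have "((\<lambda>h. 0) has_vector_derivative coord d j) (at t)" by simp
  then show "coord d j = 0" by (rule vector_derivative_unique_at[OF _ has_vector_derivative_const])
qed

text \<open>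
  The crude bound by the entries of the matrix of \<open>L\<close>.
\<close>

lemma linear_columns_bound:
  assumes L: "linear L" and R: "\<And>i. i < k \<Longrightarrow> L (ax i) \<in> Rn m"
    and c: "\<And>i j. i < k \<Longrightarrow> j < m \<Longrightarrow> \<bar>coord (L (ax i)) j\<bar> \<le> c" and u: "u \<in> Rn k"
  shows "L u \<in> Rn m" "norm (L u) \<le> real k * real m * c * norm u"
proof -
  have Lu: "L u = (\<Sum>i<k. coord u i *\<^sub>R L (ax i))"
    by (subst Rn_expand[OF u]) (simp add: linear_sum[OF L] linear_scale[OF L])
  show "L u \<in> Rn m" unfolding Lu by (intro Rn_sum Rn_scale) (use R in auto)
  have col: "norm (L (ax i)) \<le> real m * c" if i: "i < k" for i
  proof -
    have "L (ax i) = (\<Sum>j<m. coord (L (ax i)) j *\<^sub>R ax j)" by (rule Rn_expand[OF R[OF i]])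
    also have "norm \<dots> \<le> (\<Sum>j<m. c)" by (rule sum_norm_le) (use c[OF i] in auto)
    finally show ?thesis by simp
  qed
  have "norm (L u) \<le> (\<Sum>i<k. norm u * (real m * c))"
    unfolding Lu by (rule sum_norm_le) (auto intro!: mult_mono abs_coord_le_norm col)
  then show "norm (L u) \<le> real k * real m * c * norm u" by (simp add: mult_ac)
qed

lemma tangent_of_parametrized_graph:
  assumes x: "x \<in> Rn k" and r: "0 < r" and Y: "C11 (ball x r \<inter> Rn k) y G K"
    and M: "\<And>x'. x' \<in> ball x r \<inter> Rn k \<Longrightarrow> permute n \<sigma> (pair k x' (y x')) \<in> M" and u: "u \<in> Rn k"
  shows "permute n \<sigma> (pair k u (G x u)) \<in> tangent_space M (permute n \<sigma> (pair k x (y x)))"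
proof -
  let ?S = "ball x r \<inter> Rn k"
  have xS: "x \<in> ?S" using x r by simp
  have uT: "u \<in> tangent_space ?S x" using tangent_space_open_Rn[OF xS] u by simp
  obtain L where L: "C11 ?S (\<lambda>x. pair k 0 (y x)) (\<lambda>x v. pair k 0 (G x v)) L"
    using C11_bounded_linear[OF bounded_linear_pair_snd Y] by blast
  obtain L' where L': "C11 ?S (\<lambda>x. permute n \<sigma> (x + pair k 0 (y x))) (\<lambda>x v. permute n \<sigma> (v + pair k 0 (G x v))) L'"
    using C11_bounded_linear[OF bounded_linear_permute C11_add[OF C11_ident L]] by blast
  have "permute n \<sigma> (u + pair k 0 (G x u)) \<in> tangent_space M (permute n \<sigma> (x + pair k 0 (y x)))"
  proof (rule tangent_space_map[OF uT open_UNIV UNIV_I L'])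
    show "(\<lambda>x. permute n \<sigma> (x + pair k 0 (y x))) ` (?S \<inter> UNIV) \<subseteq> M"
    proof (rule image_subsetI)
      fix x' assume "x' \<in> ?S \<inter> UNIV"
      then show "permute n \<sigma> (x' + pair k 0 (y x')) \<in> M" using M[of x'] pair_eq_sum[of x' k "y x'"] by simp
    qed
  qed simp
  then show ?thesis using pair_eq_sum[OF x, of "y x"] pair_eq_sum[OF u, of "G x u"] by metis
qed

text \<open>
  By \<open>gu\<close>, near the base point \<open>M\<close> is contained in the graph of \<open>g\<close> up to the permutation, so its
  tangent vectors are tangent to the graph.
\<close>

lemma tangent_in_graph_coordinates:
  assumes x: "x \<in> ball a \<rho> \<inter> Rn k" and r: "0 < r" and Y: "C11 (ball x r \<inter> Rn k) g G K"
    and p: "p permutes {..<k + m}" and M: "M \<subseteq> Rn (k + m)" and gx: "g x \<in> Rn m" "norm (g x - b) < \<epsilon>"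
    and gu: "\<And>x y. x \<in> ball a \<rho> \<inter> Rn k \<Longrightarrow> y \<in> Rn m \<Longrightarrow> norm (y - b) < \<epsilon> \<Longrightarrow> permute (k + m) (inv p) (pair k x y) \<in> M \<Longrightarrow> y = g x"
    and v: "v \<in> tangent_space M (permute (k + m) (inv p) (pair k x (g x)))"
  obtains u where "u \<in> Rn k" "permute (k + m) p v = pair k u (G x u)"
proof -
  let ?P = "permute (k + m) p" and ?Q = "permute (k + m) (inv p)" and ?B = "ball a \<rho> \<inter> Rn k"
  have PQ: "?P (?Q z) = z" "?Q (?P z) = z" if "z \<in> Rn (k + m)" for z using permute_inverse[OF p that] by auto
  have Pz: "?P (?Q (pair k x (g x))) = pair k x (g x)" by (rule PQ(1)[OF pair_in_Rn[OF gx(1)]])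
  obtain L where L: "C11 UNIV ?P (\<lambda>_. ?P) L" using C11_bounded_linear[OF bounded_linear_permute C11_ident] by blast
  let ?T = "{z. norm (proj k (?P z) - a) < \<rho>} \<inter> {z. norm (tail k (?P z) - b) < \<epsilon>}"
  have cont: "continuous_on UNIV (\<lambda>z. proj k (?P z))" "continuous_on UNIV (\<lambda>z. tail k (?P z))"
    using bounded_linear_compose[OF bounded_linear_proj bounded_linear_permute] bounded_linear_compose[OF bounded_linear_tail bounded_linear_permute]
    by (auto intro!: linear_continuous_on)
  have T: "open ?T" by (intro open_Int open_Collect_less continuous_intros cont)
  have "?P v \<in> tangent_space (graph_on k ?B g) (?P (?Q (pair k x (g x))))"
  proof (rule tangent_space_map[OF v T _ L])
    show "?Q (pair k x (g x)) \<in> ?T" using Pz x gx by (auto simp: dist_norm norm_minus_commute)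
    show "?P ` (M \<inter> ?T) \<subseteq> graph_on k ?B g"
    proof (rule image_subsetI)
      fix z assume z: "z \<in> M \<inter> ?T"
      have zR: "z \<in> Rn (k + m)" using z M by blast
      have B: "proj k (?P z) \<in> ?B" using z by (auto simp: dist_norm norm_minus_commute)
      have "tail k (?P z) = g (proj k (?P z))"
        by (rule gu[OF B]) (use z PQ(2)[OF zR] tail_in_Rn[of "?P z" k m] in auto)
      then have "?P z = pair k (proj k (?P z)) (g (proj k (?P z)))" using pair_proj_tail[of k "?P z"] by simp
      then show "?P z \<in> graph_on k ?B g" using graph_onI[OF B, of k g] by metis
    qed
  qed simp
  also have "?P (?Q (pair k x (g x))) = pair k x (g x)" by (rule Pz)
  also have "tangent_space (graph_on k ?B g) (pair k x (g x)) = (\<lambda>v. pair k v (G x v)) ` tangent_space ?B x"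
    by (rule graph_tangent[OF _ Y]) (use x r in auto)
  finally show ?thesis using that tangent_space_open_Rn[OF x] by auto
qed

text \<open>
  Two graphs over the same base, one inside \<open>\<Gamma>\<close> and one inside \<open>\<Lambda>\<close>: the distance between tangent
  spaces is controlled by the difference of the derivatives.
\<close>

lemma graphs_vbound:
  assumes x: "x \<in> ball a \<rho> \<inter> Rn k" and r: "0 < r" and g: "C11 (ball x r \<inter> Rn k) g G\<^sub>1 K\<^sub>1" and y: "C11 (ball x r \<inter> Rn k) y G\<^sub>2 K\<^sub>2"
    and p: "p permutes {..<k + m}" and \<Gamma>: "\<Gamma> \<subseteq> Rn (k + m)" and gx: "\<And>x. g x \<in> Rn m" "norm (g x - b) < \<epsilon>" and yR: "\<And>x. y x \<in> Rn m"
    and gu: "\<And>x y. x \<in> ball a \<rho> \<inter> Rn k \<Longrightarrow> y \<in> Rn m \<Longrightarrow> norm (y - b) < \<epsilon> \<Longrightarrow> permute (k + m) (inv p) (pair k x y) \<in> \<Gamma> \<Longrightarrow> y = g x"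
    and \<Lambda>: "\<And>x'. x' \<in> ball x r \<inter> Rn k \<Longrightarrow> permute (k + m) (inv p) (pair k x' (y x')) \<in> \<Lambda>"
    and c: "\<And>i j d. i < k \<Longrightarrow> j < m \<Longrightarrow> ((\<lambda>h. coord (y (x + h *\<^sub>R ax i) - g (x + h *\<^sub>R ax i)) j) has_real_derivative d) (at 0) \<Longrightarrow> \<bar>d\<bar> \<le> c"
  shows "vbound (tangent_space \<Gamma> (permute (k + m) (inv p) (pair k x (g x))))
    (tangent_space \<Lambda> (permute (k + m) (inv p) (pair k x (y x)))) (real k * real m * c)"
proof (rule vboundI)
  let ?P = "permute (k + m) p" and ?Q = "permute (k + m) (inv p)" and ?S = "ball x r \<inter> Rn k"
  have xR: "x \<in> Rn k" and xS: "x \<in> ?S" using x r by auto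
  have axR: "ax i \<in> Rn k" if "i < k" for i using that by (auto simp: Rn_def)
  have dg: "((\<lambda>h. g (x + h *\<^sub>R ax i)) has_vector_derivative G\<^sub>1 x (ax i)) (at 0)" if "i < k" for i
    by (rule C11_direction[OF g xS axR[OF that]])
  have dy: "((\<lambda>h. y (x + h *\<^sub>R ax i)) has_vector_derivative G\<^sub>2 x (ax i)) (at 0)" if "i < k" for i
    by (rule C11_direction[OF y xS axR[OF that]])
  have lin: "linear (G\<^sub>1 x)" "linear (G\<^sub>2 x)"
    using C11_derivD(2)[OF g xS] C11_derivD(2)[OF y xS] by (auto intro: bounded_linear.linear)
  define L where "L u = G\<^sub>2 x u - G\<^sub>1 x u" for u
  have linL: "linear L" unfolding L_def using lin by (intro linear_compose_sub)
  have dL: "((\<lambda>h. y (x + h *\<^sub>R ax i) - g (x + h *\<^sub>R ax i)) has_vector_derivative L (ax i)) (at 0)" if "i < k" for i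
    unfolding L_def by (rule has_vector_derivative_diff[OF dy[OF that] dg[OF that]])
  have LR: "L (ax i) \<in> Rn m" if "i < k" for i
    by (rule vector_derivative_in_Rn[OF dL[OF that]]) (use gx yR in \<open>auto intro: Rn_diff\<close>)
  have Lc: "\<bar>coord (L (ax i)) j\<bar> \<le> c" if "i < k" "j < m" for i j
  proof (rule c[OF that])
    show "((\<lambda>h. coord (y (x + h *\<^sub>R ax i) - g (x + h *\<^sub>R ax i)) j) has_real_derivative coord (L (ax i)) j) (at 0)"
      using bounded_linear.has_vector_derivative[OF bounded_linear_coord dL[OF that(1)], of j]
      by (simp only: has_real_derivative_iff_has_vector_derivative)
  qed
  fix v assume v: "v \<in> tangent_space \<Gamma> (?Q (pair k x (g x)))"
  obtain u where u: "u \<in> Rn k" "?P v = pair k u (G\<^sub>1 x u)"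
    by (rule tangent_in_graph_coordinates[OF x r g p \<Gamma> gx gu v]) (assumption | rule that)+
  have zG: "?Q (pair k x (g x)) \<in> \<Gamma>" by (rule tangent_point[OF v])
  have vR: "v \<in> Rn (k + m)" using tangent_space_subset_Rn[OF \<Gamma> zG] v by blast
  have LuR: "L u \<in> Rn m" and Lu: "norm (L u) \<le> real k * real m * c * norm u"
    using linear_columns_bound[OF linL LR Lc u(1)] by auto
  have PvR: "?P v \<in> Rn (k + m)" by simp
  have G2: "pair k u (G\<^sub>2 x u) = ?P v + pair k 0 (L u)"
    unfolding u(2) L_def by (simp add: pair_add[symmetric])
  have LR': "pair k 0 (L u) \<in> Rn (k + m)" by (rule pair_in_Rn[OF LuR])
  have G2R: "pair k u (G\<^sub>2 x u) \<in> Rn (k + m)" unfolding G2 by (rule Rn_add[OF PvR LR'])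
  have "norm (v - ?Q (pair k u (G\<^sub>2 x u))) = norm (?P v - pair k u (G\<^sub>2 x u))"
    using norm_permute_diff[OF permutes_inv[OF p] PvR G2R] permute_inverse(1)[OF p vR] by simp
  also have "\<dots> = norm (pair k 0 (L u))" unfolding G2 by simp
  also have "\<dots> \<le> norm (L u)" using norm_pair_bounds(3)[of 0 k "L u"] by simp
  also have "\<dots> \<le> real k * real m * c * norm v"
  proof -
    have "norm u \<le> norm v" using norm_pair_bounds(1)[OF u(1), of "G\<^sub>1 x u"] u(2) norm_permute[OF p vR] by simp
    show ?thesis
    proof (cases "k = 0 \<or> m = 0")
      case False
      then have "0 \<le> c" using Lc[of 0 0] by auto
      then have "real k * real m * c * norm u \<le> real k * real m * c * norm v"
        using \<open>norm u \<le> norm v\<close> by (intro mult_left_mono) auto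
      then show ?thesis using Lu by linarith
    qed (use Lu in auto)
  qed
  finally have "norm (v - ?Q (pair k u (G\<^sub>2 x u))) \<le> real k * real m * c * norm v" .
  moreover have "?Q (pair k u (G\<^sub>2 x u)) \<in> tangent_space \<Lambda> (?Q (pair k x (y x)))"
    by (rule tangent_of_parametrized_graph[OF xR r y \<Lambda> u(1)])
  ultimately show "\<exists>w\<in>tangent_space \<Lambda> (?Q (pair k x (y x))). norm (v - w) \<le> real k * real m * c * norm v" by blast
qed

context o_minimal_structure
begin

lemma dfn_vbound:
  assumes q: "at_least_C2 q" and \<Gamma>: "submanifold q n \<Gamma>" "\<Gamma> \<in> D n" and \<Lambda>: "submanifold q n \<Lambda>" "\<Lambda> \<in> D n"
    and p: "dvec N n p" and p': "dvec N n p'" and c: "dfun N c"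
  shows "dfn N (\<lambda>z. p z \<in> \<Gamma> \<and> p' z \<in> \<Lambda> \<and> vbound (tangent_space \<Gamma> (p z)) (tangent_space \<Lambda> (p' z)) (c z))"
proof -
  have 1: "dfn N (\<lambda>z. p z \<in> \<Gamma> \<and> p' z \<in> \<Lambda> \<and> (\<forall>v\<in>Rn n. (p z \<in> \<Gamma> \<and> v \<in> tangent_space \<Gamma> (p z)) \<longrightarrow>
      (\<exists>w\<in>Rn n. (p' z \<in> \<Lambda> \<and> w \<in> tangent_space \<Lambda> (p' z)) \<and> norm (v - w) \<le> c z * norm v)))"
    by (rule dfn_subst[OF dfn_mem[OF \<Gamma>(2)] p] dfn_subst[OF dfn_mem[OF \<Lambda>(2)] p'] dfn_tangent[OF q \<Gamma>] dfn_tangent[OF q \<Lambda>] p p' c dfn_rules | (simp; fail))+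
  have GR: "\<Gamma> \<subseteq> Rn n" and LR: "\<Lambda> \<subseteq> Rn n" using \<Gamma> \<Lambda> subset_Rn by auto
  show ?thesis
  proof (rule dfn_eqI[OF 1], intro conj_cong refl)
    fix z assume z: "p z \<in> \<Gamma>" "p' z \<in> \<Lambda>"
    have "tangent_space \<Gamma> (p z) \<subseteq> Rn n" "tangent_space \<Lambda> (p' z) \<subseteq> Rn n"
      using tangent_space_subset_Rn GR LR z by auto
    then show "(\<forall>v\<in>Rn n. (p z \<in> \<Gamma> \<and> v \<in> tangent_space \<Gamma> (p z)) \<longrightarrow>
      (\<exists>w\<in>Rn n. (p' z \<in> \<Lambda> \<and> w \<in> tangent_space \<Lambda> (p' z)) \<and> norm (v - w) \<le> c z * norm v)) \<longleftrightarrow>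
      vbound (tangent_space \<Gamma> (p z)) (tangent_space \<Lambda> (p' z)) (c z)"
      unfolding vbound_def using z by (meson subsetD)
  qed
qed

text \<open>
  The values of the map whose graph is \<open>\<Gamma>\<close> are unique, so any choice function yields it; over a
  suitable ball \<open>definable_choice\<close> provides one of class \<open>C11\<close>, here evaluated in the middle of the slab.
\<close>

lemma definable_graph_section:
  assumes q: "at_least_C2 q" and adm: "admits_cell_decompositions D q"
    and p: "p permutes {..<k + m}" and \<Gamma>: "\<Gamma> \<in> D (k + m)" and a: "a \<in> Rn k" "0 < \<delta>" and b: "b \<in> Rn m"
    and gu: "\<And>x. x \<in> Rn k \<Longrightarrow> norm (x - a) < \<delta> \<Longrightarrow> \<exists>!y. y \<in> Rn m \<and> norm (y - b) < \<epsilon> \<and> permute (k + m) (inv p) (pair k x y) \<in> \<Gamma>"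
  obtains a' \<rho> g where "a' \<in> Rn k" "0 < \<rho>" "ball a' \<rho> \<inter> Rn k \<subseteq> ball a \<delta> \<inter> Rn k" "\<And>x. g x \<in> Rn m"
    "\<And>x. x \<in> ball a' \<rho> \<inter> Rn k \<Longrightarrow> norm (g x - b) < \<epsilon> \<and> permute (k + m) (inv p) (pair k x (g x)) \<in> \<Gamma>"
    "\<And>x. x \<in> ball a' \<rho> \<inter> Rn k \<Longrightarrow> \<exists>r>0. \<exists>G K. C11 (ball x r \<inter> Rn k) g G K"
proof -
  let ?Q = "permute (k + m) (inv p)"
  have q': "inv p permutes {..<k + m}" by (rule permutes_inv[OF p])
  let ?P = "\<lambda>z. norm (tail (Suc k) z - b) < \<epsilon> \<and> ?Q (pair k (proj k z) (tail (Suc k) z)) \<in> \<Gamma>"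
  define Y where "Y = {z \<in> Rn (Suc k + m). ?P z}"
  have "dfn (Suc k + m) ?P"
    by (rule dfn_rules dvec_const[OF b] dvec_permute[OF q'] dfn_subst[OF dfn_mem[OF \<Gamma>]] | (simp; fail))+
  then have YD: "Y \<in> D (Suc k + m)" by (simp add: dfn_def Y_def)
  let ?U = "ball a \<delta> \<inter> Rn k"
  have U: "open_in_Rn k ?U" "?U \<noteq> {}" using a open_in_Rn_Int_open[of "ball a \<delta>" k] by (auto simp: Int_commute)
  obtain a1 \<rho>1 \<eta>1 where a1: "0 < \<rho>1" "0 < \<eta>1" "a1 \<in> Rn k" "ball a1 \<rho>1 \<inter> Rn k \<subseteq> ?U"
    and alt: "(\<forall>z\<in>Y. proj (Suc k) z \<notin> slab k a1 \<rho>1 \<eta>1) \<or>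
     (\<exists>s. (\<forall>w\<in>slab k a1 \<rho>1 \<eta>1. s w \<in> Y \<and> proj (Suc k) (s w) = w) \<and>
       C11_loc (Suc k) (slab k a1 \<rho>1 \<eta>1) s \<and> s ` slab k a1 \<rho>1 \<eta>1 \<in> D (Suc k + m))"
    by (rule definable_choice[OF q adm YD U]) (rule that)
  let ?W = "slab k a1 \<rho>1 \<eta>1"
  have inW: "over k x (\<eta>1 / 2) \<in> ?W" if "x \<in> ball a1 \<rho>1 \<inter> Rn k" for x
    using that a1(2) by (simp add: over_in_slab dist_norm norm_minus_commute)
  have proj_pair': "proj k (pair (Suc k) (over k x t) y) = x" if "x \<in> Rn k" for x y t
  proof -
    have "proj k (pair (Suc k) (over k x t) y) = proj k (proj (Suc k) (pair (Suc k) (over k x t) y))" by simp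
    also have "\<dots> = x" by (simp only: proj_pair[OF over_in_Rn[OF that]] proj_over[OF that])
    finally show ?thesis .
  qed
  have "\<not> (\<forall>z\<in>Y. proj (Suc k) z \<notin> ?W)"
  proof
    assume e: "\<forall>z\<in>Y. proj (Suc k) z \<notin> ?W"
    have "a1 \<in> ball a \<delta> \<inter> Rn k" using subsetD[OF a1(4) centre_in_ball_Rn[OF a1(3,1)]] .
    then have "a1 \<in> Rn k" "norm (a1 - a) < \<delta>" by (auto simp: dist_norm norm_minus_commute)
    then obtain y where y: "y \<in> Rn m" "norm (y - b) < \<epsilon>" "?Q (pair k a1 y) \<in> \<Gamma>" using gu by blast
    let ?z = "pair (Suc k) (over k a1 (\<eta>1 / 2)) y"
    have "?z \<in> Rn (Suc k + m)" by (rule pair_in_Rn[OF y(1)])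
    then have "?z \<in> Y" using y proj_pair'[OF a1(3)] by (simp add: Y_def)
    moreover have "proj (Suc k) ?z \<in> ?W" using inW[of a1] a1 by (simp only: proj_pair[OF over_in_Rn[OF a1(3)]]) simp
    ultimately show False using e by blast
  qed
  then obtain s where s: "\<And>w. w \<in> ?W \<Longrightarrow> s w \<in> Y \<and> proj (Suc k) (s w) = w" "C11_loc (Suc k) ?W s"
    using alt by blast
  define g where "g x = proj m (tail (Suc k) (s (over k x (\<eta>1 / 2))))" for x
  have "C11_loc (Suc k) ?W (\<lambda>w. proj m (tail (Suc k) (s w)))"
    by (rule C11_loc_bounded_linear[OF bounded_linear_compose[OF bounded_linear_proj bounded_linear_tail] s(2)])
  note C = slice_C11[OF this]
  show ?thesis
  proof (rule that[OF a1(3,1,4), of g])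
    show "g x \<in> Rn m" for x by (simp add: g_def)
    fix x assume x: "x \<in> ball a1 \<rho>1 \<inter> Rn k"
    show "\<exists>r>0. \<exists>G K. C11 (ball x r \<inter> Rn k) g G K"
      using C[OF _ inW[OF x]] x unfolding g_def by blast
    let ?w = "over k x (\<eta>1 / 2)"
    have sY: "s ?w \<in> Y" "proj (Suc k) (s ?w) = ?w" using s(1)[OF inW[OF x]] by auto
    have gt: "g x = tail (Suc k) (s ?w)" unfolding g_def
      by (rule proj_Rn) (use sY(1) tail_in_Rn[of _ "Suc k" m] in \<open>auto simp: Y_def\<close>)
    have "proj k (s ?w) = proj k (proj (Suc k) (s ?w))" by simp
    also have "\<dots> = x" using x by (simp only: sY(2)) simp
    finally show "norm (g x - b) < \<epsilon> \<and> ?Q (pair k x (g x)) \<in> \<Gamma>" using sY(1) unfolding gt by (simp add: Y_def)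
  qed
qed

text \<open>
  Choose, over each \<open>(x, t)\<close>, a point \<open>y\<close> of the fibre of \<open>\<Lambda>\<close> over \<open>x\<close> at distance \<open>t\<close> from \<open>g x\<close> for which the
  constant is nearly the worst one, by a \<open>C11\<close> map on a slab. The derivative of \<open>y - g x\<close> in \<open>x\<close> is \<open>O(t)\<close> by
  \<open>derivative_bounds\<close>, so \<open>graphs_vbound\<close> gives the estimate at the chosen points, and near-maximality at all
  others. If the choice is impossible, no point of \<open>\<Lambda>\<close> is close enough for the estimate to say anything.
\<close>

lemma fibre_estimate:
  assumes q: "at_least_C2 q" and adm: "admits_cell_decompositions D q"
    and p: "p permutes {..<k + m}" and i: "incident_pair q (k + m) \<Lambda> \<Gamma>" and \<Lambda>: "\<Lambda> \<in> D (k + m)" and \<Gamma>: "\<Gamma> \<in> D (k + m)"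
    and a: "a \<in> Rn k" "0 < \<rho>" and b: "b \<in> Rn m"
    and gR: "\<And>x. g x \<in> Rn m"
    and g: "\<And>x. x \<in> ball a \<rho> \<inter> Rn k \<Longrightarrow> norm (g x - b) < \<epsilon> \<and> permute (k + m) (inv p) (pair k x (g x)) \<in> \<Gamma>"
    and gu: "\<And>x y. x \<in> ball a \<rho> \<inter> Rn k \<Longrightarrow> y \<in> Rn m \<Longrightarrow> norm (y - b) < \<epsilon> \<Longrightarrow> permute (k + m) (inv p) (pair k x y) \<in> \<Gamma> \<Longrightarrow> y = g x"
    and gC: "\<And>x. x \<in> ball a \<rho> \<inter> Rn k \<Longrightarrow> \<exists>r>0. \<exists>G K. C11 (ball x r \<inter> Rn k) g G K"
  obtains a' \<rho>' \<eta> C where "a' \<in> Rn k" "0 < \<rho>'" "0 < \<eta>" "0 < C" "ball a' \<rho>' \<inter> Rn k \<subseteq> ball a \<rho> \<inter> Rn k"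
    "\<And>x y. x \<in> ball a' \<rho>' \<inter> Rn k \<Longrightarrow> y \<in> Rn m \<Longrightarrow> permute (k + m) (inv p) (pair k x y) \<in> \<Lambda> \<Longrightarrow> norm (y - g x) < \<eta> \<Longrightarrow>
      vbound (tangent_space \<Gamma> (permute (k + m) (inv p) (pair k x (g x)))) (tangent_space \<Lambda> (permute (k + m) (inv p) (pair k x y))) (C * norm (y - g x))"
proof -
  note d = incident_pairD[OF i]
  define Q where "Q x y = permute (k + m) (inv p) (pair k x y)" for x y
  note Qf = Q_def[symmetric]
  have q': "inv p permutes {..<k + m}" by (rule permutes_inv[OF p])
  define VB where "VB z z' c \<longleftrightarrow> z \<in> \<Gamma> \<and> z' \<in> \<Lambda> \<and> vbound (tangent_space \<Gamma> z) (tangent_space \<Lambda> z') c" for z z' c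
  let ?B = "ball a \<rho> \<inter> Rn k"
  let ?near = "\<lambda>z. \<exists>y\<in>Rn m. norm (y - b) < \<epsilon> \<and> Q (proj k z) y \<in> \<Gamma> \<and> norm (tail (Suc k) z - y) = coord z k \<and>
      (\<forall>y'\<in>Rn m. Q (proj k z) y' \<in> \<Lambda> \<and> norm (y' - y) = coord z k \<longrightarrow>
        (\<forall>c. 0 < c \<and> VB (Q (proj k z) y) (Q (proj k z) (tail (Suc k) z)) c \<longrightarrow> VB (Q (proj k z) y) (Q (proj k z) y') (2 * c)))"
  let ?PY = "\<lambda>z. norm (proj k z - a) < \<rho> \<and> Q (proj k z) (tail (Suc k) z) \<in> \<Lambda> \<and> ?near z"
  define Y where "Y = {z \<in> Rn (Suc k + m). ?PY z}"
  have "dfn (Suc k + m) ?PY"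
    unfolding Q_def VB_def
    by (rule dfn_vbound[OF q d(2) \<Gamma> d(1) \<Lambda>] dfn_rules dvec_const[OF a(1)] dvec_const[OF b] dvec_permute[OF q']
        dfn_subst[OF dfn_mem[OF \<Gamma>]] dfn_subst[OF dfn_mem[OF \<Lambda>]] | (simp; fail))+
  then have YD: "Y \<in> D (Suc k + m)" by (simp add: dfn_def Y_def)
  have gQ: "Q x (g x) \<in> \<Gamma>" if "x \<in> ?B" for x using g[OF that] by (simp add: Qf)
  have gu': "y = g x" if "x \<in> ?B" "y \<in> Rn m" "norm (y - b) < \<epsilon>" "Q x y \<in> \<Gamma>" for x y
    using gu[OF that(1-3)] that(4) by (simp add: Qf)
  have proj_k: "proj k z = proj k (proj (Suc k) z)" "coord z k = coord (proj (Suc k) z) k" for z by simp_all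
  \<comment> \<open>points of \<open>Y\<close> over \<open>(x, t)\<close>: points of \<open>\<Lambda>\<close> at vertical distance \<open>t\<close> with a nearly maximal bound\<close>
  have YI: "\<exists>z\<in>Y. proj (Suc k) z = over k x (norm (y - g x))"
    if x: "x \<in> ?B" and y: "y \<in> Rn m" "Q x y \<in> \<Lambda>" for x y
  proof -
    let ?t = "norm (y - g x)"
    let ?F = "{y' \<in> Rn m. Q x y' \<in> \<Lambda> \<and> norm (y' - g x) = ?t}"
    have xR: "x \<in> Rn k" using x by simp
    have "\<exists>y0\<in>?F. \<forall>y'\<in>?F. \<forall>c. 0 < c \<and> VB (Q x (g x)) (Q x y0) c \<longrightarrow> VB (Q x (g x)) (Q x y') (2 * c)"
    proof (rule near_maximal_exists)
      show "?F \<noteq> {}" using y by blast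
      show "VB (Q x (g x)) (Q x y') 1" if "y' \<in> ?F" for y'
        using that gQ[OF x] vbound_1[OF zero_in_tangent_space[of "Q x y'" \<Lambda>]] by (simp add: VB_def)
      show "VB (Q x (g x)) (Q x y') e" if "VB (Q x (g x)) (Q x y') c" "c \<le> e" for y' c e
        using that vbound_mono unfolding VB_def by blast
    qed
    then obtain y0 where y0: "y0 \<in> Rn m" "Q x y0 \<in> \<Lambda>" "norm (y0 - g x) = ?t"
      and mx: "\<And>y' c. y' \<in> ?F \<Longrightarrow> 0 < c \<Longrightarrow> VB (Q x (g x)) (Q x y0) c \<Longrightarrow> VB (Q x (g x)) (Q x y') (2 * c)" by blast
    define z where "z = pair (Suc k) (over k x ?t) y0"
    have pz: "proj (Suc k) z = over k x ?t" unfolding z_def by (rule proj_pair[OF over_in_Rn[OF xR]])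
    have z: "proj k z = x" "coord z k = ?t" using proj_k[of z] xR by (simp_all only: pz) simp_all
    have z': "tail (Suc k) z = y0" "z \<in> Rn (Suc k + m)" unfolding z_def by (rule tail_pair pair_in_Rn[OF y0(1)])+
    have "?near z" unfolding z z'
      using gR[of x] g[OF x] gQ[OF x] y0(3) mx by (intro bexI[of _ "g x"]) auto
    then have "z \<in> Y" unfolding Y_def using x y0 z z' by (auto simp: dist_norm norm_minus_commute)
    then show ?thesis using pz by blast
  qed
  have YE: "tail (Suc k) z \<in> Rn m \<and> Q x (tail (Suc k) z) \<in> \<Lambda> \<and> norm (tail (Suc k) z - g x) = t \<and>
      (\<forall>y'\<in>Rn m. Q x y' \<in> \<Lambda> \<and> norm (y' - g x) = t \<longrightarrow> (\<forall>c. 0 < c \<and> VB (Q x (g x)) (Q x (tail (Suc k) z)) c \<longrightarrow> VB (Q x (g x)) (Q x y') (2 * c)))"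
    if zY: "z \<in> Y" and pz: "proj (Suc k) z = over k x t" and x: "x \<in> ?B" for z x t
  proof -
    have xR: "x \<in> Rn k" using x by simp
    have z: "proj k z = x" "coord z k = t" using proj_k[of z] xR by (simp_all only: pz) simp_all
    have "?near z" using zY by (simp add: Y_def)
    then obtain y where y: "y \<in> Rn m" "norm (y - b) < \<epsilon>" "Q x y \<in> \<Gamma>" "norm (tail (Suc k) z - y) = t"
      and mx: "\<forall>y'\<in>Rn m. Q x y' \<in> \<Lambda> \<and> norm (y' - y) = t \<longrightarrow> (\<forall>c. 0 < c \<and> VB (Q x y) (Q x (tail (Suc k) z)) c \<longrightarrow> VB (Q x y) (Q x y') (2 * c))"
      unfolding z by (elim bexE conjE) (rule that)
    have yg: "y = g x" by (rule gu'[OF x y(1-3)])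
    show ?thesis using zY y(4) mx tail_in_Rn[of z "Suc k" m] unfolding yg by (simp add: Y_def z)
  qed
  have pos: "0 < norm (y - g x)" if "x \<in> ?B" "Q x y \<in> \<Lambda>" for x y
    using d(5) gQ[OF that(1)] that(2) by auto
  have U: "open_in_Rn k ?B" "?B \<noteq> {}" using a open_in_Rn_Int_open[of "ball a \<rho>" k] by (auto simp: Int_commute)
  obtain a2 \<rho>2 \<eta>2 where a2: "0 < \<rho>2" "0 < \<eta>2" "a2 \<in> Rn k" "ball a2 \<rho>2 \<inter> Rn k \<subseteq> ?B"
    and alt: "(\<forall>z\<in>Y. proj (Suc k) z \<notin> slab k a2 \<rho>2 \<eta>2) \<or>
     (\<exists>s. (\<forall>w\<in>slab k a2 \<rho>2 \<eta>2. s w \<in> Y \<and> proj (Suc k) (s w) = w) \<and>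
       C11_loc (Suc k) (slab k a2 \<rho>2 \<eta>2) s \<and> s ` slab k a2 \<rho>2 \<eta>2 \<in> D (Suc k + m))"
    by (rule definable_choice[OF q adm YD U]) (rule that)
  let ?W = "slab k a2 \<rho>2 \<eta>2"
  have in_slab: "over k x t \<in> slab k a' \<rho>' \<eta>'" if "x \<in> ball a' \<rho>' \<inter> Rn k" "0 < t" "t < \<eta>'" for x t a' \<rho>' \<eta>'
    using that by (simp add: over_in_slab dist_norm norm_minus_commute)
  show ?thesis
  proof (cases "\<forall>z\<in>Y. proj (Suc k) z \<notin> ?W")
    case True
    show ?thesis
    proof (rule that[OF a2(3,1,2) zero_less_one a2(4)], unfold Qf)
      fix x y assume x: "x \<in> ball a2 \<rho>2 \<inter> Rn k" and y: "y \<in> Rn m" "Q x y \<in> \<Lambda>" "norm (y - g x) < \<eta>2"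
      have xB: "x \<in> ?B" using x a2(4) by blast
      have "over k x (norm (y - g x)) \<in> ?W" by (rule in_slab[OF x pos[OF xB y(2)] y(3)])
      then show "vbound (tangent_space \<Gamma> (Q x (g x))) (tangent_space \<Lambda> (Q x y)) (1 * norm (y - g x))"
        using True YI[OF xB y(1,2)] by metis
    qed
  next
    case False
    then obtain s where s: "\<And>w. w \<in> ?W \<Longrightarrow> s w \<in> Y" "\<And>w. w \<in> ?W \<Longrightarrow> proj (Suc k) (s w) = w"
      "C11_loc (Suc k) ?W s" "s ` ?W \<in> D (Suc k + m)" using alt by blast
    define y where "y w = proj m (tail (Suc k) (s w))" for w
    have yC: "C11_loc (Suc k) ?W y" unfolding y_def
      by (rule C11_loc_bounded_linear[OF bounded_linear_compose[OF bounded_linear_proj bounded_linear_tail] s(3)])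
    have yR: "y w \<in> Rn m" for w by (simp add: y_def)
    have WB: "proj k w \<in> ?B" "w = over k (proj k w) (coord w k)" if w: "w \<in> ?W" for w
    proof -
      have "proj k w \<in> ball a2 \<rho>2 \<inter> Rn k" using w by (simp add: slab_def dist_norm norm_minus_commute)
      then show "proj k w \<in> ?B" using a2(4) by blast
      show "w = over k (proj k w) (coord w k)" using over_proj[of w k] w by (simp add: slab_def)
    qed
    have ys: "y w = tail (Suc k) (s w)" if "w \<in> ?W" for w
      unfolding y_def by (rule proj_Rn) (use s(1)[OF that] tail_in_Rn[of _ "Suc k" m] in \<open>auto simp: Y_def\<close>)
    have yY: "Q (proj k w) (y w) \<in> \<Lambda>" "norm (y w - g (proj k w)) = coord w k"
      "\<And>y' c. y' \<in> Rn m \<Longrightarrow> Q (proj k w) y' \<in> \<Lambda> \<Longrightarrow> norm (y' - g (proj k w)) = coord w k \<Longrightarrow> 0 < c \<Longrightarrow>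
        VB (Q (proj k w) (g (proj k w))) (Q (proj k w) (y w)) c \<Longrightarrow> VB (Q (proj k w) (g (proj k w))) (Q (proj k w) y') (2 * c)"
      if w: "w \<in> ?W" for w
    proof -
      have "proj (Suc k) (s w) = over k (proj k w) (coord w k)" using s(2)[OF w] WB(2)[OF w] by simp
      from YE[OF s(1)[OF w] this WB(1)[OF w]] 
      show "Q (proj k w) (y w) \<in> \<Lambda>" "norm (y w - g (proj k w)) = coord w k"
      "\<And>y' c. y' \<in> Rn m \<Longrightarrow> Q (proj k w) y' \<in> \<Lambda> \<Longrightarrow> norm (y' - g (proj k w)) = coord w k \<Longrightarrow> 0 < c \<Longrightarrow>
        VB (Q (proj k w) (g (proj k w))) (Q (proj k w) (y w)) c \<Longrightarrow> VB (Q (proj k w) (g (proj k w))) (Q (proj k w) y') (2 * c)"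
        unfolding ys[OF w] by blast+
    qed
    define r where "r j w = coord (y w - g (proj k w)) j" for j w
    define r' where "r' i j w = deriv (\<lambda>h. r j (w + h *\<^sub>R ax i)) 0" for i j w
    have WR: "?W \<subseteq> Rn (Suc k)" by (auto simp: slab_def)
    have proj_shift: "proj k (w + h *\<^sub>R ax i) = proj k w + h *\<^sub>R ax i" if "i < k" for w h i
      by (rule rvec_eqI) (use that in auto)
    have der: "((\<lambda>h. r j (w + h *\<^sub>R ax i)) has_real_derivative r' i j w) (at 0)" if ij: "i < k" "j < m" and w: "w \<in> ?W" for i j w
    proof -
      obtain e where e: "((\<lambda>h. y (w + h *\<^sub>R ax i)) has_vector_derivative e) (at 0)"
        using C11_loc_partial[OF WR yC w, of i] ij by auto
      obtain \<sigma> G K where \<sigma>: "\<sigma> > 0" "C11 (ball (proj k w) \<sigma> \<inter> Rn k) g G K" using gC[OF WB(1)[OF w]] by blast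
      have e': "((\<lambda>h. g (proj k w + h *\<^sub>R ax i)) has_vector_derivative G (proj k w) (ax i)) (at 0)"
        by (rule C11_direction[OF \<sigma>(2)]) (use \<sigma>(1) ij in auto)
      have "((\<lambda>h. r j (w + h *\<^sub>R ax i)) has_vector_derivative coord (e - G (proj k w) (ax i)) j) (at 0)"
        unfolding r_def proj_shift[OF ij(1)]
        by (rule bounded_linear.has_vector_derivative[OF bounded_linear_coord has_vector_derivative_diff[OF e e']])
      then have "((\<lambda>h. r j (w + h *\<^sub>R ax i)) has_real_derivative coord (e - G (proj k w) (ax i)) j) (at 0)"
        by (simp only: has_real_derivative_iff_has_vector_derivative)
      then show ?thesis unfolding r'_def by (simp only: DERIV_imp_deriv)
    qed
    define R where "R j z \<longleftrightarrow> (\<exists>u\<in>Rn m. norm (u - b) < \<epsilon> \<and> Q (proj k z) u \<in> \<Gamma> \<and>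
       (\<exists>v\<in>Rn m. pair (Suc k) (proj (Suc k) z) v \<in> s ` ?W \<and> coord z (Suc k) = coord v j - coord u j))" for j z
    have Rd: "dfn (Suc (Suc k)) (R j)" if j: "j < m" for j
      unfolding R_def Q_def
      by (rule dfn_rules dvec_const[OF b] dvec_permute[OF q'] dfn_subst[OF dfn_mem[OF \<Gamma>]] dfn_subst[OF dfn_mem[OF s(4)]]
          dvec_coord[OF _ j] | (simp; fail))+
    have Riff: "R j (over (Suc k) w t) \<longleftrightarrow> t = r j w" if j: "j < m" and w: "w \<in> ?W" for j w t
    proof -
      have wR: "w \<in> Rn (Suc k)" using w WR by blast
      let ?z = "over (Suc k) w t"
      have z: "proj (Suc k) ?z = w" "coord ?z (Suc k) = t" using wR by simp_all
      have zk: "proj k ?z = proj k w" using proj_k(1)[of ?z] by (simp only: z)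
      have img: "pair (Suc k) w v \<in> s ` ?W \<longleftrightarrow> v = y w" if v: "v \<in> Rn m" for v
      proof
        assume "pair (Suc k) w v \<in> s ` ?W"
        then obtain w' where w': "w' \<in> ?W" "pair (Suc k) w v = s w'" by blast
        have "w = w'" using s(2)[OF w'(1)] w'(2)[symmetric] proj_pair[OF wR, of v] by simp
        then show "v = y w" using ys[OF w] w'(2)[symmetric] by simp
      next
        assume "v = y w"
        then have "pair (Suc k) w v = s w" using pair_proj_tail[of "Suc k" "s w"] s(2)[OF w] ys[OF w] by simp
        then show "pair (Suc k) w v \<in> s ` ?W" using w by blast
      qed
      have "R j ?z \<longleftrightarrow> (\<exists>u\<in>Rn m. norm (u - b) < \<epsilon> \<and> Q (proj k w) u \<in> \<Gamma> \<and> t = coord (y w) j - coord u j)"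
        unfolding R_def z zk using img yR[of w] by blast
      also have "\<dots> \<longleftrightarrow> t = r j w"
      proof -
        have "u = g (proj k w) \<longleftrightarrow> u \<in> Rn m \<and> norm (u - b) < \<epsilon> \<and> Q (proj k w) u \<in> \<Gamma>" for u
          using gu'[OF WB(1)[OF w]] gQ[OF WB(1)[OF w]] g[OF WB(1)[OF w]] gR[of "proj k w"] by blast
        then have "(\<exists>u\<in>Rn m. norm (u - b) < \<epsilon> \<and> Q (proj k w) u \<in> \<Gamma> \<and> t = coord (y w) j - coord u j) \<longleftrightarrow>
            t = coord (y w) j - coord (g (proj k w)) j" by metis
        then show ?thesis by (simp add: r_def)
      qed
      finally show ?thesis .
    qed
    have bd: "\<bar>r j w\<bar> \<le> coord w k" if "w \<in> ?W" for j w
      using abs_coord_le_norm[of "y w - g (proj k w)" j] yY(2)[OF that] by (simp add: r_def)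
    obtain a3 \<rho>3 \<eta>3 C3 where a3: "0 < \<rho>3" "0 < \<eta>3" "\<eta>3 \<le> \<eta>2" "0 < C3" "a3 \<in> Rn k" "ball a3 \<rho>3 \<inter> Rn k \<subseteq> ball a2 \<rho>2 \<inter> Rn k"
      and C3: "\<And>i j w. i < k \<Longrightarrow> j < m \<Longrightarrow> w \<in> slab k a3 \<rho>3 \<eta>3 \<Longrightarrow> \<bar>r' i j w\<bar> \<le> C3 * coord w k"
    proof (rule derivative_bounds[OF q adm a2(3,1,2), of m R r r'])
      fix i j w assume j: "j < m"
      show "dfn (Suc (Suc k)) (R j)" by (rule Rd[OF j])
      assume w: "w \<in> ?W"
      show "R j (over (Suc k) w t) \<longleftrightarrow> t = r j w" for t by (rule Riff[OF j w])
      show "\<bar>r j w\<bar> \<le> coord w k" by (rule bd[OF w])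
      show "((\<lambda>h. r j (w + h *\<^sub>R ax i)) has_real_derivative r' i j w) (at 0)" if "i < k" by (rule der[OF that j w])
    qed (rule that)
    define E where "E = real k * real m * C3 + 1"
    have E: "0 < E" using a3(4) by (simp add: E_def add_nonneg_pos)
    show ?thesis
    proof (rule that[OF a3(5,1,2), of "2 * E"], unfold Qf)
      show "0 < 2 * E" using E by simp
      show "ball a3 \<rho>3 \<inter> Rn k \<subseteq> ?B" using a3(6) a2(4) by blast
      fix x v assume x: "x \<in> ball a3 \<rho>3 \<inter> Rn k" and v: "v \<in> Rn m" "Q x v \<in> \<Lambda>" "norm (v - g x) < \<eta>3"
      have xB: "x \<in> ?B" using x a3(6) a2(4) by blast
      have xR: "x \<in> Rn k" using x by simp
      define t where "t = norm (v - g x)"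
      have t: "0 < t" unfolding t_def by (rule pos[OF xB v(2)])
      have t3: "t < \<eta>3" using v(3) by (simp add: t_def)
      define w where "w = over k x t"
      have w3: "w \<in> slab k a3 \<rho>3 \<eta>3" unfolding w_def by (rule in_slab[OF x t t3])
      have w2: "w \<in> ?W" using slab_mono[OF a3(6,3)] w3 by blast
      have pw: "proj k w = x" "coord w k = t" using xR by (simp_all add: w_def)
      obtain \<sigma>1 G1 K1 where g1: "\<sigma>1 > 0" "C11 (ball x \<sigma>1 \<inter> Rn k) g G1 K1" using gC[OF xB] by blast
      obtain \<sigma>2 G2 K2 where g2: "\<sigma>2 > 0" "C11 (ball x \<sigma>2 \<inter> Rn k) (\<lambda>x. y (over k x t)) G2 K2"
        using slice_C11[OF yC xR, of t] w2 unfolding w_def by blast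
      define \<sigma> where "\<sigma> = min (min \<sigma>1 \<sigma>2) (\<rho>3 - dist a3 x)"
      have \<sigma>: "0 < \<sigma>" using g1(1) g2(1) x by (simp add: \<sigma>_def)
      have "vbound (tangent_space \<Gamma> (Q x (g x))) (tangent_space \<Lambda> (Q x (y (over k x t)))) (real k * real m * (C3 * t))"
        unfolding Q_def
      proof (rule graphs_vbound[OF xB \<sigma> _ _ p d(4) gR])
        show "C11 (ball x \<sigma> \<inter> Rn k) g G1 K1" by (rule C11_subset[OF g1(2)]) (auto simp: \<sigma>_def)
        show "C11 (ball x \<sigma> \<inter> Rn k) (\<lambda>x. y (over k x t)) G2 K2" by (rule C11_subset[OF g2(2)]) (auto simp: \<sigma>_def)
        show "norm (g x - b) < \<epsilon>" using g[OF xB] by blast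
        show "y (over k x' t) \<in> Rn m" for x' by (rule yR)
        show "v = g x" if "x \<in> ?B" "v \<in> Rn m" "norm (v - b) < \<epsilon>" "permute (k + m) (inv p) (pair k x v) \<in> \<Gamma>" for x v by (rule gu[OF that])
        show "permute (k + m) (inv p) (pair k x' (y (over k x' t))) \<in> \<Lambda>" if x': "x' \<in> ball x \<sigma> \<inter> Rn k" for x'
        proof -
          have "dist a3 x' \<le> dist a3 x + dist x x'" by (rule dist_triangle)
          then have "x' \<in> ball a3 \<rho>3 \<inter> Rn k" using x' by (auto simp: \<sigma>_def)
          then have "over k x' t \<in> ?W" using slab_mono[OF a3(6,3)] in_slab[OF _ t t3] by blast
          from yY(1)[OF this] show ?thesis using x' by (simp add: Qf)
        qed
        fix i j e assume ij: "i < k" "j < m" and e: "((\<lambda>h. coord (y (over k (x + h *\<^sub>R ax i) t) - g (x + h *\<^sub>R ax i)) j) has_real_derivative e) (at 0)"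
        have "(\<lambda>h. coord (y (over k (x + h *\<^sub>R ax i) t) - g (x + h *\<^sub>R ax i)) j) = (\<lambda>h. r j (w + h *\<^sub>R ax i))"
          unfolding r_def proj_shift[OF ij(1)] pw over_shift by (simp add: w_def)
        then have "e = r' i j w" using e der[OF ij w2] DERIV_unique by metis
        then show "\<bar>e\<bar> \<le> C3 * t" using C3[OF ij w3] pw by simp
      qed
      then have "vbound (tangent_space \<Gamma> (Q x (g x))) (tangent_space \<Lambda> (Q x (y w))) (E * t)"
        unfolding w_def by (rule vbound_mono) (use t in \<open>simp add: E_def algebra_simps\<close>)
      then have "VB (Q (proj k w) (g (proj k w))) (Q (proj k w) (y w)) (E * t)"
        using yY(1)[OF w2] gQ[OF xB] unfolding pw VB_def by blast
      then have "VB (Q (proj k w) (g (proj k w))) (Q (proj k w) v) (2 * (E * t))"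
        by (rule yY(3)[OF w2 v(1), rotated -1]) (use v E t in \<open>simp_all add: pw t_def\<close>)
      then show "vbound (tangent_space \<Gamma> (Q x (g x))) (tangent_space \<Lambda> (Q x v)) (2 * E * norm (v - g x))"
        unfolding pw VB_def by (simp add: t_def mult.assoc)
    qed
  qed
qed

text \<open>
  Both balls obtained by definable choice may lie off the centre, so the Verdier condition is
  reached at a point \<open>x\<^sub>1\<close> near \<open>x\<^sub>0\<close> and not at \<open>x\<^sub>0\<close> itself.
\<close>

lemma verdier_vb_near:
  assumes q: "at_least_C2 q" and adm: "admits_cell_decompositions D q"
    and i: "incident_pair q n \<Lambda> \<Gamma>" and \<Lambda>: "\<Lambda> \<in> D n" and \<Gamma>: "\<Gamma> \<in> D n" and x0: "x\<^sub>0 \<in> \<Gamma>" and e: "0 < e"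
  shows "\<exists>x\<^sub>1\<in>\<Gamma>. dist x\<^sub>1 x\<^sub>0 < e \<and> verdier_vb \<Lambda> \<Gamma> x\<^sub>1"
proof -
  note d = incident_pairD[OF i]
  obtain k' r0 s0 \<phi> \<psi> G0 H0 K0 where ch: "chart n k' \<Gamma> x\<^sub>0 r0 s0 \<phi> \<psi> G0 H0 K0"
    by (rule submanifold_chart[OF q d(2) x0]) (rule that)
  obtain p k \<delta> \<epsilon> where p: "p permutes {..<n}" and k: "k \<le> n" and \<delta>: "0 < \<delta>" "0 < \<epsilon>" "\<delta> + \<epsilon> \<le> e"
    and gu: "\<And>x. x \<in> Rn k \<Longrightarrow> norm (x - proj k (permute n p x\<^sub>0)) < \<delta> \<Longrightarrow>
      \<exists>!y. y \<in> Rn (n - k) \<and> norm (y - tail k (permute n p x\<^sub>0)) < \<epsilon> \<and> permute n (inv p) (pair k x y) \<in> \<Gamma>"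
    by (rule chart.local_graph[OF ch e]) (rule that)
  define m where "m = n - k"
  have n: "n = k + m" using k by (simp add: m_def)
  define a where "a = proj k (permute n p x\<^sub>0)"
  define b where "b = tail k (permute n p x\<^sub>0)"
  let ?Q = "\<lambda>x y. permute n (inv p) (pair k x y)"
  have aR: "a \<in> Rn k" by (simp add: a_def)
  have bR: "b \<in> Rn m" unfolding b_def by (rule tail_in_Rn) (simp add: n)
  have x0R: "x\<^sub>0 \<in> Rn n" using x0 d(4) by blast
  have Qab: "?Q a b = x\<^sub>0" using permute_inverse(1)[OF p x0R] by (simp add: a_def b_def)
  have gu': "\<exists>!y. y \<in> Rn m \<and> norm (y - b) < \<epsilon> \<and> ?Q x y \<in> \<Gamma>" if "x \<in> Rn k" "norm (x - a) < \<delta>" for x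
    using gu that by (simp only: a_def b_def m_def)
  obtain a1 \<rho>1 g where a1: "a1 \<in> Rn k" "0 < \<rho>1" "ball a1 \<rho>1 \<inter> Rn k \<subseteq> ball a \<delta> \<inter> Rn k" and gR: "\<And>x. g x \<in> Rn m"
    and g: "\<And>x. x \<in> ball a1 \<rho>1 \<inter> Rn k \<Longrightarrow> norm (g x - b) < \<epsilon> \<and> ?Q x (g x) \<in> \<Gamma>"
    and gC: "\<And>x. x \<in> ball a1 \<rho>1 \<inter> Rn k \<Longrightarrow> \<exists>r>0. \<exists>G K. C11 (ball x r \<inter> Rn k) g G K"
    by (rule definable_graph_section[OF q adm p[unfolded n] \<Gamma>[unfolded n] aR \<delta>(1) bR gu'[unfolded n]])
      (assumption | rule that[unfolded n])+
  have gx: "y = g x" if x: "x \<in> ball a1 \<rho>1 \<inter> Rn k" and y: "y \<in> Rn m" "norm (y - b) < \<epsilon>" "?Q x y \<in> \<Gamma>" for x y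
  proof -
    have "x \<in> ball a \<delta> \<inter> Rn k" using x a1(3) by blast
    then have "\<exists>!y. y \<in> Rn m \<and> norm (y - b) < \<epsilon> \<and> ?Q x y \<in> \<Gamma>" by (intro gu') (auto simp: dist_norm norm_minus_commute)
    then show ?thesis using y g[OF x] gR[of x] by blast
  qed
  obtain a2 \<rho>2 \<eta> C where a2: "a2 \<in> Rn k" "0 < \<rho>2" "0 < \<eta>" "0 < C" "ball a2 \<rho>2 \<inter> Rn k \<subseteq> ball a1 \<rho>1 \<inter> Rn k"
    and vert: "\<And>x y. x \<in> ball a2 \<rho>2 \<inter> Rn k \<Longrightarrow> y \<in> Rn m \<Longrightarrow> ?Q x y \<in> \<Lambda> \<Longrightarrow> norm (y - g x) < \<eta> \<Longrightarrow>
      vbound (tangent_space \<Gamma> (?Q x (g x))) (tangent_space \<Lambda> (?Q x y)) (C * norm (y - g x))"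
    by (rule fibre_estimate[OF q adm p[unfolded n] i[unfolded n] \<Lambda>[unfolded n] \<Gamma>[unfolded n] a1(1,2) bR gR g[unfolded n] gx[unfolded n] gC])
      (assumption | rule that[unfolded n])+
  have a2B: "a2 \<in> ball a1 \<rho>1 \<inter> Rn k" by (rule subsetD[OF a2(5) centre_in_ball_Rn[OF a2(1,2)]])
  have a2d: "norm (a2 - a) < \<delta>" using subsetD[OF a1(3) a2B] by (simp add: dist_norm norm_minus_commute)
  define x1 where "x1 = ?Q a2 (g a2)"
  have x1: "x1 \<in> \<Gamma>" using g[OF a2B] by (simp add: x1_def)
  have "dist x1 x\<^sub>0 < e"
  proof -
    have "dist x1 x\<^sub>0 = norm (?Q a2 (g a2) - ?Q a b)" by (simp add: x1_def Qab dist_norm)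
    also have "\<dots> = norm (pair k (a2 - a) (g a2 - b))"
      unfolding pair_diff by (rule norm_permute_diff[OF permutes_inv[OF p]]) (use gR bR pair_in_Rn n in auto)
    also have "\<dots> \<le> norm (a2 - a) + norm (g a2 - b)" by (rule norm_pair_bounds(3)[OF Rn_diff[OF a2(1) aR]])
    also have "\<dots> < \<delta> + \<epsilon>" using a2d g[OF a2B] by (intro add_strict_mono) auto
    finally show ?thesis using \<delta>(3) by simp
  qed
  moreover have "verdier_vb \<Lambda> \<Gamma> x1"
  proof -
    obtain k1 r1 s1 \<phi>1 \<psi>1 G1 H1 K1 where ch1: "chart n k1 \<Gamma> x1 r1 s1 \<phi>1 \<psi>1 G1 H1 K1"
      by (rule submanifold_chart[OF q d(2) x1]) (rule that)
    have K1: "0 < K1" and r1: "0 < r1" using chart.K[OF ch1] chart.r[OF ch1] by auto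
    obtain r2 G2 A where r2: "r2 > 0" "C11 (ball a2 r2 \<inter> Rn k) g G2 A" using gC[OF a2B] by blast
    have A: "0 < A" using r2(2) by (simp add: C11_def)
    define \<rho> where "\<rho> = min \<rho>2 r2"
    have \<rho>: "0 < \<rho>" using a2(2) r2(1) by (simp add: \<rho>_def)
    have sub: "x \<in> ball a2 \<rho>2 \<inter> Rn k" "x \<in> ball a2 r2 \<inter> Rn k" if "x \<in> ball a2 \<rho> \<inter> Rn k" for x using that by (auto simp: \<rho>_def)
    show ?thesis
    proof (rule verdier_vb_from_fibres[OF p[unfolded n] d(3,4)[unfolded n] d(5) a2(1) \<rho> \<delta>(2) a2(3,4), of A g b r1 "K1 * K1 * K1"])
      show "0 \<le> A" using A by simp
      show "0 < r1" "0 < K1 * K1 * K1" using r1 K1 by simp_all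
      fix z z' assume z: "z \<in> \<Gamma>" "z' \<in> \<Gamma>" "dist z x1 < r1" "dist z' x1 < r1"
      show "vbound (tangent_space \<Gamma> z) (tangent_space \<Gamma> z') (K1 * K1 * K1 * norm (z - z'))"
        by (rule chart.tangent_lipschitz[OF ch1]) (use z in \<open>auto simp: dist_commute\<close>)
    next
      fix x assume x: "x \<in> ball a2 \<rho> \<inter> Rn k"
      have xB: "x \<in> ball a1 \<rho>1 \<inter> Rn k" using sub(1)[OF x] a2(5) by blast
      show "g x \<in> Rn m \<and> norm (g x - b) < \<epsilon> \<and> permute (k + m) (inv p) (pair k x (g x)) \<in> \<Gamma>"
        using g[OF xB] gR n by simp
      show "y = g x" if "y \<in> Rn m" "norm (y - b) < \<epsilon>" "permute (k + m) (inv p) (pair k x y) \<in> \<Gamma>" for y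
        by (rule gx[OF xB]) (use that n in auto)
      show "norm (g x - g x') \<le> A * norm (x - x')" if "x' \<in> ball a2 \<rho> \<inter> Rn k" for x'
        by (rule C11_lipschitz[OF r2(2) convex_ball_Rn sub(2)[OF x] sub(2)[OF that]])
      show "vbound (tangent_space \<Gamma> (permute (k + m) (inv p) (pair k x (g x))))
          (tangent_space \<Lambda> (permute (k + m) (inv p) (pair k x y))) (C * norm (y - g x))"
        if "y \<in> Rn m" "permute (k + m) (inv p) (pair k x y) \<in> \<Lambda>" "norm (y - g x) < \<eta>" for y
        using vert[OF sub(1)[OF x] that(1) _ that(3)] that(2) n by simp
    qed (simp add: x1_def n)
  qed
  ultimately show ?thesis using x1 by blast
qed

text \<open>
  The Verdier condition at a point, with a radius \<open>\<delta>\<close>, implies it at all points of \<open>\<Gamma>\<close> within \<open>\<delta> / 2\<close>.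
  So if the failures were dense in an open part of \<open>\<Gamma>\<close>, the condition would fail on that part, against
  \<open>verdier_vb_near\<close>.
\<close>

lemma verdier_generic:
  assumes q: "at_least_C2 q" and adm: "admits_cell_decompositions D q"
  shows "generic_condition D q verdier"
  unfolding generic_condition_def
proof (intro allI impI, elim conjE)
  fix n \<Lambda> \<Gamma> assume i: "incident_pair q n \<Lambda> \<Gamma>" and \<Lambda>: "\<Lambda> \<in> D n" and \<Gamma>: "\<Gamma> \<in> D n"
  let ?E = "{x \<in> \<Gamma>. \<not> verdier n \<Lambda> \<Gamma> x}"
  let ?I = "top_of_set \<Gamma> interior_of (top_of_set \<Gamma> closure_of ?E)"
  show "?I = {}"
  proof (rule ccontr)
    assume "?I \<noteq> {}"
    then obtain x0 where x0: "x0 \<in> ?I" by blast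
    have "openin (top_of_set \<Gamma>) ?I" by simp
    moreover have "?I \<subseteq> closure ?E"
    proof -
      have "\<Gamma> \<inter> ?E = ?E" by blast
      then have "top_of_set \<Gamma> closure_of ?E \<subseteq> closure ?E" by (simp only: closure_of_subtopology) simp
      then show ?thesis using interior_of_subset[of "top_of_set \<Gamma>" "top_of_set \<Gamma> closure_of ?E"] by blast
    qed
    ultimately obtain e where e: "0 < e" and eI: "\<And>x. x \<in> \<Gamma> \<Longrightarrow> dist x x0 < e \<Longrightarrow> x \<in> closure ?E" and x0G: "x0 \<in> \<Gamma>"
      using x0 unfolding openin_euclidean_subtopology_iff by (meson subsetD)
    obtain x1 where x1: "x1 \<in> \<Gamma>" "dist x1 x0 < e" "verdier_vb \<Lambda> \<Gamma> x1"
      using verdier_vb_near[OF q adm i \<Lambda> \<Gamma> x0G e] by blast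
    obtain \<delta> C where \<delta>: "\<delta> > 0" "C > 0" "\<And>x y. x \<in> \<Gamma> \<Longrightarrow> y \<in> \<Lambda> \<Longrightarrow> dist x x1 < \<delta> \<Longrightarrow> dist y x1 < \<delta> \<Longrightarrow>
       vbound (tangent_space \<Gamma> x) (tangent_space \<Lambda> y) (C * norm (x - y))"
      by (rule verdier_vbE[OF x1(3)]) (rule that)
    have "x1 \<in> closure ?E" by (rule eI[OF x1(1,2)])
    then obtain x2 where x2: "x2 \<in> ?E" "dist x2 x1 < \<delta> / 2" using \<delta>(1) unfolding closure_approachable by (meson half_gt_zero)
    have "verdier_vb \<Lambda> \<Gamma> x2"
    proof (rule verdier_vbI[OF half_gt_zero[OF \<delta>(1)] \<delta>(2)])
      fix x y assume xy: "x \<in> \<Gamma>" "y \<in> \<Lambda>" "dist x x2 < \<delta> / 2" "dist y x2 < \<delta> / 2"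
      have "dist x x1 < \<delta>" "dist y x1 < \<delta>"
        using xy(3,4) x2(2) dist_triangle[of x x1 x2] dist_triangle[of y x1 x2] by linarith+
      then show "vbound (tangent_space \<Gamma> x) (tangent_space \<Lambda> y) (C * norm (x - y))" by (rule \<delta>(3)[OF xy(1,2)])
    qed
    then show False using x2(1) incident_verdier_iff[OF q i, of x2] by blast
  qed
qed

end

theorem corollary5p15:
  fixes D :: "nat \<Rightarrow> rvec set set" and q :: smoothness
  assumes "o_minimal_structure D"
    and "at_least_C2 q"
    and "admits_cell_decompositions D q"
  shows "WL_condition D q verdier"
proof -
  interpret o_minimal_structure D by (rule assms(1))
  note q = assms(2)
  show ?thesis
    unfolding WL_condition_def
    by (intro conjI verdier_local verdier_definable verdier_generic verdier_invariant verdier_projection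
        verdier_lifting q assms(3))
qed

end
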